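(* Let $n\ge 1$, let $D\subset\mathbb{R}^{n+1}$ be a bounded $C^2$ domain, $T>0$, $Q_T=D\times(0,T)$, let $A$ be a symmetric positive definite real $(n+1)\times(n+1)$ matrix and $\Phi(p)=\sqrt{p^TAp}$. Let $u_0$ be initial data on $\bar D$, and let $\psi\in C^{1,1}(\bar Q_T)$ be a convex obstacle with $\psi<0$ on $\partial D\times[0,T]$ and $\psi(\cdot,0)<u_0$ in $\bar D$. Let $u$ be the minimizer of $J_\Phi$ over $\mathcal{K}_T$ (defined in the context), with free boundaries $\Gamma(t)$. For each $t\in(0,T)$ let $\Sigma(t)\subset\Gamma(t)$ be the set of singular free boundary points at time $t$. Then the space-time singular set $\Sigma=\bigcup_{t\in(0,T)}\Sigma(t)\times\{t\}$ satisfies $$\dim^P_H(\Sigma)\le n-1,$$ where $\dim^P_H$ is the parabolic Hausdorff dimension with the scaling $\rho\times\rho^2$ in space-time.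
   Context: The functional is $$J_\Phi(u)=\int_0^T\int_D\left[\Phi(Du)+\tfrac12|u_t|^2\right]dx\,dt,$$ where $Du$ is the spatial gradient and $u_t$ the weak time derivative ($J_\Phi(u)=+\infty$ if $u_t\notin L^2(Q_T)$). The admissible class is $$\mathcal{K}_T=\{u\in L^2(0,T;W^{1,1}(D)):\ u\ge\psi\text{ a.e.},\ u=0\text{ on }\partial D\times[0,T],\ u(\cdot,0)=u_0\},$$ with boundary and initial values understood in the sense of traces. "Convex obstacle" means that $\psi$ is convex on every line segment contained in $\bar Q_T$. For the minimizer $u$: $\Lambda(t)=\{x\in D:u(x,t)=\psi(x,t)\}$ is the contact set, $\Gamma(t)=\partial\Lambda(t)\cap D$ is the free boundary at time $t$, and $\Gamma=\bigcup_{t\in(0,T)}\Gamma(t)\times\{t\}$. For $(x_0,t_0)\in\Gamma$ and $r>0$ the parabolic blow-up sequence is $$u_r(y,s)=\frac{u(x_0+ry,t_0+r^2s)-u(x_0,t_0)}{r^2},\qquad (y,s)\in Q_1(0,0)=B_1(0)\times(-1,0].$$ A blow-up at $(x_0,t_0)$ is a limit of $u_{r_j}$ in $C^{1,\alpha}_{\mathrm{loc}}(Q_1)$ for all $\alpha\in(0,1)$ along some sequence $r_j\to0$. The point $(x_0,t_0)$ is singular (that is, $x_0\in\Sigma(t_0)$) if it has a blow-up which is a parabolic homogeneous polynomial, i.e. of the form $\tfrac12y^TQy+\lambda s$ with $Q$ a symmetric matrix and $\lambda\in\mathbb{R}$. The parabolic Hausdorff dimension is the Hausdorff dimension computed with coverings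 by parabolic cylinders $B_\rho(x)\times(t-\rho^2,t+\rho^2)$, each counted with size $\rho$ (equivalently, with respect to the metric $\max(|x-x'|,|t-t'|^{1/2})$). *)

theory Defs
  imports "HOL-Analysis.Analysis"
begin

section \<open>Smooth functions, smooth domains, convex \<open>C\<^sup>1\<^sup>,\<^sup>1\<close> obstacles\<close>

text \<open>On a finite-dimensional space, continuity of all iterated directional derivatives together
  with differentiability at every order below \<open>k\<close> is the usual class \<open>C\<^sup>k\<close>.\<close>

primrec Ck :: "nat \<Rightarrow> ('a::euclidean_space \<Rightarrow> real) \<Rightarrow> bool" where
  "Ck 0 f \<longleftrightarrow> continuous_on UNIV f"
| "Ck (Suc k) f \<longleftrightarrow>
     (\<exists>f'. (\<forall>x. (f has_derivative f' x) (at x)) \<and> (\<forall>v. Ck k (\<lambda>x. f' x v)))"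

text \<open>Near each boundary point \<open>D\<close> is the strict epigraph, in the direction of a unit vector \<open>e\<close>,
  of a \<open>C\<^sup>2\<close> function on the hyperplane orthogonal to \<open>e\<close>. That function is represented by an
  extension \<open>\<gamma>\<close> to the whole space, evaluated only at orthogonal projections.\<close>

definition C2_domain :: "'a::euclidean_space set \<Rightarrow> bool" where
  "C2_domain D \<longleftrightarrow> open D \<and> connected D \<and> D \<noteq> {} \<and>
     (\<forall>p\<in>frontier D. \<exists>r>0. \<exists>e \<gamma>. norm e = 1 \<and> Ck 2 \<gamma> \<and>
        D \<inter> ball p r = {x \<in> ball p r. \<gamma> (x - (x \<bullet> e) *\<^sub>R e) < x \<bullet> e})"

text \<open>\<open>C\<^sup>1\<^sup>,\<^sup>1\<close> up to the boundary: a Lipschitz gradient on a bounded open set is bounded and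
  extends continuously to the closure.\<close>

definition C11_closure :: "'a::euclidean_space set \<Rightarrow> ('a \<Rightarrow> real) \<Rightarrow> bool" where
  "C11_closure \<Omega> f \<longleftrightarrow> continuous_on (closure \<Omega>) f \<and>
     (\<exists>g L. (\<forall>z\<in>\<Omega>. (f has_derivative (\<lambda>h. g z \<bullet> h)) (at z)) \<and> L-lipschitz_on \<Omega> g)"

definition convex_on_segments :: "'a::euclidean_space set \<Rightarrow> ('a \<Rightarrow> real) \<Rightarrow> bool" where
  "convex_on_segments S f \<longleftrightarrow>
     (\<forall>a b. closed_segment a b \<subseteq> S \<longrightarrow> convex_on (closed_segment a b) f)"

section \<open>Hausdorff measures with respect to a family of gauge sets\<close>

text \<open>\<open>P z \<rho>\<close> is the gauge set with centre \<open>z\<close> and size \<open>\<rho>\<close>. For \<open>P = ball\<close> this is the (unnormalised)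
  spherical Hausdorff measure, which has the same null sets as the Hausdorff measure. Covers
  are countable and may be finite or empty.\<close>

definition hausdorff_premeasure ::
    "('a \<Rightarrow> real \<Rightarrow> 'a set) \<Rightarrow> real \<Rightarrow> real \<Rightarrow> 'a set \<Rightarrow> ennreal" where
  "hausdorff_premeasure P s \<delta> E =
     Inf {(\<Sum>\<^sub>\<infinity>(z, \<rho>)\<in>C. ennreal (\<rho> powr s)) | C.
            countable C \<and> (\<forall>(z, \<rho>)\<in>C. 0 < \<rho> \<and> \<rho> \<le> \<delta>) \<and> E \<subseteq> (\<Union>(z, \<rho>)\<in>C. P z \<rho>)}"

definition hausdorff_measure ::
    "('a \<Rightarrow> real \<Rightarrow> 'a set) \<Rightarrow> real \<Rightarrow> 'a set \<Rightarrow> ennreal" where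
  "hausdorff_measure P s E = (SUP \<delta>\<in>{0<..}. hausdorff_premeasure P s \<delta> E)"

definition hausdorff_dim :: "('a \<Rightarrow> real \<Rightarrow> 'a set) \<Rightarrow> 'a set \<Rightarrow> ereal" where
  "hausdorff_dim P E = Inf {ereal s | s. 0 \<le> s \<and> hausdorff_measure P s E = 0}"

definition parabolic_cylinder ::
    "'a::metric_space \<times> real \<Rightarrow> real \<Rightarrow> ('a \<times> real) set" where
  "parabolic_cylinder z \<rho> = ball (fst z) \<rho> \<times> {snd z - \<rho>\<^sup>2 <..< snd z + \<rho>\<^sup>2}"

definition parabolic_hausdorff_dim :: "('a::metric_space \<times> real) set \<Rightarrow> ereal" where
  "parabolic_hausdorff_dim E = hausdorff_dim parabolic_cylinder E"

section \<open>Approximate limits and traces\<close>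

definition approx_limit ::
    "'a::euclidean_space set \<Rightarrow> ('a \<Rightarrow> real) \<Rightarrow> 'a \<Rightarrow> real \<Rightarrow> bool" where
  "approx_limit \<Omega> f x c \<longleftrightarrow>
     ((\<lambda>r. (\<integral>\<^sup>+y\<in>\<Omega> \<inter> ball x r. ennreal \<bar>f y - c\<bar> \<partial>lebesgue) / emeasure lebesgue (\<Omega> \<inter> ball x r))
        \<longlongrightarrow> 0) (at_right 0)"

text \<open>The boundary trace of a \<open>W\<^sup>1\<^sup>,\<^sup>1\<close> (or \<open>BV\<close>) function on a Lipschitz domain is the function \<open>g\<close>
  on the boundary, unique up to surface null sets, whose value is the one-sided approximate limit
  at almost every boundary point. Surface measure is the Hausdorff measure of codimension one.\<close>

definition has_trace ::
    "'a::euclidean_space set \<Rightarrow> ('a \<Rightarrow> real) \<Rightarrow> 'a set \<Rightarrow> ('a \<Rightarrow> real) \<Rightarrow> bool" where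
  "has_trace \<Omega> f S g \<longleftrightarrow>
     hausdorff_measure ball (real DIM('a) - 1) {x\<in>S. \<not> approx_limit \<Omega> f x (g x)} = 0"

section \<open>Weak derivatives and Sobolev spaces\<close>

definition test_function :: "'a::euclidean_space set \<Rightarrow> ('a \<Rightarrow> real) \<Rightarrow> bool" where
  "test_function \<Omega> \<phi> \<longleftrightarrow>
     (\<forall>k. Ck k \<phi>) \<and> compact (closure {x. \<phi> x \<noteq> 0}) \<and> closure {x. \<phi> x \<noteq> 0} \<subseteq> \<Omega>"

definition L1_loc :: "'a::euclidean_space set \<Rightarrow> ('a \<Rightarrow> real) \<Rightarrow> bool" where
  "L1_loc \<Omega> f \<longleftrightarrow> (\<forall>K. compact K \<and> K \<subseteq> \<Omega> \<longrightarrow> f absolutely_integrable_on K)"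

definition weak_derivative ::
    "'a::euclidean_space set \<Rightarrow> 'a \<Rightarrow> ('a \<Rightarrow> real) \<Rightarrow> ('a \<Rightarrow> real) \<Rightarrow> bool" where
  "weak_derivative \<Omega> v f g \<longleftrightarrow> L1_loc \<Omega> f \<and> L1_loc \<Omega> g \<and>
     (\<forall>\<phi>. test_function \<Omega> \<phi> \<longrightarrow>
        (LINT x:\<Omega>|lebesgue. f x * frechet_derivative \<phi> (at x) v)
          = - (LINT x:\<Omega>|lebesgue. g x * \<phi> x))"

definition W11 :: "(real^'m) set \<Rightarrow> (real^'m \<Rightarrow> real) \<Rightarrow> (real^'m \<Rightarrow> real^'m) \<Rightarrow> bool" where
  "W11 D f g \<longleftrightarrow> f absolutely_integrable_on D \<and> g absolutely_integrable_on D \<and>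
     (\<forall>i. weak_derivative D (axis i 1) f (\<lambda>x. g x $ i))"

definition space_time :: "'a set \<Rightarrow> real \<Rightarrow> ('a \<times> real) set" where
  "space_time D T = D \<times> {0<..<T}"

text \<open>\<open>u \<in> L\<^sup>2(0,T; W\<^sup>1\<^sup>,\<^sup>1(D))\<close> with weak spatial gradient \<open>G\<close>. Elements of this Bochner space are
  identified with jointly measurable functions on \<open>D \<times> (0,T)\<close>.\<close>

definition L2_W11 ::
    "(real^'m) set \<Rightarrow> real \<Rightarrow> ((real^'m) \<times> real \<Rightarrow> real) \<Rightarrow> ((real^'m) \<times> real \<Rightarrow> real^'m) \<Rightarrow> bool" where
  "L2_W11 D T u G \<longleftrightarrow>
     u \<in> borel_measurable (lebesgue_on (space_time D T)) \<and>
     G \<in> borel_measurable (lebesgue_on (space_time D T)) \<and>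
     (AE t in lebesgue_on {0<..<T}. W11 D (\<lambda>x. u (x, t)) (\<lambda>x. G (x, t))) \<and>
     (\<integral>\<^sup>+t. (\<integral>\<^sup>+x. ennreal (\<bar>u (x, t)\<bar> + norm (G (x, t))) \<partial>lebesgue_on D)\<^sup>2
        \<partial>lebesgue_on {0<..<T}) < \<infinity>"

definition L2_time_derivative ::
    "(real^'m) set \<Rightarrow> real \<Rightarrow> ((real^'m) \<times> real \<Rightarrow> real) \<Rightarrow> ((real^'m) \<times> real \<Rightarrow> real) \<Rightarrow> bool" where
  "L2_time_derivative D T u w \<longleftrightarrow>
     weak_derivative (space_time D T) (0, 1) u w \<and>
     w \<in> borel_measurable (lebesgue_on (space_time D T)) \<and>
     (\<integral>\<^sup>+z. ennreal ((w z)\<^sup>2) \<partial>lebesgue_on (space_time D T)) < \<infinity>"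

text \<open>Both choices below are unique up to null sets, so integrals do not depend on them.\<close>

definition spatial_gradient ::
    "(real^'m) set \<Rightarrow> real \<Rightarrow> ((real^'m) \<times> real \<Rightarrow> real) \<Rightarrow> (real^'m) \<times> real \<Rightarrow> real^'m" where
  "spatial_gradient D T u = (SOME G. L2_W11 D T u G)"

definition time_derivative ::
    "(real^'m) set \<Rightarrow> real \<Rightarrow> ((real^'m) \<times> real \<Rightarrow> real) \<Rightarrow> (real^'m) \<times> real \<Rightarrow> real" where
  "time_derivative D T u = (SOME w. L2_time_derivative D T u w)"

section \<open>The variational problem\<close>

definition sym_pos_def :: "real^'m^'m \<Rightarrow> bool" where
  "sym_pos_def A \<longleftrightarrow> transpose A = A \<and> (\<forall>p. p \<noteq> 0 \<longrightarrow> p \<bullet> (A *v p) > 0)"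

definition aniso :: "real^'m^'m \<Rightarrow> real^'m \<Rightarrow> real" where
  "aniso A p = sqrt (p \<bullet> (A *v p))"

definition energy ::
    "(real^'m \<Rightarrow> real) \<Rightarrow> (real^'m) set \<Rightarrow> real \<Rightarrow> ((real^'m) \<times> real \<Rightarrow> real) \<Rightarrow> ennreal" where
  "energy \<Phi> D T u =
     (if \<exists>w. L2_time_derivative D T u w
      then \<integral>\<^sup>+z. ennreal (\<Phi> (spatial_gradient D T u z) + (time_derivative D T u z)\<^sup>2 / 2)
             \<partial>lebesgue_on (space_time D T)
      else \<infinity>)"

definition admissible ::
    "(real^'m) set \<Rightarrow> real \<Rightarrow> ((real^'m) \<times> real \<Rightarrow> real) \<Rightarrow> (real^'m \<Rightarrow> real)
       \<Rightarrow> ((real^'m) \<times> real \<Rightarrow> real) set" where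
  "admissible D T \<psi> u0 =
     {u. (\<exists>G. L2_W11 D T u G) \<and>
         (AE z in lebesgue_on (space_time D T). \<psi> z \<le> u z) \<and>
         (AE t in lebesgue_on {0<..<T}. has_trace D (\<lambda>x. u (x, t)) (frontier D) (\<lambda>x. 0)) \<and>
         has_trace (space_time D T) u (D \<times> {0}) (\<lambda>z. u0 (fst z))}"

text \<open>Finite energy is required, since otherwise every admissible function would be a minimizer
  whenever the functional is identically infinite on the admissible class.\<close>

definition is_minimizer ::
    "(real^'m \<Rightarrow> real) \<Rightarrow> (real^'m) set \<Rightarrow> real \<Rightarrow> ((real^'m) \<times> real \<Rightarrow> real) \<Rightarrow> (real^'m \<Rightarrow> real)
       \<Rightarrow> ((real^'m) \<times> real \<Rightarrow> real) \<Rightarrow> bool" where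
  "is_minimizer \<Phi> D T \<psi> u0 u \<longleftrightarrow>
     u \<in> admissible D T \<psi> u0 \<and> energy \<Phi> D T u < \<infinity> \<and>
     (\<forall>v\<in>admissible D T \<psi> u0. energy \<Phi> D T u \<le> energy \<Phi> D T v)"

text \<open>The minimizer is an almost-everywhere class, whereas contact sets and blow-ups use its
  pointwise values. This fixes the representative without assuming any regularity: every locally
  integrable function agrees almost everywhere with a precise one, and a function that has
  a continuous representative is precise on an open set iff it is that representative there.\<close>

definition precise_representative ::
    "'a::euclidean_space set \<Rightarrow> ('a \<Rightarrow> real) \<Rightarrow> bool" where
  "precise_representative \<Omega> u \<longleftrightarrow> (\<forall>z\<in>\<Omega>. \<forall>c. approx_limit \<Omega> u z c \<longrightarrow> u z = c)"

section \<open>Free boundary, blow-ups and singular points\<close>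

definition contact_set ::
    "'a set \<Rightarrow> ('a \<times> real \<Rightarrow> real) \<Rightarrow> ('a \<times> real \<Rightarrow> real) \<Rightarrow> real \<Rightarrow> 'a set" where
  "contact_set D \<psi> u t = {x\<in>D. u (x, t) = \<psi> (x, t)}"

definition free_boundary ::
    "'a::topological_space set \<Rightarrow> ('a \<times> real \<Rightarrow> real) \<Rightarrow> ('a \<times> real \<Rightarrow> real) \<Rightarrow> real \<Rightarrow> 'a set" where
  "free_boundary D \<psi> u t = frontier (contact_set D \<psi> u t) \<inter> D"

definition parabolic_rescaling ::
    "('a::real_normed_vector \<times> real \<Rightarrow> real) \<Rightarrow> 'a \<Rightarrow> real \<Rightarrow> real \<Rightarrow> 'a \<times> real \<Rightarrow> real" where
  "parabolic_rescaling u x0 t0 r =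
     (\<lambda>(y, s). (u (x0 + r *\<^sub>R y, t0 + r\<^sup>2 * s) - u (x0, t0)) / r\<^sup>2)"

definition Q1 :: "('a::real_normed_vector \<times> real) set" where
  "Q1 = ball 0 1 \<times> {-1<..0}"

text \<open>Convergence in \<open>C\<^sup>1\<^sup>,\<^sup>\<alpha>\<close>-norm on every compact subset of \<open>Q\<close>. The members of the sequence
  need to be differentiable on a given compact set only from some index on (a rescaled function
  is meaningful there only once the scale is small). Derivatives are taken within \<open>Q\<close>, hence
  one-sided in time at the top of \<open>Q1\<close>. All space-time variables enter, with the Euclidean
  distance.\<close>

definition C1_holder_loc_limit ::
    "real \<Rightarrow> 'a::euclidean_space set \<Rightarrow> (nat \<Rightarrow> 'a \<Rightarrow> real) \<Rightarrow> ('a \<Rightarrow> real) \<Rightarrow> bool" where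
  "C1_holder_loc_limit \<alpha> Q f p \<longleftrightarrow>
     (\<exists>F P. (\<forall>z\<in>Q. (p has_derivative (\<lambda>h. P z \<bullet> h)) (at z within Q)) \<and>
       (\<forall>K. compact K \<and> K \<subseteq> Q \<longrightarrow>
          (\<exists>C. \<forall>z\<in>K. \<forall>w\<in>K. norm (P z - P w) \<le> C * dist z w powr \<alpha>) \<and>
          (\<forall>\<epsilon>>0. \<forall>\<^sub>F j in sequentially.
             (\<forall>z\<in>K. (f j has_derivative (\<lambda>h. F j z \<bullet> h)) (at z within Q)) \<and>
             (\<forall>z\<in>K. \<bar>f j z - p z\<bar> \<le> \<epsilon> \<and> norm (F j z - P z) \<le> \<epsilon>) \<and>
             (\<forall>z\<in>K. \<forall>w\<in>K.
                norm ((F j z - P z) - (F j w - P w)) \<le> \<epsilon> * dist z w powr \<alpha>))))"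

definition is_blowup ::
    "('a::euclidean_space \<times> real \<Rightarrow> real) \<Rightarrow> 'a \<Rightarrow> real \<Rightarrow> ('a \<times> real \<Rightarrow> real) \<Rightarrow> bool" where
  "is_blowup u x0 t0 p \<longleftrightarrow>
     (\<exists>r :: nat \<Rightarrow> real. (\<forall>j. 0 < r j) \<and> r \<longlonglongrightarrow> 0 \<and>
        (\<forall>\<alpha>\<in>{0<..<1}. C1_holder_loc_limit \<alpha> Q1 (\<lambda>j. parabolic_rescaling u x0 t0 (r j)) p))"

definition parabolic_polynomial :: "real^'m^'m \<Rightarrow> real \<Rightarrow> (real^'m) \<times> real \<Rightarrow> real" where
  "parabolic_polynomial M c = (\<lambda>(y, s). (y \<bullet> (M *v y)) / 2 + c * s)"

definition singular_points ::
    "(real^'m) set \<Rightarrow> ((real^'m) \<times> real \<Rightarrow> real) \<Rightarrow> ((real^'m) \<times> real \<Rightarrow> real) \<Rightarrow> real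
       \<Rightarrow> (real^'m) set" where
  "singular_points D \<psi> u t =
     {x \<in> free_boundary D \<psi> u t.
        \<exists>M c. transpose M = M \<and> is_blowup u x t (parabolic_polynomial M c)}"

definition singular_set ::
    "(real^'m) set \<Rightarrow> real \<Rightarrow> ((real^'m) \<times> real \<Rightarrow> real) \<Rightarrow> ((real^'m) \<times> real \<Rightarrow> real)
       \<Rightarrow> ((real^'m) \<times> real) set" where
  "singular_set D T \<psi> u = (\<Union>t\<in>{0<..<T}. singular_points D \<psi> u t \<times> {t})"

end

theory Submission
  imports Defs
begin

text \<open>The singular set is in fact empty, because the minimizer lies strictly above the obstacle inside
  the space-time cylinder. The barrier \<open>b = \<psi> + \<epsilon> sin (\<pi> t / T) exp (K \<bar>x\<bar>\<^sup>2 / 2)\<close> agrees with \<open>\<psi>\<close> at the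
  two ends of the time interval and stays admissible near the parabolic boundary when \<open>\<epsilon>\<close> is small. For large \<open>K\<close> it is a
  strict subsolution of the Euler-Lagrange equation: \<open>\<psi>\<close> is convex, and the integrand, whose Hessian degenerates
  only in the direction of the gradient, turns the strong spatial convexity of the added term into a lower bound for
  the divergence of the flux which dominates the second time derivative of \<open>sin (\<pi> t / T)\<close>. Comparing the
  minimizer \<open>u\<close> with \<open>u + j (b - u)\<close>, where \<open>j\<close> is a \<open>C\<^sup>1\<^sup>,\<^sup>1\<close> version of the positive part, gives \<open>u \<ge> b\<close> almost everywhere.
  On the other hand, a blow-up in \<open>C\<^sup>1\<^sup>,\<^sup>\<alpha>\<close> at a free boundary point forces \<open>u\<close> to be continuous, from the past, at a contact
  point close to it, where \<open>u = \<psi> < b\<close>.\<close>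

section \<open>Smooth functions and mollification\<close>

text \<open>The integrand has linear growth and is not differentiable at 0, so no regularity of
  \<open>u\<close> is at hand and no Euler-Lagrange equation can be written for it. First-order
  quantities are therefore evaluated at the gradient of the barrier: convexity bounds the change of
  energy by the flux at that gradient paired with the derivatives of the increment, and the flux is
  taken from a regularised integrand, at a cost of \<delta> times the volume. The added term S =
  \<epsilon> sin(pi t / T) exp(K |x|^2 / 2) enters both sides as a common factor: its second time
  derivative is -(pi/T)^2 S and its spatial Hessian is at least K S, so \<epsilon> cancels from the
  comparison and is chosen last, as small as the boundary values require. Two defects of regularity
  shape the rest. The gradient of \<psi> is only Lipschitz, so its spatial part is mollified, which
  preserves monotonicity. Traces are known only as approximate limits off a null set, so removing
  the spatial cutoff needs a covering argument on the boundary.\<close>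

lemma Ck_SucD: "Ck (Suc k) f \<Longrightarrow> Ck k f"
proof (induction k arbitrary: f)
  case 0
  then obtain f' where "\<forall>x. (f has_derivative f' x) (at x)" by auto
  then show ?case
    by (auto intro!: continuous_at_imp_continuous_on has_derivative_continuous)
next
  case (Suc k)
  from Suc.prems obtain f' where f': "\<forall>x. (f has_derivative f' x) (at x)"
    "\<forall>v. Ck (Suc k) (\<lambda>x. f' x v)"
    by (subst (asm) Ck.simps) blast
  then show ?case using Suc.IH by auto
qed

lemma Ck_SucI:
  assumes "\<And>x. (f has_derivative f' x) (at x)" "\<And>v. Ck k (\<lambda>x. f' x v)"
  shows "Ck (Suc k) f"
  using assms by auto

lemma Ck_SucE:
  assumes "Ck (Suc k) f"
  obtains f' where "\<And>x. (f has_derivative f' x) (at x)" "\<And>v. Ck k (\<lambda>x. f' x v)"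
  using assms by auto

lemma Ck_continuous: "Ck k f \<Longrightarrow> continuous_on UNIV f"
  by (induction k) (auto dest!: Ck_SucD simp del: Ck.simps(2))

lemma Ck_const: "Ck k (\<lambda>x. c)"
proof (induction k arbitrary: c)
  case (Suc k)
  show ?case by (rule Ck_SucI[where f'="\<lambda>x v. 0"]) (use Suc in auto)
qed auto

lemma Ck_inner: "Ck k (\<lambda>x. x \<bullet> c)"
proof (cases k)
  case (Suc m)
  show ?thesis unfolding Suc
    by (rule Ck_SucI[where f'="\<lambda>x v. v \<bullet> c"]) (auto intro!: derivative_eq_intros Ck_const)
qed (auto intro!: continuous_intros)

lemma Ck_add: "Ck k f \<Longrightarrow> Ck k g \<Longrightarrow> Ck k (\<lambda>x. f x + g x)"
proof (induction k arbitrary: f g)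
  case (Suc k)
  from Suc.prems(1) obtain f' where f': "\<And>x. (f has_derivative f' x) (at x)" "\<And>v. Ck k (\<lambda>x. f' x v)"
    by (metis Ck_SucE)
  from Suc.prems(2) obtain g' where g': "\<And>x. (g has_derivative g' x) (at x)" "\<And>v. Ck k (\<lambda>x. g' x v)"
    by (metis Ck_SucE)
  show ?case
    by (rule Ck_SucI[where f'="\<lambda>x v. f' x v + g' x v"])
      (use f' g' Suc.IH in \<open>auto intro!: has_derivative_add\<close>)
qed (auto intro!: continuous_intros)

lemma Ck_mult: "Ck k f \<Longrightarrow> Ck k g \<Longrightarrow> Ck k (\<lambda>x. f x * g x)"
proof (induction k arbitrary: f g)
  case (Suc k)
  from Suc.prems(1) obtain f' where f': "\<And>x. (f has_derivative f' x) (at x)" "\<And>v. Ck k (\<lambda>x. f' x v)"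
    by (metis Ck_SucE)
  from Suc.prems(2) obtain g' where g': "\<And>x. (g has_derivative g' x) (at x)" "\<And>v. Ck k (\<lambda>x. g' x v)"
    by (metis Ck_SucE)
  have "Ck k f" "Ck k g" using Suc.prems by (auto simp del: Ck.simps dest: Ck_SucD)
  then show ?case
    by (intro Ck_SucI[where f'="\<lambda>x v. f x * g' x v + f' x v * g x"])
      (use f' g' Suc.IH in \<open>auto intro!: has_derivative_mult Ck_add\<close>)
qed (auto intro!: continuous_intros)

lemma Ck_affine: "Ck k f \<Longrightarrow> Ck k (\<lambda>x. f (a + c *\<^sub>R x))"
proof (induction k arbitrary: f)
  case 0
  have "continuous_on UNIV (f \<circ> (\<lambda>x. a + c *\<^sub>R x))"
    by (rule continuous_on_compose) (use 0 in \<open>auto intro!: continuous_intros intro: continuous_on_subset\<close>)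
  then show ?case by (simp add: o_def)
next
  case (Suc k)
  then obtain f' where f': "\<And>x. (f has_derivative f' x) (at x)" "\<And>v. Ck k (\<lambda>x. f' x v)"
    by (metis Ck_SucE)
  show ?case
  proof (rule Ck_SucI[where f'="\<lambda>x v. f' (a + c *\<^sub>R x) (c *\<^sub>R v)"])
    show "((\<lambda>x. f (a + c *\<^sub>R x)) has_derivative (\<lambda>v. f' (a + c *\<^sub>R x) (c *\<^sub>R v))) (at x)" for x
      by (rule has_derivative_compose[of "\<lambda>x. a + c *\<^sub>R x" _ x UNIV f "f' (a + c *\<^sub>R x)", simplified])
        (auto intro!: derivative_eq_intros f')
    show "Ck k (\<lambda>x. f' (a + c *\<^sub>R x) (c *\<^sub>R v))" for v
      using Suc.IH[OF f'(2)[of "c *\<^sub>R v"]] .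
  qed
qed

section \<open>A smooth bump and mollifiers\<close>

lemma poly_div_exp_tendsto: "((\<lambda>s. poly p s * exp (- s)) \<longlongrightarrow> (0::real)) at_top"
proof -
  have "((\<lambda>s. \<Sum>i\<le>degree p. coeff p i * (s ^ i / exp s)) \<longlongrightarrow> (\<Sum>i\<le>degree p. coeff p i * 0)) at_top"
    by (intro tendsto_intros tendsto_power_div_exp_0)
  then show ?thesis
    by (simp add: poly_altdef sum_distrib_right exp_minus divide_inverse mult.assoc)
qed

text \<open>With s = 1/t, the derivative of p(s) exp(-s) with respect to t is s^2 (p(s) - p'(s))
  exp(-s); \<open>bump_poly i\<close> is the resulting prefactor of the i-th derivative of
  exp(-1/t).\<close>

primrec bump_poly :: "nat \<Rightarrow> real poly" where
  "bump_poly 0 = 1"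
| "bump_poly (Suc i) = [:0, 0, 1:] * (bump_poly i - pderiv (bump_poly i))"

definition bump_fun :: "nat \<Rightarrow> real \<Rightarrow> real" where
  "bump_fun i t = (if t > 0 then poly (bump_poly i) (1 / t) * exp (- (1 / t)) else 0)"

lemma bump_fun_deriv: "(bump_fun i has_real_derivative bump_fun (Suc i) t) (at t)"
proof -
  consider "t > 0" | "t < 0" | "t = 0" by linarith
  then show ?thesis
  proof cases
    case 1
    have "((\<lambda>t. poly (bump_poly i) (1 / t) * exp (- (1 / t))) has_real_derivative bump_fun (Suc i) t) (at t)"
      using 1 by (auto intro!: derivative_eq_intros DERIV_chain2[OF poly_DERIV]
          simp: bump_fun_def field_simps power2_eq_square)
    then show ?thesis
      by (rule DERIV_cong_ev[THEN iffD1, rotated -1])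
        (use 1 in \<open>auto simp: bump_fun_def eventually_nhds intro!: exI[of _ "{0<..}"]\<close>)
  next
    case 2
    have "((\<lambda>t. 0) has_real_derivative bump_fun (Suc i) t) (at t)"
      using 2 by (auto simp: bump_fun_def)
    then show ?thesis
      by (rule DERIV_cong_ev[THEN iffD1, rotated -1])
        (use 2 in \<open>auto simp: bump_fun_def eventually_nhds intro!: exI[of _ "{..<0}"]\<close>)
  next
    case 3
    have lim: "((\<lambda>h. bump_fun i h / h) \<longlongrightarrow> 0) (at_right 0)"
    proof -
      \<comment> \<open>Dividing by h costs one more factor 1/h, which \<open>pCons 0\<close> adds
        to the polynomial; the exponential still wins.\<close>
      have "((\<lambda>h. poly (pCons 0 (bump_poly i)) (inverse h) * exp (- inverse h)) \<longlongrightarrow> 0) (at_right (0::real))"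
        by (rule filterlim_compose[OF poly_div_exp_tendsto filterlim_inverse_at_top_right])
      then show ?thesis
        by (rule Lim_transform_eventually)
          (auto simp: eventually_at_right_less bump_fun_def divide_inverse mult_ac
            intro!: eventually_mono[OF eventually_at_right_less[of 0]])
    qed
    have "((\<lambda>h. bump_fun i h / h) \<longlongrightarrow> 0) (at_left 0)"
      by (rule tendsto_eventually) (auto simp: eventually_at_filter bump_fun_def)
    with lim have "((\<lambda>h. bump_fun i h / h) \<longlongrightarrow> 0) (at 0)"
      by (simp add: filterlim_split_at)
    then show ?thesis
      unfolding 3 DERIV_def by (simp add: bump_fun_def)
  qed
qed

text \<open>All i are treated at once, because differentiating in x replaces
  \<open>bump_fun i\<close> by \<open>bump_fun (Suc i)\<close> times a smooth factor. This special
  case takes the place of a general chain rule for \<open>Ck\<close>.\<close>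

lemma bump_fun_smooth:
  fixes q :: "'a::euclidean_space \<Rightarrow> real"
  assumes q: "\<And>x. (q has_derivative q' x) (at x)" "\<And>k v. Ck k (\<lambda>x. q' x v)"
  shows "Ck k (\<lambda>x. bump_fun i (q x))"
proof (induction k arbitrary: i)
  case 0
  have "isCont (\<lambda>x. bump_fun i (q x)) x" for x
    by (rule isCont_o2[OF has_derivative_continuous[OF q(1)] DERIV_isCont[OF bump_fun_deriv]])
  then have "continuous_on UNIV (\<lambda>x. bump_fun i (q x))"
    by (simp add: continuous_at_imp_continuous_on)
  then show ?case by simp
next
  case (Suc k)
  show ?case
  proof (rule Ck_SucI[where f'="\<lambda>x v. q' x v * bump_fun (Suc i) (q x)"])
    show "((\<lambda>x. bump_fun i (q x)) has_derivative (\<lambda>v. q' x v * bump_fun (Suc i) (q x))) (at x)" for x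
      using has_derivative_compose[OF q(1)[of x] bump_fun_deriv[unfolded has_field_derivative_def, of i "q x"]]
      by (simp add: mult.commute)
    show "Ck k (\<lambda>x. q' x v * bump_fun (Suc i) (q x))" for v
      by (intro Ck_mult Suc q)
  qed
qed

definition mollifier :: "real \<Rightarrow> ('a::euclidean_space \<Rightarrow> real) \<Rightarrow> bool" where
  "mollifier \<delta> \<rho> \<longleftrightarrow> (\<forall>k. Ck k \<rho>) \<and> (\<forall>x. 0 \<le> \<rho> x) \<and> (\<forall>x. \<rho> x \<noteq> 0 \<longrightarrow> norm x < \<delta>) \<and>
     integrable lebesgue \<rho> \<and> integral\<^sup>L lebesgue \<rho> = 1"

lemma continuous_measurable_lebesgue:
  fixes f :: "'a::euclidean_space \<Rightarrow> 'b::euclidean_space"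
  shows "continuous_on UNIV f \<Longrightarrow> f \<in> borel_measurable lebesgue"
  by (simp add: borel_measurable_continuous_onI measurable_completion)

lemma integrable_bounded_support:
  fixes f :: "'a::euclidean_space \<Rightarrow> 'b::euclidean_space"
  assumes "f \<in> borel_measurable lebesgue" "\<And>x. norm (f x) \<le> B" "\<And>x. norm x > R \<Longrightarrow> f x = 0"
  shows "integrable lebesgue f"
proof (rule Bochner_Integration.integrable_bound)
  show "integrable lebesgue (\<lambda>x. B * indicator (cball (0::'a) R) x)"
    using lmeasurable_cball[of "0::'a" R] by (auto simp: lmeasurable_iff_integrable)
  show "AE x in lebesgue. norm (f x) \<le> norm (B * indicator (cball 0 R) x)"
  proof (rule AE_I2)
    fix x show "norm (f x) \<le> norm (B * indicator (cball 0 R) x)"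
      using assms(2)[of x] assms(3)[of x] norm_ge_zero[of "f x"]
      by (cases "norm x \<le> R") (auto simp: indicator_def intro: order_trans)
  qed
qed fact

lemma continuous_bounded_support_bound:
  fixes f :: "'a::euclidean_space \<Rightarrow> 'b::real_normed_vector"
  assumes "continuous_on UNIV f" "\<And>x. norm x > R \<Longrightarrow> f x = 0"
  obtains B where "B > 0" "\<And>x. norm (f x) \<le> B"
proof -
  have "compact (f ` cball 0 R)"
    using assms(1) by (intro compact_continuous_image) (auto intro: continuous_on_subset)
  then obtain B where B: "B > 0" "\<And>x. norm x \<le> R \<Longrightarrow> norm (f x) \<le> B"
    using compact_imp_bounded[of "f ` cball 0 R"] unfolding bounded_pos by auto
  show ?thesis
  proof (rule that[of B])
    fix x show "norm (f x) \<le> B" using B assms(2)[of x] by (cases "norm x \<le> R") auto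
  qed fact
qed

lemma integrable_continuous_bounded_support:
  fixes f :: "'a::euclidean_space \<Rightarrow> 'b::euclidean_space"
  assumes "continuous_on UNIV f" "\<And>x. norm x > R \<Longrightarrow> f x = 0"
  shows "integrable lebesgue f"
  by (metis assms continuous_bounded_support_bound continuous_measurable_lebesgue integrable_bounded_support)

text \<open>The bump applied to \<delta>^2 - |x|^2 is positive exactly on the open ball of radius
  \<delta>. That ball is not negligible, so the integral is positive and can be normalised.\<close>

lemma mollifier_exists:
  assumes "\<delta> > 0"
  obtains \<rho> :: "'a::euclidean_space \<Rightarrow> real" where "mollifier \<delta> \<rho>"
proof -
  define q :: "'a \<Rightarrow> real" where "q = (\<lambda>x. \<delta>\<^sup>2 - x \<bullet> x)"
  define \<beta> where "\<beta> = (\<lambda>x. bump_fun 0 (q x))"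
  have Ck: "Ck k \<beta>" for k
    unfolding \<beta>_def
  proof (rule bump_fun_smooth[where q'="\<lambda>x v. - 2 * (x \<bullet> v)"])
    show "(q has_derivative (\<lambda>v. - 2 * (x \<bullet> v))) (at x)" for x
      unfolding q_def by (auto intro!: derivative_eq_intros simp: inner_commute)
    show "Ck k (\<lambda>x. - 2 * (x \<bullet> v))" for k v
      by (intro Ck_mult Ck_const Ck_inner)
  qed
  have nn: "\<beta> x \<ge> 0" for x by (auto simp: \<beta>_def bump_fun_def)
  have supp: "\<beta> x \<noteq> 0 \<longleftrightarrow> norm x < \<delta>" for x
    using assms by (auto simp: \<beta>_def bump_fun_def q_def norm_lt_square)
  have int: "integrable lebesgue \<beta>"
    by (rule integrable_continuous_bounded_support[of _ \<delta>])
      (use Ck[of 0] supp in \<open>auto dest: less_asym\<close>)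
  have "integral\<^sup>L lebesgue \<beta> \<noteq> 0"
  proof
    assume "integral\<^sup>L lebesgue \<beta> = 0"
    then have "AE x in lebesgue. \<beta> x = 0"
      using integral_nonneg_eq_0_iff_AE[OF int] nn by auto
    then have "AE x in lebesgue. x \<notin> ball (0::'a) \<delta>"
      by (rule eventually_mono) (use supp in auto)
    then have "ball (0::'a) \<delta> \<in> null_sets lebesgue"
      by (subst (asm) AE_iff_null_sets[symmetric]) auto
    then have "negligible (ball (0::'a) \<delta>)"
      by (simp add: negligible_iff_null_sets)
    then show False
      using assms open_not_negligible[of "ball (0::'a) \<delta>"] by auto
  qed
  moreover have "integral\<^sup>L lebesgue \<beta> \<ge> 0" using nn by (simp add: integral_nonneg_AE)
  ultimately have pos: "integral\<^sup>L lebesgue \<beta> > 0" by simp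
  show ?thesis
  proof (rule that[of "\<lambda>x. inverse (integral\<^sup>L lebesgue \<beta>) * \<beta> x"])
    show "mollifier \<delta> (\<lambda>x. inverse (integral\<^sup>L lebesgue \<beta>) * \<beta> x)"
      unfolding mollifier_def using Ck nn supp int pos
      by (auto intro!: Ck_mult Ck_const mult_nonneg_nonneg)
  qed
qed

text \<open>The two signs cover translations and the reflections y -> t - y that occur in
  convolutions. The completed measure is used because weak derivatives are tested with integrals
  over \<open>lebesgue\<close>.\<close>

lemma distr_lebesgue_affine:
  fixes t :: "'a::euclidean_space"
  assumes "s = 1 \<or> s = -1"
  shows "distr lebesgue lebesgue (\<lambda>x. t + s *\<^sub>R x) = lebesgue"
    and "(\<lambda>x. t + s *\<^sub>R x) \<in> lebesgue \<rightarrow>\<^sub>M lebesgue"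
proof -
  have eq: "(\<lambda>x. t + (\<Sum>j\<in>Basis. (s * (x \<bullet> j)) *\<^sub>R j)) = (\<lambda>x. t + s *\<^sub>R x)"
    by (simp only: scaleR_scaleR[symmetric] scaleR_sum_right[symmetric] euclidean_representation)
  have "lebesgue = density (distr lebesgue lebesgue (\<lambda>x. t + s *\<^sub>R x)) (\<lambda>_. (\<Prod>j\<in>(Basis::'a set). \<bar>s\<bar>))"
    using lebesgue_affine_euclidean[of "\<lambda>_. s" t] assms unfolding eq by auto
  then show "distr lebesgue lebesgue (\<lambda>x. t + s *\<^sub>R x) = lebesgue"
    using assms by (auto simp: density_1)
  show "(\<lambda>x. t + s *\<^sub>R x) \<in> lebesgue \<rightarrow>\<^sub>M lebesgue"
    using lebesgue_affine_measurable[of "\<lambda>_. s" t] assms unfolding eq by auto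
qed

lemma lebesgue_affine_integral:
  fixes f :: "'a::euclidean_space \<Rightarrow> real"
  assumes "s = 1 \<or> s = -1" "integrable lebesgue f"
  shows "integrable lebesgue (\<lambda>x. f (t + s *\<^sub>R x))"
    and "(LINT x|lebesgue. f (t + s *\<^sub>R x)) = integral\<^sup>L lebesgue f"
proof -
  let ?T = "\<lambda>x. t + s *\<^sub>R x"
  note d = distr_lebesgue_affine[OF assms(1), of t]
  have f: "f \<in> borel_measurable lebesgue" using assms(2) by auto
  show "integrable lebesgue (\<lambda>x. f (?T x))"
    using integrable_distr_eq[OF d(2) f] assms(2) unfolding d(1) by blast
  show "(LINT x|lebesgue. f (?T x)) = integral\<^sup>L lebesgue f"
    using integral_distr[OF d(2) f] unfolding d(1) by simp
qed

lemma lebesgue_shift_integral: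
  fixes f :: "'a::euclidean_space \<Rightarrow> real"
  assumes "integrable lebesgue f"
  shows "integrable lebesgue (\<lambda>x. f (x + t))" "(LINT x|lebesgue. f (x + t)) = integral\<^sup>L lebesgue f"
  using lebesgue_affine_integral[OF _ assms, of 1 t] by (simp_all add: add.commute)

lemma integrable_times_bounded:
  fixes f g :: "'a \<Rightarrow> real"
  assumes "integrable M f" "g \<in> borel_measurable M" "\<And>x. \<bar>g x\<bar> \<le> B"
  shows "integrable M (\<lambda>x. f x * g x)"
proof (rule Bochner_Integration.integrable_bound[of _ "\<lambda>x. B * \<bar>f x\<bar>"])
  show "AE x in M. norm (f x * g x) \<le> norm (B * \<bar>f x\<bar>)"
  proof (rule AE_I2)
    fix x
    have "\<bar>g x\<bar> * \<bar>f x\<bar> \<le> B * \<bar>f x\<bar>" by (rule mult_right_mono) (use assms(3) in auto)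
    then show "norm (f x * g x) \<le> norm (B * \<bar>f x\<bar>)"
      using abs_ge_self[of B] mult_right_mono[of B "\<bar>B\<bar>" "\<bar>f x\<bar>"] by (simp add: abs_mult mult.commute)
  qed
qed (use assms in \<open>auto intro: borel_measurable_times borel_measurable_integrable\<close>)

section \<open>Convolution and its derivatives\<close>

definition conv :: "('a::euclidean_space \<Rightarrow> real) \<Rightarrow> ('a \<Rightarrow> real) \<Rightarrow> 'a \<Rightarrow> real" where
  "conv f \<theta> x = (LINT y|lebesgue. f y * \<theta> (x - y))"

lemma continuous_on_diff_shift:
  fixes \<theta> :: "'a::real_normed_vector \<Rightarrow> 'b::topological_space"
  shows "continuous_on UNIV \<theta> \<Longrightarrow> continuous_on UNIV (\<lambda>y. \<theta> (x - y))"
  by (rule continuous_on_compose2[of UNIV \<theta>]) (auto intro!: continuous_intros)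

lemma conv_integrable:
  fixes f \<theta> :: "'a::euclidean_space \<Rightarrow> real"
  assumes "integrable lebesgue f" "continuous_on UNIV \<theta>" "\<And>x. \<bar>\<theta> x\<bar> \<le> B"
  shows "integrable lebesgue (\<lambda>y. f y * \<theta> (x - y))"
  by (rule integrable_times_bounded[OF assms(1), where B=B])
    (use assms in \<open>auto intro!: continuous_measurable_lebesgue continuous_on_diff_shift\<close>)

text \<open>Regularity of a convolution is inherited from the second argument of
  \<open>conv\<close>; commuting allows either factor to carry the derivatives.\<close>

lemma conv_commute:
  fixes f \<theta> :: "'a::euclidean_space \<Rightarrow> real"
  assumes "integrable lebesgue f" "continuous_on UNIV \<theta>" "\<And>x. \<bar>\<theta> x\<bar> \<le> B"
  shows "conv f \<theta> x = conv \<theta> f x"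
proof -
  note * = lebesgue_affine_integral(2)[OF _ conv_integrable[OF assms, of x], of "-1" x]
  show ?thesis unfolding conv_def by (subst *[symmetric]) (auto simp: mult.commute)
qed

lemma conv_continuous:
  fixes f \<theta> :: "'a::euclidean_space \<Rightarrow> real"
  assumes f: "integrable lebesgue f" and \<theta>: "continuous_on UNIV \<theta>" "\<And>x. \<bar>\<theta> x\<bar> \<le> B"
  shows "continuous_on UNIV (conv f \<theta>)"
proof (intro continuous_at_imp_continuous_on ballI)
  fix x
  show "isCont (conv f \<theta>) x"
    unfolding continuous_at_sequentially
  proof (intro allI impI)
    fix X :: "nat \<Rightarrow> 'a" assume X: "X \<longlonglongrightarrow> x"
    show "(conv f \<theta> \<circ> X) \<longlonglongrightarrow> conv f \<theta> x"
      unfolding conv_def o_def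
    proof (rule integral_dominated_convergence[where w="\<lambda>y. B * \<bar>f y\<bar>"])
      show "AE y in lebesgue. (\<lambda>i. f y * \<theta> (X i - y)) \<longlonglongrightarrow> f y * \<theta> (x - y)"
      proof (intro AE_I2 tendsto_mult tendsto_const)
        fix y
        have "isCont \<theta> (x - y)" using \<theta>(1) by (simp add: continuous_on_eq_continuous_at)
        then show "(\<lambda>i. \<theta> (X i - y)) \<longlonglongrightarrow> \<theta> (x - y)"
          by (rule isCont_tendsto_compose) (intro tendsto_intros X)
      qed
      show "AE y in lebesgue. norm (f y * \<theta> (X i - y)) \<le> B * \<bar>f y\<bar>" for i
      proof (rule AE_I2)
        fix y
        show "norm (f y * \<theta> (X i - y)) \<le> B * \<bar>f y\<bar>"
          using mult_right_mono[OF \<theta>(2)[of "X i - y"], of "\<bar>f y\<bar>"] by (simp add: abs_mult mult.commute)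
      qed
    qed (use conv_integrable[OF assms] f in auto)
  qed
qed

lemma derivative_zero_outside:
  fixes \<theta> :: "'a::euclidean_space \<Rightarrow> real"
  assumes "(\<theta> has_derivative \<theta>') (at x)" "open S" "x \<in> S" "\<And>y. y \<in> S \<Longrightarrow> \<theta> y = 0"
  shows "\<theta>' v = 0"
proof -
  have "(\<theta> has_derivative (\<lambda>v. 0)) (at x)"
    by (rule has_derivative_transform_within_open[of "\<lambda>x. 0"]) (use assms in auto)
  then have "\<theta>' = (\<lambda>v. 0)" using assms(1) has_derivative_unique by blast
  then show ?thesis by simp
qed

lemma directional_bound:
  fixes \<theta>' :: "'b \<Rightarrow> 'a::euclidean_space \<Rightarrow> real"
  assumes "\<And>x. linear (\<theta>' x)" "\<And>b. b \<in> Basis \<Longrightarrow> \<exists>B. \<forall>x. \<bar>\<theta>' x b\<bar> \<le> B"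
  obtains B where "B > 0" "\<And>x v. \<bar>\<theta>' x v\<bar> \<le> B * norm v"
proof -
  obtain Bf where Bf: "\<And>x b. b \<in> Basis \<Longrightarrow> \<bar>\<theta>' x b\<bar> \<le> Bf b" using assms(2) by metis
  have "\<bar>\<theta>' x v\<bar> \<le> (1 + (\<Sum>b\<in>Basis. \<bar>Bf b\<bar>)) * norm v" for x v
  proof -
    have "\<theta>' x v = \<theta>' x (\<Sum>b\<in>Basis. (v \<bullet> b) *\<^sub>R b)" by (simp add: euclidean_representation)
    also have "\<dots> = (\<Sum>b\<in>Basis. (v \<bullet> b) * \<theta>' x b)"
      by (simp add: linear_sum[OF assms(1)] linear_scale[OF assms(1)])
    also have "\<bar>\<dots>\<bar> \<le> (\<Sum>b\<in>Basis. norm v * \<bar>Bf b\<bar>)"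
    proof (intro sum_abs[THEN order_trans] sum_mono)
      fix b :: 'a assume b: "b \<in> Basis"
      have "\<bar>\<theta>' x b\<bar> \<le> \<bar>Bf b\<bar>" using Bf[OF b, of x] by simp
      then show "\<bar>(v \<bullet> b) * \<theta>' x b\<bar> \<le> norm v * \<bar>Bf b\<bar>"
        unfolding abs_mult by (intro mult_mono Basis_le_norm b) auto
    qed
    finally have "\<bar>\<theta>' x v\<bar> \<le> (\<Sum>b\<in>Basis. \<bar>Bf b\<bar>) * norm v"
      by (simp add: sum_distrib_left[symmetric] mult.commute)
    then show ?thesis using norm_ge_zero[of v] unfolding distrib_right by linarith
  qed
  then show ?thesis by (intro that[of "1 + (\<Sum>b\<in>Basis. \<bar>Bf b\<bar>)"]) (auto intro!: add_pos_nonneg sum_nonneg)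
qed

lemma C1_bounded_support_bound:
  fixes \<theta> :: "'a::euclidean_space \<Rightarrow> real"
  assumes "\<And>x. (\<theta> has_derivative \<theta>' x) (at x)" "\<And>v. continuous_on UNIV (\<lambda>x. \<theta>' x v)"
    and "\<And>x. norm x > R \<Longrightarrow> \<theta> x = 0"
  obtains B where "B > 0" "\<And>x v. \<bar>\<theta>' x v\<bar> \<le> B * norm v"
proof (rule directional_bound[of \<theta>'])
  show "linear (\<theta>' x)" for x using assms(1) has_derivative_linear by blast
  fix b :: 'a
  have "open {x::'a. norm x > R}" by (intro open_Collect_less continuous_intros)
  then have "\<theta>' x b = 0" if "norm x > R" for x
    using derivative_zero_outside[OF assms(1), of "{x. norm x > R}" x b] that assms(3) by auto
  then show "\<exists>B. \<forall>x. \<bar>\<theta>' x b\<bar> \<le> B"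
    by (rule continuous_bounded_support_bound[OF assms(2)]) auto
qed (use that in auto)

lemma lipschitz_from_derivative_bound:
  fixes \<theta> :: "'a::euclidean_space \<Rightarrow> real"
  assumes "\<And>x. (\<theta> has_derivative \<theta>' x) (at x)" "\<And>x v. \<bar>\<theta>' x v\<bar> \<le> B * norm v"
  shows "\<bar>\<theta> x - \<theta> y\<bar> \<le> B * norm (x - y)"
proof -
  have "norm (\<theta> x - \<theta> y) \<le> B * norm (x - y)"
    by (rule differentiable_bound[of UNIV \<theta> \<theta>'])
      (use assms in \<open>auto intro!: onorm_le has_derivative_linear\<close>)
  then show ?thesis by simp
qed

text \<open>Dominated convergence along sequences: the remainder quotients of \<theta> tend to 0
  pointwise, and the mean value bound on \<theta> keeps them below 2 B, so
  \<open>2 * B * \<bar>f y\<bar>\<close> dominates.\<close>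

lemma conv_has_derivative:
  fixes \<theta> :: "'a::euclidean_space \<Rightarrow> real"
  assumes f: "integrable lebesgue f"
    and \<theta>: "\<And>x. (\<theta> has_derivative \<theta>' x) (at x)" "\<And>v. continuous_on UNIV (\<lambda>x. \<theta>' x v)"
    and B: "\<And>x. \<bar>\<theta> x\<bar> \<le> B0" "\<And>x v. \<bar>\<theta>' x v\<bar> \<le> B * norm v"
  shows "(conv f \<theta> has_derivative (\<lambda>v. conv f (\<lambda>z. \<theta>' z v) x)) (at x)"
proof -
  have lin: "linear (\<theta>' z)" for z using \<theta>(1) has_derivative_linear by blast
  have cont: "continuous_on UNIV \<theta>"
    using \<theta>(1) by (auto intro!: continuous_at_imp_continuous_on has_derivative_continuous)
  have int': "integrable lebesgue (\<lambda>y. f y * \<theta>' (x - y) v)" for v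
    by (rule conv_integrable[OF f \<theta>(2) B(2)])
  note int = conv_integrable[OF f cont B(1)]
  have "linear (\<lambda>v. conv f (\<lambda>z. \<theta>' z v) x)"
    unfolding conv_def
    by (rule linearI)
      (simp_all add: linear_add[OF lin] linear_scale[OF lin] distrib_left int' mult.left_commute)
  then have bl: "bounded_linear (\<lambda>v. conv f (\<lambda>z. \<theta>' z v) x)"
    by (simp add: linear_conv_bounded_linear)
  have "((\<lambda>y. norm (conv f \<theta> y - conv f \<theta> x - conv f (\<lambda>z. \<theta>' z (y - x)) x) / norm (y - x)) \<longlongrightarrow> 0) (at x)"
    unfolding tendsto_at_iff_sequentially
  proof (intro allI impI)
    fix X :: "nat \<Rightarrow> 'a" assume ne: "\<forall>i. X i \<in> UNIV - {x}" and X: "X \<longlonglongrightarrow> x"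
    define q where "q = (\<lambda>i y. f y * ((\<theta> (X i - y) - \<theta> (x - y) - \<theta>' (x - y) (X i - x)) / norm (X i - x)))"
    have q_eq: "q i = (\<lambda>y. (f y * \<theta> (X i - y) - f y * \<theta> (x - y) - f y * \<theta>' (x - y) (X i - x)) / norm (X i - x))" for i
      unfolding q_def by (simp add: right_diff_distrib)
    have dint: "integrable lebesgue (\<lambda>y. f y * \<theta> (X i - y) - f y * \<theta> (x - y) - f y * \<theta>' (x - y) (X i - x))" for i
      by (intro Bochner_Integration.integrable_diff int int')
    have qint: "integrable lebesgue (q i)" for i
      unfolding q_eq using dint[of i] by (rule integrable_divide)
    have "(\<lambda>i. integral\<^sup>L lebesgue (q i)) \<longlonglongrightarrow> (LINT y|(lebesgue::'a measure). 0)"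
    proof (rule integral_dominated_convergence[where w="\<lambda>y. 2 * B * \<bar>f y\<bar>"])
      show "AE y in lebesgue. (\<lambda>i. q i y) \<longlonglongrightarrow> 0"
      proof (rule AE_I2)
        fix y
        have "((\<lambda>z. norm (\<theta> z - \<theta> (x - y) - \<theta>' (x - y) (z - (x - y))) / norm (z - (x - y))) \<longlongrightarrow> 0) (at (x - y))"
          using \<theta>(1)[of "x - y"] unfolding has_derivative_iff_norm by blast
        then have "((\<lambda>z. norm (\<theta> z - \<theta> (x - y) - \<theta>' (x - y) (z - (x - y))) / norm (z - (x - y))) \<circ> (\<lambda>i. X i - y)) \<longlonglongrightarrow> 0"
          unfolding tendsto_at_iff_sequentially
          by (elim allE[where x="\<lambda>i. X i - y"]) (use ne X in \<open>auto intro!: tendsto_intros\<close>)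
        then have "(\<lambda>i. \<bar>f y\<bar> * (norm (\<theta> (X i - y) - \<theta> (x - y) - \<theta>' (x - y) (X i - x)) / norm (X i - x))) \<longlonglongrightarrow> \<bar>f y\<bar> * 0"
          by (intro tendsto_intros) (simp add: o_def)
        moreover have "(\<lambda>i. norm (q i y)) = (\<lambda>i. \<bar>f y\<bar> * (norm (\<theta> (X i - y) - \<theta> (x - y) - \<theta>' (x - y) (X i - x)) / norm (X i - x)))"
          by (simp add: q_def abs_mult)
        ultimately show "(\<lambda>i. q i y) \<longlonglongrightarrow> 0"
          by (intro tendsto_norm_zero_cancel[of "\<lambda>i. q i y"]) simp
      qed
      show "AE y in lebesgue. norm (q i y) \<le> 2 * B * \<bar>f y\<bar>" for i
      proof (rule AE_I2)
        fix y
        have "\<bar>\<theta> (X i - y) - \<theta> (x - y) - \<theta>' (x - y) (X i - x)\<bar> \<le> 2 * B * norm (X i - x)"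
          using lipschitz_from_derivative_bound[OF \<theta>(1) B(2), of "X i - y" "x - y"] B(2)[of "x - y" "X i - x"]
          by auto
        then have "\<bar>(\<theta> (X i - y) - \<theta> (x - y) - \<theta>' (x - y) (X i - x)) / norm (X i - x)\<bar> \<le> 2 * B"
          using ne by (auto simp: abs_divide divide_le_eq)
        then show "norm (q i y) \<le> 2 * B * \<bar>f y\<bar>"
          unfolding q_def real_norm_def abs_mult by (metis abs_ge_zero mult.commute mult_right_mono)
      qed
    qed (use f qint in auto)
    moreover have "(conv f \<theta> (X i) - conv f \<theta> x - conv f (\<lambda>z. \<theta>' z (X i - x)) x) / norm (X i - x)
        = integral\<^sup>L lebesgue (q i)" for i
    proof -
      have "(LINT y|lebesgue. f y * \<theta> (X i - y) - f y * \<theta> (x - y) - f y * \<theta>' (x - y) (X i - x))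
          = conv f \<theta> (X i) - conv f \<theta> x - conv f (\<lambda>z. \<theta>' z (X i - x)) x"
        unfolding conv_def using int[of "X i"] int[of x] int'[of "X i - x"]
        by (simp only: Bochner_Integration.integral_diff Bochner_Integration.integrable_diff)
      then show ?thesis
        unfolding q_eq by (simp only: integral_divide_zero)
    qed
    ultimately have "(\<lambda>i. norm ((conv f \<theta> (X i) - conv f \<theta> x - conv f (\<lambda>z. \<theta>' z (X i - x)) x) / norm (X i - x))) \<longlonglongrightarrow> 0"
      by (simp add: tendsto_rabs_zero)
    then show "((\<lambda>y. norm (conv f \<theta> y - conv f \<theta> x - conv f (\<lambda>z. \<theta>' z (y - x)) x) / norm (y - x)) \<circ> X) \<longlonglongrightarrow> 0"
      by (simp add: o_def)
  qed
  with bl show ?thesis by (simp add: has_derivative_iff_norm)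
qed

lemma Ck_conv:
  assumes f: "integrable lebesgue f"
  shows "Ck k \<theta> \<Longrightarrow> (\<And>x. norm x > R \<Longrightarrow> \<theta> x = 0) \<Longrightarrow> Ck k (conv f \<theta>)"
proof (induction k arbitrary: \<theta>)
  case 0
  obtain B where "\<And>x. norm (\<theta> x) \<le> B"
    by (rule continuous_bounded_support_bound[of \<theta> R]) (use 0 in auto)
  then show ?case using conv_continuous[OF f, of \<theta> B] 0 by simp
next
  case (Suc k)
  from Suc.prems(1) obtain \<theta>' where \<theta>': "\<And>x. (\<theta> has_derivative \<theta>' x) (at x)" "\<And>v. Ck k (\<lambda>x. \<theta>' x v)"
    by (metis Ck_SucE)
  have c: "continuous_on UNIV (\<lambda>x. \<theta>' x v)" for v using Ck_continuous \<theta>'(2) by blast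
  obtain B where B: "\<And>x v. \<bar>\<theta>' x v\<bar> \<le> B * norm v"
    by (rule C1_bounded_support_bound[of \<theta> \<theta>' R]) (use \<theta>' c Suc.prems in auto)
  obtain B0 where B0: "\<And>x. norm (\<theta> x) \<le> B0"
    by (rule continuous_bounded_support_bound[of \<theta> R])
      (use Suc.prems Ck_continuous[OF Suc.prems(1)] in \<open>auto simp del: Ck.simps\<close>)
  have "open {x::'a. norm x > R}" by (intro open_Collect_less continuous_intros)
  then have z: "\<theta>' x v = 0" if "norm x > R" for x v
    using derivative_zero_outside[OF \<theta>'(1), of "{x. norm x > R}" x v] that Suc.prems by auto
  show ?case
    by (rule Ck_SucI[OF conv_has_derivative[OF f \<theta>'(1) c _ B, of B0]])
      (use B0 Suc.IH \<theta>' z in auto)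
qed

section \<open>Continuity of translations in L1\<close>

lemma shift_diff_integrable:
  fixes f :: "'a::euclidean_space \<Rightarrow> real"
  assumes "integrable lebesgue f"
  shows "integrable lebesgue (\<lambda>x. \<bar>f (x + y) - f x\<bar>)"
  using lebesgue_shift_integral(1)[OF assms, of y] assms by auto

definition shift_modulus :: "('a::euclidean_space \<Rightarrow> real) \<Rightarrow> 'a \<Rightarrow> real" where
  "shift_modulus f y = (LINT x|lebesgue. \<bar>f (x + y) - f x\<bar>)"

lemma shift_modulus_approx:
  assumes f: "integrable lebesgue f" and g: "integrable lebesgue g"
  shows "shift_modulus f y \<le> shift_modulus g y + 2 * (LINT x|lebesgue. \<bar>f x - g x\<bar>)"
proof -
  have d: "integrable lebesgue (\<lambda>x. \<bar>f x - g x\<bar>)" using f g by auto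
  note d' = lebesgue_shift_integral[OF d, of y]
  have "shift_modulus f y \<le> (LINT x|lebesgue. \<bar>f (x + y) - g (x + y)\<bar> + (\<bar>g (x + y) - g x\<bar> + \<bar>f x - g x\<bar>))"
    unfolding shift_modulus_def
    by (rule integral_mono[OF shift_diff_integrable[OF f]])
      (use d' d shift_diff_integrable[OF g] in auto)
  also have "\<dots> = (LINT x|lebesgue. \<bar>f (x + y) - g (x + y)\<bar>) + ((LINT x|lebesgue. \<bar>g (x + y) - g x\<bar>) + (LINT x|lebesgue. \<bar>f x - g x\<bar>))"
    using d' d shift_diff_integrable[OF g, of y] by (simp only: Bochner_Integration.integral_add Bochner_Integration.integrable_add)
  finally show ?thesis using d'(2) by (simp add: shift_modulus_def)
qed

lemma shift_modulus_nonneg: "shift_modulus f y \<ge> 0"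
  by (simp add: shift_modulus_def)

text \<open>Openness makes the positive part of the difference between the indicator and its
  translate vanish eventually at each point, and it is dominated by the indicator. The negative part
  has the same integral by translation invariance, so the modulus is twice the integral of the
  positive part.\<close>

lemma shift_modulus_open:
  assumes U: "open U" "emeasure lebesgue U < \<infinity>"
  shows "(shift_modulus (indicator U) \<longlongrightarrow> 0) (at 0)"
  unfolding tendsto_at_iff_sequentially
proof (intro allI impI)
  fix X :: "nat \<Rightarrow> 'a" assume X: "X \<longlonglongrightarrow> 0"
  have I: "integrable lebesgue (indicator U :: 'a \<Rightarrow> real)"
    using U by (simp add: integrable_indicator_iff less_top)
  note I' = lebesgue_shift_integral[OF I]
  define p where "p = (\<lambda>i x. max 0 (indicator U x - indicator U (x + X i) :: real))"
  have pi: "integrable lebesgue (p i)" for i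
    unfolding p_def using I I'(1)[of "X i"] by (intro integrable_max) auto
  have "(\<lambda>i. integral\<^sup>L lebesgue (p i)) \<longlonglongrightarrow> (LINT x|(lebesgue::'a measure). 0)"
  proof (rule integral_dominated_convergence[where w="indicator U"])
    show "AE x in lebesgue. (\<lambda>i. p i x) \<longlonglongrightarrow> 0"
    proof (rule AE_I2)
      fix x
      show "(\<lambda>i. p i x) \<longlonglongrightarrow> 0"
      proof (cases "x \<in> U")
        case True
        have "(\<lambda>i. x + X i) \<longlonglongrightarrow> x" using tendsto_add[OF tendsto_const X, of x] by simp
        then have "eventually (\<lambda>i. x + X i \<in> U) sequentially"
          using True U(1) by (simp add: topological_tendstoD)
        then show ?thesis
          by (intro tendsto_eventually) (auto elim!: eventually_mono simp: p_def True)
      qed (auto simp: p_def indicator_def)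
    qed
    show "AE x in lebesgue. norm (p i x) \<le> indicator U x" for i
      by (rule AE_I2) (auto simp: p_def indicator_def)
  qed (use pi I in auto)
  then have "(\<lambda>i. 2 * integral\<^sup>L lebesgue (p i)) \<longlonglongrightarrow> 2 * 0"
    by (intro tendsto_intros) simp
  moreover have "shift_modulus (indicator U) (X i) = 2 * integral\<^sup>L lebesgue (p i)" for i
  proof -
    have "shift_modulus (indicator U) (X i) = (LINT x|lebesgue. 2 * p i x + (indicator U (x + X i) - indicator U x))"
      unfolding shift_modulus_def by (rule Bochner_Integration.integral_cong) (auto simp: p_def indicator_def)
    also have "\<dots> = 2 * integral\<^sup>L lebesgue (p i)"
      using pi[of i] I'(1)[of "X i"] I I'(2)[of "X i"]
      by (subst Bochner_Integration.integral_add) auto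
    finally show ?thesis .
  qed
  ultimately show "(shift_modulus (indicator U) \<circ> X) \<longlonglongrightarrow> 0"
    by (simp add: o_def)
qed

lemma shift_modulus_tendsto_approx:
  fixes f :: "'a::euclidean_space \<Rightarrow> real"
  assumes f: "integrable lebesgue f"
    and approx: "\<And>e. e > 0 \<Longrightarrow> \<exists>g. integrable lebesgue g \<and> (shift_modulus g \<longlongrightarrow> 0) (at 0) \<and>
                     (LINT x|lebesgue. \<bar>f x - g x\<bar>) < e"
  shows "(shift_modulus f \<longlongrightarrow> 0) (at 0)"
proof (rule tendstoI)
  fix e :: real assume "e > 0"
  then obtain g where g: "integrable lebesgue g" "(shift_modulus g \<longlongrightarrow> 0) (at 0)"
    "(LINT x|lebesgue. \<bar>f x - g x\<bar>) < e / 4" using approx[of "e / 4"] by auto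
  have "eventually (\<lambda>y. shift_modulus g y < e / 2) (at 0)"
    by (rule order_tendstoD[OF g(2)]) (use \<open>e > 0\<close> in auto)
  then show "\<forall>\<^sub>F y in at 0. dist (shift_modulus f y) 0 < e"
  proof (rule eventually_mono)
    fix y assume "shift_modulus g y < e / 2"
    then show "dist (shift_modulus f y) 0 < e"
      using shift_modulus_approx[OF f g(1), of y] g(3) shift_modulus_nonneg[of f y] by simp
  qed
qed

text \<open>Open sets are handled directly; measurable sets of finite measure are approximated by
  open ones from outside, and sums and L1 limits give the rest.\<close>

lemma shift_modulus_tendsto_0:
  fixes f :: "'a::euclidean_space \<Rightarrow> real"
  assumes "integrable lebesgue f"
  shows "(shift_modulus f \<longlongrightarrow> 0) (at 0)"
  using assms
proof (induction rule: integrable_induct)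
  case (base A c)
  have Ai: "integrable lebesgue (indicator A :: 'a \<Rightarrow> real)"
    using base by (simp add: integrable_indicator_iff less_top)
  have "(shift_modulus (indicator A) \<longlongrightarrow> 0) (at 0)"
  proof (rule shift_modulus_tendsto_approx[OF Ai])
    fix e :: real assume e: "e > 0"
    obtain U where U: "open U" "A \<subseteq> U" "U - A \<in> lmeasurable" "emeasure lebesgue (U - A) < ennreal e"
      by (rule sets_lebesgue_outer_open[OF base(1) e])
    have fin: "emeasure lebesgue U < \<infinity>"
    proof -
      have "emeasure lebesgue (A \<union> (U - A)) \<le> emeasure lebesgue A + emeasure lebesgue (U - A)"
        using U(3) base(1) by (intro emeasure_subadditive) auto
      moreover have "A \<union> (U - A) = U" using U(2) by auto
      moreover have "emeasure lebesgue (U - A) < \<infinity>" using U(3) unfolding fmeasurable_def by blast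
      ultimately show ?thesis using base(2) by (simp add: order_le_less_trans)
    qed
    show "\<exists>g. integrable lebesgue g \<and> (shift_modulus g \<longlongrightarrow> 0) (at 0) \<and>
                     (LINT x|lebesgue. \<bar>indicator A x - g x\<bar>) < e"
    proof (intro exI[of _ "indicator U"] conjI)
      show "integrable lebesgue (indicator U :: 'a \<Rightarrow> real)"
        using U(1) fin by (simp add: integrable_indicator_iff less_top)
      have "(LINT x|lebesgue. \<bar>indicator A x - indicator U x :: real\<bar>) = (LINT x|lebesgue. indicator (U - A) x)"
        by (rule Bochner_Integration.integral_cong) (use U(2) in \<open>auto simp: indicator_def\<close>)
      also have "\<dots> = measure lebesgue (U - A)" using U(3) by simp
      also have "\<dots> < e" using U(3,4) e by (simp add: emeasure_eq_measure2 ennreal_less_iff)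
      finally show "(LINT x|lebesgue. \<bar>indicator A x - indicator U x :: real\<bar>) < e" .
    qed (rule shift_modulus_open[OF U(1) fin])
  qed
  then have "((\<lambda>y. \<bar>c\<bar> * shift_modulus (indicator A) y) \<longlongrightarrow> \<bar>c\<bar> * 0) (at 0)"
    by (rule tendsto_mult_left)
  moreover have "shift_modulus (\<lambda>x. indicator A x *\<^sub>R c) y = \<bar>c\<bar> * shift_modulus (indicator A) y" for y
  proof -
    have "(\<lambda>x. \<bar>indicator A (x + y) *\<^sub>R c - indicator A x *\<^sub>R c\<bar>)
        = (\<lambda>x. \<bar>c\<bar> * \<bar>indicator A (x + y) - indicator A x\<bar>)"
      by (auto simp: indicator_def)
    then show ?thesis unfolding shift_modulus_def by simp
  qed
  ultimately show ?case by simp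
next
  case (add f g)
  have "shift_modulus (\<lambda>x. f x + g x) y \<le> shift_modulus f y + shift_modulus g y" for y
  proof -
    note i = shift_diff_integrable[OF add(1), of y] shift_diff_integrable[OF add(2), of y]
      shift_diff_integrable[OF Bochner_Integration.integrable_add[OF add(1,2)], of y]
    show ?thesis
      unfolding shift_modulus_def Bochner_Integration.integral_add[OF i(1,2), symmetric]
      by (rule integral_mono[OF i(3) Bochner_Integration.integrable_add[OF i(1,2)]]) simp
  qed
  then show ?case
    by (intro tendsto_sandwich[OF _ _ tendsto_const tendsto_add_zero[OF add(3,4)]])
      (auto simp: shift_modulus_nonneg)
next
  case (lim f s)
  show ?case
  proof (rule shift_modulus_tendsto_approx[OF lim(4)])
    fix e :: real assume e: "e > 0"
    have "(\<lambda>i. LINT x|lebesgue. \<bar>f x - s i x\<bar>) \<longlonglongrightarrow> (LINT x|(lebesgue::'a measure). 0)"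
    proof (rule integral_dominated_convergence[where w="\<lambda>x. 3 * \<bar>f x\<bar>"])
      show "AE x in lebesgue. (\<lambda>i. \<bar>f x - s i x\<bar>) \<longlonglongrightarrow> 0"
      proof (rule AE_I2)
        fix x :: 'a
        have "(\<lambda>i. f x - s i x) \<longlonglongrightarrow> f x - f x" using lim(2)[of x] by (intro tendsto_intros) auto
        then show "(\<lambda>i. \<bar>f x - s i x\<bar>) \<longlonglongrightarrow> 0" by (simp add: tendsto_rabs_zero)
      qed
      show "AE x in lebesgue. norm \<bar>f x - s i x\<bar> \<le> 3 * \<bar>f x\<bar>" for i
      proof (rule AE_I2)
        fix x :: 'a
        have "\<bar>s i x\<bar> \<le> 2 * \<bar>f x\<bar>" using lim(3)[of x i] by simp
        then show "norm \<bar>f x - s i x\<bar> \<le> 3 * \<bar>f x\<bar>" by simp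
      qed
    qed (use lim(1,4) in auto)
    then have "eventually (\<lambda>i. (LINT x|lebesgue. \<bar>f x - s i x\<bar>) < e) sequentially"
      using e by (intro order_tendstoD(2)) auto
    then obtain i where "(LINT x|lebesgue. \<bar>f x - s i x\<bar>) < e"
      using eventually_happens by fastforce
    then show "\<exists>g. integrable lebesgue g \<and> (shift_modulus g \<longlongrightarrow> 0) (at 0) \<and> (LINT x|lebesgue. \<bar>f x - g x\<bar>) < e"
      using lim(1,5) by blast
  qed
qed

lemma mollifier_props:
  fixes \<rho> :: "'a::euclidean_space \<Rightarrow> real"
  assumes "mollifier \<delta> \<rho>"
  shows "Ck k \<rho>" "0 \<le> \<rho> x" "norm x \<ge> \<delta> \<Longrightarrow> \<rho> x = 0" "integrable lebesgue \<rho>"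
    "integral\<^sup>L lebesgue \<rho> = 1" "continuous_on UNIV \<rho>" "\<exists>B. \<forall>x. \<bar>\<rho> x\<bar> \<le> B"
proof -
  show *: "Ck k \<rho>" for k using assms by (simp add: mollifier_def)
  show c: "continuous_on UNIV \<rho>" using *[of 0] by simp
  show z: "norm x \<ge> \<delta> \<Longrightarrow> \<rho> x = 0" for x using assms unfolding mollifier_def by force
  show "\<exists>B. \<forall>x. \<bar>\<rho> x\<bar> \<le> B"
    by (rule continuous_bounded_support_bound[OF c, of \<delta>]) (use z in auto)
qed (use assms in \<open>auto simp: mollifier_def\<close>)

lemma conv_mollifier_shift:
  fixes f :: "'a::euclidean_space \<Rightarrow> real"
  assumes f: "integrable lebesgue f" and \<rho>: "mollifier \<delta> \<rho>"
  shows "integrable lebesgue (\<lambda>y. \<rho> y * (f (x - y) - f x))"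
    "conv f \<rho> x - f x = (LINT y|lebesgue. \<rho> y * (f (x - y) - f x))"
proof -
  note m = mollifier_props[OF \<rho>]
  obtain B where B: "\<And>x. \<bar>\<rho> x\<bar> \<le> B" using m(7) by blast
  have i: "integrable lebesgue (\<lambda>y. \<rho> y * f (x - y))"
    using integrable_times_bounded[OF _ _ B, of lebesgue "\<lambda>y. f (x - y)"] lebesgue_affine_integral(1)[OF _ f, of "-1" x]
      continuous_measurable_lebesgue[OF m(6)] by (simp add: mult.commute)
  show "integrable lebesgue (\<lambda>y. \<rho> y * (f (x - y) - f x))"
    using i m(4) by (simp add: right_diff_distrib)
  show "conv f \<rho> x - f x = (LINT y|lebesgue. \<rho> y * (f (x - y) - f x))"
    using i m(4,5) conv_commute[OF f m(6) B, of x]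
    by (simp add: right_diff_distrib conv_def)
qed

text \<open>Exchanging the order of integration bounds the L1 error by the average of
  \<open>shift_modulus f (- y)\<close> with weight \<open>\<rho> y\<close>, and \<rho> vanishes
  unless the norm of y is below \<delta>.\<close>

lemma mollify_L1_bound:
  fixes f :: "'a::euclidean_space \<Rightarrow> real"
  assumes f: "integrable lebesgue f" and \<rho>: "mollifier \<delta> \<rho>"
    and bd: "\<And>y. norm y < \<delta> \<Longrightarrow> shift_modulus f y \<le> e" and e: "e \<ge> 0"
  shows "integrable lebesgue (conv f \<rho>)" "(LINT x|lebesgue. \<bar>conv f \<rho> x - f x\<bar>) \<le> e"
proof -
  note m = mollifier_props[OF \<rho>]
  obtain B where B: "\<And>x. \<bar>\<rho> x\<bar> \<le> B" using m(7) by blast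
  \<comment> \<open>The exchange of integrals takes place on \<open>lborel\<close>, so f is replaced
    by a Borel function equal to it almost everywhere; neither \<open>conv\<close> nor
    \<open>shift_modulus\<close> sees the change.\<close>
  obtain f0 where f0[measurable]: "f0 \<in> borel_measurable lborel" and ae: "AE x in lborel. f x = f0 x"
    using completion_ex_borel_measurable_real[of f lborel] f by auto
  have ael: "AE x in lebesgue. f x = f0 x" using ae by (simp add: AE_completion)
  have f0i: "integrable lebesgue f0"
    by (rule integrable_cong_AE_imp[OF f measurable_completion[OF f0]])
      (rule eventually_mono[OF ael], simp)
  have \<rho>m[measurable]: "\<rho> \<in> borel_measurable lborel"
    using m(6) by (simp add: borel_measurable_continuous_onI)
  have conv_eq: "conv f \<rho> = conv f0 \<rho>"
  proof
    fix x
    show "conv f \<rho> x = conv f0 \<rho> x"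
      unfolding conv_def using ael conv_integrable[OF f m(6) B, of x] conv_integrable[OF f0i m(6) B, of x]
      by (intro integral_cong_AE) (auto elim: eventually_mono)
  qed
  have sm: "shift_modulus f0 y = shift_modulus f y" for y
  proof (rule antisym)
    have z: "(LINT x|lebesgue. \<bar>f x - f0 x\<bar>) = 0" "(LINT x|lebesgue. \<bar>f0 x - f x\<bar>) = 0"
      by (rule integral_eq_zero_AE, rule eventually_mono[OF ael], simp)+
    show "shift_modulus f0 y \<le> shift_modulus f y" "shift_modulus f y \<le> shift_modulus f0 y"
      using shift_modulus_approx[OF f0i f, of y] shift_modulus_approx[OF f f0i, of y] z by auto
  qed
  have "(\<integral>\<^sup>+x. ennreal \<bar>conv f0 \<rho> x - f0 x\<bar> \<partial>lborel)
      \<le> (\<integral>\<^sup>+x. (\<integral>\<^sup>+y. ennreal (\<rho> y * \<bar>f0 (x - y) - f0 x\<bar>) \<partial>lborel) \<partial>lborel)"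
  proof (rule nn_integral_mono)
    fix x
    have "ennreal \<bar>conv f0 \<rho> x - f0 x\<bar> \<le> (\<integral>\<^sup>+y. ennreal (norm (\<rho> y * (f0 (x - y) - f0 x))) \<partial>lebesgue)"
      unfolding conv_mollifier_shift(2)[OF f0i \<rho>] real_norm_def[symmetric]
      by (rule integral_norm_bound_ennreal[OF conv_mollifier_shift(1)[OF f0i \<rho>]])
    then show "ennreal \<bar>conv f0 \<rho> x - f0 x\<bar> \<le> (\<integral>\<^sup>+y. ennreal (\<rho> y * \<bar>f0 (x - y) - f0 x\<bar>) \<partial>lborel)"
      using m(2) by (simp add: abs_mult nn_integral_completion)
  qed
  also have "\<dots> = (\<integral>\<^sup>+y. (\<integral>\<^sup>+x. ennreal (\<rho> y * \<bar>f0 (x - y) - f0 x\<bar>) \<partial>lborel) \<partial>lborel)"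
    by (rule lborel_pair.Fubini') measurable
  also have "\<dots> \<le> (\<integral>\<^sup>+y. ennreal (\<rho> y) * ennreal e \<partial>lborel)"
  proof (rule nn_integral_mono)
    fix y
    show "(\<integral>\<^sup>+x. ennreal (\<rho> y * \<bar>f0 (x - y) - f0 x\<bar>) \<partial>lborel) \<le> ennreal (\<rho> y) * ennreal e"
    proof (cases "norm y < \<delta>")
      case True
      have "(\<integral>\<^sup>+x. ennreal (\<rho> y * \<bar>f0 (x - y) - f0 x\<bar>) \<partial>lborel) = ennreal (\<rho> y) * (\<integral>\<^sup>+x. ennreal \<bar>f0 (x - y) - f0 x\<bar> \<partial>lebesgue)"
        using m(2)[of y] by (simp add: ennreal_mult' nn_integral_cmult nn_integral_completion)
      also have "(\<integral>\<^sup>+x. ennreal \<bar>f0 (x - y) - f0 x\<bar> \<partial>lebesgue) = ennreal (shift_modulus f0 (- y))"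
        unfolding shift_modulus_def using shift_diff_integrable[OF f0i, of "- y"]
        by (subst nn_integral_eq_integral) auto
      also have "\<dots> \<le> ennreal e" using bd[of "- y"] True by (simp add: sm ennreal_leI)
      finally show ?thesis by (simp add: mult_left_mono)
    next
      case False
      then show ?thesis using m(3)[of y] by simp
    qed
  qed
  also have "\<dots> = ennreal e"
  proof -
    have "(\<integral>\<^sup>+y. ennreal (\<rho> y) \<partial>lborel) = 1"
      using nn_integral_eq_integral[OF m(4)] m(2,5) by (simp add: nn_integral_completion)
    then show ?thesis by (simp add: nn_integral_multc)
  qed
  finally have le: "(\<integral>\<^sup>+x. ennreal \<bar>conv f0 \<rho> x - f0 x\<bar> \<partial>lebesgue) \<le> ennreal e"
    by (simp add: nn_integral_completion)
  have meas: "conv f0 \<rho> \<in> borel_measurable lebesgue"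
    by (rule continuous_measurable_lebesgue[OF conv_continuous[OF f0i m(6) B]])
  have di: "integrable lebesgue (\<lambda>x. conv f0 \<rho> x - f0 x)"
    using meas f0i le by (intro integrableI_bounded) (auto simp: less_top[symmetric] top_unique)
  have "integrable lebesgue (\<lambda>x. (conv f0 \<rho> x - f0 x) + f0 x)"
    by (intro Bochner_Integration.integrable_add di f0i)
  then show ci: "integrable lebesgue (conv f \<rho>)" by (simp add: conv_eq)
  have "(LINT x|lebesgue. \<bar>conv f \<rho> x - f x\<bar>) = (LINT x|lebesgue. \<bar>conv f0 \<rho> x - f0 x\<bar>)"
    using ci f f0i ael unfolding conv_eq[symmetric] by (intro integral_cong_AE) (auto elim: eventually_mono)
  also have "\<dots> \<le> e"
    using le e nn_integral_eq_integral[of lebesgue "\<lambda>x. \<bar>conv f0 \<rho> x - f0 x\<bar>"] di by simp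
  finally show "(LINT x|lebesgue. \<bar>conv f \<rho> x - f x\<bar>) \<le> e" .
qed

lemma mollify_L1:
  fixes f :: "'a::euclidean_space \<Rightarrow> real"
  assumes f: "integrable lebesgue f" and \<rho>: "\<And>n. mollifier (\<delta> n) (\<rho> n)" and \<delta>: "\<delta> \<longlonglongrightarrow> 0"
  shows "\<And>n. integrable lebesgue (conv f (\<rho> n))"
    "(\<lambda>n. LINT x|lebesgue. \<bar>conv f (\<rho> n) x - f x\<bar>) \<longlonglongrightarrow> 0"
proof -
  \<comment> \<open>For integrability alone it is enough to bound the modulus by twice the L1 norm
    of f.\<close>
  show "integrable lebesgue (conv f (\<rho> n))" for n
  proof (rule mollify_L1_bound(1)[OF f \<rho>])
    fix y
    have "shift_modulus f y \<le> shift_modulus (\<lambda>x. 0) y + 2 * (LINT x|lebesgue. \<bar>f x - 0\<bar>)"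
      by (rule shift_modulus_approx[OF f]) simp
    then show "shift_modulus f y \<le> 2 * (LINT x|lebesgue. \<bar>f x\<bar>)" by (simp add: shift_modulus_def)
  qed simp
  show "(\<lambda>n. LINT x|lebesgue. \<bar>conv f (\<rho> n) x - f x\<bar>) \<longlonglongrightarrow> 0"
  proof (rule tendstoI)
    fix e :: real assume e: "e > 0"
    obtain d where d: "d > 0" "\<And>y. norm y < d \<Longrightarrow> y \<noteq> 0 \<Longrightarrow> shift_modulus f y < e / 2"
      using tendstoD[OF shift_modulus_tendsto_0[OF f], of "e / 2"] e
      unfolding eventually_at by (auto simp: dist_norm abs_of_nonneg[OF shift_modulus_nonneg])
    have d': "shift_modulus f y \<le> e / 2" if "norm y < d" for y
      using d(2)[OF that] e by (cases "y = 0") (auto simp: shift_modulus_def)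
    have "eventually (\<lambda>n. \<delta> n < d) sequentially" using \<delta> d(1) by (rule order_tendstoD)
    then show "\<forall>\<^sub>F n in sequentially. dist (LINT x|lebesgue. \<bar>conv f (\<rho> n) x - f x\<bar>) 0 < e"
    proof (rule eventually_mono)
      fix n assume "\<delta> n < d"
      then have "(LINT x|lebesgue. \<bar>conv f (\<rho> n) x - f x\<bar>) \<le> e / 2"
        using e by (intro mollify_L1_bound(2)[OF f \<rho>] d') auto
      then show "dist (LINT x|lebesgue. \<bar>conv f (\<rho> n) x - f x\<bar>) 0 < e"
        using e by (simp add: abs_of_nonneg)
    qed
  qed
qed

section \<open>Weak derivatives\<close>

lemma compact_neighbourhood:
  fixes K :: "'a::euclidean_space set"
  assumes "compact K" "open \<Omega>" "K \<subseteq> \<Omega>"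
  obtains K' e where "compact K'" "K' \<subseteq> \<Omega>" "e > 0" "\<And>x. x \<in> K \<Longrightarrow> cball x e \<subseteq> K'" "K \<subseteq> K'"
proof -
  obtain e where e: "e > 0" "(\<Union>x\<in>K. cball x e) \<subseteq> \<Omega>"
    using compact_subset_open_imp_cball_epsilon_subset[OF assms] by blast
  define K' where "K' = {x + y | x y. x \<in> K \<and> y \<in> cball (0::'a) e}"
  have c: "cball x e \<subseteq> K'" if "x \<in> K" for x
  proof
    fix z assume "z \<in> cball x e"
    then have "z = x + (z - x)" "z - x \<in> cball 0 e" by (auto simp: dist_norm norm_minus_commute)
    then show "z \<in> K'" unfolding K'_def using that by blast
  qed
  have sub: "K' \<subseteq> \<Omega>"
  proof
    fix z assume "z \<in> K'"
    then obtain x y where "z = x + y" "x \<in> K" "norm y \<le> e" unfolding K'_def by auto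
    then have "z \<in> cball x e" "x \<in> K" by (auto simp: dist_norm)
    then show "z \<in> \<Omega>" using e(2) by blast
  qed
  have "compact K'" unfolding K'_def by (intro compact_sums assms compact_cball)
  moreover have "K \<subseteq> K'"
  proof
    fix x assume "x \<in> K"
    then show "x \<in> K'" using c[of x] e(1) by force
  qed
  ultimately show ?thesis using that[OF _ sub e(1) c] by blast
qed

lemma integrable_indicator_times:
  fixes f :: "'a::euclidean_space \<Rightarrow> real"
  assumes "L1_loc \<Omega> f" "compact K" "K \<subseteq> \<Omega>"
  shows "integrable lebesgue (\<lambda>x. indicator K x * f x)"
  using assms unfolding L1_loc_def set_integrable_def by auto

text \<open>Trades a locally integrable f on \<Omega> for the globally integrable
  \<open>indicator K x * f x\<close>, so that translations and convolutions on the whole space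
  apply.\<close>

lemma set_integral_support:
  fixes f g :: "'a \<Rightarrow> real"
  assumes "\<And>x. x \<notin> K \<Longrightarrow> g x = 0" "K \<subseteq> \<Omega>"
  shows "(LINT x:\<Omega>|M. f x * g x) = (LINT x|M. (indicator K x * f x) * g x)"
  unfolding set_lebesgue_integral_def
proof (rule Bochner_Integration.integral_cong[OF refl])
  fix x show "indicator \<Omega> x *\<^sub>R (f x * g x) = (indicator K x * f x) * g x"
    using assms(1)[of x] assms(2) by (cases "x \<in> K") (auto simp: indicator_def)
qed

lemma test_function_Ck: "test_function \<Omega> \<phi> \<Longrightarrow> Ck k \<phi>"
  by (simp add: test_function_def)

lemma test_function_bounded_support:
  assumes "test_function \<Omega> \<phi>"
  obtains R where "\<And>x. norm x > R \<Longrightarrow> \<phi> x = 0"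
proof -
  have "bounded (closure {x. \<phi> x \<noteq> 0})"
    using assms by (auto simp: test_function_def compact_imp_bounded)
  then obtain R where "\<And>x. x \<in> closure {x. \<phi> x \<noteq> 0} \<Longrightarrow> norm x \<le> R" unfolding bounded_iff by blast
  then show ?thesis using that[of R] closure_subset[of "{x. \<phi> x \<noteq> 0}"] by force
qed

lemma mollifier_test:
  assumes "mollifier \<delta> \<rho>" "cball x \<delta> \<subseteq> \<Omega>"
  shows "test_function \<Omega> (\<lambda>y. \<rho> (x - y))"
proof -
  have sub: "closure {y. \<rho> (x - y) \<noteq> 0} \<subseteq> cball x \<delta>"
    by (rule closure_minimal)
      (use mollifier_props(3)[OF assms(1)] in \<open>force simp: dist_norm not_le[symmetric]\<close>)+
  then have "compact (closure {y. \<rho> (x - y) \<noteq> 0})"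
    using bounded_subset[OF bounded_cball] by (simp add: compact_eq_bounded_closed)
  moreover have "Ck k (\<lambda>y. \<rho> (x - y))" for k
    using Ck_affine[OF mollifier_props(1)[OF assms(1)], of k x "-1"] by simp
  ultimately show ?thesis using sub assms(2) unfolding test_function_def by blast
qed

lemma mollifier_sequence:
  assumes "e > 0"
  obtains \<delta> and \<rho> :: "nat \<Rightarrow> 'a::euclidean_space \<Rightarrow> real"
  where "\<And>n. mollifier (\<delta> n) (\<rho> n)" "\<delta> \<longlonglongrightarrow> 0" "\<And>n. 0 < \<delta> n" "\<And>n. \<delta> n \<le> e"
proof -
  define \<delta> where "\<delta> = (\<lambda>n. min e (1 / real (Suc n)))"
  have pos: "\<delta> n > 0" for n using assms by (simp add: \<delta>_def)
  then have "\<exists>\<rho> :: 'a \<Rightarrow> real. mollifier (\<delta> n) \<rho>" for n using mollifier_exists by metis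
  then obtain \<rho> :: "nat \<Rightarrow> 'a \<Rightarrow> real" where "\<And>n. mollifier (\<delta> n) (\<rho> n)" by metis
  moreover have "\<delta> \<longlonglongrightarrow> 0"
  proof (rule tendsto_sandwich[OF _ _ tendsto_const])
    show "(\<lambda>n. 1 / real (Suc n)) \<longlonglongrightarrow> 0"
      using LIMSEQ_Suc[OF lim_1_over_n] by simp
  qed (use pos in \<open>auto simp: \<delta>_def less_imp_le\<close>)
  ultimately show ?thesis using that[of \<delta> \<rho>] pos by (auto simp: \<delta>_def)
qed

lemma conv_bound:
  fixes g :: "'a::euclidean_space \<Rightarrow> real"
  assumes g: "integrable lebesgue g" "\<And>x. \<bar>g x\<bar> \<le> B" and \<rho>: "mollifier \<delta> \<rho>"
    and loc: "\<And>y. norm y < \<delta> \<Longrightarrow> \<bar>g (x - y) - c\<bar> \<le> e"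
  shows "\<bar>conv g \<rho> x - c\<bar> \<le> e"
proof -
  note m = mollifier_props[OF \<rho>]
  obtain C where C: "\<And>x. \<bar>\<rho> x\<bar> \<le> C" using m(7) by blast
  have i: "integrable lebesgue (\<lambda>y. \<rho> y * g (x - y))"
    using integrable_times_bounded[OF lebesgue_affine_integral(1)[OF _ g(1), of "-1" x] continuous_measurable_lebesgue[OF m(6)] C]
    by (simp add: mult.commute)
  have "conv g \<rho> x - c = (LINT y|lebesgue. \<rho> y * (g (x - y) - c))"
    using i m(4,5) conv_commute[OF g(1) m(6) C, of x]
    by (simp add: right_diff_distrib conv_def)
  also have "\<bar>\<dots>\<bar> \<le> (LINT y|lebesgue. \<bar>\<rho> y * (g (x - y) - c)\<bar>)"
    by (rule integral_abs_bound)
  also have "\<dots> \<le> (LINT y|lebesgue. \<rho> y * e)"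
  proof (rule integral_mono)
    show "\<bar>\<rho> y * (g (x - y) - c)\<bar> \<le> \<rho> y * e" for y
      using m(2)[of y] m(3)[of y] loc[of y] by (cases "norm y < \<delta>") (auto simp: abs_mult intro: mult_left_mono)
  qed (use i m(4) in \<open>auto simp: right_diff_distrib\<close>)
  also have "\<dots> = e" using m(5) by simp
  finally show ?thesis .
qed

lemma conv_pointwise:
  fixes g :: "'a::euclidean_space \<Rightarrow> real"
  assumes g: "integrable lebesgue g" "\<And>x. \<bar>g x\<bar> \<le> B" "isCont g x"
    and \<rho>: "\<And>n. mollifier (\<delta> n) (\<rho> n)" "\<delta> \<longlonglongrightarrow> 0"
  shows "(\<lambda>n. conv g (\<rho> n) x) \<longlonglongrightarrow> g x"
proof (rule tendstoI)
  fix e :: real assume e: "e > 0"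
  obtain d where d: "d > 0" "\<And>z. dist z x < d \<Longrightarrow> dist (g z) (g x) < e / 2"
    using g(3) e unfolding continuous_at_eps_delta by (meson half_gt_zero)
  have "eventually (\<lambda>n. \<delta> n < d) sequentially" using \<rho>(2) d(1) by (rule order_tendstoD)
  then show "\<forall>\<^sub>F n in sequentially. dist (conv g (\<rho> n) x) (g x) < e"
  proof (rule eventually_mono)
    fix n assume n: "\<delta> n < d"
    have "\<bar>conv g (\<rho> n) x - g x\<bar> \<le> e / 2"
    proof (rule conv_bound[OF g(1,2) \<rho>(1)])
      fix y :: 'a assume "norm y < \<delta> n"
      then show "\<bar>g (x - y) - g x\<bar> \<le> e / 2"
        using d(2)[of "x - y"] n by (simp add: dist_norm)
    qed
    then show "dist (conv g (\<rho> n) x) (g x) < e" using e by (simp add: dist_norm)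
  qed
qed

text \<open>The definition of a weak derivative admits smooth tests only. Mollifying a C^1 test
  keeps its support inside the slightly larger compact set \<open>K'\<close>, and the mollified test
  and its derivative converge pointwise with uniform bounds.\<close>

lemma weak_derivative_C1_test:
  fixes \<phi> :: "'a::euclidean_space \<Rightarrow> real"
  assumes w: "weak_derivative \<Omega> v f h" and \<Omega>: "open \<Omega>"
    and \<phi>: "\<And>x. (\<phi> has_derivative \<phi>' x) (at x)" "\<And>w. continuous_on UNIV (\<lambda>x. \<phi>' x w)"
    and K: "compact K" "K \<subseteq> \<Omega>" "\<And>x. x \<notin> K \<Longrightarrow> \<phi> x = 0"
  shows "(LINT x:\<Omega>|lebesgue. f x * \<phi>' x v) = - (LINT x:\<Omega>|lebesgue. h x * \<phi> x)"
proof -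
  obtain K' e where K': "compact K'" "K' \<subseteq> \<Omega>" "e > 0" "\<And>x. x \<in> K \<Longrightarrow> cball x e \<subseteq> K'" "K \<subseteq> K'"
    using compact_neighbourhood[OF K(1) \<Omega> K(2)] by metis
  obtain \<delta> and \<rho> :: "nat \<Rightarrow> 'a \<Rightarrow> real" where \<rho>: "\<And>n. mollifier (\<delta> n) (\<rho> n)" "\<delta> \<longlonglongrightarrow> 0" "\<And>n. 0 < \<delta> n" "\<And>n. \<delta> n \<le> e"
    using mollifier_sequence[OF K'(3)] by metis
  obtain R where "\<And>x. x \<in> K \<Longrightarrow> norm x \<le> R" using compact_imp_bounded[OF K(1)] unfolding bounded_iff by blast
  then have R: "\<phi> x = 0" if "norm x > R" for x using K(3) that by force
  have \<phi>'0: "\<phi>' x v = 0" if "x \<notin> K" for x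
    using derivative_zero_outside[OF \<phi>(1), of "- K" x v] that K compact_imp_closed by auto
  have \<phi>'R: "\<phi>' x v = 0" if "norm x > R" for x
    using \<phi>'0 that \<open>\<And>x. x \<in> K \<Longrightarrow> norm x \<le> R\<close> by force
  obtain B where B: "\<And>x v. \<bar>\<phi>' x v\<bar> \<le> B * norm v"
    by (rule C1_bounded_support_bound[OF \<phi> R]) auto
  have c: "continuous_on UNIV \<phi>"
    using \<phi>(1) by (auto intro!: continuous_at_imp_continuous_on has_derivative_continuous)
  obtain B0 where B0: "\<And>x. \<bar>\<phi> x\<bar> \<le> B0"
    by (rule continuous_bounded_support_bound[OF c R]) auto
  have i: "integrable lebesgue \<phi>" "integrable lebesgue (\<lambda>x. \<phi>' x v)"
    using integrable_continuous_bounded_support[OF c R] integrable_continuous_bounded_support[OF \<phi>(2) \<phi>'R] by auto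
  define \<phi>n where "\<phi>n = (\<lambda>n. conv \<phi> (\<rho> n))"
  have supp: "conv g (\<rho> n) x = 0" if "\<And>x. x \<notin> K \<Longrightarrow> g x = 0" "x \<notin> K'" for g :: "'a \<Rightarrow> real" and n x
    unfolding conv_def
  proof (rule integral_eq_zero_AE, rule AE_I2)
    fix y
    show "g y * \<rho> n (x - y) = 0"
    proof (cases "y \<in> K")
      case True
      then have "\<not> dist y x \<le> e" using K'(4)[OF True] that(2) by auto
      then show ?thesis using mollifier_props(3)[OF \<rho>(1), of n "x - y"] \<rho>(4)[of n] by (simp add: dist_norm norm_minus_commute)
    qed (simp add: that)
  qed
  have smooth: "Ck k (\<phi>n n)" for k n
    unfolding \<phi>n_def
    by (rule Ck_conv[OF i(1) mollifier_props(1)[OF \<rho>(1)], where R="\<delta> n"])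
      (use mollifier_props(3)[OF \<rho>(1)] in auto)
  \<comment> \<open>The factors are commuted so that the derivative falls on \<phi>: the derivative
    of the mollified test is the mollification of \<open>\<phi>'\<close>.\<close>
  have der: "frechet_derivative (\<phi>n n) (at x) v = conv (\<lambda>x. \<phi>' x v) (\<rho> n) x" for n x
  proof -
    note m = mollifier_props[OF \<rho>(1)[of n]]
    obtain C where C: "\<And>x. \<bar>\<rho> n x\<bar> \<le> C" using m(7) by blast
    have "conv \<phi> (\<rho> n) = conv (\<rho> n) \<phi>" using conv_commute[OF i(1) m(6) C] by auto
    moreover have "(conv (\<rho> n) \<phi> has_derivative (\<lambda>v. conv (\<rho> n) (\<lambda>z. \<phi>' z v) x)) (at x)"
      by (rule conv_has_derivative[OF m(4) \<phi> B0 B])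
    ultimately show ?thesis
      unfolding \<phi>n_def by (simp add: frechet_derivative_at[symmetric] conv_commute[OF i(2) m(6) C])
  qed
  have test: "test_function \<Omega> (\<phi>n n)" for n
  proof -
    have "\<phi>n n x = 0" if "x \<notin> K'" for x
      unfolding \<phi>n_def by (rule supp[OF K(3) that])
    then have "closure {x. \<phi>n n x \<noteq> 0} \<subseteq> K'"
      using K'(1) by (intro closure_minimal compact_imp_closed) auto
    moreover from this have "compact (closure {x. \<phi>n n x \<noteq> 0})"
      using K'(1) closed_closure by (metis Int_absorb1 compact_Int_closed)
    ultimately show ?thesis using smooth K'(2) unfolding test_function_def by blast
  qed
  have lim: "(\<lambda>n. LINT x:\<Omega>|lebesgue. p x * conv g (\<rho> n) x) \<longlonglongrightarrow> (LINT x:\<Omega>|lebesgue. p x * g x)"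
    if p: "L1_loc \<Omega> p" and g: "continuous_on UNIV g" "\<And>x. x \<notin> K \<Longrightarrow> g x = 0" "\<And>x. \<bar>g x\<bar> \<le> C" "integrable lebesgue g"
    for p g :: "'a \<Rightarrow> real" and C
  proof -
    have C0: "C \<ge> 0" using g(3)[of 0] by linarith
    have cb: "\<bar>conv g (\<rho> n) x\<bar> \<le> C" for n x
      using conv_bound[OF g(4,3) \<rho>(1), of n x 0 C] g(3) by simp
    have pi: "integrable lebesgue (\<lambda>x. indicator K' x * p x)" using integrable_indicator_times[OF p K'(1,2)] .
    have cm: "conv g (\<rho> n) \<in> borel_measurable lebesgue" for n
      using mollify_L1(1)[OF g(4) \<rho>(1,2)] by auto
    have "(\<lambda>n. LINT x|lebesgue. (indicator K' x * p x) * conv g (\<rho> n) x) \<longlonglongrightarrow> (LINT x|lebesgue. (indicator K' x * p x) * g x)"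
    proof (rule integral_dominated_convergence[where w="\<lambda>x. C * \<bar>indicator K' x * p x\<bar>"])
      show "AE x in lebesgue. (\<lambda>n. (indicator K' x * p x) * conv g (\<rho> n) x) \<longlonglongrightarrow> (indicator K' x * p x) * g x"
      proof (intro AE_I2 tendsto_mult tendsto_const)
        fix x
        have "isCont g x" using g(1) by (simp add: continuous_on_eq_continuous_at)
        then show "(\<lambda>n. conv g (\<rho> n) x) \<longlonglongrightarrow> g x" by (rule conv_pointwise[OF g(4,3) _ \<rho>(1,2)])
      qed
      show "AE x in lebesgue. norm ((indicator K' x * p x) * conv g (\<rho> n) x) \<le> C * \<bar>indicator K' x * p x\<bar>" for n
      proof (rule AE_I2)
        fix x
        show "norm ((indicator K' x * p x) * conv g (\<rho> n) x) \<le> C * \<bar>indicator K' x * p x\<bar>"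
          using mult_left_mono[OF cb[of n x], of "\<bar>indicator K' x * p x\<bar>"] by (simp add: abs_mult mult.commute)
      qed
    qed (use pi cm continuous_measurable_lebesgue[OF g(1)] in auto)
    moreover have "g x = 0" if "x \<notin> K'" for x using g(2) K'(5) that by auto
    ultimately show ?thesis using supp[OF g(2)] K'(2) by (simp add: set_integral_support[of K'])
  qed
  have L: "L1_loc \<Omega> f" "L1_loc \<Omega> h" using w by (auto simp: weak_derivative_def)
  have "(\<lambda>n. LINT x:\<Omega>|lebesgue. f x * conv (\<lambda>x. \<phi>' x v) (\<rho> n) x) \<longlonglongrightarrow> (LINT x:\<Omega>|lebesgue. f x * \<phi>' x v)"
    by (rule lim[OF L(1) \<phi>(2) \<phi>'0 B i(2)])
  moreover have "(\<lambda>n. - (LINT x:\<Omega>|lebesgue. h x * conv \<phi> (\<rho> n) x)) \<longlonglongrightarrow> - (LINT x:\<Omega>|lebesgue. h x * \<phi> x)"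
    by (intro tendsto_minus lim[OF L(2) c K(3) B0 i(1)])
  moreover have "(LINT x:\<Omega>|lebesgue. f x * conv (\<lambda>x. \<phi>' x v) (\<rho> n) x) = - (LINT x:\<Omega>|lebesgue. h x * conv \<phi> (\<rho> n) x)" for n
    using w test[of n] unfolding weak_derivative_def der[symmetric] \<phi>n_def[symmetric]
    by (simp add: \<phi>n_def der)
  ultimately show ?thesis by (simp add: LIMSEQ_unique)
qed

text \<open>For x in K the function y -> \<open>\<rho> n (x - y)\<close> is itself an admissible
  test, so the mollifications of \<open>F\<close> vanish on K. They converge to \<open>F\<close> in
  L1, hence almost everywhere along a subsequence, and compact sets exhaust \<Omega>.\<close>

lemma fundamental_lemma:
  fixes H :: "'a::euclidean_space \<Rightarrow> real"
  assumes \<Omega>: "open \<Omega>" and H: "L1_loc \<Omega> H"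
    and z: "\<And>\<phi>. test_function \<Omega> \<phi> \<Longrightarrow> (LINT x:\<Omega>|lebesgue. H x * \<phi> x) = 0"
  shows "AE x in lebesgue. x \<in> \<Omega> \<longrightarrow> H x = 0"
proof -
  have loc: "AE x in lebesgue. x \<in> K \<longrightarrow> H x = 0" if K: "compact K" "K \<subseteq> \<Omega>" for K
  proof -
    obtain K' e where K': "compact K'" "K' \<subseteq> \<Omega>" "e > 0" "\<And>x. x \<in> K \<Longrightarrow> cball x e \<subseteq> K'" "K \<subseteq> K'"
      using compact_neighbourhood[OF K(1) \<Omega> K(2)] by metis
    obtain \<delta> and \<rho> :: "nat \<Rightarrow> 'a \<Rightarrow> real" where \<rho>: "\<And>n. mollifier (\<delta> n) (\<rho> n)" "\<delta> \<longlonglongrightarrow> 0" "\<And>n. 0 < \<delta> n" "\<And>n. \<delta> n \<le> e"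
      using mollifier_sequence[OF K'(3)] by metis
    define F where "F = (\<lambda>x. indicator K' x * H x)"
    have F: "integrable lebesgue F" unfolding F_def by (rule integrable_indicator_times[OF H K'(1,2)])
    note M = mollify_L1[OF F \<rho>(1,2)]
    obtain r where r: "strict_mono r" "AE x in lebesgue. (\<lambda>n. conv F (\<rho> (r n)) x - F x) \<longlonglongrightarrow> 0"
      using tendsto_L1_AE_subseq[of lebesgue "\<lambda>n x. conv F (\<rho> n) x - F x"] M F by auto
    have zero: "conv F (\<rho> n) x = 0" if "x \<in> K" for n x
    proof -
      have sub: "cball x (\<delta> n) \<subseteq> K'" using K'(4)[OF that] \<rho>(4)[of n] by (meson subset_cball order_trans)
      have "(LINT y:\<Omega>|lebesgue. H y * \<rho> n (x - y)) = (LINT y|lebesgue. (indicator K' y * H y) * \<rho> n (x - y))"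
      proof (rule set_integral_support[OF _ K'(2)])
        fix y assume "y \<notin> K'"
        then have "y \<notin> cball x (\<delta> n)" using sub by blast
        then show "\<rho> n (x - y) = 0"
          using mollifier_props(3)[OF \<rho>(1), of n "x - y"] by (simp add: dist_norm)
      qed
      then show ?thesis
        using z[OF mollifier_test[OF \<rho>(1)[of n], of x]] sub K'(2) by (auto simp: conv_def F_def)
    qed
    from r(2) show ?thesis
    proof (rule eventually_mono)
      fix x assume "(\<lambda>n. conv F (\<rho> (r n)) x - F x) \<longlonglongrightarrow> 0"
      then show "x \<in> K \<longrightarrow> H x = 0"
        using zero K'(5) by (auto simp: F_def LIMSEQ_const_iff)
    qed
  qed
  have "\<exists>C::nat \<Rightarrow> 'a set. (\<forall>n. compact (C n)) \<and> (\<forall>n. C n \<subseteq> \<Omega>) \<and> \<Union>(range C) = \<Omega>"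
    by (rule open_Union_compact_subsets[OF \<Omega>]) metis
  then obtain C :: "nat \<Rightarrow> 'a set" where C: "\<And>n. compact (C n)" "\<And>n. C n \<subseteq> \<Omega>" "\<Union>(range C) = \<Omega>"
    by metis
  have "AE x in lebesgue. \<forall>n. x \<in> C n \<longrightarrow> H x = 0"
    unfolding AE_all_countable using loc[OF C(1,2)] by blast
  then show ?thesis by (rule eventually_mono) (use C(3) in blast)
qed

lemma L1_loc_diff:
  fixes f g :: "'a::euclidean_space \<Rightarrow> real"
  shows "L1_loc \<Omega> f \<Longrightarrow> L1_loc \<Omega> g \<Longrightarrow> L1_loc \<Omega> (\<lambda>x. f x - g x)"
  unfolding L1_loc_def by (blast intro: set_integral_diff(1))

lemma test_integrable:
  fixes f :: "'a::euclidean_space \<Rightarrow> real"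
  assumes L: "L1_loc \<Omega> f" and g: "continuous_on UNIV g" "\<And>x. x \<notin> K \<Longrightarrow> g x = 0" and K: "compact K" "K \<subseteq> \<Omega>"
  shows "set_integrable lebesgue \<Omega> (\<lambda>x. f x * g x)"
proof -
  obtain R where "\<And>x. x \<in> K \<Longrightarrow> norm x \<le> R" using compact_imp_bounded[OF K(1)] unfolding bounded_iff by blast
  then have R: "g x = 0" if "norm x > R" for x using g(2) that by force
  obtain B where B: "\<And>x. \<bar>g x\<bar> \<le> B" by (rule continuous_bounded_support_bound[OF g(1) R]) auto
  have "integrable lebesgue (\<lambda>x. (indicator K x * f x) * g x)"
    by (rule integrable_times_bounded[OF integrable_indicator_times[OF L K] continuous_measurable_lebesgue[OF g(1)] B])
  moreover have "(\<lambda>x. (indicator K x * f x) * g x) = (\<lambda>x. indicator \<Omega> x *\<^sub>R (f x * g x))"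
  proof
    fix x show "(indicator K x * f x) * g x = indicator \<Omega> x *\<^sub>R (f x * g x)"
      using g(2)[of x] K(2) by (cases "x \<in> K") (auto simp: indicator_def)
  qed
  ultimately show ?thesis unfolding set_integrable_def by simp
qed

text \<open>Only \<open>C\<^sup>1\<close>, so that piecewise polynomial cutoffs are allowed.\<close>

definition test_data :: "'a::euclidean_space set \<Rightarrow> ('a \<Rightarrow> real) \<Rightarrow> ('a \<Rightarrow> 'a \<Rightarrow> real) \<Rightarrow> 'a set \<Rightarrow> bool" where
  "test_data \<Omega> \<phi> \<phi>' K \<longleftrightarrow> (\<forall>x. (\<phi> has_derivative \<phi>' x) (at x)) \<and> (\<forall>w. continuous_on UNIV (\<lambda>x. \<phi>' x w)) \<and>
     compact K \<and> K \<subseteq> \<Omega> \<and> (\<forall>x. x \<notin> K \<longrightarrow> \<phi> x = 0)"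

lemma test_dataD:
  assumes "test_data \<Omega> \<phi> \<phi>' K"
  shows "(\<phi> has_derivative \<phi>' x) (at x)" "continuous_on UNIV (\<lambda>x. \<phi>' x w)"
    "continuous_on UNIV \<phi>" "compact K" "K \<subseteq> \<Omega>" "x \<notin> K \<Longrightarrow> \<phi> x = 0" "x \<notin> K \<Longrightarrow> \<phi>' x w = 0"
    "frechet_derivative \<phi> (at x) = \<phi>' x"
proof -
  show d: "(\<phi> has_derivative \<phi>' x) (at x)" for x using assms by (simp add: test_data_def)
  show z: "x \<notin> K \<Longrightarrow> \<phi> x = 0" for x using assms by (simp add: test_data_def)
  show K: "compact K" "K \<subseteq> \<Omega>" "continuous_on UNIV (\<lambda>x. \<phi>' x w)" using assms by (auto simp: test_data_def)
  show "continuous_on UNIV \<phi>"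
    using d by (auto intro!: continuous_at_imp_continuous_on has_derivative_continuous)
  show "x \<notin> K \<Longrightarrow> \<phi>' x w = 0"
    using derivative_zero_outside[OF d, of "- K" x w] z K(1) compact_imp_closed by auto
  show "frechet_derivative \<phi> (at x) = \<phi>' x"
    by (rule frechet_derivative_at[OF d, symmetric])
qed

lemma test_function_data:
  assumes "test_function \<Omega> \<phi>"
  obtains \<phi>' K where "test_data \<Omega> \<phi> \<phi>' K"
proof -
  define K where "K = closure {x. \<phi> x \<noteq> 0}"
  have K: "compact K" "K \<subseteq> \<Omega>" using assms by (auto simp: K_def test_function_def)
  have z: "\<phi> x = 0" if "x \<notin> K" for x using that closure_subset[of "{x. \<phi> x \<noteq> 0}"] by (auto simp: K_def)
  obtain \<phi>' where \<phi>': "\<And>x. (\<phi> has_derivative \<phi>' x) (at x)" "\<And>v. Ck 1 (\<lambda>x. \<phi>' x v)"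
    using test_function_Ck[OF assms, of "Suc 1"] by (metis Ck_SucE)
  have c: "continuous_on UNIV (\<lambda>x. \<phi>' x w)" for w using \<phi>'(2) Ck_continuous by blast
  show ?thesis by (rule that[of \<phi>' K]) (use \<phi>' c K z in \<open>auto simp: test_data_def\<close>)
qed

lemma weak_derivative_unique:
  assumes "open \<Omega>" "weak_derivative \<Omega> v f h1" "weak_derivative \<Omega> v f h2"
  shows "AE x in lebesgue. x \<in> \<Omega> \<longrightarrow> h1 x = h2 x"
proof -
  have L: "L1_loc \<Omega> h1" "L1_loc \<Omega> h2" using assms by (auto simp: weak_derivative_def)
  have "AE x in lebesgue. x \<in> \<Omega> \<longrightarrow> h1 x - h2 x = 0"
  proof (rule fundamental_lemma[OF assms(1) L1_loc_diff[OF L]])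
    fix \<phi> assume t: "test_function \<Omega> \<phi>"
    obtain \<phi>' K where "test_data \<Omega> \<phi> \<phi>' K" by (rule test_function_data[OF t])
    note \<phi> = test_dataD[OF this]
    note i = test_integrable[OF L(1) \<phi>(3,6,4,5)] test_integrable[OF L(2) \<phi>(3,6,4,5)]
    have "(LINT x:\<Omega>|lebesgue. (h1 x - h2 x) * \<phi> x) = (LINT x:\<Omega>|lebesgue. h1 x * \<phi> x) - (LINT x:\<Omega>|lebesgue. h2 x * \<phi> x)"
      using i by (simp add: left_diff_distrib set_integral_diff)
    also have "\<dots> = 0" using assms(2,3) t unfolding weak_derivative_def by (metis diff_self neg_equal_iff_equal)
    finally show "(LINT x:\<Omega>|lebesgue. (h1 x - h2 x) * \<phi> x) = 0" .
  qed
  then show ?thesis by simp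
qed

lemma weak_derivative_diff:
  assumes "weak_derivative \<Omega> v f1 h1" "weak_derivative \<Omega> v f2 h2"
  shows "weak_derivative \<Omega> v (\<lambda>x. f1 x - f2 x) (\<lambda>x. h1 x - h2 x)"
proof -
  have L: "L1_loc \<Omega> f1" "L1_loc \<Omega> f2" "L1_loc \<Omega> h1" "L1_loc \<Omega> h2" using assms by (auto simp: weak_derivative_def)
  have "(LINT x:\<Omega>|lebesgue. (f1 x - f2 x) * frechet_derivative \<phi> (at x) v) = - (LINT x:\<Omega>|lebesgue. (h1 x - h2 x) * \<phi> x)"
    if t: "test_function \<Omega> \<phi>" for \<phi>
  proof -
    obtain \<phi>' K where "test_data \<Omega> \<phi> \<phi>' K" by (rule test_function_data[OF t])
    note \<phi> = test_dataD[OF this]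
    note i = test_integrable[OF L(3) \<phi>(3,6,4,5)] test_integrable[OF L(4) \<phi>(3,6,4,5)]
      test_integrable[OF L(1) \<phi>(2)[of v] \<phi>(7) \<phi>(4,5)] test_integrable[OF L(2) \<phi>(2)[of v] \<phi>(7) \<phi>(4,5)]
    have "(LINT x:\<Omega>|lebesgue. f1 x * \<phi>' x v) = - (LINT x:\<Omega>|lebesgue. h1 x * \<phi> x)"
      "(LINT x:\<Omega>|lebesgue. f2 x * \<phi>' x v) = - (LINT x:\<Omega>|lebesgue. h2 x * \<phi> x)"
      using assms t unfolding weak_derivative_def \<phi>(8)[symmetric] by blast+
    then show ?thesis using i by (simp add: left_diff_distrib set_integral_diff \<phi>(8))
  qed
  then show ?thesis using L by (auto simp: weak_derivative_def intro: L1_loc_diff)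
qed

text \<open>Each difference quotient in direction v has integral 0 by translation invariance; the
  mean value theorem bounds the quotients uniformly on a fixed ball, so their limit has integral 0
  too.\<close>

lemma integral_derivative_zero:
  fixes F :: "'a::euclidean_space \<Rightarrow> real"
  assumes F: "\<And>x. (F has_derivative F' x) (at x)" "continuous_on UNIV (\<lambda>x. F' x v)" "\<And>x. norm x > R \<Longrightarrow> F x = 0"
  shows "(LINT x|lebesgue. F' x v) = 0"
proof -
  have "open {x::'a. norm x > R}" by (intro open_Collect_less continuous_intros)
  then have z: "F' x v = 0" if "norm x > R" for x
    using derivative_zero_outside[OF F(1), of "{x. norm x > R}" x v] that F(3) by auto
  obtain B where B: "\<And>x. \<bar>F' x v\<bar> \<le> B" by (rule continuous_bounded_support_bound[OF F(2) z]) auto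
  have c: "continuous_on UNIV F"
    using F(1) by (auto intro!: continuous_at_imp_continuous_on has_derivative_continuous)
  have i: "integrable lebesgue F" by (rule integrable_continuous_bounded_support[OF c F(3)])
  define s where "s = (\<lambda>n. 1 / real (Suc n))"
  have s: "s n > 0" "s n \<le> 1" for n by (auto simp: s_def)
  have s0: "s \<longlonglongrightarrow> 0" unfolding s_def using LIMSEQ_Suc[OF lim_1_over_n] by simp
  define q where "q = (\<lambda>n x. (F (x + s n *\<^sub>R v) - F x) / s n)"
  have line: "((\<lambda>t. F (x + t *\<^sub>R v)) has_real_derivative F' (x + t *\<^sub>R v) v) (at t)" for x t
  proof -
    have "((\<lambda>t. F (x + t *\<^sub>R v)) has_derivative (\<lambda>a. F' (x + t *\<^sub>R v) (a *\<^sub>R v))) (at t)"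
      by (rule has_derivative_compose[OF _ F(1)]) (auto intro!: derivative_eq_intros)
    then show ?thesis
      unfolding has_field_derivative_def
      by (simp add: linear_scale[OF has_derivative_linear[OF F(1)]] mult_commute_abs)
  qed
  have qi: "integrable lebesgue (q n)" "integral\<^sup>L lebesgue (q n) = 0" for n
    unfolding q_def using lebesgue_shift_integral[OF i, of "s n *\<^sub>R v"] i by auto
  have qb: "\<bar>q n x\<bar> \<le> B" for n x
  proof -
    obtain t where "F (x + s n *\<^sub>R v) - F (x + 0 *\<^sub>R v) = (s n - 0) * F' (x + t *\<^sub>R v) v"
      using MVT2[OF s(1)[of n] line, of x] by blast
    then have "q n x = F' (x + t *\<^sub>R v) v" using s(1)[of n] by (simp add: q_def)
    then show ?thesis using B by simp
  qed
  have qz: "q n x = 0" if "norm x > R + norm v" for n x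
  proof -
    have "norm x - norm (s n *\<^sub>R v) \<le> norm (x + s n *\<^sub>R v)"
      using norm_diff_ineq[of x "s n *\<^sub>R v"] by simp
    moreover have "norm (s n *\<^sub>R v) \<le> norm v" using s[of n] by (simp add: mult_left_le_one_le)
    ultimately have "norm (x + s n *\<^sub>R v) > R" using that by linarith
    moreover have "norm x > R" using that norm_ge_zero[of v] by linarith
    ultimately show ?thesis using F(3) by (simp add: q_def)
  qed
  have "(\<lambda>n. integral\<^sup>L lebesgue (q n)) \<longlonglongrightarrow> (LINT x|lebesgue. F' x v)"
  proof (rule integral_dominated_convergence[where w="\<lambda>x. B * indicator (cball 0 (R + norm v)) x"])
    show "AE x in lebesgue. (\<lambda>n. q n x) \<longlonglongrightarrow> F' x v"
    proof (rule AE_I2)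
      fix x
      have "(\<lambda>h. (F (x + h *\<^sub>R v) - F x) / h) \<midarrow>0\<rightarrow> F' x v"
        using line[of x 0] by (simp add: DERIV_def)
      then show "(\<lambda>n. q n x) \<longlonglongrightarrow> F' x v"
        unfolding tendsto_at_iff_sequentially q_def
        by (elim allE[where x=s]) (use s s0 in \<open>auto simp: o_def less_imp_neq[symmetric]\<close>)
    qed
    show "AE x in lebesgue. norm (q n x) \<le> B * indicator (cball 0 (R + norm v)) x" for n
    proof (rule AE_I2)
      fix x show "norm (q n x) \<le> B * indicator (cball 0 (R + norm v)) x"
        using qb[of n x] qz[where x=x and n=n] by (cases "norm x \<le> R + norm v") (auto simp: indicator_def)
    qed
    show "integrable lebesgue (\<lambda>x. B * indicator (cball (0::'a) (R + norm v)) x)"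
      using lmeasurable_cball[of "0::'a" "R + norm v"] by (auto simp: lmeasurable_iff_integrable)
    show "q n \<in> borel_measurable lebesgue" for n
      by (rule borel_measurable_integrable[OF qi(1)])
  qed (rule continuous_measurable_lebesgue[OF F(2)])
  then show ?thesis using qi(2) by (simp add: LIMSEQ_const_iff)
qed

text \<open>One factor converges in L1, the other boundedly and almost everywhere. This is the limit
  passage of the chain rule, where mollified weak derivatives converge in L1 only.\<close>

lemma L1_mult_tendsto:
  fixes u g :: "'a \<Rightarrow> real"
  assumes u: "\<And>n. integrable M (un n)" "integrable M u" "(\<lambda>n. LINT x|M. \<bar>un n x - u x\<bar>) \<longlonglongrightarrow> 0"
    and g: "\<And>n. gn n \<in> borel_measurable M" "g \<in> borel_measurable M" "\<And>n x. \<bar>gn n x\<bar> \<le> B" "\<And>x. \<bar>g x\<bar> \<le> B"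
    "AE x in M. (\<lambda>n. gn n x) \<longlonglongrightarrow> g x"
  shows "(\<lambda>n. LINT x|M. un n x * gn n x) \<longlonglongrightarrow> (LINT x|M. u x * g x)"
proof -
  have i1: "integrable M (\<lambda>x. u x * gn n x)" for n by (rule integrable_times_bounded[OF u(2) g(1,3)])
  have i2: "integrable M (\<lambda>x. (un n x - u x) * gn n x)" for n
    by (rule integrable_times_bounded[OF _ g(1,3)]) (use u in auto)
  have "(\<lambda>n. LINT x|M. u x * gn n x) \<longlonglongrightarrow> (LINT x|M. u x * g x)"
  proof (rule integral_dominated_convergence[where w="\<lambda>x. B * \<bar>u x\<bar>"])
    show "AE x in M. (\<lambda>n. u x * gn n x) \<longlonglongrightarrow> u x * g x"
      using g(5) by (rule eventually_mono) (intro tendsto_intros)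
    show "AE x in M. norm (u x * gn n x) \<le> B * \<bar>u x\<bar>" for n
    proof (rule AE_I2)
      fix x show "norm (u x * gn n x) \<le> B * \<bar>u x\<bar>"
        using mult_right_mono[OF g(3)[of n x], of "\<bar>u x\<bar>"] by (simp add: abs_mult mult.commute)
    qed
    show "integrable M (\<lambda>x. B * \<bar>u x\<bar>)" using u(2) by auto
    show "(\<lambda>x. u x * gn n x) \<in> borel_measurable M" for n by (rule borel_measurable_integrable[OF i1])
  qed (use u(2) g(2) in auto)
  moreover have "(\<lambda>n. LINT x|M. (un n x - u x) * gn n x) \<longlonglongrightarrow> 0"
  proof (rule Lim_null_comparison)
    have "(\<lambda>n. B * (LINT x|M. \<bar>un n x - u x\<bar>)) \<longlonglongrightarrow> B * 0" by (intro tendsto_intros u(3))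
    then show "(\<lambda>n. B * (LINT x|M. \<bar>un n x - u x\<bar>)) \<longlonglongrightarrow> 0" by simp
    show "\<forall>\<^sub>F n in sequentially. norm (LINT x|M. (un n x - u x) * gn n x) \<le> B * (LINT x|M. \<bar>un n x - u x\<bar>)"
    proof (rule always_eventually, rule allI)
      fix n
      have "norm (LINT x|M. (un n x - u x) * gn n x) \<le> (LINT x|M. \<bar>(un n x - u x) * gn n x\<bar>)"
        by (simp add: integral_abs_bound)
      also have "\<dots> \<le> (LINT x|M. B * \<bar>un n x - u x\<bar>)"
      proof (rule integral_mono)
        show "integrable M (\<lambda>x. B * \<bar>un n x - u x\<bar>)" using u(1,2) by auto
        show "\<bar>(un n x - u x) * gn n x\<bar> \<le> B * \<bar>un n x - u x\<bar>" for x
          using mult_right_mono[OF g(3)[of n x], of "\<bar>un n x - u x\<bar>"] by (simp add: abs_mult mult.commute)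
      qed (rule integrable_abs[OF i2])
      finally show "norm (LINT x|M. (un n x - u x) * gn n x) \<le> B * (LINT x|M. \<bar>un n x - u x\<bar>)" by simp
    qed
  qed
  ultimately have "(\<lambda>n. (LINT x|M. u x * gn n x) + (LINT x|M. (un n x - u x) * gn n x)) \<longlonglongrightarrow> (LINT x|M. u x * g x) + 0"
    by (rule tendsto_add)
  moreover have "(LINT x|M. u x * gn n x) + (LINT x|M. (un n x - u x) * gn n x) = (LINT x|M. un n x * gn n x)" for n
    unfolding Bochner_Integration.integral_add[OF i1 i2, symmetric] by (simp add: algebra_simps)
  ultimately show ?thesis by simp
qed

text \<open>The classical chain rule for the mollified function, followed by a limit. The
  normalisation \<open>j 0 = 0\<close> lets the truncation to a compact set pass inside j, and the
  Lipschitz bounds with constant 1 are those that \<open>pen\<close> and \<open>clip\<close>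
  satisfy.\<close>

lemma weak_derivative_chain:
  fixes f :: "'a::euclidean_space \<Rightarrow> real"
  assumes w: "weak_derivative \<Omega> v f h" and \<Omega>: "open \<Omega>"
    and j: "\<And>t. (j has_real_derivative j' t) (at t)" "j 0 = 0"
    and j': "\<And>t. \<bar>j' t\<bar> \<le> 1" "\<And>s t. \<bar>j' s - j' t\<bar> \<le> \<bar>s - t\<bar>"
  shows "weak_derivative \<Omega> v (\<lambda>x. j (f x)) (\<lambda>x. j' (f x) * h x)"
proof -
  have L: "L1_loc \<Omega> f" "L1_loc \<Omega> h" using w by (auto simp: weak_derivative_def)
  have jc: "continuous_on UNIV j" using j(1) by (meson DERIV_isCont continuous_at_imp_continuous_on)
  have jc': "continuous_on UNIV j'"
    unfolding continuous_on_iff dist_real_def using j'(2) by (meson le_less_trans)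
  have jm[measurable]: "j \<in> borel_measurable borel" "j' \<in> borel_measurable borel"
    using jc jc' by (auto intro: borel_measurable_continuous_onI)
  have jlip: "\<bar>j s - j t\<bar> \<le> \<bar>s - t\<bar>" for s t
  proof -
    have "norm (j s - j t) \<le> 1 * norm (s - t)"
      by (rule field_differentiable_bound[of UNIV j j']) (use j j' in auto)
    then show ?thesis by simp
  qed
  have j1: "\<bar>j t\<bar> \<le> \<bar>t\<bar>" for t using jlip[of t 0] j(2) by simp
  have jint: "integrable M (\<lambda>x. j (p x))" if "integrable M p" for M and p :: "'b \<Rightarrow> real"
    by (rule Bochner_Integration.integrable_bound[OF that]) (use that j1 in \<open>auto intro: AE_I2 measurable_compose[OF borel_measurable_integrable]\<close>)
  have jint': "integrable M (\<lambda>x. q x * j' (p x))" if "integrable M q" "p \<in> borel_measurable M" for M and p q :: "'b \<Rightarrow> real"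
    by (rule integrable_times_bounded[OF that(1) measurable_compose[OF that(2) jm(2)] j'(1)])
  have L1: "L1_loc \<Omega> (\<lambda>x. j (f x))"
    unfolding L1_loc_def set_integrable_def
  proof (intro allI impI, elim conjE)
    fix K assume K: "compact K" "K \<subseteq> \<Omega>"
    have "(\<lambda>x. indicator K x *\<^sub>R j (f x)) = (\<lambda>x. j (indicator K x * f x))"
      using j(2) by (auto simp: indicator_def)
    then show "integrable lebesgue (\<lambda>x. indicator K x *\<^sub>R j (f x))"
      using jint[OF integrable_indicator_times[OF L(1) K]] by simp
  qed
  have L2: "L1_loc \<Omega> (\<lambda>x. j' (f x) * h x)"
    unfolding L1_loc_def set_integrable_def
  proof (intro allI impI, elim conjE)
    fix K assume K: "compact K" "K \<subseteq> \<Omega>"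
    have "(\<lambda>x. indicator K x *\<^sub>R (j' (f x) * h x)) = (\<lambda>x. (indicator K x * h x) * j' (indicator K x * f x))"
      by (auto simp: indicator_def)
    then show "integrable lebesgue (\<lambda>x. indicator K x *\<^sub>R (j' (f x) * h x))"
      using jint'[OF integrable_indicator_times[OF L(2) K] borel_measurable_integrable[OF integrable_indicator_times[OF L(1) K]]] by simp
  qed
  have "(LINT x:\<Omega>|lebesgue. j (f x) * frechet_derivative \<phi> (at x) v) = - (LINT x:\<Omega>|lebesgue. (j' (f x) * h x) * \<phi> x)"
    if t: "test_function \<Omega> \<phi>" for \<phi>
  proof -
    obtain \<phi>' K where "test_data \<Omega> \<phi> \<phi>' K" by (rule test_function_data[OF t])
    note \<phi> = test_dataD[OF this]
    obtain R where R: "\<And>x. norm x > R \<Longrightarrow> \<phi> x = 0" by (rule test_function_bounded_support[OF t]) auto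
    obtain K' e where K': "compact K'" "K' \<subseteq> \<Omega>" "e > 0" "\<And>x. x \<in> K \<Longrightarrow> cball x e \<subseteq> K'" "K \<subseteq> K'"
      using compact_neighbourhood[OF \<phi>(4) \<Omega> \<phi>(5)] by metis
    obtain \<delta> and \<rho> :: "nat \<Rightarrow> 'a \<Rightarrow> real" where \<rho>: "\<And>n. mollifier (\<delta> n) (\<rho> n)" "\<delta> \<longlonglongrightarrow> 0" "\<And>n. 0 < \<delta> n" "\<And>n. \<delta> n \<le> e"
      using mollifier_sequence[OF K'(3)] by metis
    define F where "F = (\<lambda>x. indicator K' x * f x)"
    define G where "G = (\<lambda>x. indicator K' x * h x)"
    have F: "integrable lebesgue F" unfolding F_def by (rule integrable_indicator_times[OF L(1) K'(1,2)])
    have G: "integrable lebesgue G" unfolding G_def by (rule integrable_indicator_times[OF L(2) K'(1,2)])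
    have nF: "integrable lebesgue (conv F (\<rho> n))" for n by (rule mollify_L1(1)[OF F \<rho>(1,2)])
    have nG: "integrable lebesgue (conv G (\<rho> n))" for n by (rule mollify_L1(1)[OF G \<rho>(1,2)])
    \<comment> \<open>Convergence in L1 says nothing about \<open>j'\<close> of the mollified
      function at a point, so an almost everywhere convergent subsequence is extracted.\<close>
    obtain r where r: "strict_mono r" "AE x in lebesgue. (\<lambda>n. conv F (\<rho> (r n)) x - F x) \<longlonglongrightarrow> 0"
      using tendsto_L1_AE_subseq[of lebesgue "\<lambda>n x. conv F (\<rho> n) x - F x"] nF mollify_L1(2)[OF F \<rho>(1,2)] F by auto
    obtain B where B: "\<And>x. \<bar>\<phi> x\<bar> \<le> B" by (rule continuous_bounded_support_bound[OF \<phi>(3) R]) auto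
    obtain R' where R': "\<And>x. x \<in> K \<Longrightarrow> norm x \<le> R'"
      using compact_imp_bounded[OF \<phi>(4)] unfolding bounded_iff by blast
    have \<phi>'R: "\<phi>' x v = 0" if "norm x > R'" for x using R'[of x] \<phi>(7)[of x v] that by force
    obtain B' where B': "\<And>x. \<bar>\<phi>' x v\<bar> \<le> B'" by (rule continuous_bounded_support_bound[OF \<phi>(2)[of v] \<phi>'R]) auto
    have parts: "(LINT x|lebesgue. j (conv F (\<rho> n) x) * \<phi>' x v) = - (LINT x|lebesgue. conv G (\<rho> n) x * (j' (conv F (\<rho> n) x) * \<phi> x))" for n
    proof -
      note m = mollifier_props[OF \<rho>(1)[of n]]
      obtain \<rho>' where \<rho>': "\<And>x. (\<rho> n has_derivative \<rho>' x) (at x)" "\<And>v. Ck 1 (\<lambda>x. \<rho>' x v)"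
        using m(1)[of "Suc 1"] by (metis Ck_SucE)
      have c': "continuous_on UNIV (\<lambda>x. \<rho>' x w)" for w using \<rho>'(2) Ck_continuous by blast
      obtain C where C: "\<And>x. \<bar>\<rho> n x\<bar> \<le> C" using m(7) by blast
      obtain C' where C': "\<And>x v. \<bar>\<rho>' x v\<bar> \<le> C' * norm v"
        by (rule C1_bounded_support_bound[OF \<rho>'(1) c', of "\<delta> n"]) (use m(3) in auto)
      define D where "D = (\<lambda>x w. conv F (\<lambda>z. \<rho>' z w) x)"
      have D: "(conv F (\<rho> n) has_derivative D x) (at x)" for x
        unfolding D_def by (rule conv_has_derivative[OF F \<rho>'(1) c' C C'])
      have Dc: "continuous_on UNIV (\<lambda>x. D x v)"
        unfolding D_def by (rule conv_continuous[OF F c' C'])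
      have Fc: "continuous_on UNIV (conv F (\<rho> n))" by (rule conv_continuous[OF F m(6) C])
      \<comment> \<open>On K the derivative of the mollified f is the mollified weak derivative: the
        weak identity is tested with y -> \<open>\<rho> n (x - y)\<close>, whose support lies in
        \<open>K'\<close>.\<close>
      have DG: "D x v = conv G (\<rho> n) x" if x: "x \<in> K" for x
      proof -
        have sub: "cball x (\<delta> n) \<subseteq> K'" using K'(4)[OF x] \<rho>(4)[of n] by (meson subset_cball order_trans)
        have z: "\<rho> n (x - y) = 0" if "y \<notin> cball x (\<delta> n)" for y
          using that m(3)[of "x - y"] by (simp add: dist_norm)
        have z': "\<rho>' (x - y) v = 0" if "y \<notin> cball x (\<delta> n)" for y
        proof -
          have "open {z::'a. norm z > \<delta> n}" by (intro open_Collect_less continuous_intros)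
          then show ?thesis
            using derivative_zero_outside[OF \<rho>'(1), of "{z. norm z > \<delta> n}" "x - y" v] that m(3) by (simp add: dist_norm)
        qed
        have "(LINT y:\<Omega>|lebesgue. f y * (- \<rho>' (x - y) v)) = - (LINT y:\<Omega>|lebesgue. h y * \<rho> n (x - y))"
        proof (rule weak_derivative_C1_test[OF w \<Omega>, where \<phi>'="\<lambda>y w. - \<rho>' (x - y) w"])
          show "((\<lambda>y. \<rho> n (x - y)) has_derivative (\<lambda>w. - \<rho>' (x - y) w)) (at y)" for y
          proof -
            have "((\<lambda>y. \<rho> n (x - y)) has_derivative (\<lambda>w. \<rho>' (x - y) (- w))) (at y)"
              by (rule has_derivative_compose[OF _ \<rho>'(1)]) (auto intro!: derivative_eq_intros)
            then show ?thesis by (simp add: linear_neg[OF has_derivative_linear[OF \<rho>'(1)]])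
          qed
          show "continuous_on UNIV (\<lambda>y. - \<rho>' (x - y) w)" for w
            by (intro continuous_on_minus continuous_on_diff_shift c')
          show "cball x (\<delta> n) \<subseteq> \<Omega>" using sub K'(2) by blast
        qed (use z in auto)
        moreover have "(LINT y:\<Omega>|lebesgue. h y * \<rho> n (x - y)) = conv G (\<rho> n) x"
          unfolding conv_def G_def by (rule set_integral_support[OF _ K'(2)]) (use z sub in blast)
        moreover have "(LINT y:\<Omega>|lebesgue. f y * (- \<rho>' (x - y) v)) = (LINT y|lebesgue. F y * (- \<rho>' (x - y) v))"
          unfolding F_def by (rule set_integral_support[OF _ K'(2)]) (metis z' sub subsetD neg_0_equal_iff_equal)
        ultimately show ?thesis by (simp add: D_def conv_def)
      qed
      define P' where "P' = (\<lambda>x w. j (conv F (\<rho> n) x) * \<phi>' x w + (j' (conv F (\<rho> n) x) * D x w) * \<phi> x)"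
      have z0: "(LINT x|lebesgue. P' x v) = 0"
      proof (rule integral_derivative_zero[where F="\<lambda>x. j (conv F (\<rho> n) x) * \<phi> x" and R=R])
        show "((\<lambda>x. j (conv F (\<rho> n) x) * \<phi> x) has_derivative P' x) (at x)" for x
          unfolding P'_def
          by (rule has_derivative_mult[OF _ \<phi>(1)])
            (use has_derivative_compose[OF D j(1)[unfolded has_field_derivative_def]] in simp)
        show "continuous_on UNIV (\<lambda>x. P' x v)" unfolding P'_def
          by (intro continuous_intros Dc \<phi>(2,3) continuous_on_compose2[OF jc Fc] continuous_on_compose2[OF jc' Fc]) auto
      qed (simp add: R)
      have i1: "integrable lebesgue (\<lambda>x. j (conv F (\<rho> n) x) * \<phi>' x v)"
        by (rule integrable_times_bounded[OF jint[OF nF] continuous_measurable_lebesgue[OF \<phi>(2)] B'])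
      have e: "(\<lambda>x. (j' (conv F (\<rho> n) x) * D x v) * \<phi> x) = (\<lambda>x. conv G (\<rho> n) x * (j' (conv F (\<rho> n) x) * \<phi> x))"
      proof
        fix x
        show "(j' (conv F (\<rho> n) x) * D x v) * \<phi> x = conv G (\<rho> n) x * (j' (conv F (\<rho> n) x) * \<phi> x)"
        proof (cases "x \<in> K")
          case True
          show ?thesis unfolding DG[OF True] by (simp only: mult.assoc mult.left_commute)
        next
          case False
          show ?thesis unfolding \<phi>(6)[OF False] by simp
        qed
      qed
      have i2: "integrable lebesgue (\<lambda>x. conv G (\<rho> n) x * j' (conv F (\<rho> n) x) * \<phi> x)"
        by (rule integrable_times_bounded[OF jint'[OF nG borel_measurable_integrable[OF nF]] continuous_measurable_lebesgue[OF \<phi>(3)] B])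
      have "(\<lambda>x. P' x v) = (\<lambda>x. j (conv F (\<rho> n) x) * \<phi>' x v + conv G (\<rho> n) x * (j' (conv F (\<rho> n) x) * \<phi> x))"
        using e unfolding P'_def by (simp add: fun_eq_iff)
      then show ?thesis
        using z0 Bochner_Integration.integral_add[OF i1 i2[unfolded mult.assoc]] by simp
    qed
    have "(\<lambda>n. LINT x|lebesgue. j (conv F (\<rho> (r n)) x) * \<phi>' x v) \<longlonglongrightarrow> (LINT x|lebesgue. j (F x) * \<phi>' x v)"
    proof (rule L1_mult_tendsto[OF jint[OF nF] jint[OF F]])
      have "(\<lambda>n. LINT x|lebesgue. \<bar>j (conv F (\<rho> n) x) - j (F x)\<bar>) \<longlonglongrightarrow> 0"
      proof (rule tendsto_sandwich[OF _ _ tendsto_const mollify_L1(2)[OF F \<rho>(1,2)]])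
        show "\<forall>\<^sub>F n in sequentially. (LINT x|lebesgue. \<bar>j (conv F (\<rho> n) x) - j (F x)\<bar>) \<le> (LINT x|lebesgue. \<bar>conv F (\<rho> n) x - F x\<bar>)"
          by (intro always_eventually allI integral_mono integrable_abs Bochner_Integration.integrable_diff
              jint[OF nF] jint[OF F] nF F jlip)
      qed simp
      then show "(\<lambda>n. LINT x|lebesgue. \<bar>j (conv F (\<rho> (r n)) x) - j (F x)\<bar>) \<longlonglongrightarrow> 0"
        using LIMSEQ_subseq_LIMSEQ[OF _ r(1)] by (auto simp: o_def)
    qed (rule continuous_measurable_lebesgue[OF \<phi>(2)] B' AE_I2 tendsto_const)+
    moreover have "(\<lambda>n. - (LINT x|lebesgue. conv G (\<rho> (r n)) x * (j' (conv F (\<rho> (r n)) x) * \<phi> x))) \<longlonglongrightarrow> - (LINT x|lebesgue. G x * (j' (F x) * \<phi> x))"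
    proof (intro tendsto_minus L1_mult_tendsto[OF nG G])
      show "(\<lambda>n. LINT x|lebesgue. \<bar>conv G (\<rho> (r n)) x - G x\<bar>) \<longlonglongrightarrow> 0"
        using LIMSEQ_subseq_LIMSEQ[OF mollify_L1(2)[OF G \<rho>(1,2)] r(1)] by (auto simp: o_def)
      have mj: "(\<lambda>x. j' (p x) * \<phi> x) \<in> borel_measurable lebesgue" if "p \<in> borel_measurable lebesgue" for p
        by (intro borel_measurable_times measurable_compose[OF that jm(2)] continuous_measurable_lebesgue[OF \<phi>(3)])
      show "(\<lambda>x. j' (conv F (\<rho> (r n)) x) * \<phi> x) \<in> borel_measurable lebesgue" for n
        by (rule mj[OF borel_measurable_integrable[OF nF]])
      show "(\<lambda>x. j' (F x) * \<phi> x) \<in> borel_measurable lebesgue"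
        by (rule mj[OF borel_measurable_integrable[OF F]])
      have bd: "\<bar>j' t * \<phi> x\<bar> \<le> B" for t x
        using mult_mono[OF j'(1)[of t] B[of x]] by (simp add: abs_mult)
      show "\<bar>j' (conv F (\<rho> (r n)) x) * \<phi> x\<bar> \<le> B" "\<bar>j' (F x) * \<phi> x\<bar> \<le> B" for n x by (rule bd)+
      show "AE x in lebesgue. (\<lambda>n. j' (conv F (\<rho> (r n)) x) * \<phi> x) \<longlonglongrightarrow> j' (F x) * \<phi> x"
        using r(2)
      proof (rule eventually_mono)
        fix x assume "(\<lambda>n. conv F (\<rho> (r n)) x - F x) \<longlonglongrightarrow> 0"
        then have "(\<lambda>n. conv F (\<rho> (r n)) x) \<longlonglongrightarrow> F x" by (simp add: LIM_zero_iff)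
        moreover have "isCont j' (F x)" using jc' by (simp add: continuous_on_eq_continuous_at)
        ultimately show "(\<lambda>n. j' (conv F (\<rho> (r n)) x) * \<phi> x) \<longlonglongrightarrow> j' (F x) * \<phi> x"
          by (intro tendsto_intros) (rule isCont_tendsto_compose)
      qed
    qed
    ultimately have main: "(LINT x|lebesgue. j (F x) * \<phi>' x v) = - (LINT x|lebesgue. G x * (j' (F x) * \<phi> x))"
      unfolding parts by (rule LIMSEQ_unique)
    have "(LINT x:\<Omega>|lebesgue. j (f x) * \<phi>' x v) = (LINT x|lebesgue. (indicator K' x * j (f x)) * \<phi>' x v)"
      by (rule set_integral_support[OF _ K'(2)]) (use \<phi>(7) K'(5) in auto)
    also have "\<dots> = (LINT x|lebesgue. j (F x) * \<phi>' x v)"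
      unfolding F_def by (rule Bochner_Integration.integral_cong) (auto simp: indicator_def j(2))
    finally have 1: "(LINT x:\<Omega>|lebesgue. j (f x) * \<phi>' x v) = (LINT x|lebesgue. j (F x) * \<phi>' x v)" .
    have "(LINT x:\<Omega>|lebesgue. (j' (f x) * h x) * \<phi> x) = (LINT x|lebesgue. (indicator K' x * (j' (f x) * h x)) * \<phi> x)"
      by (rule set_integral_support[OF _ K'(2)]) (use \<phi>(6) K'(5) in auto)
    also have "\<dots> = (LINT x|lebesgue. G x * (j' (F x) * \<phi> x))"
      unfolding F_def G_def by (rule Bochner_Integration.integral_cong) (auto simp: indicator_def)
    finally show ?thesis using 1 main by (simp add: \<phi>(8))
  qed
  then show ?thesis using L1 L2 by (simp add: weak_derivative_def)
qed

lemma L1_loc_continuous: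
  fixes f :: "'a::euclidean_space \<Rightarrow> real"
  assumes "continuous_on \<Omega> f"
  shows "L1_loc \<Omega> f"
  unfolding L1_loc_def set_integrable_def
proof (intro allI impI, elim conjE)
  fix K assume "compact K" "K \<subseteq> \<Omega>"
  then have "integrable lborel (\<lambda>x. indicator K x *\<^sub>R f x)"
    using borel_integrable_compact[of K f] assms continuous_on_subset by (auto simp: set_integrable_def)
  then show "integrable lebesgue (\<lambda>x. indicator K x *\<^sub>R f x)"
    by (subst integrable_completion) auto
qed

text \<open>The product of f with a test function, extended by 0, is C^1 on the whole space, so
  \<open>integral_derivative_zero\<close> yields integration by parts.\<close>

lemma weak_derivative_C1:
  fixes f :: "'a::euclidean_space \<Rightarrow> real"
  assumes \<Omega>: "open \<Omega>" and f: "\<And>x. x \<in> \<Omega> \<Longrightarrow> (f has_derivative f' x) (at x)" "continuous_on \<Omega> (\<lambda>x. f' x v)"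
  shows "weak_derivative \<Omega> v f (\<lambda>x. f' x v)"
proof -
  have c: "continuous_on \<Omega> f"
    using f(1) by (meson continuous_at_imp_continuous_on has_derivative_continuous)
  note L = L1_loc_continuous[OF c] L1_loc_continuous[OF f(2)]
  have "(LINT x:\<Omega>|lebesgue. f x * frechet_derivative \<phi> (at x) v) = - (LINT x:\<Omega>|lebesgue. f' x v * \<phi> x)"
    if t: "test_function \<Omega> \<phi>" for \<phi>
  proof -
    obtain \<phi>' K where "test_data \<Omega> \<phi> \<phi>' K" by (rule test_function_data[OF t])
    note \<phi> = test_dataD[OF this]
    obtain R where R: "\<And>x. norm x > R \<Longrightarrow> \<phi> x = 0" by (rule test_function_bounded_support[OF t]) auto
    define P where "P = (\<lambda>x. if x \<in> \<Omega> then f x * \<phi> x else 0)"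
    define P' where "P' = (\<lambda>x w. if x \<in> \<Omega> then f x * \<phi>' x w + f' x w * \<phi> x else 0)"
    have oK: "open (- K)" using \<phi>(4) by (simp add: compact_imp_closed open_Compl)
    have "(LINT x|lebesgue. P' x v) = 0"
    proof (rule integral_derivative_zero[where F=P and R=R])
      show "(P has_derivative P' x) (at x)" for x
      proof (cases "x \<in> \<Omega>")
        case True
        have "((\<lambda>x. f x * \<phi> x) has_derivative (\<lambda>w. f x * \<phi>' x w + f' x w * \<phi> x)) (at x)"
          by (rule has_derivative_mult[OF f(1)[OF True] \<phi>(1)])
        then have "(P has_derivative (\<lambda>w. f x * \<phi>' x w + f' x w * \<phi> x)) (at x)"
          by (rule has_derivative_transform_within_open[OF _ \<Omega> True]) (simp add: P_def)
        then show ?thesis using True by (simp add: P'_def)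
      next
        case False
        have "((\<lambda>x. 0) has_derivative (\<lambda>w. 0)) (at x)" by simp
        then have "(P has_derivative (\<lambda>w. 0)) (at x)"
          by (rule has_derivative_transform_within_open[OF _ oK]) (use False \<phi>(5,6) in \<open>auto simp: P_def\<close>)
        then show ?thesis using False by (simp add: P'_def)
      qed
      have "continuous_on \<Omega> (\<lambda>x. f x * \<phi>' x v + f' x v * \<phi> x)"
        by (intro continuous_intros c f(2) continuous_on_subset[OF \<phi>(2)] continuous_on_subset[OF \<phi>(3)]) auto
      then have 1: "continuous_on \<Omega> (\<lambda>x. P' x v)"
        by (rule continuous_on_eq) (simp add: P'_def)
      have 2: "continuous_on (- K) (\<lambda>x. P' x v)"
        by (rule continuous_on_eq[OF continuous_on_const[of _ 0]]) (simp add: P'_def \<phi>(6,7))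
      have "\<Omega> \<union> - K = UNIV" using \<phi>(5) by auto
      then show "continuous_on UNIV (\<lambda>x. P' x v)"
        using continuous_on_open_Un[OF \<Omega> oK 1 2] by simp
    qed (simp add: P_def R)
    moreover have "(LINT x|lebesgue. P' x v) = (LINT x:\<Omega>|lebesgue. f x * \<phi>' x v + f' x v * \<phi> x)"
      unfolding set_lebesgue_integral_def by (rule Bochner_Integration.integral_cong) (auto simp: P'_def indicator_def)
    moreover have "\<dots> = (LINT x:\<Omega>|lebesgue. f x * \<phi>' x v) + (LINT x:\<Omega>|lebesgue. f' x v * \<phi> x)"
      using test_integrable[OF L(1) \<phi>(2)[of v] \<phi>(7) \<phi>(4,5)] test_integrable[OF L(2) \<phi>(3,6,4,5)]
      by (rule set_integral_add(2))
    ultimately show ?thesis by (simp add: \<phi>(8))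
  qed
  then show ?thesis using L by (simp add: weak_derivative_def)
qed

section \<open>The anisotropic integrand\<close>

definition outer :: "real^'m \<Rightarrow> real^'m^'m" where
  "outer s = (\<chi> i j. s $ i * s $ j)"

lemma outer_mult: "outer s *v x = (s \<bullet> x) *\<^sub>R s"
  by (simp add: outer_def matrix_vector_mult_def vec_eq_iff inner_vec_def sum_distrib_left mult_ac)

lemma outer_inner: "outer s \<bullet> N = s \<bullet> (N *v s)"
  by (simp add: outer_def inner_vec_def matrix_vector_mult_def sum_distrib_left mult_ac)

definition psd :: "real^'m^'m \<Rightarrow> bool" where
  "psd S \<longleftrightarrow> transpose S = S \<and> (\<forall>x. 0 \<le> x \<bullet> (S *v x))"

lemma symmetric_inner:
  fixes S :: "real^'m^'m"
  assumes "transpose S = S"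
  shows "x \<bullet> (S *v y) = y \<bullet> (S *v x)"
  by (metis assms dot_lmul_matrix inner_commute transpose_matrix_vector)

lemma quad_add:
  fixes S :: "real^'m^'m"
  assumes "transpose S = S"
  shows "(x + t *\<^sub>R y) \<bullet> (S *v (x + t *\<^sub>R y)) = x \<bullet> (S *v x) + 2 * t * (x \<bullet> (S *v y)) + t\<^sup>2 * (y \<bullet> (S *v y))"
  using symmetric_inner[OF assms, of x y]
  by (simp add: matrix_vector_right_distrib inner_add_left inner_add_right power2_eq_square
      matrix_vector_mult_scaleR algebra_simps)

lemma axis_quad: "axis i 1 \<bullet> (S *v axis j 1) = (S :: real^'m^'m) $ i $ j"
  by (simp add: inner_axis' matrix_vector_mult_basis column_def)

text \<open>If the i-th diagonal entry is 0, the form on the line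
  \<open>axis j 1 + t *\<^sub>R axis i 1\<close> is affine in t, so nonnegativity forces the slope
  to vanish; the chosen t would give the value -1.\<close>

lemma psd_zero_diag:
  fixes S :: "real^'m^'m"
  assumes "psd S" "S $ i $ i = 0"
  shows "S $ j $ i = 0"
proof (rule ccontr)
  assume ne: "S $ j $ i \<noteq> 0"
  have sym: "transpose S = S" and nn: "\<And>x. 0 \<le> x \<bullet> (S *v x)" using assms by (auto simp: psd_def)
  define t where "t = - (S $ j $ j + 1) / (2 * S $ j $ i)"
  have "0 \<le> S $ j $ j + 2 * t * S $ j $ i"
    using nn[of "axis j 1 + t *\<^sub>R axis i 1"] assms(2) unfolding quad_add[OF sym] axis_quad by simp
  moreover have "2 * t * S $ j $ i = - (S $ j $ j + 1)" using ne by (simp add: t_def)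
  ultimately show False by simp
qed

text \<open>Subtracting a rank-one matrix clears a row and keeps S positive semidefinite, so
  induction on the number of nonzero rows writes S as a sum of multiples of \<open>outer s\<close>,
  each of which pairs with N to a value of the form of N. Only the quadratic form of N is
  constrained, which suits Jacobian matrices.\<close>

lemma psd_inner_nonneg:
  fixes S N :: "real^'m^'m"
  assumes "psd S" and N: "\<And>x. 0 \<le> x \<bullet> (N *v x)"
  shows "0 \<le> S \<bullet> N"
  using assms(1)
proof (induction "card {i. S $ i \<noteq> 0}" arbitrary: S rule: less_induct)
  case less
  have sym: "transpose S = S" and nn: "\<And>x. 0 \<le> x \<bullet> (S *v x)" using less.prems by (auto simp: psd_def)
  have symc: "S $ a $ b = S $ b $ a" for a b
    using sym by (metis transpose_def vec_lambda_beta)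
  show ?case
  proof (cases "S = 0")
    case False
    then obtain k l where "S $ k $ l \<noteq> 0" by (auto simp: vec_eq_iff)
    then obtain i where i: "S $ i $ i \<noteq> 0" using psd_zero_diag[OF less.prems] by blast
    define d where "d = S $ i $ i"
    have "d \<ge> 0" using nn[of "axis i 1"] by (simp add: axis_quad d_def)
    with i have d: "d > 0" by (simp add: d_def)
    define s where "s = S *v axis i 1"
    have s: "s $ a = S $ a $ i" for a by (simp add: s_def matrix_vector_mult_basis column_def)
    \<comment> \<open>The Schur complement with respect to the pivot d: row and column i become
      0.\<close>
    define S' where "S' = S - (1 / d) *\<^sub>R outer s"
    have entry: "S' $ a $ b = S $ a $ b - S $ a $ i * S $ b $ i / d" for a b
      by (simp add: S'_def outer_def s)
    have "psd S'"
      unfolding psd_def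
    proof (intro conjI allI)
      show "transpose S' = S'" by (simp add: vec_eq_iff transpose_def entry symc mult.commute)
      fix x
      \<comment> \<open>This t minimises the form of S along the i-th axis through x, and the
        minimum is the form of \<open>S'\<close> at x.\<close>
      define t where "t = - (s \<bullet> x) / d"
      have xs: "x \<bullet> (S *v axis i 1) = s \<bullet> x" by (simp add: s_def inner_commute)
      have "0 \<le> x \<bullet> (S *v x) + 2 * t * (s \<bullet> x) + t\<^sup>2 * d"
        using nn[of "x + t *\<^sub>R axis i 1"] unfolding quad_add[OF sym] xs by (simp add: axis_quad d_def)
      also have "\<dots> = x \<bullet> (S *v x) - (s \<bullet> x)\<^sup>2 / d"
        using d by (simp add: t_def power2_eq_square field_simps)
      also have "\<dots> = x \<bullet> (S' *v x)"
        by (simp add: S'_def matrix_vector_mult_diff_rdistrib scaleR_matrix_vector_assoc[symmetric] outer_mult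
            inner_diff_right inner_commute power2_eq_square)
      finally show "0 \<le> x \<bullet> (S' *v x)" .
    qed
    moreover have "card {a. S' $ a \<noteq> 0} < card {a. S $ a \<noteq> 0}"
    proof (rule psubset_card_mono)
      have "S' $ i $ b = 0" for b
        using d symc[of i b] by (simp add: entry d_def[symmetric])
      then have "S' $ i = 0" by (simp add: vec_eq_iff)
      moreover have "S $ i \<noteq> 0" using i by auto
      moreover have "S' $ a = 0" if "S $ a = 0" for a using that by (simp add: vec_eq_iff entry)
      ultimately show "{a. S' $ a \<noteq> 0} \<subset> {a. S $ a \<noteq> 0}" by blast
    qed simp
    ultimately have "0 \<le> S' \<bullet> N" using less.hyps by blast
    moreover have "S \<bullet> N = S' \<bullet> N + (1 / d) * (s \<bullet> (N *v s))"
      by (simp add: S'_def inner_diff_left outer_inner)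
    ultimately show ?thesis using d N[of s] by simp
  qed simp
qed

lemma inner_mat_1: "(S :: real^'m^'m) \<bullet> mat 1 = (\<Sum>i\<in>UNIV. S $ i $ i)"
  by (simp add: inner_vec_def mat_def if_distrib sum.delta cong: if_cong)

lemma outer_trace: "(\<Sum>i\<in>UNIV. outer s $ i $ i) = s \<bullet> s"
  by (simp add: outer_def inner_vec_def)

context
  fixes A :: "real^'m^'m"
  assumes A: "sym_pos_def A"
begin

lemma A_sym: "transpose A = A" using A by (simp add: sym_pos_def_def)

lemma A_pos: "p \<noteq> 0 \<Longrightarrow> 0 < p \<bullet> (A *v p)" using A by (simp add: sym_pos_def_def)

lemma A_nonneg: "0 \<le> p \<bullet> (A *v p)" using A_pos[of p] by (cases "p = 0") auto

lemma A_Cauchy_Schwarz: "(x \<bullet> (A *v p))\<^sup>2 \<le> (x \<bullet> (A *v x)) * (p \<bullet> (A *v p))"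
proof (cases "p = 0")
  case False
  note d = A_pos[OF False]
  define t where "t = - (x \<bullet> (A *v p)) / (p \<bullet> (A *v p))"
  have "0 \<le> x \<bullet> (A *v x) + 2 * t * (x \<bullet> (A *v p)) + t\<^sup>2 * (p \<bullet> (A *v p))"
    using A_nonneg[of "x + t *\<^sub>R p"] unfolding quad_add[OF A_sym] .
  also have "\<dots> = x \<bullet> (A *v x) - (x \<bullet> (A *v p))\<^sup>2 / (p \<bullet> (A *v p))"
    using d by (simp add: t_def power2_eq_square field_simps)
  finally show ?thesis using d by (simp add: field_simps)
qed simp

text \<open>\<open>aniso A\<close> has no derivative at 0. Adding \<delta>^2 under the root makes it
  smooth and changes its value by at most \<delta>.\<close>

definition aniso_reg :: "real \<Rightarrow> real^'m \<Rightarrow> real" where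
  "aniso_reg \<delta> p = sqrt (\<delta>\<^sup>2 + p \<bullet> (A *v p))"

lemma aniso_reg_pos: "\<delta> > 0 \<Longrightarrow> aniso_reg \<delta> p > 0"
  using A_nonneg[of p] by (simp add: aniso_reg_def add_pos_nonneg)

lemma aniso_reg_sq: "(aniso_reg \<delta> p)\<^sup>2 = \<delta>\<^sup>2 + p \<bullet> (A *v p)"
  using A_nonneg[of p] by (simp add: aniso_reg_def)

lemma aniso_nonneg: "aniso A p \<ge> 0"
  using A_nonneg[of p] by (simp add: aniso_def)

lemma aniso_le_reg: "aniso A p \<le> aniso_reg \<delta> p"
  by (simp add: aniso_def aniso_reg_def)

lemma aniso_reg_le: "\<delta> > 0 \<Longrightarrow> aniso_reg \<delta> p \<le> aniso A p + \<delta>"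
  unfolding aniso_reg_def aniso_def
  using sqrt_add_le_add_sqrt[of "p \<bullet> (A *v p)" "\<delta>\<^sup>2"] A_nonneg[of p] by (simp add: add.commute)

text \<open>The tangent plane inequality. After multiplication by
  \<open>aniso_reg \<delta> p\<close> it becomes the Cauchy-Schwarz inequality for the vectors
  (\<delta>, x) and (\<delta>, p) in one dimension more, with the inner product given by A on the
  last components.\<close>

lemma aniso_reg_convex:
  assumes "\<delta> > 0"
  shows "aniso_reg \<delta> p + (A *v p) \<bullet> (x - p) / aniso_reg \<delta> p \<le> aniso_reg \<delta> x"
proof -
  define m where "m = x \<bullet> (A *v p)"
  define a where "a = x \<bullet> (A *v x)"
  define b where "b = p \<bullet> (A *v p)"
  have nn: "a \<ge> 0" "b \<ge> 0" by (auto simp: a_def b_def A_nonneg)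
  have "0 \<le> (x + (-1) *\<^sub>R p) \<bullet> (A *v (x + (-1) *\<^sub>R p))" by (rule A_nonneg)
  then have "2 * m \<le> a + b" unfolding quad_add[OF A_sym] by (simp add: m_def a_def b_def)
  then have "\<delta>\<^sup>2 * (2 * m) \<le> \<delta>\<^sup>2 * (a + b)" by (rule mult_left_mono) simp
  moreover have "m\<^sup>2 \<le> a * b" unfolding m_def a_def b_def by (rule A_Cauchy_Schwarz)
  ultimately have "(\<delta>\<^sup>2 + m)\<^sup>2 \<le> (\<delta>\<^sup>2 + a) * (\<delta>\<^sup>2 + b)"
    by (simp add: power2_eq_square algebra_simps)
  then have "\<delta>\<^sup>2 + m \<le> sqrt ((\<delta>\<^sup>2 + a) * (\<delta>\<^sup>2 + b))" by (rule real_le_rsqrt)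
  then have le: "\<delta>\<^sup>2 + m \<le> aniso_reg \<delta> x * aniso_reg \<delta> p"
    by (simp add: aniso_reg_def a_def b_def real_sqrt_mult)
  have q: "aniso_reg \<delta> p > 0" by (rule aniso_reg_pos[OF assms])
  have "aniso_reg \<delta> p + (A *v p) \<bullet> (x - p) / aniso_reg \<delta> p = ((aniso_reg \<delta> p)\<^sup>2 + (A *v p) \<bullet> (x - p)) / aniso_reg \<delta> p"
    using q by (simp add: field_simps power2_eq_square)
  also have "\<dots> = (\<delta>\<^sup>2 + m) / aniso_reg \<delta> p"
    unfolding aniso_reg_sq by (simp add: m_def inner_diff_right inner_commute)
  also have "\<dots> \<le> aniso_reg \<delta> x" using le q by (simp add: divide_le_eq)
  finally show ?thesis .
qed

lemma aniso_triangle: "aniso A (x + y) \<le> aniso A x + aniso A y"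
proof -
  have "(x \<bullet> (A *v y))\<^sup>2 \<le> (aniso A x * aniso A y)\<^sup>2"
    using A_Cauchy_Schwarz[of x y] by (simp add: aniso_def power_mult_distrib A_nonneg)
  then have "x \<bullet> (A *v y) \<le> aniso A x * aniso A y"
    by (rule power2_le_imp_le) (simp add: aniso_nonneg)
  then have "(x + 1 *\<^sub>R y) \<bullet> (A *v (x + 1 *\<^sub>R y)) \<le> (aniso A x + aniso A y)\<^sup>2"
    unfolding quad_add[OF A_sym] by (simp add: aniso_def power2_sum A_nonneg)
  then show ?thesis
    unfolding aniso_def[of A "x + y"] by (intro real_le_lsqrt) (auto simp: aniso_nonneg)
qed

lemma aniso_scale: "aniso A (t *\<^sub>R x) = \<bar>t\<bar> * aniso A x"
  by (simp add: aniso_def matrix_vector_mult_scaleR real_sqrt_mult mult.assoc[symmetric])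

lemma aniso_convex:
  assumes "0 \<le> a" "a \<le> 1"
  shows "aniso A (x + a *\<^sub>R (y - x)) \<le> aniso A x + a * (aniso A y - aniso A x)"
proof -
  have "x + a *\<^sub>R (y - x) = (1 - a) *\<^sub>R x + a *\<^sub>R y" by (simp add: algebra_simps)
  then have "aniso A (x + a *\<^sub>R (y - x)) \<le> (1 - a) * aniso A x + a * aniso A y"
    using aniso_triangle[of "(1 - a) *\<^sub>R x" "a *\<^sub>R y"] assms by (simp add: aniso_scale)
  then show ?thesis by (simp add: algebra_simps)
qed

lemma continuous_quad: "continuous_on UNIV (\<lambda>p. p \<bullet> (A *v p))"
  by (intro continuous_intros linear_continuous_on matrix_vector_mul_bounded_linear)

lemma aniso_continuous: "continuous_on UNIV (aniso A)"
  unfolding aniso_def by (intro continuous_intros continuous_quad)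

lemma aniso_reg_continuous: "continuous_on UNIV (aniso_reg \<delta>)"
  unfolding aniso_reg_def by (intro continuous_intros continuous_quad)

lemma aniso_linear_bound: "\<exists>C>0. \<forall>p. aniso A p \<le> C * norm p"
proof -
  define B where "B = onorm ((*v) A)"
  have B: "norm (A *v p) \<le> B * norm p" for p
    unfolding B_def by (rule onorm) simp
  have "B \<ge> 0" unfolding B_def by (rule onorm_pos_le) simp
  show ?thesis
  proof (intro exI[of _ "sqrt B + 1"] conjI allI)
    show "0 < sqrt B + 1" using \<open>B \<ge> 0\<close> by (simp add: add_nonneg_pos)
    fix p
    have "p \<bullet> (A *v p) \<le> norm p * (B * norm p)"
      using norm_cauchy_schwarz[of p "A *v p"] mult_left_mono[OF B norm_ge_zero, of p p] by linarith
    then have "aniso A p \<le> sqrt (B * (norm p)\<^sup>2)"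
      unfolding aniso_def by (intro real_sqrt_le_mono) (simp add: power2_eq_square algebra_simps)
    then show "aniso A p \<le> (sqrt B + 1) * norm p"
      by (simp add: real_sqrt_mult distrib_right) (use norm_ge_zero[of p] in linarith)
  qed
qed

definition tr :: real where "tr = (\<Sum>i\<in>UNIV. A $ i $ i)"

text \<open>This is where the dimension enters: in dimension one the flux depends only on the sign of the gradient and the barrier gains nothing.\<close>

lemma A_trace_gap:
  assumes "CARD('m) \<ge> 2" "p \<noteq> 0"
  shows "(A *v p) \<bullet> (A *v p) < tr * (p \<bullet> (A *v p))"
proof (rule ccontr)
  assume not: "\<not> ?thesis"
  define a where "a = p \<bullet> (A *v p)"
  have a: "a > 0" using A_pos[OF assms(2)] by (simp add: a_def)
  \<comment> \<open>S is positive semidefinite by Cauchy-Schwarz, and its trace is the difference of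
    the two sides. If that is not positive then S is 0, which contradicts its form at a nonzero
    vector orthogonal to \<open>A *v p\<close>; such a vector exists from dimension two on.\<close>
  define S where "S = a *\<^sub>R A - outer (A *v p)"
  have Sx: "x \<bullet> (S *v x) = a * (x \<bullet> (A *v x)) - (x \<bullet> (A *v p))\<^sup>2" for x
    by (simp add: S_def matrix_vector_mult_diff_rdistrib scaleR_matrix_vector_assoc[symmetric] outer_mult
            inner_diff_right inner_commute power2_eq_square)
  have psd: "psd S"
    unfolding psd_def Sx
  proof (intro conjI allI)
    show "transpose S = S"
      using A_sym by (simp add: S_def outer_def transpose_def vec_eq_iff mult.commute)
    show "0 \<le> a * (x \<bullet> (A *v x)) - (x \<bullet> (A *v p))\<^sup>2" for x
      using A_Cauchy_Schwarz[of x p] by (simp add: a_def mult.commute)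
  qed
  have nn: "S $ i $ i \<ge> 0" for i
    using psd axis_quad[of i S i] unfolding psd_def by metis
  have "(\<Sum>i\<in>UNIV. S $ i $ i) = a * tr - (A *v p) \<bullet> (A *v p)"
    unfolding S_def tr_def by (simp add: sum_subtractf sum_distrib_left outer_trace[symmetric])
  then have "(\<Sum>i\<in>UNIV. S $ i $ i) \<le> 0" using not by (simp add: a_def mult.commute)
  then have "(\<Sum>i\<in>UNIV. S $ i $ i) = 0" using nn by (simp add: antisym sum_nonneg)
  then have "S $ i $ i = 0" for i using nn by (simp add: sum_nonneg_eq_0_iff)
  then have "S = 0" using psd_zero_diag[OF psd] by (simp add: vec_eq_iff)
  have "2 \<le> DIM(real^'m)" using assms(1) by simp
  then obtain x where x: "x \<noteq> 0" "orthogonal (A *v p) x"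
    using orthogonal_to_vector_exists by blast
  have "x \<bullet> (S *v x) = a * (x \<bullet> (A *v x))" unfolding Sx using x(2) by (simp add: orthogonal_def inner_commute)
  then show False using \<open>S = 0\<close> a A_pos[OF x(1)] by simp
qed

text \<open>Both sides are homogeneous of degree two, so the strict inequality becomes uniform by
  compactness of the unit sphere. The additional fact \<open>c \<le> tr\<close> is what later
  absorbs the \<delta>^2 in the square of \<open>aniso_reg\<close>.\<close>

lemma A_trace_gap_uniform:
  assumes "CARD('m) \<ge> 2"
  obtains c where "c > 0" "\<And>p. c * (p \<bullet> (A *v p)) \<le> tr * (p \<bullet> (A *v p)) - (A *v p) \<bullet> (A *v p)" "c \<le> tr"
proof -
  define f where "f = (\<lambda>p. tr * (p \<bullet> (A *v p)) - (A *v p) \<bullet> (A *v p))"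
  have cf: "continuous_on UNIV f"
    unfolding f_def by (intro continuous_intros continuous_quad linear_continuous_on matrix_vector_mul_bounded_linear)
  let ?S = "sphere (0::real^'m) 1"
  have ne: "?S \<noteq> {}" by simp
  obtain p0 where p0: "p0 \<in> ?S" "\<And>p. p \<in> ?S \<Longrightarrow> f p0 \<le> f p"
    using continuous_attains_inf[OF compact_sphere ne continuous_on_subset[OF cf]] by auto
  obtain p1 where p1: "p1 \<in> ?S" "\<And>p. p \<in> ?S \<Longrightarrow> p \<bullet> (A *v p) \<le> p1 \<bullet> (A *v p1)"
    using continuous_attains_sup[OF compact_sphere ne continuous_on_subset[OF continuous_quad]] by auto
  have f0: "f p0 > 0" using A_trace_gap[OF assms, of p0] p0(1) by (force simp: f_def)
  have m1: "p1 \<bullet> (A *v p1) > 0" using A_pos[of p1] p1(1) by force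
  define c where "c = f p0 / (p1 \<bullet> (A *v p1))"
  have c: "c > 0" using f0 m1 by (simp add: c_def)
  have main: "c * (p \<bullet> (A *v p)) \<le> f p" for p
  proof (cases "p = 0")
    case False
    define e where "e = (1 / norm p) *\<^sub>R p"
    have e: "e \<in> ?S" "p = norm p *\<^sub>R e" using False by (auto simp: e_def)
    have "c * (e \<bullet> (A *v e)) \<le> c * (p1 \<bullet> (A *v p1))" using p1(2)[OF e(1)] c by simp
    also have "\<dots> = f p0" using m1 by (simp add: c_def)
    also have "\<dots> \<le> f e" by (rule p0(2)[OF e(1)])
    finally have "(norm p)\<^sup>2 * (c * (e \<bullet> (A *v e))) \<le> (norm p)\<^sup>2 * f e" by (rule mult_left_mono) simp
    moreover have sc: "(r *\<^sub>R e) \<bullet> (A *v (r *\<^sub>R e)) = r\<^sup>2 * (e \<bullet> (A *v e))"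
      "f (r *\<^sub>R e) = r\<^sup>2 * f e" for r
      by (simp_all add: f_def matrix_vector_mult_scaleR power2_eq_square right_diff_distrib)
    have "p \<bullet> (A *v p) = (norm p)\<^sup>2 * (e \<bullet> (A *v e))" "f p = (norm p)\<^sup>2 * f e"
      using sc[of "norm p"] unfolding e(2)[symmetric] by auto
    ultimately show ?thesis by (simp only: mult.left_commute[of c "(norm p)\<^sup>2"])
  qed (simp add: f_def)
  have "c * (p0 \<bullet> (A *v p0)) \<le> tr * (p0 \<bullet> (A *v p0))"
    using main[of p0] inner_ge_zero[of "A *v p0"] unfolding f_def by linarith
  moreover have "p0 \<bullet> (A *v p0) > 0" using A_pos[of p0] p0(1) by force
  ultimately have "c \<le> tr" by simp
  with c main show ?thesis using that[of c] by (simp add: f_def)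
qed

text \<open>Provides the bound sqrt (tr A) for the flux, uniform in p and \<delta>, that serves to
  dominate integrands in later limits.\<close>

lemma A_norm_bound:
  assumes "CARD('m) \<ge> 2"
  shows "norm (A *v p) \<le> sqrt tr * aniso_reg \<delta> p"
proof -
  obtain c where c: "c > 0" "\<And>p. c * (p \<bullet> (A *v p)) \<le> tr * (p \<bullet> (A *v p)) - (A *v p) \<bullet> (A *v p)" "c \<le> tr"
    by (rule A_trace_gap_uniform[OF assms]) blast
  have "(A *v p) \<bullet> (A *v p) \<le> tr * (p \<bullet> (A *v p))"
    using c(2)[of p] mult_nonneg_nonneg[of c "p \<bullet> (A *v p)"] c(1) A_nonneg[of p] by linarith
  also have "\<dots> \<le> tr * (aniso_reg \<delta> p)\<^sup>2"
    unfolding aniso_reg_sq using c by (intro mult_left_mono) auto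
  finally have "sqrt ((A *v p) \<bullet> (A *v p)) \<le> sqrt (tr * (aniso_reg \<delta> p)\<^sup>2)" by (rule real_sqrt_le_mono)
  moreover have "aniso_reg \<delta> p \<ge> 0" by (simp add: aniso_reg_def A_nonneg)
  ultimately show ?thesis by (simp add: norm_eq_sqrt_inner real_sqrt_mult)
qed

text \<open>The matrix paired with N is the Hessian of \<open>aniso_reg \<delta>\<close> at p, and
  the pairing is the divergence of the flux along a field with Jacobian N. It is positive
  semidefinite, so N may be replaced by its lower bound \<mu> times the identity, which leaves \<mu>
  times the trace; the trace gap bounds that from below with c independent of p and
  \<delta>.\<close>

lemma aniso_hessian_bound:
  assumes "CARD('m) \<ge> 2"
  obtains c where "c > 0"
    "\<And>\<delta> p N \<mu>. \<lbrakk>\<delta> > 0; \<mu> \<ge> 0; \<And>x. \<mu> * (x \<bullet> x) \<le> x \<bullet> (N *v x)\<rbrakk> \<Longrightarrow>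
       c * \<mu> / aniso_reg \<delta> p \<le>
       ((1 / aniso_reg \<delta> p) *\<^sub>R A - (1 / (aniso_reg \<delta> p) ^ 3) *\<^sub>R outer (A *v p)) \<bullet> N"
proof -
  obtain c where c: "c > 0" "\<And>p. c * (p \<bullet> (A *v p)) \<le> tr * (p \<bullet> (A *v p)) - (A *v p) \<bullet> (A *v p)" "c \<le> tr"
    by (rule A_trace_gap_uniform[OF assms]) blast
  have "c * \<mu> / aniso_reg \<delta> p \<le>
       ((1 / aniso_reg \<delta> p) *\<^sub>R A - (1 / (aniso_reg \<delta> p) ^ 3) *\<^sub>R outer (A *v p)) \<bullet> N"
    if d: "\<delta> > 0" and \<mu>: "\<mu> \<ge> 0" and N: "\<And>x. \<mu> * (x \<bullet> x) \<le> x \<bullet> (N *v x)" for \<delta> p N \<mu>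
  proof -
    define q where "q = aniso_reg \<delta> p"
    have q: "q > 0" "q\<^sup>2 = \<delta>\<^sup>2 + p \<bullet> (A *v p)" using aniso_reg_pos[OF d] aniso_reg_sq by (auto simp: q_def)
    define S where "S = (1 / q) *\<^sub>R A - (1 / q ^ 3) *\<^sub>R outer (A *v p)"
    have Sx: "x \<bullet> (S *v x) = (1 / q ^ 3) * (q\<^sup>2 * (x \<bullet> (A *v x)) - (x \<bullet> (A *v p))\<^sup>2)" for x
      using q(1) by (simp add: S_def matrix_vector_mult_diff_rdistrib scaleR_matrix_vector_assoc[symmetric] outer_mult
            inner_diff_right inner_commute power2_eq_square power3_eq_cube field_simps)
    have psd: "psd S"
      unfolding psd_def
    proof (intro conjI allI)
      show "transpose S = S"
        using A_sym by (simp add: S_def outer_def transpose_def vec_eq_iff mult.commute)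
      fix x
      have "(x \<bullet> (A *v p))\<^sup>2 \<le> (x \<bullet> (A *v x)) * (p \<bullet> (A *v p))" by (rule A_Cauchy_Schwarz)
      also have "\<dots> \<le> (x \<bullet> (A *v x)) * q\<^sup>2" unfolding q(2) by (intro mult_left_mono A_nonneg) simp
      finally show "0 \<le> x \<bullet> (S *v x)" unfolding Sx using q(1) by (simp add: mult.commute)
    qed
    have "0 \<le> S \<bullet> (N - \<mu> *\<^sub>R mat 1)"
    proof (rule psd_inner_nonneg[OF psd])
      show "0 \<le> x \<bullet> ((N - \<mu> *\<^sub>R mat 1) *v x)" for x
        using N[of x] by (simp add: matrix_vector_mult_diff_rdistrib scaleR_matrix_vector_assoc[symmetric] inner_diff_right)
    qed
    then have "\<mu> * (S \<bullet> mat 1) \<le> S \<bullet> N" by (simp add: inner_diff_right)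
    moreover have "c / q \<le> S \<bullet> mat 1"
    proof -
      have "S \<bullet> mat 1 = tr / q - (A *v p) \<bullet> (A *v p) / q ^ 3"
        unfolding inner_mat_1 S_def tr_def
        by (simp add: sum_subtractf sum_divide_distrib[symmetric] outer_trace)
      also have "\<dots> = (1 / q ^ 3) * (tr * q\<^sup>2 - (A *v p) \<bullet> (A *v p))"
        using q(1) by (simp add: field_simps power2_eq_square power3_eq_cube)
      also have "\<dots> \<ge> (1 / q ^ 3) * (c * q\<^sup>2)"
      proof (rule mult_left_mono)
        \<comment> \<open>The trace gap covers the quadratic part of q^2 only; the \<delta>^2 part
          uses c \<le> tr.\<close>
        have "c * \<delta>\<^sup>2 \<le> tr * \<delta>\<^sup>2" using c(3) by (simp add: mult_right_mono)
        then show "c * q\<^sup>2 \<le> tr * q\<^sup>2 - (A *v p) \<bullet> (A *v p)"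
          unfolding q(2) distrib_left using c(2)[of p] by linarith
      qed (use q(1) in simp)
      also have "(1 / q ^ 3) * (c * q\<^sup>2) = c / q" using q(1) by (simp add: field_simps power2_eq_square power3_eq_cube)
      finally show ?thesis .
    qed
    ultimately have "\<mu> * (c / q) \<le> S \<bullet> N" using mult_left_mono[OF _ \<mu>] by (meson order_trans)
    then show ?thesis by (simp add: S_def q_def mult.commute)
  qed
  then show ?thesis using that[OF c(1)] by blast
qed

end

section \<open>Cutoffs near a \<open>C\<^sup>2\<close> boundary\<close>

definition proj_perp :: "'a::real_inner \<Rightarrow> 'a \<Rightarrow> 'a" where
  "proj_perp e x = x - (x \<bullet> e) *\<^sub>R e"

lemma proj_perp_diff: "proj_perp e (x - y) = proj_perp e x - proj_perp e y"
  by (simp add: proj_perp_def inner_diff_left algebra_simps)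

lemma proj_perp_add_scale:
  assumes "norm e = 1"
  shows "proj_perp e (x + t *\<^sub>R e) = proj_perp e x"
  using assms by (simp add: proj_perp_def inner_add_left norm_eq_1 algebra_simps)

lemma proj_perp_norm_le:
  assumes "norm e = 1"
  shows "norm (proj_perp e x) \<le> norm x"
proof -
  have "(norm (proj_perp e x))\<^sup>2 = (norm x)\<^sup>2 - (x \<bullet> e)\<^sup>2"
    using assms unfolding power2_norm_eq_inner proj_perp_def norm_eq_1
    by (simp add: inner_diff_left inner_diff_right inner_commute power2_eq_square algebra_simps)
  then show ?thesis by (metis diff_le_eq le_add_same_cancel1 norm_ge_zero power2_le_imp_le zero_le_power2)
qed

lemma proj_perp_continuous: "continuous_on S (proj_perp e)"
  unfolding proj_perp_def by (intro continuous_intros)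

lemma C1_locally_lipschitz:
  fixes \<gamma> :: "'a::euclidean_space \<Rightarrow> real"
  assumes "Ck (Suc k) \<gamma>"
  obtains L where "L \<ge> 0" "\<And>x y. x \<in> cball p r \<Longrightarrow> y \<in> cball p r \<Longrightarrow> \<bar>\<gamma> x - \<gamma> y\<bar> \<le> L * norm (x - y)"
proof -
  obtain \<gamma>' where \<gamma>': "\<And>x. (\<gamma> has_derivative \<gamma>' x) (at x)" "\<And>v. Ck k (\<lambda>x. \<gamma>' x v)"
    using assms by (metis Ck_SucE)
  define \<theta>' where "\<theta>' = (\<lambda>x v. if x \<in> cball p r then \<gamma>' x v else 0)"
  obtain B where B: "B > 0" "\<And>x v. \<bar>\<theta>' x v\<bar> \<le> B * norm v"
  proof (rule directional_bound[of \<theta>'])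
    show "linear (\<theta>' x)" for x
      using has_derivative_linear[OF \<gamma>'(1)[of x]] by (cases "x \<in> cball p r") (auto simp: \<theta>'_def module_hom_zero)
    fix b :: 'a
    have "compact ((\<lambda>x. \<gamma>' x b) ` cball p r)"
      using Ck_continuous[OF \<gamma>'(2)] by (intro compact_continuous_image) (auto intro: continuous_on_subset)
    then obtain B where B: "B > 0" "\<And>x. x \<in> cball p r \<Longrightarrow> \<bar>\<gamma>' x b\<bar> \<le> B"
      using compact_imp_bounded[of "(\<lambda>x. \<gamma>' x b) ` cball p r"] unfolding bounded_pos by auto
    then show "\<exists>B. \<forall>x. \<bar>\<theta>' x b\<bar> \<le> B" by (intro exI[of _ B]) (auto simp: \<theta>'_def)
  qed auto
  have "norm (\<gamma> x - \<gamma> y) \<le> B * norm (x - y)" if "x \<in> cball p r" "y \<in> cball p r" for x y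
  proof (rule differentiable_bound[of "cball p r" \<gamma> \<gamma>'])
    fix z assume z: "z \<in> cball p r"
    show "(\<gamma> has_derivative \<gamma>' z) (at z within cball p r)" by (rule has_derivative_at_withinI[OF \<gamma>'(1)])
    show "onorm (\<gamma>' z) \<le> B"
      using B(2)[of z] z by (intro onorm_le) (auto simp: \<theta>'_def)
  qed (use that in auto)
  then show ?thesis using that[of B] B(1) by auto
qed

text \<open>Near p the boundary is the graph of a function with Lipschitz constant L over the
  hyperplane orthogonal to e, so two boundary points are at most 1 + L times as far apart as their
  projections. Hence c = 1 / (1 + L).\<close>

lemma C2_domain_frontier_lipschitz:
  assumes D: "C2_domain D" and p: "p \<in> frontier D"
  obtains R e c where "R > 0" "norm e = 1" "0 < c" "c \<le> 1"
    "\<And>x y. x \<in> frontier D \<inter> ball p R \<Longrightarrow> y \<in> frontier D \<inter> ball p R \<Longrightarrow> c * norm (x - y) \<le> norm (proj_perp e (x - y))"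
proof -
  have oD: "open D" using D by (simp add: C2_domain_def)
  obtain r e \<gamma> where r: "r > 0" "norm e = 1" "Ck 2 \<gamma>"
    and eq: "D \<inter> ball p r = {x \<in> ball p r. \<gamma> (x - (x \<bullet> e) *\<^sub>R e) < x \<bullet> e}"
    using D p unfolding C2_domain_def by blast
  have graph: "\<gamma> (proj_perp e x) = x \<bullet> e" if x: "x \<in> frontier D" "x \<in> ball p r" for x
  proof (rule antisym)
    have "x \<notin> D" using x(1) oD by (simp add: frontier_def interior_open)
    then show "x \<bullet> e \<le> \<gamma> (proj_perp e x)" using eq x(2) unfolding proj_perp_def by force
    show "\<gamma> (proj_perp e x) \<le> x \<bullet> e"
    proof (rule ccontr)
      assume "\<not> \<gamma> (proj_perp e x) \<le> x \<bullet> e"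
      define U where "U = {y. y \<bullet> e < \<gamma> (proj_perp e y)} \<inter> ball p r"
      have "open {y. y \<bullet> e < \<gamma> (proj_perp e y)}"
        by (intro open_Collect_less continuous_on_compose2[OF Ck_continuous[OF r(3)] proj_perp_continuous] continuous_intros) auto
      then have "open U" unfolding U_def by auto
      moreover have "x \<in> U" using x(2) \<open>\<not> \<gamma> (proj_perp e x) \<le> x \<bullet> e\<close> by (simp add: U_def)
      moreover have "x \<in> closure D" using x(1) by (simp add: frontier_def)
      ultimately obtain y where "y \<in> U" "y \<in> D"
        by (metis disjoint_iff open_Int_closure_eq_empty)
      then show False using eq unfolding U_def proj_perp_def by force
    qed
  qed
  obtain L where L: "L \<ge> 0" "\<And>x y. x \<in> cball (proj_perp e p) r \<Longrightarrow> y \<in> cball (proj_perp e p) r \<Longrightarrow> \<bar>\<gamma> x - \<gamma> y\<bar> \<le> L * norm (x - y)"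
    by (rule C1_locally_lipschitz[of 1 \<gamma> "proj_perp e p" r]) (use r(3) in \<open>auto simp: numeral_2_eq_2 simp del: Ck.simps\<close>)
  show ?thesis
  proof (rule that[of r e "1 / (1 + L)"])
    fix x y assume x: "x \<in> frontier D \<inter> ball p r" and y: "y \<in> frontier D \<inter> ball p r"
    have in_cb: "proj_perp e z \<in> cball (proj_perp e p) r" if "z \<in> ball p r" for z
      using proj_perp_norm_le[OF r(2), of "p - z"] that by (simp add: dist_norm proj_perp_diff)
    have "\<bar>x \<bullet> e - y \<bullet> e\<bar> \<le> L * norm (proj_perp e x - proj_perp e y)"
      using L(2)[OF in_cb in_cb, of x y] graph x y by auto
    moreover have "norm (x - y) \<le> norm (proj_perp e (x - y)) + \<bar>(x - y) \<bullet> e\<bar>"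
    proof -
      have "x - y = proj_perp e (x - y) + ((x - y) \<bullet> e) *\<^sub>R e" by (simp add: proj_perp_def)
      then show ?thesis using norm_triangle_ineq[of "proj_perp e (x - y)" "((x - y) \<bullet> e) *\<^sub>R e"] r(2) by simp
    qed
    ultimately have "norm (x - y) \<le> (1 + L) * norm (proj_perp e (x - y))"
      by (simp add: proj_perp_diff inner_diff_left distrib_right)
    then show "1 / (1 + L) * norm (x - y) \<le> norm (proj_perp e (x - y))"
      using L(1) by (simp add: field_simps)
  qed (use r L in auto)
qed

text \<open>A volume count that turns exponent N into N - 1. Over each point stands a column, in
  direction e, of about 1/t disjoint balls of radius t = c s, whose total volume is of order
  t^(N-1). Different columns are disjoint because their projections along e are separated, and all
  of them lie in one fixed ball.\<close>

lemma packing_local: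
  fixes a :: "'i \<Rightarrow> 'a::euclidean_space"
  assumes e: "norm e = 1" and c: "0 < c" "c \<le> 1" and fin: "finite I"
    and s: "\<And>i. i \<in> I \<Longrightarrow> 0 < s i \<and> s i \<le> 1" and q: "\<And>i. i \<in> I \<Longrightarrow> a i \<in> ball q R"
    and R0: "R > 0"
    and sep: "\<And>i j. i \<in> I \<Longrightarrow> j \<in> I \<Longrightarrow> i \<noteq> j \<Longrightarrow> c * (s i + s j) \<le> norm (proj_perp e (a i - a j))"
  shows "(\<Sum>i\<in>I. s i ^ (DIM('a) - 1)) \<le> 2 * (R + 3) ^ DIM('a) / c ^ (DIM('a) - 1)"
proof (cases "I = {}")
  case True
  then show ?thesis using c R0 by simp
next
  case False
  let ?N = "DIM('a)"
  let ?w = "unit_ball_vol (real ?N)"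
  have w: "?w > 0" by simp
  have N: "?N = Suc (?N - 1)" using DIM_positive[where 'a='a] by simp
  note R = R0
  define t where "t = (\<lambda>i. c * s i)"
  have t: "0 < t i" "t i \<le> 1" if "i \<in> I" for i
    using s[OF that] c mult_mono[of c 1 "s i" 1] by (auto simp: t_def)
  \<comment> \<open>The height of a column. Since t is at most 1, rounding down keeps K t between
    1/2 and 1; the 1/2 is the factor 2 of the final bound.\<close>
  define K where "K = (\<lambda>i. nat \<lfloor>1 / t i\<rfloor>)"
  have K: "real (K i) * t i \<le> 1" "1 \<le> 2 * (real (K i) * t i)" if "i \<in> I" for i
  proof -
    have p: "1 / t i \<ge> 1" using t[OF that] by simp
    then have "0 \<le> \<lfloor>1 / t i\<rfloor>" by linarith
    then have f: "real (K i) = of_int \<lfloor>1 / t i\<rfloor>" unfolding K_def by (rule of_nat_nat)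
    have "real (K i) \<le> 1 / t i" unfolding f by linarith
    then show "real (K i) * t i \<le> 1" using t[OF that] by (simp add: field_simps)
    have "1 \<le> \<lfloor>1 / t i\<rfloor>" using p by (simp only: le_floor_iff of_int_1)
    then have "(1::real) \<le> of_int \<lfloor>1 / t i\<rfloor>" by linarith
    moreover have "1 / t i < of_int \<lfloor>1 / t i\<rfloor> + 1" using floor_correct[of "1 / t i"] by simp
    ultimately have "1 / t i \<le> 2 * real (K i)" unfolding f by linarith
    then show "1 \<le> 2 * (real (K i) * t i)" using t[OF that] by (simp add: field_simps)
  qed
  define J where "J = Sigma I (\<lambda>i. {..<K i})"
  define B where "B = (\<lambda>(i, k). ball (a i + (2 * t i * real k) *\<^sub>R e) (t i))"
  have fJ: "finite J" using fin by (simp add: J_def)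
  have disj: "disjoint_family_on B J"
    unfolding disjoint_family_on_def
  proof (intro ballI impI)
    fix x y assume xy: "x \<in> J" "y \<in> J" "x \<noteq> y"
    obtain i k where x: "x = (i, k)" "i \<in> I" using xy(1) unfolding J_def by auto
    obtain j l where y: "y = (j, l)" "j \<in> I" using xy(2) unfolding J_def by auto
    have "t i + t j \<le> dist (a i + (2 * t i * real k) *\<^sub>R e) (a j + (2 * t j * real l) *\<^sub>R e)"
    proof (cases "i = j")
      case True
      then have "k \<noteq> l" using xy(3) x y by auto
      then have kl: "1 \<le> \<bar>real k - real l\<bar>" by (simp add: abs_if)
      have "dist (a i + (2 * t i * real k) *\<^sub>R e) (a j + (2 * t j * real l) *\<^sub>R e) = 2 * t i * \<bar>real k - real l\<bar>"
        using True e t[OF x(2)] by (simp add: dist_norm scaleR_diff_left[symmetric] right_diff_distrib[symmetric] abs_mult)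
      also have "\<dots> \<ge> 2 * t i * 1" using kl t[OF x(2)] by (intro mult_left_mono) auto
      finally show ?thesis using True by simp
    next
      case False
      have "t i + t j \<le> norm (proj_perp e (a i - a j))"
        using sep[OF x(2) y(2) False] by (simp add: t_def distrib_left)
      also have "\<dots> = norm (proj_perp e ((a i + (2 * t i * real k) *\<^sub>R e) - (a j + (2 * t j * real l) *\<^sub>R e)))"
        unfolding proj_perp_diff proj_perp_add_scale[OF e] ..
      also have "\<dots> \<le> dist (a i + (2 * t i * real k) *\<^sub>R e) (a j + (2 * t j * real l) *\<^sub>R e)"
        unfolding dist_norm by (rule proj_perp_norm_le[OF e])
      finally show ?thesis .
    qed
    then show "B x \<inter> B y = {}" unfolding x y B_def prod.case by (rule disjoint_ballI)
  qed
  \<comment> \<open>The radius R + 3 consists of R for the base point, 2 for the height 2 k t of a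
    centre in its column, and 1 for the ball.\<close>
  have sub: "(\<Union>x\<in>J. B x) \<subseteq> ball q (R + 3)"
  proof (intro UN_least)
    fix x assume "x \<in> J"
    then obtain i k where x: "x = (i, k)" "i \<in> I" "k < K i" unfolding J_def by auto
    have "real k * t i \<le> real (K i) * t i" using x(3) t[OF x(2)] by (intro mult_right_mono) auto
    then have "real k * t i \<le> 1" using K(1)[OF x(2)] by linarith
    then have "norm ((2 * t i * real k) *\<^sub>R e) \<le> 2"
      using e t[OF x(2)] by (simp add: abs_mult mult.commute)
    then have "dist q (a i + (2 * t i * real k) *\<^sub>R e) < R + 2"
      using q[OF x(2)] dist_triangle[of q "a i + (2 * t i * real k) *\<^sub>R e" "a i"] by (auto simp: dist_norm)
    then show "B x \<subseteq> ball q (R + 3)"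
      unfolding x B_def prod.case using t(2)[OF x(2)]
      by (auto intro: le_less_trans[OF dist_triangle])
        (smt (verit) dist_triangle)
  qed
  have lm: "B x \<in> lmeasurable" for x by (cases x) (auto simp: B_def)
  have "(\<Sum>x\<in>J. measure lebesgue (B x)) = measure lebesgue (\<Union>x\<in>J. B x)"
  proof (rule measure_finite_Union[symmetric, OF fJ _ disj])
    show "B ` J \<subseteq> sets lebesgue" using lm by (blast intro: fmeasurableD)
    show "emeasure lebesgue (B x) \<noteq> \<infinity>" for x using fmeasurableD2[OF lm] unfolding infinity_ennreal_def .
  qed
  also have "\<dots> \<le> measure lebesgue (ball q (R + 3))"
    by (rule measure_mono_fmeasurable[OF sub]) (use fJ lm in \<open>auto intro: fmeasurableD\<close>)
  also have "\<dots> = ?w * (R + 3) ^ ?N" using R by (simp add: content_ball)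
  finally have "(\<Sum>x\<in>J. measure lebesgue (B x)) \<le> ?w * (R + 3) ^ ?N" .
  moreover have "(\<Sum>x\<in>J. measure lebesgue (B x)) = (\<Sum>i\<in>I. real (K i) * (?w * t i ^ ?N))"
  proof -
    have "(\<Sum>x\<in>J. measure lebesgue (B x)) = (\<Sum>i\<in>I. \<Sum>k<K i. measure lebesgue (B (i, k)))"
      unfolding J_def by (subst sum.Sigma) (use fin in \<open>auto simp: case_prod_beta\<close>)
    also have "\<dots> = (\<Sum>i\<in>I. real (K i) * (?w * t i ^ ?N))"
      using t by (intro sum.cong refl) (auto simp: B_def content_ball less_imp_le)
    finally show ?thesis .
  qed
  ultimately have le: "(\<Sum>i\<in>I. real (K i) * (?w * t i ^ ?N)) \<le> ?w * (R + 3) ^ ?N" by simp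
  have "(\<Sum>i\<in>I. ?w * c ^ (?N - 1) * s i ^ (?N - 1)) \<le> (\<Sum>i\<in>I. 2 * (real (K i) * (?w * t i ^ ?N)))"
  proof (rule sum_mono)
    fix i assume i: "i \<in> I"
    have "?w * c ^ (?N - 1) * s i ^ (?N - 1) = 1 * (?w * t i ^ (?N - 1))"
      by (simp add: t_def power_mult_distrib)
    also have "\<dots> \<le> (2 * (real (K i) * t i)) * (?w * t i ^ (?N - 1))"
      using K(2)[OF i] t[OF i] w by (intro mult_right_mono) auto
    also have "\<dots> = 2 * (real (K i) * (?w * t i ^ ?N))"
    proof -
      have "t i ^ ?N = t i * t i ^ (?N - 1)" using N by (metis power_Suc)
      then show ?thesis by (simp only: mult_ac)
    qed
    finally show "?w * c ^ (?N - 1) * s i ^ (?N - 1) \<le> 2 * (real (K i) * (?w * t i ^ ?N))" .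
  qed
  also have "\<dots> \<le> 2 * (?w * (R + 3) ^ ?N)" unfolding sum_distrib_left[symmetric] using le by simp
  finally have "?w * (c ^ (?N - 1) * (\<Sum>i\<in>I. s i ^ (?N - 1))) \<le> ?w * (2 * (R + 3) ^ ?N)"
    by (simp add: sum_distrib_left mult_ac)
  then have "c ^ (?N - 1) * (\<Sum>i\<in>I. s i ^ (?N - 1)) \<le> 2 * (R + 3) ^ ?N"
    using w by (simp only: mult_le_cancel_left_pos)
  then show ?thesis using c by (simp add: pos_le_divide_eq mult.commute)
qed

lemma sum_UN_le:
  fixes f :: "'a \<Rightarrow> real"
  assumes "finite F" "\<And>p. p \<in> F \<Longrightarrow> finite (A p)" "\<And>p x. p \<in> F \<Longrightarrow> x \<in> A p \<Longrightarrow> 0 \<le> f x"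
  shows "sum f (\<Union>p\<in>F. A p) \<le> (\<Sum>p\<in>F. sum f (A p))"
  using assms
proof (induction F rule: finite_induct)
  case (insert p F)
  have "sum f (A p \<union> (\<Union>p\<in>F. A p)) + sum f (A p \<inter> (\<Union>p\<in>F. A p)) = sum f (A p) + sum f (\<Union>p\<in>F. A p)"
    using insert by (intro sum.union_inter) auto
  moreover have "0 \<le> sum f (A p \<inter> (\<Union>p\<in>F. A p))" using insert by (intro sum_nonneg) auto
  moreover have "sum f (\<Union>p\<in>F. A p) \<le> (\<Sum>p\<in>F. sum f (A p))" using insert by (intro insert.IH) auto
  ultimately show ?case using insert(1,2) by simp
qed simp

text \<open>If the centres were closer, the point dividing their segment in the ratio r : s would
  lie in both balls.\<close>

lemma disjnt_cball_dist:
  fixes x y :: "'a::real_normed_vector"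
  assumes "disjnt (cball x r) (cball y s)" "r > 0" "s > 0"
  shows "r + s \<le> dist x y"
proof (rule ccontr)
  assume "\<not> r + s \<le> dist x y"
  then have d: "norm (y - x) < r + s" by (simp add: dist_norm norm_minus_commute)
  define z where "z = x + (r / (r + s)) *\<^sub>R (y - x)"
  have "dist x z = r * (norm (y - x) / (r + s))" using assms by (simp add: z_def dist_norm)
  also have "\<dots> \<le> r * 1" using d assms by (intro mult_left_mono) auto
  finally have "z \<in> cball x r" by simp
  have "y - z = (s / (r + s)) *\<^sub>R (y - x)"
  proof -
    have "1 - r / (r + s) = s / (r + s)" using assms by (simp add: field_simps)
    moreover have "y - z = (1 - r / (r + s)) *\<^sub>R (y - x)" by (simp add: z_def algebra_simps)
    ultimately show ?thesis by simp
  qed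
  then have "dist y z = s * (norm (y - x) / (r + s))" using assms by (simp add: dist_norm)
  also have "\<dots> \<le> s * 1" using d assms by (intro mult_left_mono) auto
  finally have "z \<in> cball y s" by simp
  with \<open>z \<in> cball x r\<close> assms(1) show False by (auto simp: disjnt_def)
qed

text \<open>Stands in for the finiteness of the surface measure of the boundary. Compactness reduces
  it to finitely many graph patches, on each of which disjoint balls give the separation of
  projections that \<open>packing_local\<close> asks for.\<close>

lemma C2_domain_packing:
  fixes D :: "'a::euclidean_space set"
  assumes D: "C2_domain D" "bounded D"
  obtains C where "C \<ge> 0"
    "\<And>I s. \<lbrakk>finite I; I \<subseteq> frontier D; \<And>x. x \<in> I \<Longrightarrow> 0 < s x \<and> s x \<le> (1::real);
        pairwise (\<lambda>x y. disjnt (cball x (s x)) (cball y (s y))) I\<rbrakk> \<Longrightarrow> (\<Sum>x\<in>I. s x ^ (DIM('a) - 1)) \<le> C"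
proof -
  have cpt: "compact (frontier D)" using D(2) by (rule compact_frontier_bounded)
  define good where "good = (\<lambda>p R e c. R > 0 \<and> norm (e::'a) = 1 \<and> 0 < c \<and> c \<le> 1 \<and>
    (\<forall>x\<in>frontier D \<inter> ball p R. \<forall>y\<in>frontier D \<inter> ball p R. c * norm (x - y) \<le> norm (proj_perp e (x - y))))"
  have "\<exists>R e c. good p R e c" if "p \<in> frontier D" for p
    by (rule C2_domain_frontier_lipschitz[OF D(1) that]) (unfold good_def, blast)
  then obtain R e c where g: "\<And>p. p \<in> frontier D \<Longrightarrow> good p (R p) (e p) (c p)" by metis
  have "frontier D \<subseteq> (\<Union>p\<in>frontier D. ball p (R p))"
    using g unfolding good_def by force
  then obtain F where F: "F \<subseteq> frontier D" "finite F" "frontier D \<subseteq> (\<Union>p\<in>F. ball p (R p))"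
    using compactE_image[OF cpt, of "frontier D" "\<lambda>p. ball p (R p)"] by auto
  define C where "C = (\<Sum>p\<in>F. 2 * (R p + 3) ^ DIM('a) / c p ^ (DIM('a) - 1))"
  have C0: "C \<ge> 0"
    unfolding C_def
  proof (rule sum_nonneg)
    fix p assume "p \<in> F"
    then have "R p > 0" "c p > 0" using F(1) g[of p] unfolding good_def by auto
    then show "0 \<le> 2 * (R p + 3) ^ DIM('a) / c p ^ (DIM('a) - 1)" by simp
  qed
  show ?thesis
  proof (rule that[OF C0])
    fix I s assume I: "finite I" "I \<subseteq> frontier D" "\<And>x. x \<in> I \<Longrightarrow> 0 < s x \<and> s x \<le> (1::real)"
      "pairwise (\<lambda>x y. disjnt (cball x (s x)) (cball y (s y))) I"
    have "(\<Sum>x\<in>I. s x ^ (DIM('a) - 1)) \<le> (\<Sum>x\<in>(\<Union>p\<in>F. I \<inter> ball p (R p)). s x ^ (DIM('a) - 1))"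
      using I F by (intro sum_mono2) (auto simp: less_imp_le)
    also have "\<dots> \<le> (\<Sum>p\<in>F. \<Sum>x\<in>I \<inter> ball p (R p). s x ^ (DIM('a) - 1))"
      using I F(2) by (intro sum_UN_le) (auto simp: less_imp_le)
    also have "\<dots> \<le> C"
      unfolding C_def
    proof (rule sum_mono)
      fix p assume p: "p \<in> F"
      have gp: "good p (R p) (e p) (c p)" using g F(1) p by blast
      show "(\<Sum>x\<in>I \<inter> ball p (R p). s x ^ (DIM('a) - 1)) \<le> 2 * (R p + 3) ^ DIM('a) / c p ^ (DIM('a) - 1)"
      proof (rule packing_local[of "e p" "c p" "I \<inter> ball p (R p)" s "\<lambda>x. x" p "R p"])
        fix x y assume xy: "x \<in> I \<inter> ball p (R p)" "y \<in> I \<inter> ball p (R p)" "x \<noteq> y"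
        have "disjnt (cball x (s x)) (cball y (s y))" using I(4) xy by (auto simp: pairwise_def)
        then have "s x + s y \<le> dist x y"
          using I(3)[of x] I(3)[of y] xy by (intro disjnt_cball_dist) auto
        then have "c p * (s x + s y) \<le> c p * norm (x - y)"
          using gp unfolding good_def dist_norm by (intro mult_left_mono) auto
        also have "\<dots> \<le> norm (proj_perp (e p) (x - y))"
        proof -
          have "x \<in> frontier D \<inter> ball p (R p)" "y \<in> frontier D \<inter> ball p (R p)" using xy I(2) by auto
          then show ?thesis using gp unfolding good_def by blast
        qed
        finally show "c p * (s x + s y) \<le> norm (proj_perp (e p) (x - y))" .
      qed (use gp I in \<open>auto simp: good_def\<close>)
    qed
    finally show "(\<Sum>x\<in>I. s x ^ (DIM('a) - 1)) \<le> C" .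
  qed
qed

section \<open>Piecewise quadratic cutoffs of class C^1\<close>

lemma pos_square_deriv: "((\<lambda>t. (max 0 t)\<^sup>2) has_real_derivative 2 * max 0 t) (at (t::real))"
proof -
  consider "t > 0" | "t < 0" | "t = 0" by linarith
  then show ?thesis
  proof cases
    case 1
    have "((\<lambda>t. t\<^sup>2) has_real_derivative 2 * max 0 t) (at t)" using 1 by (auto intro!: derivative_eq_intros)
    then show ?thesis
      by (rule has_field_derivative_transform_within_open[of _ _ _ "{0<..}"]) (use 1 in auto)
  next
    case 2
    have "((\<lambda>t. 0) has_real_derivative 2 * max 0 t) (at t)" using 2 by simp
    then show ?thesis
      by (rule has_field_derivative_transform_within_open[of _ _ _ "{..<0}"]) (use 2 in auto)
  next
    case 3
    have "((\<lambda>h::real. (max 0 h)\<^sup>2 / h) \<longlongrightarrow> 0) (at 0)"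
    proof (rule Lim_null_comparison)
      show "\<forall>\<^sub>F h in at 0. norm ((max 0 h)\<^sup>2 / h) \<le> \<bar>h::real\<bar>"
        by (rule always_eventually) (auto simp: power2_eq_square max_def)
      show "((\<lambda>h::real. \<bar>h\<bar>) \<longlongrightarrow> 0) (at 0)" by (rule tendsto_rabs_zero) simp
    qed
    then show ?thesis unfolding 3 DERIV_def by simp
  qed
qed

text \<open>A C^1 step from 0 at 1 to 1 at 4, made of two parabolas that meet at 5/2, where the
  slope attains its maximum 2/3; the factor 2/9 normalises the final value. The knots 1 and 4 are
  the squares of 1 and 2, because the argument will be a squared distance.\<close>

definition ramp :: "real \<Rightarrow> real" where
  "ramp t = (2 / 9) * ((max 0 (t - 1))\<^sup>2 - 2 * (max 0 (t - 5 / 2))\<^sup>2 + (max 0 (t - 4))\<^sup>2)"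

definition ramp' :: "real \<Rightarrow> real" where
  "ramp' t = (4 / 9) * (max 0 (t - 1) - 2 * max 0 (t - 5 / 2) + max 0 (t - 4))"

lemma ramp_deriv: "(ramp has_real_derivative ramp' t) (at t)"
  unfolding ramp_def[abs_def] ramp'_def
  by (rule derivative_eq_intros DERIV_chain2[OF pos_square_deriv] refl)+ simp

lemma ramp'_cont: "continuous_on UNIV ramp'"
  unfolding ramp'_def[abs_def] by (intro continuous_intros)

lemma ramp'_bounds: "0 \<le> ramp' t" "ramp' t \<le> 2 / 3" "t \<le> 1 \<Longrightarrow> ramp' t = 0" "4 \<le> t \<Longrightarrow> ramp' t = 0"
  by (auto simp: ramp'_def max_def)

lemma ramp_zero: "t \<le> 1 \<Longrightarrow> ramp t = 0"
  by (simp add: ramp_def max_def)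

lemma ramp_one: "4 \<le> t \<Longrightarrow> ramp t = 1"
  by (simp add: ramp_def max_def power2_eq_square algebra_simps)

lemma ramp_mono: "s \<le> t \<Longrightarrow> ramp s \<le> ramp t"
  by (rule DERIV_nonneg_imp_nondecreasing) (use ramp_deriv ramp'_bounds in blast)+

lemma ramp_bounds: "0 \<le> ramp t" "ramp t \<le> 1"
  using ramp_mono[of "min t 1" t] ramp_mono[of t "max t 4"] ramp_zero[of "min t 1"] ramp_one[of "max t 4"] by auto

text \<open>Vanishes up to distance r from y and equals 1 from distance 2 r on. The squared distance
  keeps it differentiable at y as well.\<close>

definition cut :: "'a::real_inner \<Rightarrow> real \<Rightarrow> 'a \<Rightarrow> real" where
  "cut y r x = ramp (((x - y) \<bullet> (x - y)) / r\<^sup>2)"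

definition cut' :: "'a::real_inner \<Rightarrow> real \<Rightarrow> 'a \<Rightarrow> 'a \<Rightarrow> real" where
  "cut' y r x v = ramp' (((x - y) \<bullet> (x - y)) / r\<^sup>2) * (2 * ((x - y) \<bullet> v) / r\<^sup>2)"

lemma cut_deriv: "(cut y r has_derivative cut' y r x) (at x)"
proof -
  have "((\<lambda>x. ((x - y) \<bullet> (x - y)) / r\<^sup>2) has_derivative (\<lambda>v. 2 * ((x - y) \<bullet> v) / r\<^sup>2)) (at x)"
    unfolding divide_inverse
    by (rule has_derivative_eq_rhs, (rule derivative_intros)+) (auto simp: inner_commute)
  from has_derivative_compose[OF this ramp_deriv[unfolded has_field_derivative_def]]
  show ?thesis unfolding cut_def[abs_def] cut'_def[abs_def] .
qed

lemma cut'_cont: "continuous_on S (\<lambda>x. cut' y r x v)"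
  unfolding cut'_def divide_inverse
  by (intro continuous_intros continuous_on_compose2[OF ramp'_cont]) auto

lemma cut_bounds: "0 \<le> cut y r x" "cut y r x \<le> 1"
  by (simp_all add: cut_def ramp_bounds)

lemma cut_zero: "r > 0 \<Longrightarrow> dist y x \<le> r \<Longrightarrow> cut y r x = 0"
  unfolding cut_def by (rule ramp_zero)
    (simp add: divide_le_eq dot_square_norm dist_norm norm_minus_commute power_mono)

lemma cut_one: "r > 0 \<Longrightarrow> 2 * r \<le> dist y x \<Longrightarrow> cut y r x = 1"
proof -
  assume r: "r > 0" "2 * r \<le> dist y x"
  then have "(2 * r)\<^sup>2 \<le> (norm (x - y))\<^sup>2" by (intro power_mono) (auto simp: dist_norm norm_minus_commute)
  then show "cut y r x = 1"
    unfolding cut_def using r by (intro ramp_one) (simp add: le_divide_eq dot_square_norm power_mult_distrib)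
qed

lemma cut'_bound:
  assumes "r > 0"
  shows "\<bar>cut' y r x v\<bar> \<le> (3 / r * indicator (ball y (2 * r)) x) * norm v"
proof (cases "dist y x < 2 * r")
  case True
  have "\<bar>(x - y) \<bullet> v\<bar> \<le> 2 * r * norm v"
    using Cauchy_Schwarz_ineq2[of "x - y" v] True
    by (intro order_trans[OF Cauchy_Schwarz_ineq2] mult_right_mono) (auto simp: dist_norm norm_minus_commute)
  then have "2 * \<bar>(x - y) \<bullet> v\<bar> / r\<^sup>2 \<le> 2 * (2 * r * norm v) / r\<^sup>2"
    by (intro divide_right_mono) auto
  \<comment> \<open>The slope 2/3 of \<open>ramp\<close> times the factor 4/r from the inner
    derivative is 8/3 over r, rounded up to 3 / r.\<close>
  then have "\<bar>cut' y r x v\<bar> \<le> 2 / 3 * (2 * (2 * r * norm v) / r\<^sup>2)"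
    unfolding cut'_def abs_mult using ramp'_bounds by (intro mult_mono) (auto simp: abs_divide abs_mult)
  also have "\<dots> = (8 / 3) / r * norm v" using assms by (simp add: power2_eq_square field_simps)
  also have "\<dots> \<le> 3 / r * norm v" using assms by (intro mult_right_mono divide_right_mono) auto
  finally show ?thesis using True by simp
next
  case False
  then have "(2 * r)\<^sup>2 \<le> (norm (x - y))\<^sup>2" using assms by (intro power_mono) (auto simp: dist_norm norm_minus_commute)
  then have "ramp' (((x - y) \<bullet> (x - y)) / r\<^sup>2) = 0"
    using assms by (intro ramp'_bounds(4)) (simp add: le_divide_eq dot_square_norm power_mult_distrib)
  then show ?thesis using assms by (simp add: cut'_def)
qed

text \<open>A zero denominator is harmless: a positive number over 0 is top, so a quotient below c
  forces the numerator to be 0.\<close>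

lemma ennreal_divide_less_imp:
  fixes a b c :: ennreal
  assumes "a / b < c" "b < top"
  shows "a \<le> c * b"
proof (cases "b = 0")
  case True
  have "a = 0"
  proof (rule ccontr)
    assume "a \<noteq> 0"
    then have "a / b = top" using True by (simp add: ennreal_divide_zero)
    then show False using assms by simp
  qed
  then show ?thesis by simp
next
  case False
  have "a = a / b * b" using False assms(2) by (simp add: ennreal_divide_times ennreal_divide_self)
  also have "\<dots> \<le> c * b" using assms(1) by (intro mult_right_mono) auto
  finally show ?thesis .
qed

text \<open>The mean over \<open>D \<inter> ball x r\<close> becomes a bound for the integral by
  estimating the volume of that set from above by the volume of the ball.\<close>

lemma approx_limit_zero_ball:
  fixes w :: "'a::euclidean_space \<Rightarrow> real"
  assumes "approx_limit D w x 0" "\<And>x. 0 \<le> w x" "\<eta> > 0"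
  obtains r1 where "r1 > 0" "\<And>r. 0 < r \<Longrightarrow> r < r1 \<Longrightarrow>
     (\<integral>\<^sup>+y. ennreal (indicator D y * w y) * indicator (ball x r) y \<partial>lebesgue) \<le> ennreal (\<eta> * (unit_ball_vol (real DIM('a)) * r ^ DIM('a)))"
proof -
  let ?b = "\<lambda>r. emeasure lebesgue (D \<inter> ball x r)"
  have "\<forall>\<^sub>F r in at_right 0. (\<integral>\<^sup>+y\<in>D \<inter> ball x r. ennreal \<bar>w y - 0\<bar> \<partial>lebesgue) / ?b r < ennreal \<eta>"
    using assms(1,3) unfolding approx_limit_def by (intro order_tendstoD(2)) auto
  then obtain r1 where r1: "r1 > 0" "\<And>r. 0 < r \<Longrightarrow> r < r1 \<Longrightarrow> (\<integral>\<^sup>+y\<in>D \<inter> ball x r. ennreal \<bar>w y - 0\<bar> \<partial>lebesgue) / ?b r < ennreal \<eta>"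
    unfolding eventually_at_right_field by auto
  show ?thesis
  proof (rule that[OF r1(1)])
    fix r assume r: "0 < r" "r < r1"
    have b: "?b r \<le> ennreal (unit_ball_vol (real DIM('a)) * r ^ DIM('a))"
      using emeasure_mono[of "D \<inter> ball x r" "ball x r" lebesgue] r by (simp add: emeasure_ball)
    have "(\<integral>\<^sup>+y. ennreal (indicator D y * w y) * indicator (ball x r) y \<partial>lebesgue) = (\<integral>\<^sup>+y\<in>D \<inter> ball x r. ennreal \<bar>w y - 0\<bar> \<partial>lebesgue)"
      by (rule nn_integral_cong) (use assms(2) in \<open>auto simp: indicator_def abs_of_nonneg\<close>)
    also have "\<dots> \<le> ennreal \<eta> * ?b r"
      using r1(2)[OF r] b by (intro ennreal_divide_less_imp) (auto simp: le_less_trans)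
    also have "\<dots> \<le> ennreal \<eta> * ennreal (unit_ball_vol (real DIM('a)) * r ^ DIM('a))"
      using b by (rule mult_left_mono) simp
    also have "\<dots> = ennreal (\<eta> * (unit_ball_vol (real DIM('a)) * r ^ DIM('a)))"
      using assms(3) by (simp add: ennreal_mult')
    finally show "(\<integral>\<^sup>+y. ennreal (indicator D y * w y) * indicator (ball x r) y \<partial>lebesgue)
        \<le> ennreal (\<eta> * (unit_ball_vol (real DIM('a)) * r ^ DIM('a)))" .
  qed
qed

text \<open>The covering sum is delivered through its finite partial sums with natural exponents,
  the form in which a finite subcover of the boundary consumes it.\<close>

lemma hausdorff_null_cover:
  fixes E :: "'a::euclidean_space set"
  assumes "hausdorff_measure ball (real DIM('a) - 1) E = 0" "\<delta> > 0" "\<epsilon> > 0"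
  obtains C :: "('a \<times> real) set" where "\<And>z \<rho>. (z, \<rho>) \<in> C \<Longrightarrow> 0 < \<rho> \<and> \<rho> \<le> \<delta>" "E \<subseteq> (\<Union>(z, \<rho>)\<in>C. ball z \<rho>)"
    "\<And>F. finite F \<Longrightarrow> F \<subseteq> C \<Longrightarrow> (\<Sum>(z, \<rho>)\<in>F. \<rho> ^ (DIM('a) - 1)) \<le> \<epsilon>"
proof -
  let ?s = "real DIM('a) - 1"
  have s: "?s = real (DIM('a) - 1)" using DIM_positive[where 'a='a] by (simp add: of_nat_diff)
  have "hausdorff_premeasure ball ?s \<delta> E \<le> hausdorff_measure ball ?s E"
    unfolding hausdorff_measure_def using assms(2) by (intro SUP_upper) auto
  then have "hausdorff_premeasure ball ?s \<delta> E < ennreal \<epsilon>" using assms(1,3) by simp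
  then obtain C where C: "\<forall>(z, \<rho>)\<in>C. 0 < \<rho> \<and> \<rho> \<le> \<delta>" "E \<subseteq> (\<Union>(z, \<rho>)\<in>C. ball z \<rho>)"
    "(\<Sum>\<^sub>\<infinity>(z, \<rho>)\<in>C. ennreal (\<rho> powr ?s)) < ennreal \<epsilon>"
    unfolding hausdorff_premeasure_def Inf_less_iff by auto
  show ?thesis
  proof (rule that[of C])
    fix F assume F: "finite F" "F \<subseteq> C"
    have "(\<Sum>(z, \<rho>)\<in>F. ennreal (\<rho> powr ?s)) \<le> (\<Sum>\<^sub>\<infinity>(z, \<rho>)\<in>C. ennreal (\<rho> powr ?s))"
      by (subst nonneg_infsum_complete) (use F in \<open>auto intro!: SUP_upper\<close>)
    then have "(\<Sum>x\<in>F. ennreal (snd x powr ?s)) < ennreal \<epsilon>" using C(3) by (simp add: case_prod_beta)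
    then have "ennreal (\<Sum>x\<in>F. snd x powr ?s) < ennreal \<epsilon>" by (simp add: sum_ennreal)
    then have "(\<Sum>x\<in>F. snd x powr ?s) \<le> \<epsilon>" by (simp add: ennreal_less_iff sum_nonneg)
    moreover have "(\<Sum>x\<in>F. snd x powr ?s) = (\<Sum>x\<in>F. snd x ^ (DIM('a) - 1))"
      unfolding s using C(1) F(2) by (intro sum.cong refl powr_realpow) fastforce
    ultimately show "(\<Sum>(z, \<rho>)\<in>F. \<rho> ^ (DIM('a) - 1)) \<le> \<epsilon>" by (simp add: case_prod_beta)
  qed (use C in auto)
qed

text \<open>The cutoff is a product over finitely many balls. Those covering the exceptional null set have small total
  perimeter, and on the others the mean of \<open>w\<close> is small compared with the radius, while the packing bound controls their number.\<close>

lemma boundary_cutoff: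
  fixes D :: "'a::euclidean_space set" and w :: "'a \<Rightarrow> real"
  assumes D: "C2_domain D" "bounded D"
    and meas: "(\<lambda>x. indicator D x * w x) \<in> borel_measurable lebesgue"
    and w0: "\<And>x. 0 \<le> w x" and wM: "AE x in lebesgue. x \<in> D \<longrightarrow> w x \<le> M"
    and tr: "hausdorff_measure ball (real DIM('a) - 1) {x\<in>frontier D. \<not> approx_limit D w x 0} = 0"
    and \<epsilon>: "\<epsilon> > 0"
  shows "\<exists>\<kappa> \<kappa>' K g. test_data D \<kappa> \<kappa>' K \<and> (\<forall>x. 0 \<le> \<kappa> x \<and> \<kappa> x \<le> 1) \<and>
    (\<forall>x\<in>D. \<epsilon> \<le> infdist x (frontier D) \<longrightarrow> \<kappa> x = 1) \<and> (\<forall>x v. \<bar>\<kappa>' x v\<bar> \<le> g x * norm v) \<and>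
    g \<in> borel_measurable lebesgue \<and> (\<forall>x. 0 \<le> g x) \<and> (\<exists>B. \<forall>x. g x \<le> B) \<and>
    (\<integral>\<^sup>+x. ennreal (indicator D x * w x * g x) \<partial>lebesgue) \<le> ennreal \<epsilon>"
proof -
  let ?N = "DIM('a)"
  let ?Fr = "frontier D"
  define \<omega> where "\<omega> = unit_ball_vol (real ?N)"
  have \<omega>: "\<omega> > 0" by (simp add: \<omega>_def)
  have oD: "open D" using D(1) by (simp add: C2_domain_def)
  have cpt: "compact ?Fr" using D(2) by (rule compact_frontier_bounded)
  have N: "?N = Suc (?N - 1)" using DIM_positive[where 'a='a] by simp
  obtain Cp where Cp: "Cp \<ge> 0" "\<And>I s. \<lbrakk>finite I; I \<subseteq> ?Fr; \<And>x. x \<in> I \<Longrightarrow> 0 < s x \<and> s x \<le> (1::real);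
        pairwise (\<lambda>x y. disjnt (cball x (s x)) (cball y (s y))) I\<rbrakk> \<Longrightarrow> (\<Sum>x\<in>I. s x ^ (?N - 1)) \<le> Cp"
    by (rule C2_domain_packing[OF D]) blast
  define M' where "M' = max M 0"
  define W where "W = (\<lambda>x. indicator D x * w x)"
  have W0: "W x \<ge> 0" for x using w0[of x] by (simp add: W_def)
  have WM: "AE x in lebesgue. W x \<le> M'"
    using wM by (rule eventually_mono) (auto simp: W_def M'_def indicator_def)
  \<comment> \<open>A1 and A2 collect the constants of the estimates over good and over exceptional
    balls, enlarged to be positive; \<eta> and the Hausdorff cover are calibrated by them so that
    each half contributes at most \<epsilon> / 2.\<close>
  define A1 where "A1 = \<omega> * 12 ^ ?N / 2 * (Cp + 1)"
  define A2 where "A2 = 3 * M' * \<omega> * 2 ^ ?N + 1"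
  have A1: "A1 > 0" using \<omega> Cp(1) by (simp add: A1_def)
  have A2: "A2 > 0" using \<omega> by (simp add: A2_def M'_def add_nonneg_pos)
  define \<eta> where "\<eta> = \<epsilon> / (2 * A1)"
  have \<eta>: "\<eta> > 0" using \<epsilon> A1 by (simp add: \<eta>_def)
  define G where "G = {x \<in> ?Fr. approx_limit D w x 0}"
  have "\<exists>r1>0. \<forall>r. 0 < r \<longrightarrow> r < r1 \<longrightarrow> (\<integral>\<^sup>+y. ennreal (W y) * indicator (ball x r) y \<partial>lebesgue) \<le> ennreal (\<eta> * (\<omega> * r ^ ?N))"
    if "x \<in> G" for x
  proof -
    have "approx_limit D w x 0" using that by (simp add: G_def)
    then show ?thesis
      using approx_limit_zero_ball[where D=D and w=w and x=x and \<eta>=\<eta>, OF _ w0 \<eta>] unfolding W_def \<omega>_def by metis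
  qed
  then obtain r1 where r1: "\<And>x. x \<in> G \<Longrightarrow> r1 x > 0" "\<And>x r. x \<in> G \<Longrightarrow> 0 < r \<Longrightarrow> r < r1 x \<Longrightarrow>
      (\<integral>\<^sup>+y. ennreal (W y) * indicator (ball x r) y \<partial>lebesgue) \<le> ennreal (\<eta> * (\<omega> * r ^ ?N))" by metis
  \<comment> \<open>Vitali's lemma enlarges s to 5 s, the open covering balls have radius 6 s, and
    the gradient of the cutoff reaches 12 s. So r1 / 24 keeps 12 s below \<open>r1 x\<close>,
    \<epsilon> / 18 keeps three covering radii within \<epsilon>, and 1 is the limit of the packing
    bound.\<close>
  define s where "s = (\<lambda>x. min 1 (min (\<epsilon> / 18) (r1 x / 24)))"
  have s: "0 < s x" "s x \<le> 1" "18 * s x \<le> \<epsilon>" "12 * s x < r1 x" if "x \<in> G" for x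
    using r1(1)[OF that] \<epsilon> unfolding s_def by (auto simp: min_def)
  obtain C1 where C1: "countable C1" "C1 \<subseteq> G" "pairwise (\<lambda>i j. disjnt (cball i (s i)) (cball j (s j))) C1"
     "G \<subseteq> (\<Union>i\<in>C1. cball i (5 * s i))"
    by (rule Vitali_covering_lemma_cballs[where S=G and K=G and a="\<lambda>x. x" and r=s and B=1])
      (use s in \<open>auto simp: less_imp_le\<close>)
  define Bd where "Bd = {x \<in> ?Fr. \<not> approx_limit D w x 0}"
  obtain C2 :: "('a \<times> real) set" where C2: "\<And>z \<rho>. (z, \<rho>) \<in> C2 \<Longrightarrow> 0 < \<rho> \<and> \<rho> \<le> \<epsilon> / 3" "Bd \<subseteq> (\<Union>(z, \<rho>)\<in>C2. ball z \<rho>)"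
    "\<And>F. finite F \<Longrightarrow> F \<subseteq> C2 \<Longrightarrow> (\<Sum>(z, \<rho>)\<in>F. \<rho> ^ (?N - 1)) \<le> \<epsilon> / (2 * A2)"
    by (rule hausdorff_null_cover[OF tr, of "\<epsilon> / 3" "\<epsilon> / (2 * A2)"]) (use \<epsilon> A2 Bd_def in auto)
  \<comment> \<open>The factor 6 instead of 5 makes open balls out of the closed ones of the
    covering lemma, as compactness requires.\<close>
  define P where "P = (\<lambda>x. (x, 6 * s x)) ` C1 \<union> C2"
  have Ppos: "0 < \<rho>" "3 * \<rho> \<le> \<epsilon>" if "(z, \<rho>) \<in> P" for z \<rho>
    using that s C1(2) C2(1)[of z \<rho>] unfolding P_def by auto
  have cover: "?Fr \<subseteq> (\<Union>i\<in>P. ball (fst i) (snd i))"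
  proof
    fix x assume x: "x \<in> ?Fr"
    show "x \<in> (\<Union>i\<in>P. ball (fst i) (snd i))"
    proof (cases "x \<in> G")
      case True
      then obtain i where i: "i \<in> C1" "x \<in> cball i (5 * s i)" using C1(4) by blast
      then have "x \<in> ball i (6 * s i)" using s(1)[of i] C1(2) by (auto intro: le_less_trans)
      then show ?thesis using i(1) unfolding P_def by force
    next
      case False
      then have "x \<in> Bd" using x by (simp add: G_def Bd_def)
      then show ?thesis using C2(2) unfolding P_def by force
    qed
  qed
  obtain F0 where F0: "F0 \<subseteq> P" "finite F0" "?Fr \<subseteq> (\<Union>i\<in>F0. ball (fst i) (snd i))"
    by (rule compactE_image[OF cpt _ cover]) auto
  \<comment> \<open>Only balls that meet the boundary are kept; otherwise the cutoff could differ
    from 1 far inside D.\<close>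
  define F where "F = {i \<in> F0. ?Fr \<inter> ball (fst i) (snd i) \<noteq> {}}"
  have F: "F \<subseteq> P" "finite F" "?Fr \<subseteq> (\<Union>i\<in>F. ball (fst i) (snd i))"
  proof -
    show "F \<subseteq> P" "finite F" using F0 unfolding F_def by auto
    show "?Fr \<subseteq> (\<Union>i\<in>F. ball (fst i) (snd i))"
    proof
      fix x assume x: "x \<in> ?Fr"
      then obtain i where i: "i \<in> F0" "x \<in> ball (fst i) (snd i)" using F0(3) by blast
      then have "i \<in> F" unfolding F_def using x by blast
      then show "x \<in> (\<Union>i\<in>F. ball (fst i) (snd i))" using i(2) by blast
    qed
  qed
  have Fpos: "0 < snd i" "3 * snd i \<le> \<epsilon>" if "i \<in> F" for i
    using Ppos[of "fst i" "snd i"] that F(1) by auto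
  define F1 where "F1 = {x \<in> C1. (x, 6 * s x) \<in> F}"
  define F2 where "F2 = F \<inter> C2"
  have F1fin: "finite F1"
    by (rule finite_subset[of _ "fst ` F"]) (use F(2) in \<open>force simp: F1_def\<close>)+
  define b where "b = (\<lambda>i. (\<integral>\<^sup>+y. ennreal (W y) * indicator (ball (fst i) (2 * snd i)) y \<partial>lebesgue))"
  define g where "g = (\<lambda>x. \<Sum>i\<in>F. 3 / snd i * indicator (ball (fst i) (2 * snd i)) x)"
  have ballm[measurable]: "ball (y::'a) r \<in> sets lebesgue" for y r by simp
  have gm[measurable]: "g \<in> borel_measurable lebesgue"
    unfolding g_def by (intro borel_measurable_sum borel_measurable_times borel_measurable_const borel_measurable_indicator ballm)
  have Wm[measurable]: "W \<in> borel_measurable lebesgue" using meas by (simp add: W_def)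
  have g0: "g x \<ge> 0" for x unfolding g_def using Fpos by (intro sum_nonneg) (auto simp: less_imp_le)
  have gB: "g x \<le> (\<Sum>i\<in>F. 3 / snd i)" for x
    unfolding g_def using Fpos by (intro sum_mono) (auto simp: indicator_def less_imp_le)
  have "(\<integral>\<^sup>+x. ennreal (W x * g x) \<partial>lebesgue) = (\<integral>\<^sup>+x. (\<Sum>i\<in>F. ennreal (3 / snd i) * (ennreal (W x) * indicator (ball (fst i) (2 * snd i)) x)) \<partial>lebesgue)"
  proof (rule nn_integral_cong)
    fix x
    have "ennreal (W x * g x) = ennreal (\<Sum>i\<in>F. 3 / snd i * (W x * indicator (ball (fst i) (2 * snd i)) x))"
      unfolding g_def by (simp add: sum_distrib_left mult_ac)
    also have "\<dots> = (\<Sum>i\<in>F. ennreal (3 / snd i * (W x * indicator (ball (fst i) (2 * snd i)) x)))"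
      using Fpos W0 by (subst sum_ennreal) (auto simp: less_imp_le)
    also have "\<dots> = (\<Sum>i\<in>F. ennreal (3 / snd i) * (ennreal (W x) * indicator (ball (fst i) (2 * snd i)) x))"
    proof (intro sum.cong refl)
      fix i assume i: "i \<in> F"
      have "0 \<le> 3 / snd i" using Fpos(1)[OF i] by simp
      then have "ennreal (3 / snd i * (W x * indicator (ball (fst i) (2 * snd i)) x))
          = ennreal (3 / snd i) * ennreal (W x * indicator (ball (fst i) (2 * snd i)) x)"
        by (rule ennreal_mult')
      moreover have "ennreal (W x * indicator (ball (fst i) (2 * snd i)) x) = ennreal (W x) * indicator (ball (fst i) (2 * snd i)) x"
        by (cases "x \<in> ball (fst i) (2 * snd i)") simp_all
      ultimately show "ennreal (3 / snd i * (W x * indicator (ball (fst i) (2 * snd i)) x))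
          = ennreal (3 / snd i) * (ennreal (W x) * indicator (ball (fst i) (2 * snd i)) x)" by (simp only:)
    qed
    finally show "ennreal (W x * g x) = (\<Sum>i\<in>F. ennreal (3 / snd i) * (ennreal (W x) * indicator (ball (fst i) (2 * snd i)) x))" .
  qed
  also have "\<dots> = (\<Sum>i\<in>F. ennreal (3 / snd i) * b i)"
    unfolding b_def by (subst nn_integral_sum) (auto simp: nn_integral_cmult)
  also have "\<dots> \<le> (\<Sum>i\<in>(\<lambda>x. (x, 6 * s x)) ` F1 \<union> F2. ennreal (3 / snd i) * b i)"
    using F1fin F(1,2) by (intro sum_mono2) (auto simp: F1_def F2_def P_def)
  also have "\<dots> \<le> (\<Sum>i\<in>(\<lambda>x. (x, 6 * s x)) ` F1. ennreal (3 / snd i) * b i) + (\<Sum>i\<in>F2. ennreal (3 / snd i) * b i)"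
    by (subst sum.union_inter[symmetric]) (use F1fin F(2) in \<open>auto simp: F2_def\<close>)
  also have "\<dots> \<le> ennreal (\<epsilon> / 2) + ennreal (\<epsilon> / 2)"
  proof (rule add_mono)
    have inF1: "x \<in> G" if "x \<in> F1" for x using that C1(2) by (auto simp: F1_def)
    have "(\<Sum>i\<in>(\<lambda>x. (x, 6 * s x)) ` F1. ennreal (3 / snd i) * b i) = (\<Sum>x\<in>F1. ennreal (3 / (6 * s x)) * b (x, 6 * s x))"
      by (subst sum.reindex) (auto simp: inj_on_def)
    also have "\<dots> \<le> (\<Sum>x\<in>F1. ennreal (\<eta> * (\<omega> * 12 ^ ?N / 2) * s x ^ (?N - 1)))"
    proof (rule sum_mono)
      fix x assume x: "x \<in> F1"
      note sx = s[OF inF1[OF x]]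
      have "b (x, 6 * s x) \<le> ennreal (\<eta> * (\<omega> * (12 * s x) ^ ?N))"
        using r1(2)[OF inF1[OF x], of "12 * s x"] sx by (simp add: b_def)
      then have "ennreal (3 / (6 * s x)) * b (x, 6 * s x) \<le> ennreal (3 / (6 * s x)) * ennreal (\<eta> * (\<omega> * (12 * s x) ^ ?N))"
        by (rule mult_left_mono) simp
      also have "\<dots> = ennreal (3 / (6 * s x) * (\<eta> * (\<omega> * (12 * s x) ^ ?N)))"
        by (rule ennreal_mult'[symmetric]) (use sx in simp)
      also have "3 / (6 * s x) * (\<eta> * (\<omega> * (12 * s x) ^ ?N)) = \<eta> * (\<omega> * 12 ^ ?N / 2) * s x ^ (?N - 1)"
      proof -
        have "s x ^ ?N = s x * s x ^ (?N - 1)" using N by (metis power_Suc)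
        then have e: "(12 * s x) ^ ?N = 12 ^ ?N * (s x * s x ^ (?N - 1))" by (simp only: power_mult_distrib)
        show ?thesis unfolding e using sx(1) by (simp add: field_simps)
      qed
      finally show "ennreal (3 / (6 * s x)) * b (x, 6 * s x) \<le> ennreal (\<eta> * (\<omega> * 12 ^ ?N / 2) * s x ^ (?N - 1))" .
    qed
    also have "\<dots> = ennreal (\<eta> * (\<omega> * 12 ^ ?N / 2) * (\<Sum>x\<in>F1. s x ^ (?N - 1)))"
      unfolding sum_distrib_left using \<eta> \<omega> s(1)[OF inF1] by (intro sum_ennreal) (auto simp: less_imp_le)
    also have "\<dots> \<le> ennreal (\<epsilon> / 2)"
    proof (rule ennreal_leI)
      \<comment> \<open>The unenlarged balls selected by Vitali's lemma are disjoint, so the packing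
        bound controls this sum however many balls the cover contains.\<close>
      have "(\<Sum>x\<in>F1. s x ^ (?N - 1)) \<le> Cp"
      proof (rule Cp(2)[OF F1fin])
        show "F1 \<subseteq> ?Fr" using inF1 by (auto simp: G_def)
        show "pairwise (\<lambda>x y. disjnt (cball x (s x)) (cball y (s y))) F1"
          by (rule pairwise_subset[OF C1(3)]) (auto simp: F1_def)
      qed (use s inF1 in auto)
      then have "\<eta> * (\<omega> * 12 ^ ?N / 2) * (\<Sum>x\<in>F1. s x ^ (?N - 1)) \<le> \<eta> * (\<omega> * 12 ^ ?N / 2) * (Cp + 1)"
        using \<eta> \<omega> by (intro mult_left_mono) auto
      also have "\<dots> = \<eta> * A1" by (simp add: A1_def)
      also have "\<dots> = \<epsilon> / 2" using A1 by (simp add: \<eta>_def)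
      finally show "\<eta> * (\<omega> * 12 ^ ?N / 2) * (\<Sum>x\<in>F1. s x ^ (?N - 1)) \<le> \<epsilon> / 2" .
    qed
    finally show "(\<Sum>i\<in>(\<lambda>x. (x, 6 * s x)) ` F1. ennreal (3 / snd i) * b i) \<le> ennreal (\<epsilon> / 2)" .
    have F2pos: "snd i > 0" if "i \<in> F2" for i using Fpos that by (auto simp: F2_def)
    have M'0: "M' \<ge> 0" by (simp add: M'_def)
    \<comment> \<open>On the exceptional balls nothing but the bound \<open>M'\<close> for w is
      known; the smallness comes from the sum of the powers of the radii.\<close>
    have "(\<Sum>i\<in>F2. ennreal (3 / snd i) * b i) \<le> (\<Sum>i\<in>F2. ennreal (3 * M' * \<omega> * 2 ^ ?N * snd i ^ (?N - 1)))"
    proof (rule sum_mono)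
      fix i assume i: "i \<in> F2"
      note r = F2pos[OF i]
      have "b i \<le> (\<integral>\<^sup>+y. ennreal M' * indicator (ball (fst i) (2 * snd i)) y \<partial>lebesgue)"
        unfolding b_def using WM by (intro nn_integral_mono_AE) (auto elim!: eventually_mono simp: indicator_def intro: ennreal_leI)
      also have "\<dots> = ennreal M' * ennreal (\<omega> * (2 * snd i) ^ ?N)"
        using r by (simp add: nn_integral_cmult_indicator emeasure_ball \<omega>_def)
      also have "\<dots> = ennreal (M' * (\<omega> * (2 * snd i) ^ ?N))" using M'0 by (simp add: ennreal_mult')
      finally have "ennreal (3 / snd i) * b i \<le> ennreal (3 / snd i) * ennreal (M' * (\<omega> * (2 * snd i) ^ ?N))"
        by (rule mult_left_mono) simp
      also have "\<dots> = ennreal (3 / snd i * (M' * (\<omega> * (2 * snd i) ^ ?N)))"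
        by (rule ennreal_mult'[symmetric]) (use r in simp)
      also have "3 / snd i * (M' * (\<omega> * (2 * snd i) ^ ?N)) = 3 * M' * \<omega> * 2 ^ ?N * snd i ^ (?N - 1)"
      proof -
        have "snd i ^ ?N = snd i * snd i ^ (?N - 1)" using N by (metis power_Suc)
        then have e: "(2 * snd i) ^ ?N = 2 ^ ?N * (snd i * snd i ^ (?N - 1))" by (simp only: power_mult_distrib)
        show ?thesis unfolding e using r by (simp add: field_simps)
      qed
      finally show "ennreal (3 / snd i) * b i \<le> ennreal (3 * M' * \<omega> * 2 ^ ?N * snd i ^ (?N - 1))" .
    qed
    also have "\<dots> = ennreal (3 * M' * \<omega> * 2 ^ ?N * (\<Sum>i\<in>F2. snd i ^ (?N - 1)))"
      unfolding sum_distrib_left using M'0 \<omega> F2pos by (intro sum_ennreal) (auto simp: less_imp_le)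
    also have "\<dots> \<le> ennreal (\<epsilon> / 2)"
    proof (rule ennreal_leI)
      have "(\<Sum>i\<in>F2. snd i ^ (?N - 1)) \<le> \<epsilon> / (2 * A2)"
        using C2(3)[of F2] F(2) by (simp add: F2_def case_prod_beta)
      moreover have "0 \<le> (\<Sum>i\<in>F2. snd i ^ (?N - 1))" using F2pos by (intro sum_nonneg) (auto simp: less_imp_le)
      ultimately have "3 * M' * \<omega> * 2 ^ ?N * (\<Sum>i\<in>F2. snd i ^ (?N - 1)) \<le> A2 * (\<epsilon> / (2 * A2))"
        using A2 M'0 \<omega> by (intro mult_mono) (auto simp: A2_def)
      also have "\<dots> = \<epsilon> / 2" using A2 by simp
      finally show "3 * M' * \<omega> * 2 ^ ?N * (\<Sum>i\<in>F2. snd i ^ (?N - 1)) \<le> \<epsilon> / 2" .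
    qed
    finally show "(\<Sum>i\<in>F2. ennreal (3 / snd i) * b i) \<le> ennreal (\<epsilon> / 2)" .
  qed
  also have "\<dots> = ennreal \<epsilon>" using \<epsilon> by (subst ennreal_plus[symmetric]) auto
  finally have int: "(\<integral>\<^sup>+x. ennreal (indicator D x * w x * g x) \<partial>lebesgue) \<le> ennreal \<epsilon>" by (simp add: W_def)
  define U where "U = (\<Union>i\<in>F. ball (fst i) (snd i))"
  define K where "K = D - U"
  define \<kappa> where "\<kappa> = (\<lambda>x. if x \<in> D then (\<Prod>i\<in>F. cut (fst i) (snd i) x) else 0)"
  define \<kappa>' where "\<kappa>' = (\<lambda>x v. if x \<in> D then (\<Sum>i\<in>F. cut' (fst i) (snd i) x v * (\<Prod>j\<in>F - {i}. cut (fst j) (snd j) x)) else 0)"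
  have oU: "open U" by (auto simp: U_def)
  \<comment> \<open>U covers the boundary, so removing U from D or from its closure gives the same
    set, which is therefore compact.\<close>
  have "K = closure D - U" using F(3) oD unfolding K_def U_def frontier_def by (auto simp: interior_open closure_subset[THEN subsetD])
  then have Kc: "compact K"
    using D(2) oU by (simp add: compact_diff compact_closure)
  have oK: "open (- K)" using Kc by (simp add: compact_imp_closed open_Compl)
  have \<kappa>0: "\<kappa> x = 0" if "x \<notin> K" for x
  proof (cases "x \<in> D")
    case True
    then have "x \<in> U" using that by (simp add: K_def)
    then obtain i where i: "i \<in> F" "x \<in> ball (fst i) (snd i)" unfolding U_def by blast
    then have "cut (fst i) (snd i) x = 0" using Fpos by (intro cut_zero) auto
    then show ?thesis using i(1) F(2) by (auto simp: \<kappa>_def)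
  qed (simp add: \<kappa>_def)
  have der: "(\<kappa> has_derivative \<kappa>' x) (at x)" for x
  proof (cases "x \<in> D")
    case True
    have "((\<lambda>x. \<Prod>i\<in>F. cut (fst i) (snd i) x) has_derivative (\<lambda>v. \<Sum>i\<in>F. cut' (fst i) (snd i) x v * (\<Prod>j\<in>F - {i}. cut (fst j) (snd j) x))) (at x)"
      by (rule has_derivative_prod) (rule cut_deriv)
    then have "(\<kappa> has_derivative (\<lambda>v. \<Sum>i\<in>F. cut' (fst i) (snd i) x v * (\<Prod>j\<in>F - {i}. cut (fst j) (snd j) x))) (at x)"
      by (rule has_derivative_transform_within_open[OF _ oD True]) (simp add: \<kappa>_def)
    then show ?thesis using True by (simp add: \<kappa>'_def)
  next
    case False
    have "((\<lambda>x. 0) has_derivative (\<lambda>v. 0)) (at x)" by simp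
    then have "(\<kappa> has_derivative (\<lambda>v. 0)) (at x)"
      by (rule has_derivative_transform_within_open[OF _ oK]) (use False \<kappa>0 in \<open>auto simp: K_def\<close>)
    then show ?thesis using False by (simp add: \<kappa>'_def)
  qed
  have \<kappa>'0: "\<kappa>' x v = 0" if "x \<notin> K" for x v
    using derivative_zero_outside[OF der[of x] oK, where v=v] that \<kappa>0 by auto
  have cont: "continuous_on UNIV (\<lambda>x. \<kappa>' x v)" for v
  proof -
    have cc: "continuous_on S (cut y r)" for S y r
      using cut_deriv by (meson continuous_at_imp_continuous_on has_derivative_continuous)
    have "continuous_on D (\<lambda>x. \<Sum>i\<in>F. cut' (fst i) (snd i) x v * (\<Prod>j\<in>F - {i}. cut (fst j) (snd j) x))"
      by (intro continuous_intros cut'_cont cc)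
    then have 1: "continuous_on D (\<lambda>x. \<kappa>' x v)" by (rule continuous_on_eq) (simp add: \<kappa>'_def)
    have 2: "continuous_on (- K) (\<lambda>x. \<kappa>' x v)"
      by (rule continuous_on_eq[OF continuous_on_const[of _ 0]]) (simp add: \<kappa>'0)
    have "D \<union> - K = UNIV" by (auto simp: K_def)
    then show ?thesis using continuous_on_open_Un[OF oD oK 1 2] by simp
  qed
  have bound: "\<bar>\<kappa>' x v\<bar> \<le> g x * norm v" for x v
  proof (cases "x \<in> D")
    case True
    have "\<bar>\<kappa>' x v\<bar> \<le> (\<Sum>i\<in>F. \<bar>cut' (fst i) (snd i) x v * (\<Prod>j\<in>F - {i}. cut (fst j) (snd j) x)\<bar>)"
      using True by (simp add: \<kappa>'_def sum_abs)
    also have "\<dots> \<le> (\<Sum>i\<in>F. (3 / snd i * indicator (ball (fst i) (2 * snd i)) x) * norm v)"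
    proof (rule sum_mono)
      fix i assume i: "i \<in> F"
      have "0 \<le> (\<Prod>j\<in>F - {i}. cut (fst j) (snd j) x)" "(\<Prod>j\<in>F - {i}. cut (fst j) (snd j) x) \<le> 1"
        by (auto intro!: prod_nonneg prod_le_1 simp: cut_bounds)
      then have "\<bar>cut' (fst i) (snd i) x v * (\<Prod>j\<in>F - {i}. cut (fst j) (snd j) x)\<bar> \<le> \<bar>cut' (fst i) (snd i) x v\<bar> * 1"
        unfolding abs_mult by (intro mult_left_mono) auto
      also have "\<dots> \<le> (3 / snd i * indicator (ball (fst i) (2 * snd i)) x) * norm v"
        using cut'_bound[OF Fpos(1)[OF i], of "fst i" x v] by simp
      finally show "\<bar>cut' (fst i) (snd i) x v * (\<Prod>j\<in>F - {i}. cut (fst j) (snd j) x)\<bar> \<le> (3 / snd i * indicator (ball (fst i) (2 * snd i)) x) * norm v" .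
    qed
    finally show ?thesis by (simp add: g_def sum_distrib_right)
  qed (use g0 in \<open>simp add: \<kappa>'_def\<close>)
  have one: "\<kappa> x = 1" if x: "x \<in> D" "\<epsilon> \<le> infdist x ?Fr" for x
  proof -
    \<comment> \<open>The ball contains a boundary point z, and x is at least \<epsilon>, hence
      three radii, away from z; so x is at least two radii away from the centre.\<close>
    have "cut (fst i) (snd i) x = 1" if i: "i \<in> F" for i
    proof (rule cut_one[OF Fpos(1)[OF i]])
      obtain z where z: "z \<in> ?Fr" "dist (fst i) z < snd i" using i unfolding F_def by auto
      have "infdist x ?Fr \<le> dist x z" by (rule infdist_le[OF z(1)])
      then show "2 * snd i \<le> dist (fst i) x"
        using x(2) z(2) Fpos(2)[OF i] dist_triangle[of x z "fst i"] by (simp add: dist_commute)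
    qed
    then show ?thesis using x(1) by (simp add: \<kappa>_def)
  qed
  have rng: "0 \<le> \<kappa> x \<and> \<kappa> x \<le> 1" for x
    by (auto simp: \<kappa>_def cut_bounds intro!: prod_nonneg prod_le_1)
  have "test_data D \<kappa> \<kappa>' K"
    unfolding test_data_def using der cont Kc \<kappa>0 by (auto simp: K_def)
  then show ?thesis using rng one bound gm g0 gB int by blast
qed

section \<open>The regularised flux on a time slice\<close>

context
  fixes A :: "real^'m^'m"
  assumes A: "sym_pos_def A"
begin

text \<open>\<open>flux \<delta>\<close> is the gradient of \<open>aniso_reg A \<delta>\<close>, and
  \<open>flux_deriv \<delta> p\<close> is its Hessian at p acting on h.\<close>

definition flux :: "real \<Rightarrow> real^'m \<Rightarrow> real^'m" where
  "flux \<delta> p = (1 / aniso_reg A \<delta> p) *\<^sub>R (A *v p)"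

definition flux_deriv :: "real \<Rightarrow> real^'m \<Rightarrow> real^'m \<Rightarrow> real^'m" where
  "flux_deriv \<delta> p h = (1 / aniso_reg A \<delta> p) *\<^sub>R (A *v h) - ((h \<bullet> (A *v p)) / (aniso_reg A \<delta> p) ^ 3) *\<^sub>R (A *v p)"

lemma flux_bound:
  assumes "CARD('m) \<ge> 2" "\<delta> > 0"
  shows "norm (flux \<delta> p) \<le> sqrt (tr A)"
  using A_norm_bound[OF A assms(1), of p \<delta>] aniso_reg_pos[OF A assms(2), of p]
  by (simp add: flux_def divide_le_eq)

lemma A_mult_continuous:
  "continuous_on S f \<Longrightarrow> continuous_on S (\<lambda>x. A *v f x)"
  by (rule continuous_on_compose2[OF linear_continuous_on[OF matrix_vector_mul_bounded_linear]]) auto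

lemma aniso_reg_continuous_compose:
  assumes "continuous_on S f"
  shows "continuous_on S (\<lambda>x. aniso_reg A \<delta> (f x))"
  by (rule continuous_on_compose2[OF aniso_reg_continuous[OF A, of \<delta>] assms]) auto

lemma flux_continuous:
  assumes "\<delta> > 0" "continuous_on S f"
  shows "continuous_on S (\<lambda>x. flux \<delta> (f x))"
  unfolding flux_def using aniso_reg_pos[OF A assms(1)]
  by (intro continuous_intros A_mult_continuous aniso_reg_continuous_compose assms) (metis less_irrefl)

lemma flux_has_derivative:
  assumes d: "\<delta> > 0" and P: "(P has_derivative P') (at x)"
  shows "((\<lambda>x. flux \<delta> (P x)) has_derivative (\<lambda>h. flux_deriv \<delta> (P x) (P' h))) (at x)"
proof -
  note q0 = aniso_reg_pos[OF A d, of "P x"]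
  have AP: "((\<lambda>x. A *v P x) has_derivative (\<lambda>h. A *v P' h)) (at x)"
    by (rule bounded_linear.has_derivative[OF _ P]) simp
  have quad: "((\<lambda>x. \<delta>\<^sup>2 + P x \<bullet> (A *v P x)) has_derivative (\<lambda>h. 2 * (P' h \<bullet> (A *v P x)))) (at x)"
    by (rule has_derivative_eq_rhs[OF has_derivative_add[OF has_derivative_const has_derivative_inner[OF P AP]]])
      (use symmetric_inner[OF A_sym[OF A]] in auto)
  have pos: "0 < \<delta>\<^sup>2 + P x \<bullet> (A *v P x)" using q0 unfolding aniso_reg_def[OF A] by simp
  have sq: "(sqrt has_derivative (\<lambda>t. inverse (aniso_reg A \<delta> (P x)) / 2 * t)) (at (\<delta>\<^sup>2 + P x \<bullet> (A *v P x)))"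
    using DERIV_real_sqrt[OF pos] unfolding has_field_derivative_def aniso_reg_def[OF A] .
  have e: "inverse s / 2 * (2 * m) = m / s" for s m :: real by (simp add: inverse_eq_divide)
  have q: "((\<lambda>x. aniso_reg A \<delta> (P x)) has_derivative (\<lambda>h. (P' h \<bullet> (A *v P x)) / aniso_reg A \<delta> (P x))) (at x)"
    using has_derivative_compose[OF quad sq] unfolding e unfolding aniso_reg_def[OF A] .
  have qi: "((\<lambda>x. inverse (aniso_reg A \<delta> (P x))) has_derivative (\<lambda>h. - ((P' h \<bullet> (A *v P x)) / (aniso_reg A \<delta> (P x)) ^ 3))) (at x)"
  proof (rule has_derivative_eq_rhs[OF Deriv.has_derivative_inverse[OF _ q]])
    show "aniso_reg A \<delta> (P x) \<noteq> 0" using q0 by simp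
    have "- (inverse r * (m / r) * inverse r) = - (m / r ^ 3)" for r m :: real
      by (simp add: inverse_eq_divide power3_eq_cube)
    then show "(\<lambda>h. - (inverse (aniso_reg A \<delta> (P x)) * ((P' h \<bullet> (A *v P x)) / aniso_reg A \<delta> (P x)) * inverse (aniso_reg A \<delta> (P x))))
        = (\<lambda>h. - ((P' h \<bullet> (A *v P x)) / (aniso_reg A \<delta> (P x)) ^ 3))" by blast
  qed
  have "((\<lambda>x. inverse (aniso_reg A \<delta> (P x)) *\<^sub>R (A *v P x)) has_derivative (\<lambda>h. flux_deriv \<delta> (P x) (P' h))) (at x)"
    by (rule has_derivative_eq_rhs[OF has_derivative_scaleR[OF qi AP]]) (simp add: flux_deriv_def inverse_eq_divide)
  then show ?thesis by (simp add: flux_def inverse_eq_divide)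
qed

text \<open>The chain rule for the divergence of the composed flux, arranged as the pairing of the
  Hessian with a Jacobian matrix so that \<open>aniso_hessian_bound\<close> applies.\<close>

lemma flux_divergence:
  assumes "linear P'"
  shows "(\<Sum>i\<in>UNIV. flux_deriv \<delta> p (P' (axis i 1)) $ i) =
    ((1 / aniso_reg A \<delta> p) *\<^sub>R A - (1 / (aniso_reg A \<delta> p) ^ 3) *\<^sub>R outer (A *v p)) \<bullet> matrix P'"
proof -
  define q where "q = aniso_reg A \<delta> p"
  have symA: "A $ i $ k = A $ k $ i" for i k using A_sym[OF A] by (metis transpose_def vec_lambda_beta)
  have "flux_deriv \<delta> p (P' (axis i 1)) $ i = (\<Sum>k\<in>UNIV. (A $ k $ i / q - (A *v p) $ k * (A *v p) $ i / q ^ 3) * matrix P' $ k $ i)" for i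
  proof -
    have "flux_deriv \<delta> p (P' (axis i 1)) $ i = (\<Sum>k\<in>UNIV. A $ i $ k * P' (axis i 1) $ k) / q - (\<Sum>k\<in>UNIV. P' (axis i 1) $ k * (A *v p) $ k) / q ^ 3 * (A *v p) $ i"
      unfolding flux_deriv_def q_def[symmetric] by (simp add: inner_vec_def) (simp add: matrix_vector_mult_def)
    also have "\<dots> = (\<Sum>k\<in>UNIV. (A $ k $ i / q - (A *v p) $ k * (A *v p) $ i / q ^ 3) * matrix P' $ k $ i)"
      unfolding left_diff_distrib sum_subtractf sum_divide_distrib sum_distrib_right
      by (simp add: matrix_def symA[of i] mult_ac)
    finally show ?thesis .
  qed
  then have "(\<Sum>i\<in>UNIV. flux_deriv \<delta> p (P' (axis i 1)) $ i) =
      (\<Sum>i\<in>UNIV. \<Sum>k\<in>UNIV. (A $ k $ i / q - (A *v p) $ k * (A *v p) $ i / q ^ 3) * matrix P' $ k $ i)"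
    by simp
  also have "\<dots> = (\<Sum>k\<in>UNIV. \<Sum>i\<in>UNIV. (A $ k $ i / q - (A *v p) $ k * (A *v p) $ i / q ^ 3) * matrix P' $ k $ i)"
    by (rule sum.swap)
  also have "\<dots> = ((1 / q) *\<^sub>R A - (1 / q ^ 3) *\<^sub>R outer (A *v p)) \<bullet> matrix P'"
    by (simp add: inner_vec_def outer_def)
  finally show ?thesis by (simp add: q_def)
qed

text \<open>V is the weak gradient of W. Integration by parts is applied to the components of
  \<kappa> times the flux along P; on K the divergence of that flux is at least the curvature term
  because P has Jacobian at least \<mu>, and W and \<kappa> are nonnegative.\<close>

lemma weak_flux_C1:
  fixes W :: "real^'m \<Rightarrow> real" and V :: "real^'m \<Rightarrow> real^'m"
  assumes card: "CARD('m) \<ge> 2" and d: "\<delta> > 0"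
    and W: "integrable lebesgue W" "\<And>x. 0 \<le> W x" and V: "integrable lebesgue V"
    and parts: "\<And>i \<phi> \<phi>' K. test_data D \<phi> \<phi>' K \<Longrightarrow>
      (LINT x|lebesgue. W x * \<phi>' x (axis i 1)) = - (LINT x|lebesgue. V x $ i * \<phi> x)"
    and \<kappa>: "test_data D \<kappa> \<kappa>' K" "\<And>x. 0 \<le> \<kappa> x"
    and P: "\<And>x. (P has_derivative P' x) (at x)" "\<And>h. continuous_on UNIV (\<lambda>x. P' x h)"
    and \<mu>: "continuous_on UNIV \<mu>" "\<And>x. 0 \<le> \<mu> x" "\<And>x h. x \<in> K \<Longrightarrow> \<mu> x * (h \<bullet> h) \<le> h \<bullet> P' x h"
    and c: "\<And>p N \<mu>. \<lbrakk>\<mu> \<ge> 0; \<And>x. \<mu> * (x \<bullet> x) \<le> x \<bullet> (N *v x)\<rbrakk> \<Longrightarrow>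
       c * \<mu> / aniso_reg A \<delta> p \<le>
       ((1 / aniso_reg A \<delta> p) *\<^sub>R A - (1 / (aniso_reg A \<delta> p) ^ 3) *\<^sub>R outer (A *v p)) \<bullet> N"
  shows "(LINT x|lebesgue. \<kappa> x * (flux \<delta> (P x) \<bullet> V x)) + (LINT x|lebesgue. W x * \<kappa>' x (flux \<delta> (P x)))
     + (LINT x|lebesgue. W x * (\<kappa> x * (c * \<mu> x / aniso_reg A \<delta> (P x)))) \<le> 0"
proof -
  note kd = test_dataD[OF \<kappa>(1)]
  define z where "z = (\<lambda>x. flux \<delta> (P x))"
  define z' where "z' = (\<lambda>x h. flux_deriv \<delta> (P x) (P' x h))"
  have Pc: "continuous_on UNIV P"
    using P(1) by (meson continuous_at_imp_continuous_on has_derivative_continuous)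
  have zc: "continuous_on UNIV z" unfolding z_def by (rule flux_continuous[OF d Pc])
  have zd: "(z has_derivative z' x) (at x)" for x
    unfolding z_def z'_def by (rule flux_has_derivative[OF d P(1)])
  have qc: "continuous_on UNIV (\<lambda>x. aniso_reg A \<delta> (P x))" by (rule aniso_reg_continuous_compose[OF Pc])
  have q0: "aniso_reg A \<delta> p \<noteq> 0" for p using aniso_reg_pos[OF A d, of p] by simp
  have z'c: "continuous_on UNIV (\<lambda>x. z' x h)" for h
    unfolding z'_def flux_deriv_def
    by (intro continuous_intros A_mult_continuous Pc P(2) qc) (auto simp: q0)
  have compc: "continuous_on UNIV (\<lambda>x. f x $ i)" if "continuous_on UNIV f" for f :: "real^'m \<Rightarrow> real^'m" and i
    using that by (intro continuous_intros)
  obtain R where R: "\<And>x. x \<in> K \<Longrightarrow> norm x \<le> R"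
    using compact_imp_bounded[OF kd(4)] unfolding bounded_iff by blast
  have bdd: "\<exists>B. \<forall>x. \<bar>f x\<bar> \<le> B" if "continuous_on UNIV f" "\<And>x. x \<notin> K \<Longrightarrow> f x = 0" for f :: "real^'m \<Rightarrow> real"
  proof -
    have z: "f x = 0" if "norm x > R" for x using \<open>\<And>x. x \<notin> K \<Longrightarrow> f x = 0\<close> R[of x] that by force
    show ?thesis by (rule continuous_bounded_support_bound[OF that(1) z]) auto
  qed
  have Wint: "integrable lebesgue (\<lambda>x. W x * f x)" if f: "continuous_on UNIV f" "\<And>x. x \<notin> K \<Longrightarrow> f x = 0" for f
  proof -
    have "\<exists>B. \<forall>x. \<bar>f x\<bar> \<le> B" by (rule bdd[OF f])
    then obtain B where B: "\<And>x. \<bar>f x\<bar> \<le> B" by blast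
    show ?thesis by (rule integrable_times_bounded[OF W(1) continuous_measurable_lebesgue[OF f(1)] B])
  qed
  have Vi: "integrable lebesgue (\<lambda>x. V x $ i)" for i
    by (rule integrable_bounded_linear[OF bounded_linear_vec_nth V])
  have Vint: "integrable lebesgue (\<lambda>x. V x $ i * f x)" if f: "continuous_on UNIV f" "\<And>x. x \<notin> K \<Longrightarrow> f x = 0" for f i
  proof -
    have "\<exists>B. \<forall>x. \<bar>f x\<bar> \<le> B" by (rule bdd[OF f])
    then obtain B where B: "\<And>x. \<bar>f x\<bar> \<le> B" by blast
    show ?thesis by (rule integrable_times_bounded[OF Vi continuous_measurable_lebesgue[OF f(1)] B])
  qed
  have kz0: "\<kappa> x * t = 0" if "x \<notin> K" for x t using kd(6)[OF that] by simp
  have i1: "integrable lebesgue (\<lambda>x. W x * (\<kappa> x * z' x (axis i 1) $ i))" for i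
    by (rule Wint) (intro continuous_intros kd(3) compc z'c | rule kz0, assumption)+
  have i2: "integrable lebesgue (\<lambda>x. W x * (\<kappa>' x (axis i 1) * z x $ i))" for i
    by (rule Wint) (intro continuous_intros kd(2) compc zc | simp add: kd(7))+
  have i3: "integrable lebesgue (\<lambda>x. V x $ i * (\<kappa> x * z x $ i))" for i
    by (rule Vint) (intro continuous_intros kd(3) compc zc | rule kz0, assumption)+
  have step: "(LINT x|lebesgue. W x * (\<kappa> x * z' x (axis i 1) $ i)) + (LINT x|lebesgue. W x * (\<kappa>' x (axis i 1) * z x $ i))
      = - (LINT x|lebesgue. V x $ i * (\<kappa> x * z x $ i))" for i
  proof -
    have zi: "((\<lambda>x. z x $ i) has_derivative (\<lambda>h. z' x h $ i)) (at x)" for x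
      using bounded_linear.has_derivative[OF bounded_linear_vec_nth zd[of x], of i] by simp
    have "test_data D (\<lambda>x. \<kappa> x * z x $ i) (\<lambda>x h. \<kappa> x * z' x h $ i + \<kappa>' x h * z x $ i) K"
      unfolding test_data_def
    proof (intro conjI allI impI)
      show "((\<lambda>x. \<kappa> x * z x $ i) has_derivative (\<lambda>h. \<kappa> x * z' x h $ i + \<kappa>' x h * z x $ i)) (at x)" for x
        by (rule has_derivative_mult[OF kd(1) zi])
      show "continuous_on UNIV (\<lambda>x. \<kappa> x * z' x h $ i + \<kappa>' x h * z x $ i)" for h
        by (intro continuous_intros kd(2,3) compc z'c zc)
    qed (use kd in auto)
    from parts[OF this, of i] show ?thesis
      using Bochner_Integration.integral_add[OF i1[of i] i2[of i]] by (simp add: distrib_left)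
  qed
  have "(LINT x|lebesgue. W x * (\<kappa> x * (\<Sum>i\<in>UNIV. z' x (axis i 1) $ i))) + (LINT x|lebesgue. W x * \<kappa>' x (z x))
      = - (LINT x|lebesgue. \<kappa> x * (z x \<bullet> V x))"
  proof -
    have "(LINT x|lebesgue. W x * (\<kappa> x * (\<Sum>i\<in>UNIV. z' x (axis i 1) $ i))) = (\<Sum>i\<in>UNIV. LINT x|lebesgue. W x * (\<kappa> x * z' x (axis i 1) $ i))"
      unfolding sum_distrib_left by (rule Bochner_Integration.integral_sum[OF i1])
    moreover have "(LINT x|lebesgue. W x * \<kappa>' x (z x)) = (\<Sum>i\<in>UNIV. LINT x|lebesgue. W x * (\<kappa>' x (axis i 1) * z x $ i))"
    proof -
      have "\<kappa>' x (z x) = (\<Sum>i\<in>UNIV. \<kappa>' x (axis i 1) * z x $ i)" for x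
      proof -
        have "\<kappa>' x (z x) = \<kappa>' x (\<Sum>i\<in>UNIV. z x $ i *\<^sub>R axis i 1)"
          using basis_expansion[of "z x"] by (simp add: scalar_mult_eq_scaleR)
        also have "\<dots> = (\<Sum>i\<in>UNIV. \<kappa>' x (axis i 1) * z x $ i)"
          by (simp add: linear_sum[OF has_derivative_linear[OF kd(1)]] linear_scale[OF has_derivative_linear[OF kd(1)]] mult.commute)
        finally show ?thesis .
      qed
      then show ?thesis unfolding sum_distrib_left by (simp add: Bochner_Integration.integral_sum[OF i2] sum_distrib_left)
    qed
    moreover have "(LINT x|lebesgue. \<kappa> x * (z x \<bullet> V x)) = (\<Sum>i\<in>UNIV. LINT x|lebesgue. V x $ i * (\<kappa> x * z x $ i))"
    proof -
      have "\<kappa> x * (z x \<bullet> V x) = (\<Sum>i\<in>UNIV. V x $ i * (\<kappa> x * z x $ i))" for x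
        by (simp add: inner_vec_def sum_distrib_left mult_ac)
      then show ?thesis by (simp add: Bochner_Integration.integral_sum[OF i3])
    qed
    ultimately show ?thesis
      using step by (simp add: sum.distrib[symmetric] sum_negf)
  qed
  moreover have "(LINT x|lebesgue. W x * (\<kappa> x * (c * \<mu> x / aniso_reg A \<delta> (P x)))) \<le> (LINT x|lebesgue. W x * (\<kappa> x * (\<Sum>i\<in>UNIV. z' x (axis i 1) $ i)))"
  proof (rule integral_mono)
    show "integrable lebesgue (\<lambda>x. W x * (\<kappa> x * (c * \<mu> x / aniso_reg A \<delta> (P x))))"
      by (rule Wint) (intro continuous_intros kd(3) \<mu>(1) qc | simp add: q0 kz0)+
    show "integrable lebesgue (\<lambda>x. W x * (\<kappa> x * (\<Sum>i\<in>UNIV. z' x (axis i 1) $ i)))"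
      by (rule Wint) (intro continuous_intros kd(3) compc z'c | rule kz0, assumption)+
    fix x
    show "W x * (\<kappa> x * (c * \<mu> x / aniso_reg A \<delta> (P x))) \<le> W x * (\<kappa> x * (\<Sum>i\<in>UNIV. z' x (axis i 1) $ i))"
    proof (cases "x \<in> K")
      case True
      have lin: "linear (P' x)" using has_derivative_linear[OF P(1)] .
      have "c * \<mu> x / aniso_reg A \<delta> (P x) \<le> (\<Sum>i\<in>UNIV. z' x (axis i 1) $ i)"
        unfolding z'_def flux_divergence[OF lin]
        by (rule c) (use \<mu>(2,3) True lin in \<open>auto simp: matrix_works\<close>)
      then show ?thesis using W(2)[of x] \<kappa>(2)[of x] by (intro mult_left_mono)
    qed (simp add: kz0)
  qed
  ultimately show ?thesis unfolding z_def by simp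
qed

end

lemma dominated_everywhere:
  fixes f :: "'a \<Rightarrow> real"
  assumes "\<And>n. s n \<in> borel_measurable M" "\<And>x. x \<in> space M \<Longrightarrow> (\<lambda>n. s n x) \<longlonglongrightarrow> f x" "\<And>n x. \<bar>s n x\<bar> \<le> w x" "integrable M w"
  shows "integrable M f" "(\<lambda>n. integral\<^sup>L M (s n)) \<longlonglongrightarrow> integral\<^sup>L M f"
proof -
  have f: "f \<in> borel_measurable M" by (rule borel_measurable_LIMSEQ_real[OF assms(2,1)])
  show "integrable M f"
    by (rule integrable_dominated_convergence[where s=s and w=w, OF f assms(1,4)]) (use assms(2,3) in auto)
  show "(\<lambda>n. integral\<^sup>L M (s n)) \<longlonglongrightarrow> integral\<^sup>L M f"
    by (rule integral_dominated_convergence[where s=s and w=w, OF f assms(1,4)]) (use assms(2,3) in auto)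
qed

lemma linear_axis_expansion:
  fixes \<kappa>' :: "real^'m \<Rightarrow> real"
  assumes "linear \<kappa>'"
  shows "\<kappa>' z = (\<Sum>i\<in>UNIV. \<kappa>' (axis i 1) * z $ i)"
proof -
  have "\<kappa>' z = \<kappa>' (\<Sum>i\<in>UNIV. z $ i *\<^sub>R axis i 1)"
    using basis_expansion[of z] by (simp add: scalar_mult_eq_scaleR)
  also have "\<dots> = (\<Sum>i\<in>UNIV. \<kappa>' (axis i 1) * z $ i)"
    by (simp add: linear_sum[OF assms] linear_scale[OF assms] mult.commute)
  finally show ?thesis .
qed

text \<open>A mollification averages translates of p, so it inherits monotonicity, and a monotone
  differentiable field has a nonnegative symmetrised Jacobian. The radius e is split in halves, one
  for the mollifier and one for the step t h, because p is monotone on the ball only.\<close>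

lemma monotone_mollified:
  fixes p :: "real^'m \<Rightarrow> real^'m"
  assumes F: "\<And>i. integrable lebesgue (F i)" and \<rho>: "mollifier \<delta> \<rho>" "\<delta> \<le> e / 2" "e > 0"
    and Fp: "\<And>i y. y \<in> cball x e \<Longrightarrow> F i y = p y $ i"
    and mono: "\<And>a b. a \<in> cball x e \<Longrightarrow> b \<in> cball x e \<Longrightarrow> 0 \<le> (p a - p b) \<bullet> (a - b)"
    and D: "\<And>i. (conv (F i) \<rho> has_derivative D i) (at x)"
  shows "0 \<le> (\<Sum>i\<in>UNIV. h $ i * D i h)"
proof (cases "h = 0")
  case False
  note m = mollifier_props[OF \<rho>(1)]
  obtain C where C: "\<And>x. \<bar>\<rho> x\<bar> \<le> C" using m(7) by blast
  have int: "integrable lebesgue (\<lambda>y. \<rho> y * F i (z - y))" for i z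
    using integrable_times_bounded[OF lebesgue_affine_integral(1)[OF _ F[of i], of "-1" z] continuous_measurable_lebesgue[OF m(6)] C]
    by (simp add: mult.commute)
  have cv: "conv (F i) \<rho> z = (LINT y|lebesgue. \<rho> y * F i (z - y))" for i z
    using conv_commute[OF F m(6) C, of i z] by (simp add: conv_def)
  define f where "f = (\<lambda>t. \<Sum>i\<in>UNIV. h $ i * conv (F i) \<rho> (x + t *\<^sub>R h))"
  have "((\<lambda>t. conv (F i) \<rho> (x + t *\<^sub>R h)) has_derivative (\<lambda>s. D i (s *\<^sub>R h))) (at 0)" for i
    by (rule has_derivative_compose[of "\<lambda>t. x + t *\<^sub>R h" _ 0 UNIV "conv (F i) \<rho>" "D i", simplified])
      (auto intro!: derivative_eq_intros D)
  then have "((\<lambda>t. conv (F i) \<rho> (x + t *\<^sub>R h)) has_real_derivative D i h) (at 0)" for i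
    unfolding has_field_derivative_def
    by (simp add: linear_scale[OF has_derivative_linear[OF D]] mult_commute_abs)
  then have df: "(f has_real_derivative (\<Sum>i\<in>UNIV. h $ i * D i h)) (at 0)"
    unfolding f_def by (intro DERIV_sum DERIV_cmult)
  have mono_f: "f 0 \<le> f t" if t: "0 < t" "t * norm h \<le> e / 2" for t
  proof -
    have "f t - f 0 = (\<Sum>i\<in>UNIV. h $ i * (LINT y|lebesgue. \<rho> y * (F i (x + t *\<^sub>R h - y) - F i (x - y))))"
      unfolding f_def cv by (simp add: right_diff_distrib int sum_subtractf)
    also have "\<dots> = (LINT y|lebesgue. (\<Sum>i\<in>UNIV. h $ i * (\<rho> y * (F i (x + t *\<^sub>R h - y) - F i (x - y)))))"
      by (subst Bochner_Integration.integral_sum) (auto simp: right_diff_distrib int)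
    also have "\<dots> \<ge> 0"
    proof (rule integral_nonneg_AE, rule AE_I2)
      fix y
      show "0 \<le> (\<Sum>i\<in>UNIV. h $ i * (\<rho> y * (F i (x + t *\<^sub>R h - y) - F i (x - y))))"
      proof (cases "norm y < \<delta>")
        case True
        have y: "norm y \<le> e / 2" using True \<rho>(2) by simp
        have a: "x - y \<in> cball x e" using y \<rho>(3) by (simp add: dist_norm)
        have "norm (y - t *\<^sub>R h) \<le> norm y + norm (t *\<^sub>R h)" by (rule norm_triangle_ineq4)
        then have b: "x + t *\<^sub>R h - y \<in> cball x e" using y t by (simp add: dist_norm)
        have "0 \<le> (p (x + t *\<^sub>R h - y) - p (x - y)) \<bullet> (t *\<^sub>R h)" using mono[OF b a] by simp
        then have nn: "0 \<le> (p (x + t *\<^sub>R h - y) - p (x - y)) \<bullet> h" using t(1) by (simp add: zero_le_mult_iff)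
        have "(\<Sum>i\<in>UNIV. h $ i * (\<rho> y * (F i (x + t *\<^sub>R h - y) - F i (x - y)))) = \<rho> y * ((p (x + t *\<^sub>R h - y) - p (x - y)) \<bullet> h)"
          unfolding Fp[OF a] Fp[OF b] by (simp add: inner_vec_def sum_distrib_left mult_ac)
        then show ?thesis using nn m(2)[of y] by simp
      qed (use m(3) in \<open>simp add: not_less\<close>)
    qed
    finally show ?thesis by simp
  qed
  show ?thesis
  proof (rule ccontr)
    assume "\<not> ?thesis"
    then obtain d where d: "d > 0" "\<And>t. 0 < t \<Longrightarrow> t < d \<Longrightarrow> f (0 + t) < f 0"
      using DERIV_neg_dec_right[OF df] by auto
    define t where "t = min (d / 2) (e / (2 * norm h))"
    have "0 < t" "t < d" "t * norm h \<le> e / 2"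
      using d(1) \<rho>(3) False by (auto simp: t_def min_def field_simps)
    then show False using mono_f[of t] d(2)[of t] by simp
  qed
qed simp

context
  fixes A :: "real^'m^'m" and \<delta> c :: real
  assumes A: "sym_pos_def A" and card: "CARD('m) \<ge> 2" and d: "\<delta> > 0"
    and c0: "c > 0" and c: "\<And>p N \<mu>. \<lbrakk>\<mu> \<ge> 0; \<And>x. \<mu> * (x \<bullet> x) \<le> x \<bullet> (N *v x)\<rbrakk> \<Longrightarrow>
       c * \<mu> / aniso_reg A \<delta> p \<le>
       ((1 / aniso_reg A \<delta> p) *\<^sub>R A - (1 / (aniso_reg A \<delta> p) ^ 3) *\<^sub>R outer (A *v p)) \<bullet> N"
begin

lemma aniso_reg_ge: "\<delta> \<le> aniso_reg A \<delta> p"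
  unfolding aniso_reg_def[OF A] using d A_nonneg[OF A, of p] by (simp add: real_le_rsqrt)

text \<open>p will be a slice of the spatial gradient of \<psi>, Lipschitz but without a Jacobian at
  every point; Z is the smooth gradient of the added term. Only p is mollified, and its monotonicity
  leaves the whole lower bound \<mu> to Z. Monotonicity is assumed along segments inside D, since D
  may be nonconvex. With \<delta> fixed, the bounded flux and \<open>aniso_reg_ge\<close> dominate
  the limits.\<close>

lemma weak_flux_lipschitz:
  fixes W :: "real^'m \<Rightarrow> real" and V :: "real^'m \<Rightarrow> real^'m"
  assumes D: "open D"
    and W: "integrable lebesgue W" "\<And>x. 0 \<le> W x" and V: "integrable lebesgue V"
    and parts: "\<And>i \<phi> \<phi>' K. test_data D \<phi> \<phi>' K \<Longrightarrow>
      (LINT x|lebesgue. W x * \<phi>' x (axis i 1)) = - (LINT x|lebesgue. V x $ i * \<phi> x)"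
    and \<kappa>: "test_data D \<kappa> \<kappa>' K" "\<And>x. 0 \<le> \<kappa> x \<and> \<kappa> x \<le> 1"
    and p: "L-lipschitz_on D p" "p \<in> borel_measurable lebesgue"
      "\<And>x y. closed_segment x y \<subseteq> D \<Longrightarrow> 0 \<le> (p x - p y) \<bullet> (x - y)"
    and Z: "\<And>x. (Z has_derivative Z' x) (at x)" "\<And>h. continuous_on UNIV (\<lambda>x. Z' x h)"
    and \<mu>: "continuous_on UNIV \<mu>" "\<And>x. 0 \<le> \<mu> x" "\<And>x h. \<mu> x * (h \<bullet> h) \<le> h \<bullet> Z' x h"
  shows "(LINT x|lebesgue. \<kappa> x * (flux A \<delta> (p x + Z x) \<bullet> V x)) + (LINT x|lebesgue. W x * \<kappa>' x (flux A \<delta> (p x + Z x)))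
     + (LINT x|lebesgue. W x * (\<kappa> x * (c * \<mu> x / aniso_reg A \<delta> (p x + Z x)))) \<le> 0"
proof -
  note kd = test_dataD[OF \<kappa>(1)]
  obtain K' e where K': "compact K'" "K' \<subseteq> D" "e > 0" "\<And>x. x \<in> K \<Longrightarrow> cball x e \<subseteq> K'" "K \<subseteq> K'"
    using compact_neighbourhood[OF kd(4) D kd(5)] by metis
  obtain \<delta>n and \<rho> :: "nat \<Rightarrow> real^'m \<Rightarrow> real" where \<rho>: "\<And>n. mollifier (\<delta>n n) (\<rho> n)" "\<delta>n \<longlonglongrightarrow> 0" "\<And>n. 0 < \<delta>n n" "\<And>n. \<delta>n n \<le> e / 2"
    using mollifier_sequence[of "e / 2"] K'(3) half_gt_zero by metis
  define F where "F = (\<lambda>i x. indicator K' x * p x $ i)"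
  have cpK: "compact (p ` K')"
    using lipschitz_on_continuous_on[OF p(1)] K'(1,2) by (intro compact_continuous_image) (auto intro: continuous_on_subset)
  then obtain Bp where Bp: "\<And>x. x \<in> K' \<Longrightarrow> norm (p x) \<le> Bp"
    using compact_imp_bounded[OF cpK] unfolding bounded_iff by auto
  obtain RK where RK: "\<And>x. x \<in> K' \<Longrightarrow> norm x \<le> RK" using compact_imp_bounded[OF K'(1)] unfolding bounded_iff by blast
  have Fb: "\<bar>F i x\<bar> \<le> \<bar>Bp\<bar>" for i x
    using Bp[of x] component_le_norm_cart[of "p x" i] by (auto simp: F_def indicator_def)
  have Fm: "F i \<in> borel_measurable lebesgue" for i
  proof -
    have "(\<lambda>x. p x $ i) \<in> borel_measurable lebesgue"
      using borel_measurable_inner[OF p(2) borel_measurable_const, of "axis i 1"] by (simp add: inner_axis)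
    then show ?thesis
      unfolding F_def using K'(1)
      by (intro borel_measurable_times borel_measurable_indicator) (auto intro: lmeasurable_compact fmeasurableD)
  qed
  have Fi: "integrable lebesgue (F i)" for i
    by (rule integrable_bounded_support[OF Fm, of _ "\<bar>Bp\<bar>" RK]) (use Fb RK in \<open>auto simp: F_def indicator_def not_less[symmetric]\<close>)
  have "\<exists>D. (\<forall>i x. (conv (F i) (\<rho> n) has_derivative D i x) (at x)) \<and> (\<forall>i h. continuous_on UNIV (\<lambda>x. D i x h))" for n
  proof -
    note m = mollifier_props[OF \<rho>(1)[of n]]
    obtain \<rho>' where \<rho>': "\<And>x. (\<rho> n has_derivative \<rho>' x) (at x)" "\<And>v. Ck 1 (\<lambda>x. \<rho>' x v)"
      using m(1)[of "Suc 1"] by (metis Ck_SucE)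
    have c': "continuous_on UNIV (\<lambda>x. \<rho>' x w)" for w using \<rho>'(2) Ck_continuous by blast
    obtain C where C: "\<And>x. \<bar>\<rho> n x\<bar> \<le> C" using m(7) by blast
    obtain C' where C': "\<And>x v. \<bar>\<rho>' x v\<bar> \<le> C' * norm v"
      by (rule C1_bounded_support_bound[OF \<rho>'(1) c', of "\<delta>n n"]) (use m(3) in auto)
    show ?thesis
      by (intro exI[of _ "\<lambda>i x h. conv (F i) (\<lambda>z. \<rho>' z h) x"] conjI allI
          conv_has_derivative[OF Fi \<rho>'(1) c' C C'] conv_continuous[OF Fi c' C'])
  qed
  then obtain Dn where Dn: "\<And>n i x. (conv (F i) (\<rho> n) has_derivative Dn n i x) (at x)" "\<And>n i h. continuous_on UNIV (\<lambda>x. Dn n i x h)"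
    by metis
  define P where "P = (\<lambda>n x. (\<Sum>i\<in>UNIV. conv (F i) (\<rho> n) x *\<^sub>R axis i (1::real)) + Z x)"
  define P' where "P' = (\<lambda>n x h. (\<Sum>i\<in>UNIV. Dn n i x h *\<^sub>R axis i (1::real)) + Z' x h)"
  have Pd: "(P n has_derivative P' n x) (at x)" for n x
    unfolding P_def P'_def
    by (intro has_derivative_add has_derivative_sum has_derivative_scaleR_left Dn Z)
  have P'c: "continuous_on UNIV (\<lambda>x. P' n x h)" for n h
    unfolding P'_def by (intro continuous_intros Dn Z)
  have mono: "\<mu> x * (h \<bullet> h) \<le> h \<bullet> P' n x h" if x: "x \<in> K" for n x h
  proof -
    have "0 \<le> (\<Sum>i\<in>UNIV. h $ i * Dn n i x h)"
    proof (rule monotone_mollified[where p=p, OF Fi \<rho>(1)[of n] \<rho>(4)[of n] K'(3)])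
      show "F i y = p y $ i" if "y \<in> cball x e" for i y using that K'(4)[OF x] by (auto simp: F_def)
      show "0 \<le> (p a - p b) \<bullet> (a - b)" if "a \<in> cball x e" "b \<in> cball x e" for a b
        using closed_segment_subset[OF that convex_cball] K'(4)[OF x] K'(2) by (intro p(3)) blast
    qed (rule Dn)
    also have "(\<Sum>i\<in>UNIV. h $ i * Dn n i x h) = h \<bullet> (\<Sum>i\<in>UNIV. Dn n i x h *\<^sub>R axis i (1::real))"
      by (simp add: inner_sum_right inner_axis mult.commute)
    finally show ?thesis using \<mu>(3)[of x h] by (simp add: P'_def inner_add_right)
  qed
  have Pc: "continuous_on UNIV (P n)" for n
    using Pd by (meson continuous_at_imp_continuous_on has_derivative_continuous)
  have conv_lim: "(\<lambda>n. conv (F i) (\<rho> n) x) \<longlonglongrightarrow> p x $ i" if x: "x \<in> K" for i x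
  proof (rule LIM_zero_cancel, rule Lim_null_comparison)
    have L0: "L \<ge> 0" using p(1) lipschitz_on_nonneg by blast
    show "\<forall>\<^sub>F n in sequentially. norm (conv (F i) (\<rho> n) x - p x $ i) \<le> L * \<delta>n n"
    proof (rule always_eventually, rule allI)
      fix n
      have "\<bar>conv (F i) (\<rho> n) x - p x $ i\<bar> \<le> L * \<delta>n n"
      proof (rule conv_bound[OF Fi Fb \<rho>(1)])
        fix y :: "real^'m" assume y: "norm y < \<delta>n n"
        have xy: "x - y \<in> K'" using y \<rho>(4)[of n] K'(3) K'(4)[OF x] by (auto simp: dist_norm subset_iff)
        have "\<bar>F i (x - y) - p x $ i\<bar> = \<bar>(p (x - y) - p x) $ i\<bar>" using xy by (simp add: F_def)
        also have "\<dots> \<le> norm (p (x - y) - p x)" by (rule component_le_norm_cart)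
        also have "\<dots> \<le> L * norm y"
          using lipschitz_onD[OF p(1), of "x - y" x] xy K'(2,5) x by (auto simp: dist_norm)
        also have "\<dots> \<le> L * \<delta>n n" using y L0 by (intro mult_left_mono) auto
        finally show "\<bar>F i (x - y) - p x $ i\<bar> \<le> L * \<delta>n n" .
      qed
      then show "norm (conv (F i) (\<rho> n) x - p x $ i) \<le> L * \<delta>n n" by simp
    qed
    show "(\<lambda>n. L * \<delta>n n) \<longlonglongrightarrow> 0" using tendsto_mult_left[OF \<rho>(2), of L] by simp
  qed
  have P_lim: "(\<lambda>n. P n x) \<longlonglongrightarrow> p x + Z x" if x: "x \<in> K" for x
  proof -
    have "(\<lambda>n. P n x) \<longlonglongrightarrow> (\<Sum>i\<in>UNIV. p x $ i *\<^sub>R axis i (1::real)) + Z x"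
      unfolding P_def by (intro tendsto_intros conv_lim x)
    then show ?thesis using basis_expansion[of "p x"] by (simp add: scalar_mult_eq_scaleR)
  qed
  have fl_cont: "continuous_on UNIV (flux A \<delta>)" by (rule flux_continuous[OF A d continuous_on_id])
  have fl_lim: "(\<lambda>n. flux A \<delta> (P n x)) \<longlonglongrightarrow> flux A \<delta> (p x + Z x)" if x: "x \<in> K" for x
    by (rule isCont_tendsto_compose[OF _ P_lim[OF x]]) (use fl_cont in \<open>simp add: continuous_on_eq_continuous_at\<close>)
  have q_lim: "(\<lambda>n. aniso_reg A \<delta> (P n x)) \<longlonglongrightarrow> aniso_reg A \<delta> (p x + Z x)" if x: "x \<in> K" for x
    by (rule isCont_tendsto_compose[OF _ P_lim[OF x]])
      (use aniso_reg_continuous[OF A, of \<delta>] in \<open>simp add: continuous_on_eq_continuous_at\<close>)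
  have flc: "continuous_on UNIV (\<lambda>x. flux A \<delta> (P n x))" for n by (rule flux_continuous[OF A d Pc])
  have qc: "continuous_on UNIV (\<lambda>x. aniso_reg A \<delta> (P n x))" for n by (rule aniso_reg_continuous_compose[OF A Pc])
  have q0: "aniso_reg A \<delta> v > 0" for v by (rule aniso_reg_pos[OF A d])
  have Wm: "W \<in> borel_measurable lebesgue" using W(1) by auto
  have Vm: "V \<in> borel_measurable lebesgue" using V by auto
  obtain R where R: "\<And>x. x \<in> K \<Longrightarrow> norm x \<le> R"
    using compact_imp_bounded[OF kd(4)] unfolding bounded_iff by blast
  have \<kappa>R: "\<kappa> x = 0" if "norm x > R" for x using kd(6)[of x] R[of x] that by force
  obtain B where B: "\<And>x v. \<bar>\<kappa>' x v\<bar> \<le> B * norm v"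
    by (rule C1_bounded_support_bound[OF kd(1,2) \<kappa>R]) auto
  have B0: "B \<ge> 0" using B[of 0 "axis undefined 1"] by simp
  obtain B3 where B3: "\<And>x. \<bar>\<kappa> x * \<mu> x\<bar> \<le> B3"
    by (rule continuous_bounded_support_bound[of "\<lambda>x. \<kappa> x * \<mu> x" R]) (auto intro!: continuous_intros kd(3) \<mu>(1) simp: \<kappa>R)
  have 1: "(\<lambda>n. LINT x|lebesgue. \<kappa> x * (flux A \<delta> (P n x) \<bullet> V x)) \<longlonglongrightarrow> (LINT x|lebesgue. \<kappa> x * (flux A \<delta> (p x + Z x) \<bullet> V x))"
  proof (rule dominated_everywhere(2)[where w="\<lambda>x. sqrt (tr A) * norm (V x)"])
    show "(\<lambda>x. \<kappa> x * (flux A \<delta> (P n x) \<bullet> V x)) \<in> borel_measurable lebesgue" for n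
      by (intro borel_measurable_times borel_measurable_inner continuous_measurable_lebesgue kd(3) flc Vm)
    show "(\<lambda>n. \<kappa> x * (flux A \<delta> (P n x) \<bullet> V x)) \<longlonglongrightarrow> \<kappa> x * (flux A \<delta> (p x + Z x) \<bullet> V x)" for x
    proof (cases "x \<in> K")
      case True then show ?thesis by (intro tendsto_intros fl_lim)
    qed (simp add: kd(6))
    show "\<bar>\<kappa> x * (flux A \<delta> (P n x) \<bullet> V x)\<bar> \<le> sqrt (tr A) * norm (V x)" for n x
    proof -
      have "\<bar>flux A \<delta> (P n x) \<bullet> V x\<bar> \<le> norm (flux A \<delta> (P n x)) * norm (V x)" by (rule Cauchy_Schwarz_ineq2)
      also have "\<dots> \<le> sqrt (tr A) * norm (V x)" by (intro mult_right_mono flux_bound[OF A card d]) auto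
      finally have 0: "\<bar>flux A \<delta> (P n x) \<bullet> V x\<bar> \<le> sqrt (tr A) * norm (V x)" .
      have "\<bar>\<kappa> x\<bar> * \<bar>flux A \<delta> (P n x) \<bullet> V x\<bar> \<le> 1 * (sqrt (tr A) * norm (V x))"
        using \<kappa>(2)[of x] 0 by (intro mult_mono) auto
      then show ?thesis by (simp add: abs_mult)
    qed
    show "integrable lebesgue (\<lambda>x. sqrt (tr A) * norm (V x))" using V by auto
  qed
  have 2: "(\<lambda>n. LINT x|lebesgue. W x * \<kappa>' x (flux A \<delta> (P n x))) \<longlonglongrightarrow> (LINT x|lebesgue. W x * \<kappa>' x (flux A \<delta> (p x + Z x)))"
  proof (rule dominated_everywhere(2)[where w="\<lambda>x. W x * (B * sqrt (tr A))"])
    show "(\<lambda>x. W x * \<kappa>' x (flux A \<delta> (P n x))) \<in> borel_measurable lebesgue" for n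
      unfolding linear_axis_expansion[OF has_derivative_linear[OF kd(1)], of _ "flux A \<delta> (P n _)"]
      by (intro borel_measurable_times Wm continuous_measurable_lebesgue) (intro continuous_intros kd(2) flc)
    show "(\<lambda>n. W x * \<kappa>' x (flux A \<delta> (P n x))) \<longlonglongrightarrow> W x * \<kappa>' x (flux A \<delta> (p x + Z x))" for x
    proof (cases "x \<in> K")
      case True
      have "bounded_linear (\<kappa>' x)" using kd(1) has_derivative_bounded_linear by blast
      then show ?thesis by (intro tendsto_mult tendsto_const bounded_linear.tendsto[of "\<kappa>' x"] fl_lim[OF True])
    qed (simp add: kd(7))
    show "\<bar>W x * \<kappa>' x (flux A \<delta> (P n x))\<bar> \<le> W x * (B * sqrt (tr A))" for n x
    proof -
      have "\<bar>\<kappa>' x (flux A \<delta> (P n x))\<bar> \<le> B * sqrt (tr A)"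
        using B[of x "flux A \<delta> (P n x)"] mult_left_mono[OF flux_bound[OF A card d, of "P n x"] B0] by linarith
      then show ?thesis using W(2)[of x] by (simp add: abs_mult mult_left_mono)
    qed
    show "integrable lebesgue (\<lambda>x. W x * (B * sqrt (tr A)))" using W(1) by auto
  qed
  have 3: "(\<lambda>n. LINT x|lebesgue. W x * (\<kappa> x * (c * \<mu> x / aniso_reg A \<delta> (P n x)))) \<longlonglongrightarrow> (LINT x|lebesgue. W x * (\<kappa> x * (c * \<mu> x / aniso_reg A \<delta> (p x + Z x))))"
  proof (rule dominated_everywhere(2)[where w="\<lambda>x. W x * (c * B3 / \<delta>)"])
    have qn: "aniso_reg A \<delta> v \<noteq> 0" for v using q0[of v] by simp
    show "(\<lambda>x. W x * (\<kappa> x * (c * \<mu> x / aniso_reg A \<delta> (P n x)))) \<in> borel_measurable lebesgue" for n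
      by (intro borel_measurable_times Wm continuous_measurable_lebesgue) (intro continuous_intros kd(3) \<mu>(1) qc ballI qn)+
    show "(\<lambda>n. W x * (\<kappa> x * (c * \<mu> x / aniso_reg A \<delta> (P n x)))) \<longlonglongrightarrow> W x * (\<kappa> x * (c * \<mu> x / aniso_reg A \<delta> (p x + Z x)))" for x
    proof (cases "x \<in> K")
      case True then show ?thesis by (intro tendsto_intros q_lim qn)
    qed (simp add: kd(6))
    show "\<bar>W x * (\<kappa> x * (c * \<mu> x / aniso_reg A \<delta> (P n x)))\<bar> \<le> W x * (c * B3 / \<delta>)" for n x
    proof -
      have "\<bar>\<kappa> x * (c * \<mu> x / aniso_reg A \<delta> (P n x))\<bar> = c * \<bar>\<kappa> x * \<mu> x\<bar> / aniso_reg A \<delta> (P n x)"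
        using q0[of "P n x"] c0 by (simp add: abs_mult)
      also have "\<dots> \<le> c * B3 / \<delta>"
        using c0 d aniso_reg_ge B3[of x] by (intro frac_le mult_left_mono) (auto intro: order_trans[OF abs_ge_zero])
      finally have "W x * \<bar>\<kappa> x * (c * \<mu> x / aniso_reg A \<delta> (P n x))\<bar> \<le> W x * (c * B3 / \<delta>)"
        by (rule mult_left_mono[OF _ W(2)])
      then show ?thesis unfolding abs_mult[of "W x"] abs_of_nonneg[OF W(2)] .
    qed
    show "integrable lebesgue (\<lambda>x. W x * (c * B3 / \<delta>))" using W(1) by auto
  qed
  show ?thesis
  proof (rule LIMSEQ_le_const2[OF tendsto_add[OF tendsto_add[OF 1 2] 3]])
    show "\<exists>N. \<forall>n\<ge>N. (LINT x|lebesgue. \<kappa> x * (flux A \<delta> (P n x) \<bullet> V x)) + (LINT x|lebesgue. W x * \<kappa>' x (flux A \<delta> (P n x)))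
       + (LINT x|lebesgue. W x * (\<kappa> x * (c * \<mu> x / aniso_reg A \<delta> (P n x)))) \<le> 0"
    proof (intro exI[of _ 0] allI impI)
      fix n
      have k0: "0 \<le> \<kappa> x" for x using \<kappa>(2) by blast
      show "(LINT x|lebesgue. \<kappa> x * (flux A \<delta> (P n x) \<bullet> V x)) + (LINT x|lebesgue. W x * \<kappa>' x (flux A \<delta> (P n x)))
       + (LINT x|lebesgue. W x * (\<kappa> x * (c * \<mu> x / aniso_reg A \<delta> (P n x)))) \<le> 0"
        by (rule weak_flux_C1[where D=D and K=K and P="P n" and P'="P' n" and \<kappa>=\<kappa> and \<kappa>'=\<kappa>' and \<mu>=\<mu> and c=c and W=W and V=V,
              OF A card d W(1) W(2) V])
          (erule parts | rule \<kappa>(1) k0 Pd P'c \<mu>(1) \<mu>(2) | erule mono | (rule c, assumption, blast))+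
    qed
  qed
qed

text \<open>Removes the spatial cutoff. The zero trace and the bound on W are what
  \<open>boundary_cutoff\<close> needs to make the integral of W times the gradient bound of the
  n-th cutoff at most 1 / (n + 1), and the flux is bounded. Then \<open>aniso_reg\<close> in the
  denominator is replaced by its upper bound Cq.\<close>

lemma slice_flux_inequality:
  fixes W :: "real^'m \<Rightarrow> real" and V :: "real^'m \<Rightarrow> real^'m"
  assumes D: "C2_domain D" "bounded D"
    and W: "integrable lebesgue W" "\<And>x. 0 \<le> W x" "\<And>x. x \<notin> D \<Longrightarrow> W x = 0" "AE x in lebesgue. W x \<le> M"
    and V: "integrable lebesgue V" "\<And>x. x \<notin> D \<Longrightarrow> V x = 0"
    and trace: "has_trace D W (frontier D) (\<lambda>x. 0)"
    and parts: "\<And>i \<phi> \<phi>' K. test_data D \<phi> \<phi>' K \<Longrightarrow>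
      (LINT x|lebesgue. W x * \<phi>' x (axis i 1)) = - (LINT x|lebesgue. V x $ i * \<phi> x)"
    and p: "L-lipschitz_on D p" "p \<in> borel_measurable lebesgue"
      "\<And>x y. closed_segment x y \<subseteq> D \<Longrightarrow> 0 \<le> (p x - p y) \<bullet> (x - y)"
    and Z: "\<And>x. (Z has_derivative Z' x) (at x)" "\<And>h. continuous_on UNIV (\<lambda>x. Z' x h)"
    and \<mu>: "continuous_on UNIV \<mu>" "\<And>x. 0 \<le> \<mu> x" "\<And>x h. \<mu> x * (h \<bullet> h) \<le> h \<bullet> Z' x h"
    and Cq: "Cq > 0" "\<And>x. x \<in> D \<Longrightarrow> aniso_reg A \<delta> (p x + Z x) \<le> Cq"
  shows "(LINT x|lebesgue. flux A \<delta> (p x + Z x) \<bullet> V x) \<le> - (LINT x|lebesgue. W x * (c * \<mu> x / Cq))"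
proof -
  have oD: "open D" and Dne: "D \<noteq> {}" using D(1) by (auto simp: C2_domain_def)
  have Wm: "W \<in> borel_measurable lebesgue" using W(1) by auto
  have Vm: "V \<in> borel_measurable lebesgue" using V by auto
  have WD: "(\<lambda>x. indicator D x * W x) = W" using W(3) by (force simp: indicator_def)
  have Zc: "continuous_on UNIV Z" using Z(1) by (meson continuous_at_imp_continuous_on has_derivative_continuous)
  have pZ: "(\<lambda>x. p x + Z x) \<in> borel_measurable lebesgue"
    by (intro borel_measurable_add p(2) continuous_measurable_lebesgue Zc)
  define z where "z = (\<lambda>x. flux A \<delta> (p x + Z x))"
  define q where "q = (\<lambda>x. aniso_reg A \<delta> (p x + Z x))"
  have zm: "z \<in> borel_measurable lebesgue"
    unfolding z_def by (rule measurable_compose[OF pZ borel_measurable_continuous_onI[OF flux_continuous[OF A d continuous_on_id]]])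
  have qm: "q \<in> borel_measurable lebesgue"
    unfolding q_def by (rule measurable_compose[OF pZ borel_measurable_continuous_onI[OF aniso_reg_continuous[OF A]]])
  have zb: "norm (z x) \<le> sqrt (tr A)" for x unfolding z_def by (rule flux_bound[OF A card d])
  have q0: "q x > 0" "\<delta> \<le> q x" for x unfolding q_def using aniso_reg_pos[OF A d] aniso_reg_ge by auto
  define Q where "Q = (\<lambda>n \<kappa> \<kappa>' K g. test_data D \<kappa> \<kappa>' K \<and> (\<forall>x. 0 \<le> \<kappa> x \<and> \<kappa> x \<le> 1) \<and>
    (\<forall>x\<in>D. 1 / real (Suc n) \<le> infdist x (frontier D) \<longrightarrow> \<kappa> x = 1) \<and> (\<forall>x v. \<bar>\<kappa>' x v\<bar> \<le> g x * norm v) \<and>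
    g \<in> borel_measurable lebesgue \<and> (\<forall>x. 0 \<le> g x) \<and> (\<exists>B. \<forall>x. g x \<le> B) \<and>
    (\<integral>\<^sup>+x. ennreal (indicator D x * W x * g x) \<partial>lebesgue) \<le> ennreal (1 / real (Suc n)))"
  have "\<exists>\<kappa> \<kappa>' K g. Q n \<kappa> \<kappa>' K g" for n
    unfolding Q_def
    by (rule boundary_cutoff[OF D, of W M])
      (use W(2,4) Wm trace in \<open>auto simp: WD has_trace_def elim: eventually_mono\<close>)
  then obtain \<kappa> \<kappa>' K g where Q: "\<And>n. Q n (\<kappa> n) (\<kappa>' n) (K n) (g n)" by metis
  have \<kappa>: "test_data D (\<kappa> n) (\<kappa>' n) (K n)" "0 \<le> \<kappa> n x \<and> \<kappa> n x \<le> 1"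
    "x \<in> D \<Longrightarrow> 1 / real (Suc n) \<le> infdist x (frontier D) \<Longrightarrow> \<kappa> n x = 1" "\<bar>\<kappa>' n x v\<bar> \<le> g n x * norm v"
    "g n \<in> borel_measurable lebesgue" "0 \<le> g n x"
    "(\<integral>\<^sup>+x. ennreal (indicator D x * W x * g n x) \<partial>lebesgue) \<le> ennreal (1 / real (Suc n))" for n x v
    using Q[of n] unfolding Q_def by blast+
  have \<kappa>m: "\<kappa> n \<in> borel_measurable lebesgue" for n by (rule continuous_measurable_lebesgue[OF test_dataD(3)[OF \<kappa>(1)]])
  have ev: "eventually (\<lambda>n. \<kappa> n x = 1) sequentially" if x: "x \<in> D" for x
  proof -
    have ne: "frontier D \<noteq> {}"
      using D(2) Dne by (metis frontier_eq_empty not_bounded_UNIV)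
    have "x \<notin> frontier D" using x oD by (simp add: frontier_def interior_open)
    then have "infdist x (frontier D) > 0" using ne by (intro infdist_pos_not_in_closed) auto
    then have "eventually (\<lambda>n. 1 / real (Suc n) < infdist x (frontier D)) sequentially"
      using LIMSEQ_Suc[OF lim_1_over_n] by (intro order_tendstoD(2)) auto
    then show ?thesis by (rule eventually_mono) (use \<kappa>(3)[OF x] in auto)
  qed
  have klim: "(\<lambda>n. \<kappa> n x * f x) \<longlonglongrightarrow> f x" if "x \<notin> D \<Longrightarrow> f x = 0" for f :: "real^'m \<Rightarrow> real" and x
  proof (cases "x \<in> D")
    case True
    show ?thesis by (rule tendsto_eventually, rule eventually_mono[OF ev[OF True]]) simp
  qed (simp add: that)
  have kb: "\<bar>\<kappa> n x * t\<bar> \<le> \<bar>t\<bar>" for n x t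
    using \<kappa>(2)[of n x] mult_right_mono[of "\<kappa> n x" 1 "\<bar>t\<bar>"] by (simp add: abs_mult)
  have 1: "(\<lambda>n. LINT x|lebesgue. \<kappa> n x * (z x \<bullet> V x)) \<longlonglongrightarrow> (LINT x|lebesgue. z x \<bullet> V x)"
  proof (rule dominated_everywhere(2)[where w="\<lambda>x. sqrt (tr A) * norm (V x)"])
    show "(\<lambda>x. \<kappa> n x * (z x \<bullet> V x)) \<in> borel_measurable lebesgue" for n
      by (intro borel_measurable_times borel_measurable_inner \<kappa>m zm Vm)
    show "(\<lambda>n. \<kappa> n x * (z x \<bullet> V x)) \<longlonglongrightarrow> z x \<bullet> V x" for x by (rule klim) (simp add: V(2))
    show "\<bar>\<kappa> n x * (z x \<bullet> V x)\<bar> \<le> sqrt (tr A) * norm (V x)" for n x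
    proof -
      have "\<bar>z x \<bullet> V x\<bar> \<le> norm (z x) * norm (V x)" by (rule Cauchy_Schwarz_ineq2)
      also have "\<dots> \<le> sqrt (tr A) * norm (V x)" by (intro mult_right_mono zb) auto
      finally show ?thesis using kb[of n x "z x \<bullet> V x"] by linarith
    qed
    show "integrable lebesgue (\<lambda>x. sqrt (tr A) * norm (V x))" using V by auto
  qed
  have 2: "(\<lambda>n. LINT x|lebesgue. W x * \<kappa>' n x (z x)) \<longlonglongrightarrow> 0"
  proof (rule Lim_null_comparison)
    have "(\<lambda>n. sqrt (tr A) * (1 / real (Suc n))) \<longlonglongrightarrow> sqrt (tr A) * 0"
      using LIMSEQ_Suc[OF lim_1_over_n] by (intro tendsto_intros) auto
    then show "(\<lambda>n. sqrt (tr A) * (1 / real (Suc n))) \<longlonglongrightarrow> 0" by simp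
    show "\<forall>\<^sub>F n in sequentially. norm (LINT x|lebesgue. W x * \<kappa>' n x (z x)) \<le> sqrt (tr A) * (1 / real (Suc n))"
    proof (rule always_eventually, rule allI)
      fix n
      have tr0: "sqrt (tr A) \<ge> 0" using norm_ge_zero[of "z 0"] zb[of 0] by linarith
      show "norm (LINT x|lebesgue. W x * \<kappa>' n x (z x)) \<le> sqrt (tr A) * (1 / real (Suc n))"
      proof (cases "integrable lebesgue (\<lambda>x. W x * \<kappa>' n x (z x))")
        case True
        have "ennreal (norm (LINT x|lebesgue. W x * \<kappa>' n x (z x))) \<le> (\<integral>\<^sup>+x. ennreal (norm (W x * \<kappa>' n x (z x))) \<partial>lebesgue)"
          by (rule integral_norm_bound_ennreal[OF True])
        also have "\<dots> \<le> (\<integral>\<^sup>+x. ennreal (sqrt (tr A)) * ennreal (indicator D x * W x * g n x) \<partial>lebesgue)"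
        proof (rule nn_integral_mono)
          fix x
          have "\<bar>\<kappa>' n x (z x)\<bar> \<le> g n x * sqrt (tr A)"
            using \<kappa>(4)[of n x "z x"] mult_left_mono[OF zb[of x] \<kappa>(6)[of n x]] by linarith
          then have "norm (W x * \<kappa>' n x (z x)) \<le> W x * (g n x * sqrt (tr A))"
            using W(2)[of x] by (simp add: abs_mult mult_left_mono)
          also have "\<dots> = sqrt (tr A) * (indicator D x * W x * g n x)"
            unfolding fun_cong[OF WD] by (simp only: mult_ac)
          finally show "ennreal (norm (W x * \<kappa>' n x (z x))) \<le> ennreal (sqrt (tr A)) * ennreal (indicator D x * W x * g n x)"
            using tr0 by (simp add: ennreal_mult'[symmetric] ennreal_leI)
        qed
        also have "\<dots> = ennreal (sqrt (tr A)) * (\<integral>\<^sup>+x. ennreal (indicator D x * W x * g n x) \<partial>lebesgue)"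
          unfolding fun_cong[OF WD] by (rule nn_integral_cmult) (use Wm \<kappa>(5) in measurable)
        also have "\<dots> \<le> ennreal (sqrt (tr A)) * ennreal (1 / real (Suc n))" by (intro mult_left_mono \<kappa>(7)) simp
        also have "\<dots> = ennreal (sqrt (tr A) * (1 / real (Suc n)))" using tr0 by (rule ennreal_mult'[symmetric])
        finally show ?thesis using tr0 by (subst (asm) ennreal_le_iff) auto
      next
        \<comment> \<open>The Bochner integral of a function that is not integrable is 0, so the
          estimate holds in this case as well.\<close>
        case False
        then show ?thesis using tr0 by (simp add: not_integrable_integral_eq)
      qed
    qed
  qed
  obtain RD where RD: "\<And>x. x \<in> D \<Longrightarrow> norm x \<le> RD" using D(2) unfolding bounded_iff by blast
  have "compact (\<mu> ` cball 0 RD)" using \<mu>(1) by (intro compact_continuous_image) (auto intro: continuous_on_subset)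
  then obtain B where B0: "\<forall>y\<in>\<mu> ` cball 0 RD. norm y \<le> B"
    using compact_imp_bounded[of "\<mu> ` cball 0 RD"] unfolding bounded_iff by blast
  have B: "\<mu> x \<le> B" if "x \<in> D" for x
  proof -
    have "x \<in> cball 0 RD" using RD[OF that] by simp
    then have "norm (\<mu> x) \<le> B" using B0 by blast
    then show ?thesis by simp
  qed
  have Wb: "W x * (c * \<mu> x / r) \<le> W x * (c * B / s)" if "r \<ge> s" "s > 0" for x r s
  proof (cases "x \<in> D")
    case True
    have "c * \<mu> x / r \<le> c * B / s"
      using that c0 \<mu>(2)[of x] B[OF True] by (intro frac_le mult_left_mono) (auto intro: order_trans)
    then show ?thesis by (intro mult_left_mono W(2))
  qed (simp add: W(3))
  have \<mu>m: "\<mu> \<in> borel_measurable lebesgue" by (rule continuous_measurable_lebesgue[OF \<mu>(1)])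
  have 3: "(\<lambda>n. LINT x|lebesgue. W x * (\<kappa> n x * (c * \<mu> x / q x))) \<longlonglongrightarrow> (LINT x|lebesgue. W x * (c * \<mu> x / q x))"
    and i3: "integrable lebesgue (\<lambda>x. W x * (c * \<mu> x / q x))"
  proof -
    have e: "W x * (\<kappa> n x * t) = \<kappa> n x * (W x * t)" for n x t by simp
    have m: "(\<lambda>x. \<kappa> n x * (W x * (c * \<mu> x / q x))) \<in> borel_measurable lebesgue" for n
      by (intro borel_measurable_times borel_measurable_divide borel_measurable_const \<kappa>m Wm \<mu>m qm)
    have l: "(\<lambda>n. \<kappa> n x * (W x * (c * \<mu> x / q x))) \<longlonglongrightarrow> W x * (c * \<mu> x / q x)" for x by (rule klim) (simp add: W(3))
    have b: "\<bar>\<kappa> n x * (W x * (c * \<mu> x / q x))\<bar> \<le> W x * (c * B / \<delta>)" for n x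
    proof -
      have "0 \<le> W x * (c * \<mu> x / q x)" using W(2) \<mu>(2) q0(1)[of x] c0 by (simp add: less_imp_le)
      then show ?thesis using kb[of n x "W x * (c * \<mu> x / q x)"] Wb[OF q0(2)[of x] d, of x] by linarith
    qed
    have i: "integrable lebesgue (\<lambda>x. W x * (c * B / \<delta>))" using W(1) by auto
    show "(\<lambda>n. LINT x|lebesgue. W x * (\<kappa> n x * (c * \<mu> x / q x))) \<longlonglongrightarrow> (LINT x|lebesgue. W x * (c * \<mu> x / q x))"
      unfolding e by (rule dominated_everywhere(2)[OF m l b i])
    show "integrable lebesgue (\<lambda>x. W x * (c * \<mu> x / q x))" by (rule dominated_everywhere(1)[OF m l b i])
  qed
  have "(LINT x|lebesgue. z x \<bullet> V x) + 0 + (LINT x|lebesgue. W x * (c * \<mu> x / q x)) \<le> 0"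
  proof (rule LIMSEQ_le_const2[OF tendsto_add[OF tendsto_add[OF 1 2] 3]])
    show "\<exists>N. \<forall>n\<ge>N. (LINT x|lebesgue. \<kappa> n x * (z x \<bullet> V x)) + (LINT x|lebesgue. W x * \<kappa>' n x (z x))
       + (LINT x|lebesgue. W x * (\<kappa> n x * (c * \<mu> x / q x))) \<le> 0"
      unfolding z_def q_def
    proof (intro exI[of _ 0] allI impI)
      fix n
      show "(LINT x|lebesgue. \<kappa> n x * (flux A \<delta> (p x + Z x) \<bullet> V x)) + (LINT x|lebesgue. W x * \<kappa>' n x (flux A \<delta> (p x + Z x)))
       + (LINT x|lebesgue. W x * (\<kappa> n x * (c * \<mu> x / aniso_reg A \<delta> (p x + Z x)))) \<le> 0"
        by (rule weak_flux_lipschitz[where D=D and K="K n" and \<kappa>="\<kappa> n" and \<kappa>'="\<kappa>' n" and Z=Z and Z'=Z' and \<mu>=\<mu> and p=p and L=L and W=W and V=V,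
              OF oD W(1) W(2) V(1)])
          (erule parts | rule \<kappa>(1) \<kappa>(2) p(1) p(2) Z \<mu>(1) \<mu>(2) \<mu>(3) | erule p(3))+
    qed
  qed
  moreover have "(LINT x|lebesgue. W x * (c * \<mu> x / Cq)) \<le> (LINT x|lebesgue. W x * (c * \<mu> x / q x))"
  proof (rule integral_mono[OF _ i3])
    show "integrable lebesgue (\<lambda>x. W x * (c * \<mu> x / Cq))"
    proof (rule Bochner_Integration.integrable_bound)
      show "integrable lebesgue (\<lambda>x. W x * (c * B / Cq))" using W(1) by auto
      show "(\<lambda>x. W x * (c * \<mu> x / Cq)) \<in> borel_measurable lebesgue"
        by (intro borel_measurable_times borel_measurable_divide borel_measurable_const Wm \<mu>m)
      show "AE x in lebesgue. norm (W x * (c * \<mu> x / Cq)) \<le> norm (W x * (c * B / Cq))"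
      proof (rule AE_I2)
        fix x
        have nn: "0 \<le> W x * (c * \<mu> x / Cq)" using W(2) \<mu>(2) Cq(1) c0 by (simp add: less_imp_le)
        show "norm (W x * (c * \<mu> x / Cq)) \<le> norm (W x * (c * B / Cq))"
          unfolding real_norm_def abs_of_nonneg[OF nn]
          by (rule order_trans[OF Wb[OF order_refl Cq(1)] abs_ge_self])
      qed
    qed
    show "W x * (c * \<mu> x / Cq) \<le> W x * (c * \<mu> x / q x)" for x
    proof (cases "x \<in> D")
      case True
      have "c * \<mu> x / Cq \<le> c * \<mu> x / q x"
        using Cq(2)[OF True] q0(1)[of x] c0 \<mu>(2)[of x] unfolding q_def by (intro divide_left_mono) (auto simp: q_def[symmetric] Cq)
      then show ?thesis by (intro mult_left_mono W(2))
    qed (simp add: W(3))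
  qed
  ultimately show ?thesis unfolding z_def by linarith
qed

end

section \<open>Slices of Lebesgue measurable functions\<close>

text \<open>The completed measure on the product is not the product of the completed measures; the
  exceptional set is enclosed in a Borel null set, to which Fubini applies.\<close>

lemma AE_lebesgue_slices:
  fixes P :: "'a::euclidean_space \<times> 'b::euclidean_space \<Rightarrow> bool"
  assumes "AE z in lebesgue. P z"
  shows "AE t in lebesgue. AE x in lebesgue. P (x, t)"
proof -
  have "AE z in (lborel :: ('a \<times> 'b) measure). P z" using assms by (simp add: AE_completion_iff)
  then obtain N where N: "N \<in> null_sets (lborel :: ('a \<times> 'b) measure)" "{z. \<not> P z} \<subseteq> N"
    by (auto elim!: AE_E simp: null_sets_def)
  have "AE z in (lborel :: 'a measure) \<Otimes>\<^sub>M (lborel :: 'b measure). z \<notin> N"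
    unfolding lborel_prod by (rule AE_not_in[OF N(1)])
  then have 1: "AE x in (lborel :: 'a measure). AE t in (lborel :: 'b measure). (x, t) \<notin> N"
    by (rule lborel_pair.AE_pair)
  have Ns: "N \<in> sets ((lborel :: 'a measure) \<Otimes>\<^sub>M (lborel :: 'b measure))"
    unfolding lborel_prod using N(1) by auto
  have m: "{x \<in> space ((lborel :: 'a measure) \<Otimes>\<^sub>M (lborel :: 'b measure)). (fst x, snd x) \<notin> N} \<in> sets ((lborel :: 'a measure) \<Otimes>\<^sub>M (lborel :: 'b measure))"
  proof -
    have "{x \<in> space ((lborel :: 'a measure) \<Otimes>\<^sub>M (lborel :: 'b measure)). (fst x, snd x) \<notin> N} = space (lborel \<Otimes>\<^sub>M lborel) - N" by auto
    then show ?thesis using sets.compl_sets[OF Ns] by simp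
  qed
  have "AE t in (lborel :: 'b measure). AE x in (lborel :: 'a measure). (x, t) \<notin> N"
    using lborel_pair.AE_commute[OF m] 1 by simp
  then have "AE t in (lborel :: 'b measure). AE x in (lborel :: 'a measure). P (x, t)"
    by (rule eventually_mono) (erule eventually_mono, use N(2) in auto)
  then show ?thesis by (simp add: AE_completion_iff)
qed

text \<open>Rests on completeness: for Borel measurability a change on a null set would not be
  allowed.\<close>

lemma lebesgue_measurable_AE_cong:
  fixes f g :: "'a::euclidean_space \<Rightarrow> 'b::topological_space"
  assumes f: "f \<in> borel_measurable lebesgue" and ae: "AE x in lebesgue. f x = g x"
  shows "g \<in> borel_measurable lebesgue"
proof (rule measurableI)
  fix S :: "'b set" assume S: "S \<in> sets borel"
  show "g -` S \<inter> space lebesgue \<in> sets lebesgue"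
  proof (rule completion.in_sets_AE)
    show "f -` S \<inter> space lebesgue \<in> sets lebesgue" using measurable_sets[OF f S] .
    show "AE x in lebesgue. (x \<in> f -` S \<inter> space lebesgue) = (x \<in> g -` S \<inter> space lebesgue)"
      using ae by (rule eventually_mono) simp
  qed simp
qed simp

text \<open>Fubini for the completed measure, by way of a Borel function that agrees with f almost
  everywhere, and hence on almost every slice almost everywhere.\<close>

lemma lebesgue_integral_slices:
  fixes f :: "'a::euclidean_space \<times> 'b::euclidean_space \<Rightarrow> real"
  assumes "integrable lebesgue f"
  shows "AE t in lebesgue. integrable lebesgue (\<lambda>x. f (x, t))"
    and "integrable lebesgue (\<lambda>t. LINT x|lebesgue. f (x, t))"
    and "integral\<^sup>L lebesgue f = (LINT t|lebesgue. LINT x|lebesgue. f (x, t))"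
proof -
  obtain f0 where f0: "f0 \<in> borel_measurable lborel" and ae: "AE z in lborel. f z = f0 z"
    using completion_ex_borel_measurable_real[of f lborel] assms by auto
  have ael: "AE z in lebesgue. f z = f0 z" using ae by (simp add: AE_completion)
  have f0i: "integrable lebesgue f0"
    by (rule integrable_cong_AE_imp[OF assms measurable_completion[OF f0]]) (use ael in simp)
  then have f0l: "integrable ((lborel :: 'a measure) \<Otimes>\<^sub>M (lborel :: 'b measure)) (case_prod (\<lambda>x t. f0 (x, t)))"
    unfolding lborel_prod using integrable_completion[OF f0] by simp
  have sl: "AE t in lebesgue. AE x in lebesgue. f (x, t) = f0 (x, t)" by (rule AE_lebesgue_slices[OF ael])
  have f0s: "(\<lambda>x. f0 (x, t)) \<in> borel_measurable lborel" for t
    using f0 by simp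
  have 1: "AE t in lebesgue. integrable lebesgue (\<lambda>x. f0 (x, t))"
    using lborel_pair.AE_integrable_snd[OF f0l] by (simp add: AE_completion integrable_completion[OF f0s])
  have fint: "integrable lebesgue (\<lambda>x. f (x, t)) \<and> (LINT x|lebesgue. f (x, t)) = (LINT x|lborel. f0 (x, t))"
    if "AE x in lebesgue. f (x, t) = f0 (x, t)" "integrable lebesgue (\<lambda>x. f0 (x, t))" for t
  proof -
    have ae': "AE x in lebesgue. f0 (x, t) = f (x, t)" using that(1) by (rule eventually_mono) simp
    have fm: "(\<lambda>x. f (x, t)) \<in> borel_measurable lebesgue"
      by (rule lebesgue_measurable_AE_cong[OF borel_measurable_integrable[OF that(2)] ae'])
    have "integrable lebesgue (\<lambda>x. f (x, t))"
      by (rule integrable_cong_AE_imp[OF that(2) fm ae'])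
    moreover have "(LINT x|lebesgue. f (x, t)) = (LINT x|lebesgue. f0 (x, t))"
      by (rule integral_cong_AE[OF fm borel_measurable_integrable[OF that(2)] that(1)])
    ultimately show ?thesis by (simp add: integral_completion[OF f0s])
  qed
  have both: "AE t in lebesgue. integrable lebesgue (\<lambda>x. f (x, t)) \<and> (LINT x|lebesgue. f (x, t)) = (LINT x|lborel. f0 (x, t))"
    using sl 1 by eventually_elim (rule fint)
  then show "AE t in lebesgue. integrable lebesgue (\<lambda>x. f (x, t))" by (rule eventually_mono) simp
  have i2: "integrable lborel (\<lambda>t. LINT x|lborel. f0 (x, t))"
    using lborel_pair.integrable_snd[OF f0l] by simp
  then have i2': "integrable lebesgue (\<lambda>t. LINT x|lborel. f0 (x, t))"
    by (subst integrable_completion) auto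
  have ae2: "AE t in lebesgue. (LINT x|lborel. f0 (x, t)) = (LINT x|lebesgue. f (x, t))"
    using both by (rule eventually_mono) simp
  have m2: "(\<lambda>t. LINT x|lebesgue. f (x, t)) \<in> borel_measurable lebesgue"
    by (rule lebesgue_measurable_AE_cong[OF borel_measurable_integrable[OF i2'] ae2])
  show "integrable lebesgue (\<lambda>t. LINT x|lebesgue. f (x, t))"
    by (rule integrable_cong_AE_imp[OF i2' m2]) (rule ae2)
  have "integral\<^sup>L lebesgue f = integral\<^sup>L lebesgue f0"
    by (rule integral_cong_AE[OF borel_measurable_integrable[OF assms] borel_measurable_integrable[OF f0i] ael])
  also have "\<dots> = integral\<^sup>L (lborel :: ('a \<times> 'b) measure) f0" by (rule integral_completion[OF f0])
  also have "\<dots> = (LINT t|lborel. LINT x|lborel. f0 (x, t))"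
    using lborel_pair.integral_snd[OF f0l] by (simp add: lborel_prod)
  also have "\<dots> = (LINT t|lebesgue. LINT x|lborel. f0 (x, t))"
    by (rule integral_completion[symmetric]) (use i2 in simp)
  also have "\<dots> = (LINT t|lebesgue. LINT x|lebesgue. f (x, t))"
    by (rule integral_cong_AE[OF borel_measurable_integrable[OF i2'] m2 ae2])
  finally show "integral\<^sup>L lebesgue f = (LINT t|lebesgue. LINT x|lebesgue. f (x, t))" .
qed

section \<open>Testing with the time derivative of the barrier\<close>

text \<open>The factor f is differentiable on U only; since the test vanishes off K inside U, the
  product extended by 0 is again a test. It will be applied to time difference quotients, which
  leave the cylinder near its top.\<close>

lemma test_data_mult:
  fixes \<phi> f :: "'a::euclidean_space \<Rightarrow> real"
  assumes \<phi>: "test_data \<Omega> \<phi> \<phi>' K" and U: "open U" "K \<subseteq> U"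
    and f: "\<And>x. x \<in> U \<Longrightarrow> (f has_derivative f' x) (at x)" "\<And>v. continuous_on U (\<lambda>x. f' x v)"
  shows "test_data \<Omega> (\<lambda>x. if x \<in> U then f x * \<phi> x else 0) (\<lambda>x w. if x \<in> U then f x * \<phi>' x w + f' x w * \<phi> x else 0) K"
proof -
  note \<phi> = test_dataD[OF \<phi>]
  have c: "continuous_on U f"
    using f(1) by (meson continuous_at_imp_continuous_on has_derivative_continuous)
  define P where "P = (\<lambda>x. if x \<in> U then f x * \<phi> x else 0)"
  define P' where "P' = (\<lambda>x w. if x \<in> U then f x * \<phi>' x w + f' x w * \<phi> x else 0)"
  have oK: "open (- K)" using \<phi>(4) by (simp add: compact_imp_closed open_Compl)
  have "(P has_derivative P' x) (at x)" for x
  proof (cases "x \<in> U")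
    case True
    have "((\<lambda>x. f x * \<phi> x) has_derivative (\<lambda>w. f x * \<phi>' x w + f' x w * \<phi> x)) (at x)"
      by (rule has_derivative_mult[OF f(1)[OF True] \<phi>(1)])
    then have "(P has_derivative (\<lambda>w. f x * \<phi>' x w + f' x w * \<phi> x)) (at x)"
      by (rule has_derivative_transform_within_open[OF _ U(1) True]) (simp add: P_def)
    then show ?thesis using True by (simp add: P'_def)
  next
    case False
    have "((\<lambda>x. 0) has_derivative (\<lambda>w. 0)) (at x)" by simp
    then have "(P has_derivative (\<lambda>w. 0)) (at x)"
      by (rule has_derivative_transform_within_open[OF _ oK]) (use False U \<phi>(6) in \<open>auto simp: P_def\<close>)
    then show ?thesis using False by (simp add: P'_def)
  qed
  moreover have "continuous_on UNIV (\<lambda>x. P' x v)" for v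
  proof -
    have "continuous_on U (\<lambda>x. f x * \<phi>' x v + f' x v * \<phi> x)"
      by (intro continuous_intros c f(2) continuous_on_subset[OF \<phi>(2)] continuous_on_subset[OF \<phi>(3)]) auto
    then have 1: "continuous_on U (\<lambda>x. P' x v)"
      by (rule continuous_on_eq) (simp add: P'_def)
    have 2: "continuous_on (- K) (\<lambda>x. P' x v)"
      by (rule continuous_on_eq[OF continuous_on_const[of _ 0]]) (simp add: P'_def \<phi>(6,7))
    have "U \<union> - K = UNIV" using U(2) by auto
    then show ?thesis
      using continuous_on_open_Un[OF U(1) oK 1 2] by simp
  qed
  moreover have "P x = 0" if "x \<notin> K" for x using that \<phi>(6) by (simp add: P_def)
  ultimately show ?thesis using \<phi>(4,5) unfolding test_data_def P_def P'_def by blast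
qed

text \<open>Zero within \<tau> of both ends of the interval and 1 from distance 4 \<tau> on, by the
  knots of \<open>ramp\<close>.\<close>

definition time_cut :: "real \<Rightarrow> real \<Rightarrow> real \<Rightarrow> real" where
  "time_cut T \<tau> t = ramp (t / \<tau>) * ramp ((T - t) / \<tau>)"

definition time_cut' :: "real \<Rightarrow> real \<Rightarrow> real \<Rightarrow> real" where
  "time_cut' T \<tau> t = ramp (t / \<tau>) * (ramp' ((T - t) / \<tau>) * (- (1 / \<tau>))) + ramp' (t / \<tau>) * (1 / \<tau>) * ramp ((T - t) / \<tau>)"

lemma time_cut_deriv: "(time_cut T \<tau> has_real_derivative time_cut' T \<tau> t) (at t)"
proof -
  have 1: "((\<lambda>t. ramp (t / \<tau>)) has_real_derivative ramp' (t / \<tau>) * (1 / \<tau>)) (at t)"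
    by (rule DERIV_chain2[OF ramp_deriv]) (rule DERIV_cdivide[OF DERIV_ident])
  have "((\<lambda>t. (T - t) / \<tau>) has_real_derivative - (1 / \<tau>)) (at t)"
    unfolding divide_inverse by (auto intro!: derivative_eq_intros)
  note 2 = DERIV_chain2[OF ramp_deriv this]
  show ?thesis
    using DERIV_mult'[OF 1 2] unfolding time_cut_def[abs_def] time_cut'_def .
qed

lemma time_cut'_continuous: "\<tau> > 0 \<Longrightarrow> continuous_on UNIV (time_cut' T \<tau>)"
proof -
  have r: "continuous_on UNIV ramp"
    by (auto intro!: continuous_at_imp_continuous_on DERIV_isCont[OF ramp_deriv])
  show "\<tau> > 0 \<Longrightarrow> ?thesis" unfolding time_cut'_def[abs_def]
    by (intro continuous_intros continuous_on_compose2[OF ramp'_cont] continuous_on_compose2[OF r]) auto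
qed

lemma time_cut_bounds: "0 \<le> time_cut T \<tau> t" "time_cut T \<tau> t \<le> 1"
  unfolding time_cut_def by (simp_all add: ramp_bounds mult_le_one)

lemma time_cut_outside:
  assumes "\<tau> > 0" "t \<le> \<tau> \<or> T - \<tau> \<le> t"
  shows "time_cut T \<tau> t = 0"
proof -
  have "t / \<tau> \<le> 1 \<or> (T - t) / \<tau> \<le> 1" using assms by (auto simp: divide_le_eq)
  then show ?thesis using ramp_zero by (auto simp: time_cut_def)
qed

lemma time_cut_inside:
  assumes "\<tau> > 0" "4 * \<tau> \<le> t" "4 * \<tau> \<le> T - t"
  shows "time_cut T \<tau> t = 1"
  unfolding time_cut_def using assms by (simp add: ramp_one le_divide_eq)

text \<open>The derivative is of order 1/\<tau> and lives within 4 \<tau> of an end, where the sine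
  is at most 4 (pi/T) \<tau>; the product with the squared sine is therefore of order \<tau>. The
  constant 32 rounds up 64/3.\<close>

lemma time_cut'_bound:
  assumes "\<tau> > 0" "0 < t" "t < T"
  shows "\<bar>time_cut' T \<tau> t\<bar> * (sin (pi * t / T))\<^sup>2 \<le> 32 * (pi / T)\<^sup>2 * \<tau>"
proof -
  have T: "T > 0" using assms by simp
  have sn: "0 \<le> sin (pi * t / T)" by (rule sin_ge_zero) (use assms in \<open>auto simp: divide_le_eq\<close>)
  have s1: "sin (pi * t / T) \<le> pi * t / T" by (rule sin_x_le_x) (use assms in simp)
  have "sin (pi * t / T) = sin (pi - pi * t / T)" by simp
  also have "pi - pi * t / T = pi * (T - t) / T" using T by (simp add: field_simps)
  also have "sin (pi * (T - t) / T) \<le> pi * (T - t) / T" by (rule sin_x_le_x) (use assms in simp)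
  finally have s2: "sin (pi * t / T) \<le> pi * (T - t) / T" .
  have key: "ramp' (r / \<tau>) * (sin (pi * t / T))\<^sup>2 \<le> 2/3 * (16 * (pi / T)\<^sup>2 * \<tau>\<^sup>2)"
    if r: "sin (pi * t / T) \<le> pi * r / T" for r
  proof (cases "4 \<le> r / \<tau>")
    case True
    then show ?thesis by (simp add: ramp'_bounds)
  next
    case False
    then have "r \<le> 4 * \<tau>" using assms(1) by (simp add: divide_simps)
    then have "pi * r / T \<le> pi * (4 * \<tau>) / T" using T by (intro divide_right_mono mult_left_mono) auto
    then have "sin (pi * t / T) \<le> 4 * (pi / T) * \<tau>" using r by (simp add: mult_ac)
    then have "(sin (pi * t / T))\<^sup>2 \<le> (4 * (pi / T) * \<tau>)\<^sup>2" using sn by (intro power_mono)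
    then have "(sin (pi * t / T))\<^sup>2 \<le> 16 * (pi / T)\<^sup>2 * \<tau>\<^sup>2" by (simp add: power_mult_distrib power_divide)
    then show ?thesis by (intro mult_mono ramp'_bounds(2)) auto
  qed
  have "\<bar>time_cut' T \<tau> t\<bar> \<le> \<bar>ramp (t / \<tau>) * (ramp' ((T - t) / \<tau>) * (- (1 / \<tau>)))\<bar> + \<bar>ramp' (t / \<tau>) * (1 / \<tau>) * ramp ((T - t) / \<tau>)\<bar>"
    unfolding time_cut'_def by (rule abs_triangle_ineq)
  also have "\<dots> = ramp (t / \<tau>) * (ramp' ((T - t) / \<tau>) / \<tau>) + ramp ((T - t) / \<tau>) * (ramp' (t / \<tau>) / \<tau>)"
    using assms(1) by (simp add: abs_mult ramp_bounds ramp'_bounds)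
  also have "\<dots> \<le> 1 * (ramp' ((T - t) / \<tau>) / \<tau>) + 1 * (ramp' (t / \<tau>) / \<tau>)"
    using assms(1) by (intro add_mono mult_right_mono) (auto simp: ramp_bounds ramp'_bounds)
  also have "\<dots> = (ramp' ((T - t) / \<tau>) + ramp' (t / \<tau>)) / \<tau>" by (simp add: add_divide_distrib)
  finally have "\<bar>time_cut' T \<tau> t\<bar> * (sin (pi * t / T))\<^sup>2 \<le> (ramp' ((T - t) / \<tau>) + ramp' (t / \<tau>)) / \<tau> * (sin (pi * t / T))\<^sup>2"
    by (rule mult_right_mono) simp
  also have "\<dots> = (ramp' ((T - t) / \<tau>) * (sin (pi * t / T))\<^sup>2 + ramp' (t / \<tau>) * (sin (pi * t / T))\<^sup>2) / \<tau>"
    by (simp add: algebra_simps)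
  also have "\<dots> \<le> (2/3 * (16 * (pi / T)\<^sup>2 * \<tau>\<^sup>2) + 2/3 * (16 * (pi / T)\<^sup>2 * \<tau>\<^sup>2)) / \<tau>"
    using assms(1) by (intro divide_right_mono add_mono key[OF s1] key[OF s2]) auto
  also have "\<dots> = 64/3 * (pi / T)\<^sup>2 * \<tau>" using assms(1) by (simp add: power2_eq_square)
  also have "\<dots> \<le> 32 * (pi / T)\<^sup>2 * \<tau>" using assms(1) by (intro mult_right_mono) auto
  finally show ?thesis .
qed

lemma hausdorff_measure_empty [simp]: "hausdorff_measure P s {} = 0"
proof -
  have "hausdorff_premeasure P s \<delta> {} \<le> 0" for \<delta>
    unfolding hausdorff_premeasure_def by (rule Inf_lower) (auto intro!: exI[of _ "{}"])
  then show ?thesis by (simp add: hausdorff_measure_def)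
qed

text \<open>\<open>boundary_cutoff\<close> with weight 0. For the time derivative the gradients of
  the cutoffs do not matter, only their convergence to 1.\<close>

lemma interior_cutoff_sequence:
  fixes D :: "'a::euclidean_space set"
  assumes D: "C2_domain D" "bounded D"
  obtains \<kappa> \<kappa>' K where "\<And>n. test_data D (\<kappa> n) (\<kappa>' n) (K n)" "\<And>n x. 0 \<le> \<kappa> n x" "\<And>n x. \<kappa> n x \<le> 1"
    "\<And>x. x \<in> D \<Longrightarrow> (\<lambda>n::nat. \<kappa> n x) \<longlonglongrightarrow> 1"
proof -
  let ?e = "\<lambda>n::nat. 1 / real (Suc n)"
  have "approx_limit D (\<lambda>x. 0) x 0" for x by (simp add: approx_limit_def)
  then have h: "hausdorff_measure ball (real DIM('a) - 1) {x \<in> frontier D. \<not> approx_limit D (\<lambda>x. 0) x 0} = 0"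
    using hausdorff_measure_empty by simp
  have "\<exists>\<kappa> \<kappa>' K. test_data D \<kappa> \<kappa>' K \<and> (\<forall>x. 0 \<le> \<kappa> x \<and> \<kappa> x \<le> 1) \<and> (\<forall>x\<in>D. ?e n \<le> infdist x (frontier D) \<longrightarrow> \<kappa> x = 1)" for n
    using boundary_cutoff[OF D, of "\<lambda>x. 0" 0 "?e n"] h by (simp del: of_nat_Suc) blast
  then obtain \<kappa> \<kappa>' K where k: "\<And>n. test_data D (\<kappa> n) (\<kappa>' n) (K n) \<and> (\<forall>x. 0 \<le> \<kappa> n x \<and> \<kappa> n x \<le> 1) \<and> (\<forall>x\<in>D. ?e n \<le> infdist x (frontier D) \<longrightarrow> \<kappa> n x = 1)"
    by metis
  show thesis
  proof (rule that[of \<kappa> \<kappa>' K])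
    fix x assume x: "x \<in> D"
    have fr: "frontier D \<noteq> {}" using D C2_domain_def[of D] by (metis frontier_eq_empty not_bounded_UNIV)
    have "x \<notin> frontier D" using x D(1) by (simp add: C2_domain_def frontier_def interior_open)
    then have "infdist x (frontier D) > 0"
      using in_closed_iff_infdist_zero[OF frontier_closed fr] infdist_nonneg[of x "frontier D"] by (metis less_eq_real_def)
    then have "eventually (\<lambda>n. ?e n < infdist x (frontier D)) sequentially"
      using LIMSEQ_inverse_real_of_nat order_tendstoD(2) by (simp add: inverse_eq_divide) blast
    then have "eventually (\<lambda>n. \<kappa> n x = 1) sequentially"
      by (rule eventually_mono) (use k x in force)
    then show "(\<lambda>n. \<kappa> n x) \<longlonglongrightarrow> 1" by (rule tendsto_eventually)
  qed (use k in auto)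
qed

lemma test_data_integrable:
  fixes W :: "'a::euclidean_space \<Rightarrow> real"
  assumes t: "test_data \<Omega> \<phi> \<phi>' K" and W: "integrable lebesgue W"
  shows "integrable lebesgue (\<lambda>x. W x * \<phi>' x v)" "integrable lebesgue (\<lambda>x. W x * \<phi> x)"
proof -
  note t' = test_dataD[OF t]
  obtain R where R: "\<And>x. x \<in> K \<Longrightarrow> norm x \<le> R"
    using compact_imp_bounded[OF t'(4)] unfolding bounded_iff by blast
  have out: "x \<notin> K" if "norm x > R" for x using R[of x] that by linarith
  obtain B1 where B1: "\<And>x. norm (\<phi>' x v) \<le> B1"
    by (rule continuous_bounded_support_bound[OF t'(2)[of v], of R]) (rule t'(7), erule out, rule that)
  obtain B2 where B2: "\<And>x. norm (\<phi> x) \<le> B2"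
    by (rule continuous_bounded_support_bound[OF t'(3), of R]) (rule t'(6), erule out, rule that)
  show "integrable lebesgue (\<lambda>x. W x * \<phi>' x v)"
    by (rule integrable_times_bounded[OF W continuous_measurable_lebesgue[OF t'(2)]]) (use B1 in simp)
  show "integrable lebesgue (\<lambda>x. W x * \<phi> x)"
    by (rule integrable_times_bounded[OF W continuous_measurable_lebesgue[OF t'(3)]]) (use B2 in simp)
qed

text \<open>Since \<open>\<psi>\<close> is only \<open>C\<^sup>1\<^sup>,\<^sup>1\<close>, its time derivative enters the test function through difference quotients, whose time
  derivatives are nonnegative by convexity. The quadratic decay of \<open>W\<close> at both ends absorbs the derivative of the time cutoff.\<close>

lemma time_flux_inequality:
  fixes D :: "'a::euclidean_space set" and \<psi> W V :: "'a \<times> real \<Rightarrow> real" and g :: "'a \<times> real \<Rightarrow> 'a \<times> real"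
  assumes D: "C2_domain D" "bounded D" and T: "T > 0"
    and \<psi>: "\<And>z. z \<in> space_time D T \<Longrightarrow> (\<psi> has_derivative (\<lambda>h. g z \<bullet> h)) (at z)"
    and g: "continuous_on (space_time D T) g" "\<And>z. z \<in> space_time D T \<Longrightarrow> norm (g z) \<le> B"
    and mono: "\<And>x t t'. \<lbrakk>x \<in> D; 0 < t; t \<le> t'; t' < T\<rbrakk> \<Longrightarrow> snd (g (x, t)) \<le> snd (g (x, t'))"
    and \<zeta>: "\<And>x. (\<zeta> has_derivative \<zeta>' x) (at x)" "\<And>v. continuous_on UNIV (\<lambda>x. \<zeta>' x v)"
      "\<And>x. x \<in> D \<Longrightarrow> 0 \<le> \<zeta> x" "\<And>x. x \<in> D \<Longrightarrow> \<zeta> x \<le> Zb"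
    and W: "integrable lebesgue W" "\<And>z. 0 \<le> W z" "\<And>z. z \<notin> space_time D T \<Longrightarrow> W z = 0"
      "AE z in lebesgue. z \<in> space_time D T \<longrightarrow> W z \<le> C * (sin (pi * snd z / T))\<^sup>2" and C: "C \<ge> 0"
    and V: "integrable lebesgue V" "\<And>z. z \<notin> space_time D T \<Longrightarrow> V z = 0"
    and parts: "\<And>\<phi> \<phi>' K. test_data (space_time D T) \<phi> \<phi>' K \<Longrightarrow>
      (LINT z|lebesgue. W z * \<phi>' z (0, 1)) = - (LINT z|lebesgue. V z * \<phi> z)"
  shows "(LINT z|lebesgue. V z * (snd (g z) + pi / T * cos (pi * snd z / T) * \<zeta> (fst z)))
    \<le> (LINT z|lebesgue. W z * ((pi / T)\<^sup>2 * sin (pi * snd z / T) * \<zeta> (fst z)))"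
proof -
  let ?\<Omega> = "space_time D T"
  have oD: "open D" and D0: "D \<noteq> {}" using D(1) by (auto simp: C2_domain_def)
  obtain x0 where x0: "x0 \<in> D" using D0 by auto
  have Zb: "0 \<le> Zb" using \<zeta>(3,4)[OF x0] by simp
  have "(x0, T/2) \<in> ?\<Omega>" using x0 T by (simp add: space_time_def)
  from g(2)[OF this] have B: "0 \<le> B" by (meson norm_ge_zero order_trans)
  obtain \<kappa> \<kappa>' K where k: "\<And>n. test_data D (\<kappa> n) (\<kappa>' n) (K n)" "\<And>n x. 0 \<le> \<kappa> n x" "\<And>n x. \<kappa> n x \<le> 1"
    "\<And>x. x \<in> D \<Longrightarrow> (\<lambda>n::nat. \<kappa> n x) \<longlonglongrightarrow> 1"
    by (rule interior_cutoff_sequence[OF D]) blast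
  \<comment> \<open>The 8 makes 4 \<tau> at most T / 2, so that the two ramps of the time cutoff do
    not interfere.\<close>
  define \<tau> where "\<tau> n = T / (8 * real (Suc n))" for n
  have \<tau>: "\<tau> n > 0" for n using T by (simp add: \<tau>_def)
  have \<tau>0: "\<tau> \<longlonglongrightarrow> 0"
  proof -
    have "(\<lambda>n. (T / 8) * inverse (real (Suc n))) \<longlonglongrightarrow> (T / 8) * 0" by (intro tendsto_mult tendsto_const LIMSEQ_inverse_real_of_nat)
    moreover have "(\<lambda>n. (T / 8) * inverse (real (Suc n))) = \<tau>" by (rule ext) (simp only: \<tau>_def divide_inverse inverse_mult_distrib mult.assoc)
    ultimately show ?thesis by (simp only: mult_zero_right)
  qed
  \<comment> \<open>Difference quotients use the step \<tau>/2 while the cutoff vanishes for times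
    above T - \<tau>; the shifted point thus stays in the cylinder on the support.\<close>
  define U where "U n = D \<times> {0<..<T - \<tau> n / 2}" for n
  define E where "E n z = (\<psi> (fst z, snd z + \<tau> n / 2) - \<psi> z) / (\<tau> n / 2) + pi / T * cos (pi * snd z / T) * \<zeta> (fst z)" for n and z :: "'a \<times> real"
  define E' where "E' n z h = (g (fst z, snd z + \<tau> n / 2) \<bullet> h - g z \<bullet> h) / (\<tau> n / 2) +
     (pi / T * cos (pi * snd z / T) * \<zeta>' (fst z) (fst h) + pi / T * (- sin (pi * snd z / T) * (pi * snd h / T)) * \<zeta> (fst z))" for n and z h :: "'a \<times> real"
  have Um: "z \<in> ?\<Omega>" "(fst z, snd z + \<tau> n / 2) \<in> ?\<Omega>" if "z \<in> U n" for z n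
    using that \<tau>[of n] by (auto simp: U_def space_time_def)
  have E': "(E n has_derivative E' n z) (at z)" if z: "z \<in> U n" for n z
  proof -
    have s: "((\<lambda>z. (fst z, snd z + \<tau> n / 2)) has_derivative (\<lambda>h. h)) (at z)"
      by (auto intro!: derivative_eq_intros)
    have 1: "((\<lambda>z. \<psi> (fst z, snd z + \<tau> n / 2)) has_derivative (\<lambda>h. g (fst z, snd z + \<tau> n / 2) \<bullet> h)) (at z)"
      by (rule has_derivative_compose[OF s \<psi>[OF Um(2)[OF z]]])
    have 2: "((\<lambda>z. \<zeta> (fst z)) has_derivative (\<lambda>h. \<zeta>' (fst z) (fst h))) (at z)"
      by (rule has_derivative_compose[OF has_derivative_fst[OF has_derivative_ident] \<zeta>(1)])
    have 3: "((\<lambda>z. cos (pi * snd z / T)) has_derivative (\<lambda>h. - sin (pi * snd z / T) * (pi * snd h / T))) (at z)"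
      unfolding divide_inverse by (auto intro!: derivative_eq_intros)
    have 4: "((\<lambda>z. pi / T * cos (pi * snd z / T)) has_derivative (\<lambda>h. pi / T * (- sin (pi * snd z / T) * (pi * snd h / T)))) (at z)"
      by (rule has_derivative_mult_right[OF 3])
    have 5: "((\<lambda>z. (\<psi> (fst z, snd z + \<tau> n / 2) - \<psi> z) / (\<tau> n / 2)) has_derivative (\<lambda>h. (g (fst z, snd z + \<tau> n / 2) \<bullet> h - g z \<bullet> h) / (\<tau> n / 2))) (at z)"
      using has_derivative_mult_right[OF has_derivative_diff[OF 1 \<psi>[OF Um(1)[OF z]]], of "inverse (\<tau> n / 2)"]
      by (simp only: divide_inverse[where b="\<tau> n / 2"] mult.commute[of _ "inverse (\<tau> n / 2)"])
    show ?thesis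
      unfolding E_def[abs_def] E'_def[abs_def]
      by (rule has_derivative_add[OF 5 has_derivative_mult[OF 4 2]])
  qed
  have cz: "continuous_on UNIV \<zeta>" using \<zeta>(1) by (auto intro!: continuous_at_imp_continuous_on has_derivative_continuous)
  have E'c: "continuous_on (U n) (\<lambda>z. E' n z h)" for n h
    unfolding E'_def using \<tau>[of n] T
    by (intro continuous_intros continuous_on_compose2[OF g(1)] continuous_on_compose2[OF cz] continuous_on_compose2[OF \<zeta>(2)] continuous_on_subset[OF g(1)])
       (use Um[of _ n] in auto)
  define \<phi> where "\<phi> n z = \<kappa> n (fst z) * time_cut T (\<tau> n) (snd z)" for n and z :: "'a \<times> real"
  define \<phi>' where "\<phi>' n z h = \<kappa> n (fst z) * (snd h * time_cut' T (\<tau> n) (snd z)) + \<kappa>' n (fst z) (fst h) * time_cut T (\<tau> n) (snd z)" for n and z h :: "'a \<times> real"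
  define KK where "KK n = K n \<times> {\<tau> n..T - \<tau> n}" for n
  have td: "test_data ?\<Omega> (\<phi> n) (\<phi>' n) (KK n)" for n
  proof -
    note kn = test_dataD[OF k(1)[of n]]
    have "(\<phi> n has_derivative \<phi>' n z) (at z)" for z
    proof -
      have 1: "((\<lambda>z. \<kappa> n (fst z)) has_derivative (\<lambda>h. \<kappa>' n (fst z) (fst h))) (at z)"
        by (rule has_derivative_compose[OF has_derivative_fst[OF has_derivative_ident] kn(1)])
      have 2: "((\<lambda>z. time_cut T (\<tau> n) (snd z)) has_derivative (\<lambda>h. snd h * time_cut' T (\<tau> n) (snd z))) (at z)"
        using has_derivative_compose[OF has_derivative_snd[OF has_derivative_ident] time_cut_deriv[unfolded has_field_derivative_def]]
        by (simp add: mult.commute)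
      show ?thesis unfolding \<phi>_def[abs_def] \<phi>'_def[abs_def] by (rule has_derivative_mult[OF 1 2])
    qed
    moreover have "continuous_on UNIV (\<lambda>z. \<phi>' n z h)" for h
    proof -
      have tc: "continuous_on UNIV (time_cut T (\<tau> n))"
        by (auto intro!: continuous_at_imp_continuous_on DERIV_isCont[OF time_cut_deriv])
      show ?thesis unfolding \<phi>'_def
        by (intro continuous_intros continuous_on_compose2[OF kn(3)] continuous_on_compose2[OF kn(2)]
            continuous_on_compose2[OF tc] continuous_on_compose2[OF time_cut'_continuous[OF \<tau>]]) auto
    qed
    moreover have "\<phi> n z = 0" if "z \<notin> KK n" for z
    proof (cases "fst z \<in> K n")
      case True
      then have "snd z \<le> \<tau> n \<or> T - \<tau> n \<le> snd z" using that by (cases z) (auto simp: KK_def)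
      then show ?thesis using time_cut_outside[OF \<tau>] by (simp add: \<phi>_def)
    qed (simp add: \<phi>_def kn(6))
    moreover have "compact (KK n)" unfolding KK_def by (intro compact_Times kn(4) compact_Icc)
    moreover have "KK n \<subseteq> ?\<Omega>" using kn(5) \<tau>[of n] by (auto simp: KK_def space_time_def)
    ultimately show ?thesis by (simp add: test_data_def)
  qed
  have U: "open (U n)" "KK n \<subseteq> U n" for n
    using test_dataD(5)[OF k(1)[of n]] \<tau>[of n] oD by (auto simp: U_def KK_def intro!: open_Times)
  define \<Psi> where "\<Psi> n z = (if z \<in> U n then E n z * \<phi> n z else 0)" for n z
  define \<Psi>' where "\<Psi>' n z h = (if z \<in> U n then E n z * \<phi>' n z h + E' n z h * \<phi> n z else 0)" for n z h
  have tP: "test_data ?\<Omega> (\<Psi> n) (\<Psi>' n) (KK n)" for n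
    unfolding \<Psi>_def[abs_def] \<Psi>'_def[abs_def] by (rule test_data_mult[OF td U E' E'c])
  define Eb where "Eb = B + pi / T * Zb"
  have zc: "\<bar>pi / T * cos (pi * t / T) * \<zeta> x\<bar> \<le> pi / T * Zb" if "x \<in> D" for x t
  proof -
    have "\<bar>pi / T * cos (pi * t / T) * \<zeta> x\<bar> = pi / T * (\<bar>cos (pi * t / T)\<bar> * \<zeta> x)" using T \<zeta>(3)[OF that] by (simp add: abs_mult)
    also have "\<dots> \<le> pi / T * (1 * Zb)" using T \<zeta>(3,4)[OF that] Zb by (intro mult_left_mono mult_mono) auto
    finally show ?thesis by simp
  qed
  \<comment> \<open>By the mean value theorem the quotient is a value of the time component of g,
    which bounds it by B uniformly in n.\<close>
  have mv: "\<exists>r. snd z < r \<and> r < snd z + \<tau> n / 2 \<and> (\<psi> (fst z, snd z + \<tau> n / 2) - \<psi> z) / (\<tau> n / 2) = snd (g (fst z, r)) \<and> (fst z, r) \<in> ?\<Omega>"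
    if z: "z \<in> U n" for n z
  proof -
    have d: "((\<lambda>t. \<psi> (fst z, t)) has_real_derivative snd (g (fst z, t))) (at t)" if t: "(fst z, t) \<in> ?\<Omega>" for t
    proof -
      have "((\<lambda>t. (fst z, t)) has_derivative (\<lambda>h. (0, h))) (at t)" by (auto intro!: derivative_eq_intros)
      from has_derivative_compose[OF this \<psi>[OF t]]
      show ?thesis unfolding has_field_derivative_def
        by (rule has_derivative_eq_rhs) (simp add: fun_eq_iff inner_prod_def mult.commute)
    qed
    have in\<Omega>: "(fst z, t) \<in> ?\<Omega>" if "snd z \<le> t" "t \<le> snd z + \<tau> n / 2" for t
      using z that by (auto simp: U_def space_time_def)
    have "\<exists>r>snd z. r < snd z + \<tau> n / 2 \<and> \<psi> (fst z, snd z + \<tau> n / 2) - \<psi> (fst z, snd z) = (snd z + \<tau> n / 2 - snd z) * snd (g (fst z, r))"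
      by (rule MVT2) (use \<tau>[of n] d in\<Omega> in auto)
    then obtain r where r: "r > snd z" "r < snd z + \<tau> n / 2" "\<psi> (fst z, snd z + \<tau> n / 2) - \<psi> z = \<tau> n / 2 * snd (g (fst z, r))"
      by auto
    show ?thesis using r \<tau>[of n] in\<Omega>[of r] by (intro exI[of _ r]) auto
  qed
  have sg: "\<bar>snd (g z)\<bar> \<le> B" if "z \<in> ?\<Omega>" for z
    using norm_snd_le[of "snd (g z)" "fst (g z)"] g(2)[OF that] by simp
  have Eb: "\<bar>E n z\<bar> \<le> Eb" if z: "z \<in> U n" for n z
  proof -
    obtain r where r: "(\<psi> (fst z, snd z + \<tau> n / 2) - \<psi> z) / (\<tau> n / 2) = snd (g (fst z, r))" "(fst z, r) \<in> ?\<Omega>" using mv[OF z] by blast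
    have "fst z \<in> D" using z by (auto simp: U_def)
    from zc[OF this, of "snd z"] sg[OF r(2)] show ?thesis unfolding E_def r(1) Eb_def by linarith
  qed
  have Eb0: "Eb \<ge> 0" unfolding Eb_def using B Zb T by simp
  have \<phi>b: "0 \<le> \<phi> n z" "\<phi> n z \<le> 1" for n z
    unfolding \<phi>_def using k(2,3) time_cut_bounds by (auto intro!: mult_le_one)
  define b where "b z = snd (g z) + pi / T * cos (pi * snd z / T) * \<zeta> (fst z)" for z
  let ?R = "\<lambda>z. W z * ((pi / T)\<^sup>2 * sin (pi * snd z / T) * \<zeta> (fst z))"
  let ?c = "\<lambda>n. C * Eb * (32 * (pi / T)\<^sup>2) * \<tau> n"
  have bd: "bounded ?\<Omega>" using D(2) by (simp add: space_time_def bounded_Times)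
  have o\<Omega>: "open ?\<Omega>" using oD by (simp add: space_time_def open_Times)
  have sin0: "0 \<le> sin (pi * snd z / T)" if "z \<in> ?\<Omega>" for z
    using that by (intro sin_ge_zero) (auto simp: space_time_def divide_le_eq)
  have pw: "- (W z * \<Psi>' n z (0, 1)) \<le> ?R z + indicator ?\<Omega> z * ?c n"
    if Wz: "z \<in> ?\<Omega> \<longrightarrow> W z \<le> C * (sin (pi * snd z / T))\<^sup>2" for z n
  proof (cases "z \<in> ?\<Omega>")
    case False then show ?thesis by (simp add: W(3))
  next
    case z\<Omega>: True
    have zD: "fst z \<in> D" "0 < snd z" "snd z < T" using z\<Omega> by (auto simp: space_time_def)
    have R0: "0 \<le> (pi / T)\<^sup>2 * sin (pi * snd z / T) * \<zeta> (fst z)" using sin0[OF z\<Omega>] \<zeta>(3)[OF zD(1)] by simp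
    have c0: "0 \<le> ?c n" using C Eb0 less_imp_le[OF \<tau>[of n]] by simp
    show ?thesis
    proof (cases "z \<in> U n")
      case False
      then show ?thesis using mult_nonneg_nonneg[OF W(2)[of z] R0] c0 z\<Omega> by (simp add: \<Psi>'_def)
    next
      case zU: True
      \<comment> \<open>Convexity in time makes the time derivative of the difference quotient
        nonnegative. It contributes with the favourable sign and is dropped, so only the explicit
        sine term is left on the right.\<close>
      have g2: "snd (g z) \<le> snd (g (fst z, snd z + \<tau> n / 2))"
        using mono[of "fst z" "snd z" "snd z + \<tau> n / 2"] Um(2)[OF zU] zD \<tau>[of n] by (simp add: space_time_def)
      have "- E' n z (0, 1) = - ((snd (g (fst z, snd z + \<tau> n / 2)) - snd (g z)) / (\<tau> n / 2)) + (pi / T)\<^sup>2 * sin (pi * snd z / T) * \<zeta> (fst z)"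
        by (simp add: E'_def inner_prod_def linear_0[OF has_derivative_linear[OF \<zeta>(1)]] power2_eq_square)
      also have "\<dots> \<le> (pi / T)\<^sup>2 * sin (pi * snd z / T) * \<zeta> (fst z)" using g2 \<tau>[of n] by simp
      finally have e: "- E' n z (0, 1) \<le> (pi / T)\<^sup>2 * sin (pi * snd z / T) * \<zeta> (fst z)" .
      have "- (E' n z (0, 1)) * \<phi> n z \<le> (pi / T)\<^sup>2 * sin (pi * snd z / T) * \<zeta> (fst z) * \<phi> n z"
        by (rule mult_right_mono[OF e \<phi>b(1)])
      also have "\<dots> \<le> (pi / T)\<^sup>2 * sin (pi * snd z / T) * \<zeta> (fst z) * 1" by (rule mult_left_mono[OF \<phi>b(2) R0])
      finally have 1: "W z * (- (E' n z (0, 1)) * \<phi> n z) \<le> ?R z" using W(2)[of z] by (intro mult_left_mono) auto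
      \<comment> \<open>In the pure time direction the derivative of the spatial cutoff vanishes, so
        only the time cutoff has to be absorbed.\<close>
      have f: "\<phi>' n z (0, 1) = \<kappa> n (fst z) * time_cut' T (\<tau> n) (snd z)"
        by (simp add: \<phi>'_def linear_0[OF has_derivative_linear[OF test_dataD(1)[OF k(1)]]])
      have "- (W z * (E n z * \<phi>' n z (0, 1))) \<le> \<bar>W z * (E n z * \<phi>' n z (0, 1))\<bar>" by (rule abs_ge_minus_self)
      also have "\<dots> = W z * (\<bar>E n z\<bar> * (\<kappa> n (fst z) * \<bar>time_cut' T (\<tau> n) (snd z)\<bar>))"
        by (simp add: f abs_mult W(2) k(2))
      also have "\<dots> \<le> C * (sin (pi * snd z / T))\<^sup>2 * (Eb * (1 * \<bar>time_cut' T (\<tau> n) (snd z)\<bar>))"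
        using Wz z\<Omega> Eb[OF zU] k(2,3) W(2) C Eb0 by (intro mult_mono) auto
      also have "\<dots> = C * Eb * (\<bar>time_cut' T (\<tau> n) (snd z)\<bar> * (sin (pi * snd z / T))\<^sup>2)" by simp
      also have "\<dots> \<le> C * Eb * (32 * (pi / T)\<^sup>2 * \<tau> n)"
        using C Eb0 zD by (intro mult_left_mono time_cut'_bound[OF \<tau>]) auto
      finally have 2: "- (W z * (E n z * \<phi>' n z (0, 1))) \<le> ?c n" by (simp add: mult_ac)
      have "- (W z * \<Psi>' n z (0, 1)) = - (W z * (E n z * \<phi>' n z (0, 1))) + W z * (- (E' n z (0, 1)) * \<phi> n z)"
        using zU by (simp add: \<Psi>'_def algebra_simps)
      then show ?thesis using 1 2 z\<Omega> by simp
    qed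
  qed
  have Rm: "(\<lambda>z. indicator ?\<Omega> z *\<^sub>R ((pi / T)\<^sup>2 * sin (pi * snd z / T) * \<zeta> (fst z))) \<in> borel_measurable lebesgue"
    using o\<Omega> T cz by (intro borel_measurable_scaleR borel_measurable_indicator continuous_measurable_lebesgue continuous_intros continuous_on_compose2[OF cz]) auto
  have intR: "integrable lebesgue ?R"
  proof -
    have "integrable lebesgue (\<lambda>z. W z * (indicator ?\<Omega> z *\<^sub>R ((pi / T)\<^sup>2 * sin (pi * snd z / T) * \<zeta> (fst z))))"
    proof (rule integrable_times_bounded[OF W(1) Rm])
      fix z
      show "\<bar>indicator ?\<Omega> z *\<^sub>R ((pi / T)\<^sup>2 * sin (pi * snd z / T) * \<zeta> (fst z))\<bar> \<le> (pi / T)\<^sup>2 * 1 * Zb"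
      proof (cases "z \<in> ?\<Omega>")
        case True
        then have "fst z \<in> D" by (auto simp: space_time_def)
        then have "(pi / T)\<^sup>2 * \<bar>sin (pi * snd z / T)\<bar> * \<bar>\<zeta> (fst z)\<bar> \<le> (pi / T)\<^sup>2 * 1 * Zb"
          using \<zeta>(3,4) Zb by (intro mult_mono) auto
        then show ?thesis using True by (simp add: abs_mult)
      qed (use Zb in simp)
    qed
    then show ?thesis by (rule Bochner_Integration.integrable_cong[THEN iffD1, rotated -1]) (auto simp: indicator_def W(3))
  qed
  have ind: "integrable lebesgue (\<lambda>z. indicator ?\<Omega> z * c :: real)" for c
    using integrable_real_indicator[of ?\<Omega> lebesgue] o\<Omega> bd emeasure_bounded_finite[OF bd] by simp
  have ineq: "(LINT z|lebesgue. V z * \<Psi> n z) \<le> (LINT z|lebesgue. ?R z) + measure lebesgue ?\<Omega> * ?c n" for n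
  proof -
    have "integrable lebesgue (\<lambda>z. W z * \<Psi>' n z (0, 1))" by (rule test_data_integrable(1)[OF tP W(1)])
    then have i: "integrable lebesgue (\<lambda>z. - (W z * \<Psi>' n z (0, 1)))" by simp
    have "(LINT z|lebesgue. V z * \<Psi> n z) = (LINT z|lebesgue. - (W z * \<Psi>' n z (0, 1)))" using parts[OF tP[of n]] by simp
    also have "\<dots> \<le> (LINT z|lebesgue. ?R z + indicator ?\<Omega> z * ?c n)"
      by (rule integral_mono_AE[OF i Bochner_Integration.integrable_add[OF intR ind]])
         (rule eventually_mono[OF W(4)], rule pw)
    also have "\<dots> = (LINT z|lebesgue. ?R z) + (LINT z|lebesgue. indicator ?\<Omega> z * ?c n)"
      by (rule Bochner_Integration.integral_add[OF intR ind])
    also have "(LINT z|lebesgue. indicator ?\<Omega> z * ?c n) = measure lebesgue ?\<Omega> * ?c n" by simp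
    finally show ?thesis .
  qed
  have lim: "(\<lambda>n. LINT z|lebesgue. V z * \<Psi> n z) \<longlonglongrightarrow> (LINT z|lebesgue. V z * b z)"
  proof (rule dominated_everywhere(2)[where w="\<lambda>z. \<bar>V z\<bar> * Eb"])
    show "(\<lambda>z. V z * \<Psi> n z) \<in> borel_measurable lebesgue" for n
      using borel_measurable_integrable[OF V(1)] continuous_measurable_lebesgue[OF test_dataD(3)[OF tP]] by (rule borel_measurable_times)
    show "\<bar>V z * \<Psi> n z\<bar> \<le> \<bar>V z\<bar> * Eb" for n z
    proof -
      have "\<bar>\<Psi> n z\<bar> \<le> Eb * 1"
      proof (cases "z \<in> U n")
        case True
        have "\<bar>E n z\<bar> * \<phi> n z \<le> Eb * 1" by (rule mult_mono[OF Eb[OF True] \<phi>b(2) Eb0 \<phi>b(1)])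
        then show ?thesis using True \<phi>b(1)[of n z] by (simp add: \<Psi>_def abs_mult)
      qed (simp add: \<Psi>_def Eb0)
      then show ?thesis by (simp add: abs_mult mult_left_mono)
    qed
    show "integrable lebesgue (\<lambda>z. \<bar>V z\<bar> * Eb)" using V(1) by simp
    fix z
    show "(\<lambda>n. V z * \<Psi> n z) \<longlonglongrightarrow> V z * b z"
    proof (cases "z \<in> ?\<Omega>")
      case False then show ?thesis by (simp add: V(2))
    next
      case z\<Omega>: True
      then have zD: "fst z \<in> D" "0 < snd z" "snd z < T" by (auto simp: space_time_def)
      have e1: "eventually (\<lambda>n. 4 * \<tau> n < min (snd z) (T - snd z)) sequentially"
      proof -
        have "(\<lambda>n. 4 * \<tau> n) \<longlonglongrightarrow> 4 * 0" by (intro tendsto_mult tendsto_const \<tau>0)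
        then show ?thesis by (rule order_tendstoD(2)) (use zD in simp)
      qed
      have e2: "eventually (\<lambda>n. z \<in> U n \<and> time_cut T (\<tau> n) (snd z) = 1) sequentially"
      proof (rule eventually_mono[OF e1])
        fix n assume a: "4 * \<tau> n < min (snd z) (T - snd z)"
        have "z \<in> U n" using a zD \<tau>[of n] by (cases z) (auto simp: U_def)
        moreover have "time_cut T (\<tau> n) (snd z) = 1" by (rule time_cut_inside[OF \<tau>]) (use a in auto)
        ultimately show "z \<in> U n \<and> time_cut T (\<tau> n) (snd z) = 1" by simp
      qed
      have dq: "(\<lambda>n. (\<psi> (fst z, snd z + \<tau> n / 2) - \<psi> z) / (\<tau> n / 2)) \<longlonglongrightarrow> snd (g z)"
      proof -
        have "((\<lambda>t. (fst z, t)) has_derivative (\<lambda>h. (0, h))) (at (snd z))" by (auto intro!: derivative_eq_intros)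
        from has_derivative_compose[OF this, of \<psi> "\<lambda>h. g z \<bullet> h"] \<psi>[OF z\<Omega>]
        have "((\<lambda>t. \<psi> (fst z, t)) has_derivative (\<lambda>h. g z \<bullet> (0, h))) (at (snd z))"
          by simp
        then have "((\<lambda>t. \<psi> (fst z, t)) has_real_derivative snd (g z)) (at (snd z))"
          unfolding has_field_derivative_def
          by (rule has_derivative_eq_rhs) (simp add: fun_eq_iff inner_prod_def mult.commute)
        then have d: "((\<lambda>h. (\<psi> (fst z, snd z + h) - \<psi> (fst z, snd z)) / h) \<longlongrightarrow> snd (g z)) (at 0)"
          by (simp add: DERIV_def)
        have "filterlim (\<lambda>n. \<tau> n / 2) (at 0) sequentially"
        proof (rule filterlim_atI)
          have "(\<lambda>n. \<tau> n / 2) \<longlonglongrightarrow> 0 / 2" by (intro tendsto_divide tendsto_const \<tau>0) simp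
          then show "(\<lambda>n. \<tau> n / 2) \<longlonglongrightarrow> 0" by simp
          show "eventually (\<lambda>n. \<tau> n / 2 \<noteq> 0) sequentially" using \<tau> by (simp add: less_imp_neq[symmetric])
        qed
        from filterlim_compose[OF d this] show ?thesis by simp
      qed
      have "(\<lambda>n. E n z * \<kappa> n (fst z)) \<longlonglongrightarrow> b z * 1"
        unfolding E_def b_def by (intro tendsto_mult tendsto_add tendsto_const dq k(4) zD(1))
      moreover have "eventually (\<lambda>n. E n z * \<kappa> n (fst z) = \<Psi> n z) sequentially"
        using e2 by (rule eventually_mono) (simp add: \<Psi>_def \<phi>_def)
      ultimately have "(\<lambda>n. \<Psi> n z) \<longlonglongrightarrow> b z" using tendsto_cong by force
      then show ?thesis by (intro tendsto_mult tendsto_const)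
    qed
  qed
  have "(\<lambda>n. (LINT z|lebesgue. ?R z) + measure lebesgue ?\<Omega> * ?c n) \<longlonglongrightarrow> (LINT z|lebesgue. ?R z) + measure lebesgue ?\<Omega> * (C * Eb * (32 * (pi / T)\<^sup>2) * 0)"
    by (intro tendsto_add tendsto_const tendsto_mult \<tau>0)
  then have "(LINT z|lebesgue. V z * b z) \<le> (LINT z|lebesgue. ?R z)"
    using LIMSEQ_le[OF lim, of "\<lambda>n. (LINT z|lebesgue. ?R z) + measure lebesgue ?\<Omega> * ?c n"] ineq by simp
  then show ?thesis by (simp add: b_def)
qed

section \<open>Convexity, slices and truncation\<close>

text \<open>Divide the convexity inequality at the parameter s by s and let s decrease to 0. Only
  one segment is involved because the domain may be nonconvex.\<close>

lemma convex_segment_tangent: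
  fixes f :: "'a::euclidean_space \<Rightarrow> real"
  assumes c: "convex_on (closed_segment a b) f" and d: "(f has_derivative (\<lambda>h. g \<bullet> h)) (at a)"
  shows "f a + g \<bullet> (b - a) \<le> f b"
proof -
  have "((\<lambda>s. a + s *\<^sub>R (b - a)) has_derivative (\<lambda>s. s *\<^sub>R (b - a))) (at (0::real))"
    by (auto intro!: derivative_eq_intros)
  then have "((\<lambda>s. f (a + s *\<^sub>R (b - a))) has_derivative (\<lambda>s. g \<bullet> (s *\<^sub>R (b - a)))) (at 0)"
    by (rule has_derivative_compose) (use d in simp)
  then have "((\<lambda>s. f (a + s *\<^sub>R (b - a))) has_real_derivative g \<bullet> (b - a)) (at 0)"
    unfolding has_field_derivative_def by (rule has_derivative_eq_rhs) (simp add: fun_eq_iff mult.commute)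
  then have "((\<lambda>s. (f (a + s *\<^sub>R (b - a)) - f a) / s) \<longlongrightarrow> g \<bullet> (b - a)) (at 0)"
    by (simp add: DERIV_def)
  then have lim: "((\<lambda>s. (f (a + s *\<^sub>R (b - a)) - f a) / s) \<longlongrightarrow> g \<bullet> (b - a)) (at_right 0)"
    by (rule filterlim_mono) (auto simp: at_le)
  have "eventually (\<lambda>s. (f (a + s *\<^sub>R (b - a)) - f a) / s \<le> f b - f a) (at_right 0)"
  proof -
    have "eventually (\<lambda>s::real. 0 < s \<and> s < 1) (at_right 0)"
      unfolding eventually_at_right_field by (intro exI[of _ 1]) auto
    then show ?thesis
    proof (rule eventually_mono)
      fix s :: real assume s: "0 < s \<and> s < 1"
      have "f ((1 - s) *\<^sub>R a + s *\<^sub>R b) \<le> (1 - s) * f a + s * f b"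
        using s by (intro convex_onD[OF c]) auto
      moreover have "(1 - s) *\<^sub>R a + s *\<^sub>R b = a + s *\<^sub>R (b - a)" by (simp add: algebra_simps)
      ultimately have "f (a + s *\<^sub>R (b - a)) - f a \<le> (f b - f a) * s" by (simp add: algebra_simps)
      then show "(f (a + s *\<^sub>R (b - a)) - f a) / s \<le> f b - f a" using s by (simp add: divide_le_eq)
    qed
  qed
  from tendsto_upperbound[OF lim this] show ?thesis by simp
qed

lemma convex_on_segments_monotone_gradient:
  fixes f :: "'a::euclidean_space \<Rightarrow> real"
  assumes c: "convex_on_segments S f" and ab: "closed_segment a b \<subseteq> S"
    and d: "(f has_derivative (\<lambda>h. g a \<bullet> h)) (at a)" "(f has_derivative (\<lambda>h. g b \<bullet> h)) (at b)"
  shows "0 \<le> (g a - g b) \<bullet> (a - b)"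
proof -
  have ca: "convex_on (closed_segment a b) f" using c ab by (simp add: convex_on_segments_def)
  then have cb: "convex_on (closed_segment b a) f" by (simp add: closed_segment_commute)
  show ?thesis
    using convex_segment_tangent[OF ca d(1)] convex_segment_tangent[OF cb d(2)]
    by (simp add: algebra_simps inner_diff_left inner_diff_right)
qed

text \<open>The converse of \<open>AE_lebesgue_slices\<close>. Measurability of the set must be
  assumed here: null slices alone do not make a set null.\<close>

lemma AE_lebesgue_from_slices:
  fixes P :: "'a::euclidean_space \<times> 'b::euclidean_space \<Rightarrow> bool"
  assumes S: "{z. P z} \<in> sets lebesgue" and P: "AE t in lebesgue. AE x in lebesgue. P (x, t)"
  shows "AE z in lebesgue. P z"
proof -
  let ?M = "(lborel :: 'a measure) \<Otimes>\<^sub>M (lborel :: 'b measure)"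
  define f :: "'a \<times> 'b \<Rightarrow> real" where "f = indicator {z. P z}"
  have "f \<in> borel_measurable lebesgue" unfolding f_def by (rule borel_measurable_indicator[OF S])
  then obtain f0 where f0: "f0 \<in> borel_measurable lborel" and ae: "AE z in lborel. f z = f0 z"
    using completion_ex_borel_measurable_real by blast
  have ael: "AE z in lebesgue. f z = f0 z" by (rule AE_completion[OF ae])
  have "AE t in lebesgue. AE x in lebesgue. f0 (x, t) = 1"
    using P AE_lebesgue_slices[OF ael]
  proof eventually_elim
    case (elim t)
    from elim show ?case by eventually_elim (simp add: f_def)
  qed
  then have sl: "AE t in lborel. AE x in lborel. f0 (x, t) = 1" by (simp add: AE_completion_iff)
  have f0': "f0 \<in> borel_measurable ?M" using f0 by (simp add: lborel_prod)
  then have m: "{z \<in> space ?M. f0 z = 1} \<in> sets ?M" by measurable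
  then have m': "{z \<in> space ?M. f0 (fst z, snd z) = 1} \<in> sets ?M" by simp
  have "AE x in (lborel :: 'a measure). AE t in (lborel :: 'b measure). f0 (x, t) = 1"
    using lborel_pair.AE_commute[OF m'] sl by simp
  then have "AE z in ?M. f0 z = 1" by (intro lborel_pair.AE_pair_measure[OF m]) simp
  then have "AE z in lborel. f0 z = 1" by (subst (asm) lborel_prod)
  then have "AE z in lebesgue. f0 z = 1" by (rule AE_completion)
  then show ?thesis using ael
    by eventually_elim (simp add: f_def indicator_def split: if_splits)
qed

lemma lebesgue_nn_integral_slices:
  fixes f :: "'a::euclidean_space \<times> 'b::euclidean_space \<Rightarrow> real"
  assumes "f \<in> borel_measurable lebesgue"
  shows "(\<lambda>t. \<integral>\<^sup>+x. ennreal (f (x, t)) \<partial>lebesgue) \<in> borel_measurable lebesgue"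
proof -
  obtain f0 where f0: "f0 \<in> borel_measurable lborel" and ae: "AE z in lborel. f z = f0 z"
    using completion_ex_borel_measurable_real[OF assms] by auto
  have f0': "f0 \<in> borel_measurable ((lborel :: 'a measure) \<Otimes>\<^sub>M (lborel :: 'b measure))" using f0 by (simp add: lborel_prod)
  have sl: "AE t in lebesgue. AE x in lebesgue. f (x, t) = f0 (x, t)" by (rule AE_lebesgue_slices[OF AE_completion[OF ae]])
  have "(\<lambda>t. \<integral>\<^sup>+x. ennreal (f0 (x, t)) \<partial>(lborel :: 'a measure)) \<in> borel_measurable (lborel :: 'b measure)"
    using f0' by measurable
  then have "(\<lambda>t. \<integral>\<^sup>+x. ennreal (f0 (x, t)) \<partial>(lborel :: 'a measure)) \<in> borel_measurable lebesgue"
    by (rule measurable_completion)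
  moreover have "AE t in lebesgue. (\<integral>\<^sup>+x. ennreal (f0 (x, t)) \<partial>(lborel :: 'a measure)) = (\<integral>\<^sup>+x. ennreal (f (x, t)) \<partial>lebesgue)"
    using sl
  proof (rule eventually_mono)
    fix t assume t: "AE x in lebesgue. f (x, t) = f0 (x, t)"
    have "(\<integral>\<^sup>+x. ennreal (f (x, t)) \<partial>lebesgue) = (\<integral>\<^sup>+x. ennreal (f0 (x, t)) \<partial>lebesgue)"
      by (rule nn_integral_cong_AE) (use t in \<open>rule eventually_mono, simp\<close>)
    also have "\<dots> = (\<integral>\<^sup>+x. ennreal (f0 (x, t)) \<partial>lborel)"
      by (rule nn_integral_completion)
    finally show "(\<integral>\<^sup>+x. ennreal (f0 (x, t)) \<partial>lborel) = (\<integral>\<^sup>+x. ennreal (f (x, t)) \<partial>lebesgue)" by simp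
  qed
  ultimately show ?thesis by (rule lebesgue_measurable_AE_cong)
qed

lemma aniso_lower_bound:
  fixes A :: "real^'m^'m"
  assumes A: "sym_pos_def A"
  shows "\<exists>c>0. \<forall>p. c * norm p \<le> aniso A p"
proof -
  have "\<exists>x\<in>sphere (0::real^'m) 1. \<forall>y\<in>sphere 0 1. aniso A x \<le> aniso A y"
    by (rule continuous_attains_inf) (use aniso_continuous[OF A] in \<open>auto intro: continuous_on_subset\<close>)
  then obtain x where x: "norm x = 1" "\<And>y. norm y = 1 \<Longrightarrow> aniso A x \<le> aniso A y" by auto
  have "aniso A x > 0" using A_pos[OF A, of x] x(1) unfolding aniso_def by (metis norm_zero real_sqrt_gt_zero zero_neq_one)
  moreover have "aniso A x * norm p \<le> aniso A p" for p
  proof (cases "p = 0")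
    case True
    then show ?thesis using aniso_nonneg[OF A, of p] by simp
  next
    case False
    have "aniso A p = norm p * aniso A ((1 / norm p) *\<^sub>R p)"
      using False by (simp add: aniso_scale[OF A])
    moreover have "aniso A x \<le> aniso A ((1 / norm p) *\<^sub>R p)" using False by (intro x(2)) simp
    ultimately show ?thesis by (simp add: mult.commute[of _ "norm p"] mult_left_mono)
  qed
  ultimately show ?thesis by blast
qed

definition clip :: "real \<Rightarrow> real" where "clip s = max 0 (min 1 s)"

text \<open>Quadratic on [0, 1] and linear with slope 1 afterwards. The linear growth keeps the
  competitor between u and the maximum of u and the barrier; the quadratic start makes the increment
  at most half the square of the excess, which is the source of its quadratic decay at both ends of
  the time interval.\<close>

definition pen :: "real \<Rightarrow> real" where "pen s = ((max 0 s)\<^sup>2 - (max 0 (s - 1))\<^sup>2) / 2"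

lemma pen_deriv: "(pen has_real_derivative clip s) (at s)"
proof -
  have "(pen has_real_derivative max 0 s - max 0 (s - 1)) (at s)"
  proof -
    have "((\<lambda>s. s - 1) has_real_derivative 1) (at s)" by (auto intro!: derivative_eq_intros)
    from DERIV_cdivide[OF DERIV_diff[OF pos_square_deriv DERIV_chain2[OF pos_square_deriv this]], of 2]
    show ?thesis unfolding pen_def[abs_def] by (simp add: diff_divide_distrib)
  qed
  moreover have "max 0 s - max 0 (s - 1) = clip s" by (auto simp: clip_def max_def min_def)
  ultimately show ?thesis by simp
qed

lemma clip_props: "0 \<le> clip s" "clip s \<le> 1" "\<bar>clip s - clip t\<bar> \<le> \<bar>s - t\<bar>" "s \<le> 0 \<Longrightarrow> clip s = 0"
  by (auto simp: clip_def max_def min_def)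

lemma pen_cases: "pen s = (if s \<le> 0 then 0 else if s \<le> 1 then s\<^sup>2 / 2 else s - 1 / 2)"
  by (auto simp: pen_def max_def power2_eq_square field_simps)

lemma pen_props: "0 \<le> pen s" "pen s \<le> max 0 s" "s \<le> 0 \<Longrightarrow> pen s = 0" "pen s \<le> (max 0 s)\<^sup>2 / 2" "pen s = 0 \<Longrightarrow> s \<le> 0"
proof -
  show "0 \<le> pen s" "s \<le> 0 \<Longrightarrow> pen s = 0" "pen s = 0 \<Longrightarrow> s \<le> 0" by (auto simp: pen_cases split: if_splits)
  show "pen s \<le> (max 0 s)\<^sup>2 / 2" by (simp add: pen_def)
  have "s * s \<le> 2 * s" if "0 < s" "s \<le> 1" using that by (intro mult_right_mono) auto
  then show "pen s \<le> max 0 s" by (auto simp: pen_cases power2_eq_square)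
qed

section \<open>Energies of competitors\<close>

lemma weak_derivative_cong:
  fixes f f' :: "'a::euclidean_space \<Rightarrow> real"
  assumes "weak_derivative \<Omega> v f g" "\<And>x. x \<in> \<Omega> \<Longrightarrow> f x = f' x" "\<And>x. x \<in> \<Omega> \<Longrightarrow> g x = g' x"
  shows "weak_derivative \<Omega> v f' g'"
proof -
  have L: "L1_loc \<Omega> q'" if "L1_loc \<Omega> q" "\<And>x. x \<in> \<Omega> \<Longrightarrow> q x = q' x" for q q' :: "'a \<Rightarrow> real"
    unfolding L1_loc_def
  proof (intro allI impI)
    fix K assume K: "compact K \<and> K \<subseteq> \<Omega>"
    then have "q absolutely_integrable_on K" using that(1) by (simp add: L1_loc_def)
    moreover have "(\<lambda>x. indicator K x *\<^sub>R q x) = (\<lambda>x. indicator K x *\<^sub>R q' x)"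
      using that(2) K by (auto simp: indicator_def fun_eq_iff)
    ultimately show "q' absolutely_integrable_on K" by (simp add: set_integrable_def)
  qed
  have "(LINT x:\<Omega>|lebesgue. f' x * h x) = (LINT x:\<Omega>|lebesgue. f x * h x)"
       "(LINT x:\<Omega>|lebesgue. g' x * h x) = (LINT x:\<Omega>|lebesgue. g x * h x)" for h
    unfolding set_lebesgue_integral_def
    by (intro Bochner_Integration.integral_cong refl, simp add: indicator_def assms)+
  then show ?thesis using assms(1) L[of f f'] L[of g g'] assms(2,3) by (simp add: weak_derivative_def)
qed

lemma weak_derivative_add:
  fixes f1 f2 :: "'a::euclidean_space \<Rightarrow> real"
  assumes "open \<Omega>" "weak_derivative \<Omega> v f1 h1" "weak_derivative \<Omega> v f2 h2"
  shows "weak_derivative \<Omega> v (\<lambda>x. f1 x + f2 x) (\<lambda>x. h1 x + h2 x)"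
proof -
  have "weak_derivative \<Omega> v (\<lambda>x. 0) (\<lambda>x. 0)" by (rule weak_derivative_C1[OF assms(1)]) auto
  from weak_derivative_diff[OF assms(2) weak_derivative_diff[OF this assms(3)]] show ?thesis by simp
qed

lemma weak_derivative_test_data:
  fixes f :: "'a::euclidean_space \<Rightarrow> real"
  assumes "weak_derivative \<Omega> v f h" "open \<Omega>" "test_data \<Omega> \<phi> \<phi>' K" "\<And>x. x \<notin> \<Omega> \<Longrightarrow> f x = 0" "\<And>x. x \<notin> \<Omega> \<Longrightarrow> h x = 0"
  shows "(LINT x|lebesgue. f x * \<phi>' x v) = - (LINT x|lebesgue. h x * \<phi> x)"
proof -
  note t = test_dataD[OF assms(3)]
  have e: "(LINT x:\<Omega>|lebesgue. q x * r x) = (LINT x|lebesgue. q x * r x)" if "\<And>x. x \<notin> \<Omega> \<Longrightarrow> q x = 0" for q r :: "'a \<Rightarrow> real"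
    unfolding set_lebesgue_integral_def by (rule Bochner_Integration.integral_cong) (auto simp: indicator_def that)
  show ?thesis
    using weak_derivative_C1_test[OF assms(1,2) t(1,2,4,5,6)] e[of f] e[of h] assms(4,5) by simp
qed

lemma space_time_lebesgue: "open D \<Longrightarrow> open (space_time D T)" for D :: "'a::euclidean_space set"
  by (simp add: space_time_def open_Times)

lemma lebesgue_on_measurable_iff:
  fixes f :: "'a::euclidean_space \<Rightarrow> 'b::{real_normed_vector, second_countable_topology}"
  shows "S \<in> sets lebesgue \<Longrightarrow> f \<in> borel_measurable (lebesgue_on S) \<longleftrightarrow> (\<lambda>x. indicator S x *\<^sub>R f x) \<in> borel_measurable lebesgue"
  by (rule borel_measurable_restrict_space_iff) simp

lemma AE_lebesgue_on_iff:
  "S \<in> sets lebesgue \<Longrightarrow> (AE x in lebesgue_on S. P x) \<longleftrightarrow> (AE x in lebesgue. x \<in> S \<longrightarrow> P x)" for S :: "'a::euclidean_space set"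
  by (rule AE_restrict_space_iff) simp

text \<open>Weak gradients are unique on almost every slice, component by component; the set of
  agreement is measurable because both gradients are jointly measurable, so Fubini lifts this to
  space-time. It justifies the choice made in \<open>spatial_gradient\<close>.\<close>

lemma L2_W11_unique:
  fixes D :: "(real^'m) set"
  assumes D: "open D" and 1: "L2_W11 D T u G1" and 2: "L2_W11 D T u G2"
  shows "AE z in lebesgue. z \<in> space_time D T \<longrightarrow> G1 z = G2 z"
proof (rule AE_lebesgue_from_slices)
  let ?\<Omega> = "space_time D T"
  have S: "?\<Omega> \<in> sets lebesgue" using space_time_lebesgue[OF D] by simp
  have m: "(\<lambda>z. indicator ?\<Omega> z *\<^sub>R G1 z) \<in> borel_measurable lebesgue" "(\<lambda>z. indicator ?\<Omega> z *\<^sub>R G2 z) \<in> borel_measurable lebesgue"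
    using 1 2 by (simp_all add: L2_W11_def lebesgue_on_measurable_iff[OF S])
  have "{z \<in> space lebesgue. indicator ?\<Omega> z *\<^sub>R G1 z = indicator ?\<Omega> z *\<^sub>R G2 z} \<in> sets lebesgue"
  proof -
    have "(\<lambda>z. indicator ?\<Omega> z *\<^sub>R G1 z - indicator ?\<Omega> z *\<^sub>R G2 z) \<in> borel_measurable lebesgue"
      using m by (rule borel_measurable_diff)
    from measurable_sets[OF this, of "{0}"] show ?thesis by (simp add: vimage_def)
  qed
  moreover have "{z \<in> space lebesgue. indicator ?\<Omega> z *\<^sub>R G1 z = indicator ?\<Omega> z *\<^sub>R G2 z} = {z. z \<in> ?\<Omega> \<longrightarrow> G1 z = G2 z}"
    by (auto simp: indicator_def)
  ultimately show "{z. z \<in> ?\<Omega> \<longrightarrow> G1 z = G2 z} \<in> sets lebesgue" by simp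
  have "AE t in lebesgue. t \<in> {0<..<T} \<longrightarrow> W11 D (\<lambda>x. u (x, t)) (\<lambda>x. G1 (x, t))"
       "AE t in lebesgue. t \<in> {0<..<T} \<longrightarrow> W11 D (\<lambda>x. u (x, t)) (\<lambda>x. G2 (x, t))"
    using 1 2 by (simp_all add: L2_W11_def AE_lebesgue_on_iff)
  then show "AE t in lebesgue. AE x in lebesgue. (x, t) \<in> ?\<Omega> \<longrightarrow> G1 (x, t) = G2 (x, t)"
  proof eventually_elim
    case (elim t)
    show ?case
    proof (cases "t \<in> {0<..<T}")
      case True
      have "AE x in lebesgue. x \<in> D \<longrightarrow> G1 (x, t) $ i = G2 (x, t) $ i" for i
        by (rule weak_derivative_unique[OF D]) (use True elim in \<open>auto simp: W11_def\<close>)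
      then have "AE x in lebesgue. \<forall>i. x \<in> D \<longrightarrow> G1 (x, t) $ i = G2 (x, t) $ i" unfolding AE_all_countable by blast
      then show ?thesis by (rule eventually_mono) (simp add: space_time_def vec_eq_iff)
    next
      case False
      then have "(x, t) \<notin> ?\<Omega>" for x by (auto simp: space_time_def)
      then show ?thesis by simp
    qed
  qed
qed

text \<open>Lets any pair of weak derivatives stand for the chosen ones, and moves the integral to
  the whole space.\<close>

lemma energy_eq:
  fixes D :: "(real^'m) set"
  assumes D: "open D" and G: "L2_W11 D T u G" and w: "L2_time_derivative D T u w"
  shows "energy \<Phi> D T u = (\<integral>\<^sup>+z. ennreal (indicator (space_time D T) z * (\<Phi> (G z) + (w z)\<^sup>2 / 2)) \<partial>lebesgue)"
proof -
  let ?\<Omega> = "space_time D T"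
  have S: "?\<Omega> \<in> sets lebesgue" and o: "open ?\<Omega>" using space_time_lebesgue[OF D] by simp_all
  have g: "L2_W11 D T u (spatial_gradient D T u)" unfolding spatial_gradient_def by (rule someI[of _ G]) (rule G)
  have t: "L2_time_derivative D T u (time_derivative D T u)" unfolding time_derivative_def by (rule someI[of _ w]) (rule w)
  have a1: "AE z in lebesgue. z \<in> ?\<Omega> \<longrightarrow> spatial_gradient D T u z = G z" by (rule L2_W11_unique[OF D g G])
  have a2: "AE z in lebesgue. z \<in> ?\<Omega> \<longrightarrow> time_derivative D T u z = w z"
    by (rule weak_derivative_unique[OF o]) (use t w in \<open>auto simp: L2_time_derivative_def\<close>)
  have "energy \<Phi> D T u = (\<integral>\<^sup>+z. ennreal (\<Phi> (spatial_gradient D T u z) + (time_derivative D T u z)\<^sup>2 / 2) \<partial>lebesgue_on ?\<Omega>)"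
    using w by (auto simp: energy_def)
  also have "\<dots> = (\<integral>\<^sup>+z. ennreal (\<Phi> (spatial_gradient D T u z) + (time_derivative D T u z)\<^sup>2 / 2) * indicator ?\<Omega> z \<partial>lebesgue)"
    by (rule nn_integral_restrict_space) (use S in simp)
  also have "\<dots> = (\<integral>\<^sup>+z. ennreal (indicator ?\<Omega> z * (\<Phi> (G z) + (w z)\<^sup>2 / 2)) \<partial>lebesgue)"
  proof (rule nn_integral_cong_AE)
    show "AE z in lebesgue. ennreal (\<Phi> (spatial_gradient D T u z) + (time_derivative D T u z)\<^sup>2 / 2) * indicator ?\<Omega> z
       = ennreal (indicator ?\<Omega> z * (\<Phi> (G z) + (w z)\<^sup>2 / 2))"
      using a1 a2 by eventually_elim (simp add: indicator_def)
  qed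
  finally show ?thesis .
qed

lemma W11_add:
  assumes "open D" "W11 D f1 g1" "W11 D f2 g2"
  shows "W11 D (\<lambda>x. f1 x + f2 x) (\<lambda>x. g1 x + g2 x)"
  using assms by (auto simp: W11_def intro!: set_integral_add(1) weak_derivative_add)

lemma ennreal_square_add_le: "(x + ennreal c)\<^sup>2 \<le> 2 * x\<^sup>2 + ennreal (2 * c\<^sup>2)" if c: "0 \<le> c"
proof (cases x)
  case (real r)
  have "(r + c)\<^sup>2 + (r - c)\<^sup>2 = 2 * r\<^sup>2 + 2 * c\<^sup>2" by (simp add: power2_eq_square algebra_simps)
  then have k: "(r + c)\<^sup>2 \<le> 2 * r\<^sup>2 + 2 * c\<^sup>2" using zero_le_power2[of "r - c"] by linarith
  have "(x + ennreal c)\<^sup>2 = ennreal ((r + c)\<^sup>2)" using real c by (simp add: ennreal_plus[symmetric] ennreal_power del: ennreal_plus)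
  also have "\<dots> \<le> ennreal (2 * r\<^sup>2 + 2 * c\<^sup>2)" using k by (rule ennreal_leI)
  also have "\<dots> = 2 * x\<^sup>2 + ennreal (2 * c\<^sup>2)"
    using real c by (simp add: ennreal_plus ennreal_power[symmetric] ennreal_mult)
  finally show ?thesis .
qed (simp add: power2_eq_square ennreal_mult_top ennreal_top_mult)

text \<open>On a bounded domain an increase by a constant B adds a constant c to the slice
  integrals, and (I + c)^2 is at most 2 I^2 + 2 c^2, which is integrable over the bounded time
  interval.\<close>

lemma L2_square_add_finite:
  fixes f g :: "(real^'m) \<times> real \<Rightarrow> real"
  assumes D: "open D" "bounded D"
    and m: "(\<lambda>z. indicator (space_time D T) z * f z) \<in> borel_measurable lebesgue" and f: "\<And>z. 0 \<le> f z"
    and fin: "(\<integral>\<^sup>+t. (\<integral>\<^sup>+x. ennreal (f (x, t)) \<partial>lebesgue_on D)\<^sup>2 \<partial>lebesgue_on {0<..<T}) < \<infinity>"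
    and g: "\<And>z. z \<in> space_time D T \<Longrightarrow> g z \<le> f z + B" and B: "0 \<le> B"
    and fs: "AE t in lebesgue_on {0<..<T}. (\<lambda>x. f (x, t)) \<in> borel_measurable (lebesgue_on D)"
  shows "(\<integral>\<^sup>+t. (\<integral>\<^sup>+x. ennreal (g (x, t)) \<partial>lebesgue_on D)\<^sup>2 \<partial>lebesgue_on {0<..<T}) < \<infinity>"
proof -
  define I where "I t = (\<integral>\<^sup>+x. ennreal (f (x, t)) \<partial>lebesgue_on D)" for t
  define c where "c = B * measure lebesgue D"
  have c: "0 \<le> c" using B by (simp add: c_def)
  have DS: "D \<in> sets lebesgue" using D(1) by simp
  have fD: "emeasure lebesgue D = ennreal (measure lebesgue D)"
    using emeasure_bounded_finite[OF D(2)] D(1) by (simp add: emeasure_eq_ennreal_measure)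
  have "(\<lambda>t. \<integral>\<^sup>+x. ennreal (indicator (space_time D T) (x, t) * f (x, t)) \<partial>lebesgue) \<in> borel_measurable lebesgue"
    by (rule lebesgue_nn_integral_slices[OF m])
  then have "(\<lambda>t. \<integral>\<^sup>+x. ennreal (indicator (space_time D T) (x, t) * f (x, t)) \<partial>lebesgue) \<in> borel_measurable (lebesgue_on {0<..<T})"
    by (rule measurable_restrict_space1)
  moreover have "(\<integral>\<^sup>+x. ennreal (indicator (space_time D T) (x, t) * f (x, t)) \<partial>lebesgue) = I t" if "t \<in> {0<..<T}" for t
  proof -
    have "I t = (\<integral>\<^sup>+x. ennreal (f (x, t)) * indicator D x \<partial>lebesgue)"
      unfolding I_def by (rule nn_integral_restrict_space) (use DS in simp)
    also have "\<dots> = (\<integral>\<^sup>+x. ennreal (indicator (space_time D T) (x, t) * f (x, t)) \<partial>lebesgue)"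
      by (rule nn_integral_cong) (use that in \<open>auto simp: indicator_def space_time_def\<close>)
    finally show ?thesis by simp
  qed
  ultimately have Im: "I \<in> borel_measurable (lebesgue_on {0<..<T})"
    by (subst measurable_cong[where g="\<lambda>t. \<integral>\<^sup>+x. ennreal (indicator (space_time D T) (x, t) * f (x, t)) \<partial>lebesgue"]) auto
  have le: "AE t in lebesgue_on {0<..<T}. (\<integral>\<^sup>+x. ennreal (g (x, t)) \<partial>lebesgue_on D)\<^sup>2 \<le> 2 * (I t)\<^sup>2 + ennreal (2 * c\<^sup>2)"
    using fs AE_space
  proof eventually_elim
    case (elim t)
    have "(\<integral>\<^sup>+x. ennreal (g (x, t)) \<partial>lebesgue_on D) \<le> (\<integral>\<^sup>+x. ennreal (f (x, t)) + ennreal B \<partial>lebesgue_on D)"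
    proof (rule nn_integral_mono)
      fix x assume "x \<in> space (lebesgue_on D)"
      then have "(x, t) \<in> space_time D T" using elim(2) by (auto simp: space_time_def space_restrict_space)
      from g[OF this] show "ennreal (g (x, t)) \<le> ennreal (f (x, t)) + ennreal B"
        using f B by (simp add: ennreal_plus[symmetric] ennreal_leI del: ennreal_plus)
    qed
    also have "\<dots> = I t + (\<integral>\<^sup>+x. ennreal B \<partial>lebesgue_on D)"
      unfolding I_def using elim(1) by (intro nn_integral_add) auto
    also have "(\<integral>\<^sup>+x. ennreal B \<partial>lebesgue_on D) = ennreal c"
      using fD B DS by (simp add: c_def emeasure_restrict_space space_restrict_space ennreal_mult)
    finally have "(\<integral>\<^sup>+x. ennreal (g (x, t)) \<partial>lebesgue_on D)\<^sup>2 \<le> (I t + ennreal c)\<^sup>2" by (rule power_mono) simp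
    also have "\<dots> \<le> 2 * (I t)\<^sup>2 + ennreal (2 * c\<^sup>2)" by (rule ennreal_square_add_le[OF c])
    finally show ?case .
  qed
  have "(\<integral>\<^sup>+t. (\<integral>\<^sup>+x. ennreal (g (x, t)) \<partial>lebesgue_on D)\<^sup>2 \<partial>lebesgue_on {0<..<T}) \<le> (\<integral>\<^sup>+t. 2 * (I t)\<^sup>2 + ennreal (2 * c\<^sup>2) \<partial>lebesgue_on {0<..<T})"
    by (rule nn_integral_mono_AE[OF le])
  also have "\<dots> = 2 * (\<integral>\<^sup>+t. (I t)\<^sup>2 \<partial>lebesgue_on {0<..<T}) + ennreal (2 * c\<^sup>2) * emeasure lebesgue {0<..<T}"
    using Im by (simp add: nn_integral_add nn_integral_cmult emeasure_restrict_space space_restrict_space)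
  also have "\<dots> < \<infinity>"
    using fin emeasure_bounded_finite[of "{0<..<T}"] by (auto simp: I_def ennreal_mult_less_top ennreal_add_less_top)
  finally show ?thesis .
qed

text \<open>A competitor is built from u and any C^1 barrier b with bounded gradient gb; the
  specific barrier and its subsolution property enter only later.\<close>

locale truncation =
  fixes D :: "(real^'m) set" and T :: real and u :: "(real^'m) \<times> real \<Rightarrow> real"
    and G :: "(real^'m) \<times> real \<Rightarrow> real^'m" and ut b :: "(real^'m) \<times> real \<Rightarrow> real"
    and gb :: "(real^'m) \<times> real \<Rightarrow> (real^'m) \<times> real" and Bb :: real
  assumes D: "open D" "bounded D" and T: "0 < T"
    and G: "L2_W11 D T u G" and ut: "L2_time_derivative D T u ut"
    and b: "\<And>z. z \<in> space_time D T \<Longrightarrow> (b has_derivative (\<lambda>h. gb z \<bullet> h)) (at z)"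
    and gb: "continuous_on (space_time D T) gb"
    and Bb: "\<And>z. z \<in> space_time D T \<Longrightarrow> \<bar>b z\<bar> \<le> Bb" "\<And>z. z \<in> space_time D T \<Longrightarrow> norm (gb z) \<le> Bb" "0 \<le> Bb"
begin

abbreviation \<Omega> where "\<Omega> \<equiv> space_time D T"

definition a where "a z = clip (b z - u z)"
text \<open>The competitor is \<open>u + W\<close>; \<open>Vs\<close> and \<open>Vt\<close> are the
  weak space and time derivatives of its increment, and \<open>a\<close> is the slope of
  \<open>pen\<close>. All three vanish off the cylinder so that integrals run over the whole
  space.\<close>

definition W where "W z = (if z \<in> \<Omega> then pen (b z - u z) else 0)"
definition Vs where "Vs z = (if z \<in> \<Omega> then a z *\<^sub>R (fst (gb z) - G z) else 0)"
definition Vt where "Vt z = (if z \<in> \<Omega> then a z * (snd (gb z) - ut z) else 0)"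

lemma open_\<Omega>: "open \<Omega>" using D(1) by (rule space_time_lebesgue)

lemma sets_\<Omega>: "\<Omega> \<in> sets lebesgue" using open_\<Omega> by simp

lemma bounded_\<Omega>: "bounded \<Omega>" using D(2) by (simp add: space_time_def bounded_Times)

lemma continuous_b: "continuous_on \<Omega> b"
  using b by (meson continuous_at_imp_continuous_on has_derivative_continuous)

lemma measurable_data:
  "(\<lambda>z. indicator \<Omega> z *\<^sub>R u z) \<in> borel_measurable lebesgue"
  "(\<lambda>z. indicator \<Omega> z *\<^sub>R G z) \<in> borel_measurable lebesgue"
  "(\<lambda>z. indicator \<Omega> z *\<^sub>R ut z) \<in> borel_measurable lebesgue"
  "(\<lambda>z. indicator \<Omega> z *\<^sub>R b z) \<in> borel_measurable lebesgue"
  "(\<lambda>z. indicator \<Omega> z *\<^sub>R gb z) \<in> borel_measurable lebesgue"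
  using G ut continuous_imp_measurable_on_sets_lebesgue[OF continuous_b sets_\<Omega>] continuous_imp_measurable_on_sets_lebesgue[OF gb sets_\<Omega>]
  by (simp_all add: L2_W11_def L2_time_derivative_def lebesgue_on_measurable_iff[OF sets_\<Omega>])

lemma pen_borel: "pen \<in> borel_measurable borel"
  unfolding pen_def[abs_def] by measurable

lemma clip_borel: "clip \<in> borel_measurable borel"
  unfolding clip_def[abs_def] by measurable

lemma W_eq: "W = (\<lambda>z. pen (indicator \<Omega> z *\<^sub>R b z - indicator \<Omega> z *\<^sub>R u z))"
  by (auto simp: W_def fun_eq_iff pen_def)

lemma Vs_eq: "Vs = (\<lambda>z. clip (indicator \<Omega> z *\<^sub>R b z - indicator \<Omega> z *\<^sub>R u z) *\<^sub>R (fst (indicator \<Omega> z *\<^sub>R gb z) - indicator \<Omega> z *\<^sub>R G z))"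
  by (auto simp: Vs_def a_def fun_eq_iff)

lemma Vt_eq: "Vt = (\<lambda>z. clip (indicator \<Omega> z *\<^sub>R b z - indicator \<Omega> z *\<^sub>R u z) * (snd (indicator \<Omega> z *\<^sub>R gb z) - indicator \<Omega> z *\<^sub>R ut z))"
  by (auto simp: Vt_def a_def fun_eq_iff)

lemma measurable_fst_snd:
  fixes f :: "'a \<Rightarrow> (real^'m) \<times> real"
  assumes "f \<in> borel_measurable M"
  shows "(\<lambda>x. fst (f x)) \<in> borel_measurable M" "(\<lambda>x. snd (f x)) \<in> borel_measurable M"
  using borel_measurable_continuous_onI[OF continuous_on_fst[OF continuous_on_id]] borel_measurable_continuous_onI[OF continuous_on_snd[OF continuous_on_id]]
    measurable_compose[OF assms] by blast+

lemma measurable_a: "(\<lambda>z. clip (indicator \<Omega> z *\<^sub>R b z - indicator \<Omega> z *\<^sub>R u z)) \<in> borel_measurable lebesgue"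
  by (intro measurable_compose[OF _ clip_borel] borel_measurable_diff measurable_data)

lemma measurable_WV: "W \<in> borel_measurable lebesgue" "Vs \<in> borel_measurable lebesgue" "Vt \<in> borel_measurable lebesgue"
proof -
  show "W \<in> borel_measurable lebesgue" unfolding W_eq
    by (intro measurable_compose[OF _ pen_borel] borel_measurable_diff measurable_data)
  show "Vs \<in> borel_measurable lebesgue" unfolding Vs_eq
    by (intro borel_measurable_scaleR measurable_a borel_measurable_diff measurable_fst_snd measurable_data)
  show "Vt \<in> borel_measurable lebesgue" unfolding Vt_eq
    by (intro borel_measurable_times measurable_a borel_measurable_diff measurable_fst_snd measurable_data)
qed

lemma a_bounds: "0 \<le> a z" "a z \<le> 1" by (simp_all add: a_def clip_props)

lemma W_nonneg: "0 \<le> W z" by (simp add: W_def pen_props)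

lemma W_outside: "z \<notin> \<Omega> \<Longrightarrow> W z = 0" "z \<notin> \<Omega> \<Longrightarrow> Vs z = 0" "z \<notin> \<Omega> \<Longrightarrow> Vt z = 0"
  by (simp_all add: W_def Vs_def Vt_def)

lemma W_le: "W z \<le> \<bar>u z\<bar> + Bb"
  using pen_props(2)[of "b z - u z"] Bb(1)[of z] Bb(3) by (auto simp: W_def)

lemma W_sum: "z \<in> \<Omega> \<Longrightarrow> \<bar>u z + W z\<bar> \<le> \<bar>u z\<bar> + Bb"
  using pen_props(1,2)[of "b z - u z"] Bb(1)[of z] Bb(3) by (auto simp: W_def max_def split: if_splits)

lemma Vs_bound: "norm (Vs z) \<le> norm (G z) + Bb"
proof (cases "z \<in> \<Omega>")
  case True
  have "norm (Vs z) \<le> 1 * norm (fst (gb z) - G z)"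
    unfolding Vs_def norm_scaleR using a_bounds[of z] True by (simp add: mult_left_le_one_le)
  also have "\<dots> \<le> norm (fst (gb z)) + norm (G z)" using norm_triangle_ineq4[of "fst (gb z)" "G z"] by simp
  also have "norm (fst (gb z)) \<le> Bb" using norm_fst_le[of "fst (gb z)" "snd (gb z)"] Bb(2)[OF True] by simp
  finally show ?thesis by simp
qed (simp add: Vs_def Bb)

text \<open>The gradient of the competitor is the convex combination of \<open>G z\<close> and the
  gradient of the barrier with weight \<open>a z\<close>.\<close>

lemma Gv_bound: "z \<in> \<Omega> \<Longrightarrow> norm (G z + Vs z) \<le> norm (G z) + Bb"
proof -
  assume z: "z \<in> \<Omega>"
  have "G z + Vs z = (1 - a z) *\<^sub>R G z + a z *\<^sub>R fst (gb z)" using z by (simp add: Vs_def algebra_simps)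
  also have "norm \<dots> \<le> (1 - a z) * norm (G z) + a z * norm (fst (gb z))"
    using a_bounds[of z] norm_triangle_ineq[of "(1 - a z) *\<^sub>R G z" "a z *\<^sub>R fst (gb z)"] by simp
  also have "\<dots> \<le> 1 * norm (G z) + 1 * Bb"
    using a_bounds[of z] Bb(2)[OF z] norm_fst_le[of "fst (gb z)" "snd (gb z)"] Bb(3)
    by (intro add_mono mult_mono) auto
  finally show ?thesis by simp
qed

lemma Vt_bound: "\<bar>Vt z\<bar> \<le> (if z \<in> \<Omega> then \<bar>ut z\<bar> + Bb else 0)"
proof (cases "z \<in> \<Omega>")
  case True
  have "\<bar>Vt z\<bar> \<le> 1 * \<bar>snd (gb z) - ut z\<bar>"
    using a_bounds[of z] True by (simp add: Vt_def abs_mult mult_left_le_one_le)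
  also have "\<dots> \<le> \<bar>snd (gb z)\<bar> + \<bar>ut z\<bar>" unfolding mult_1 by (rule abs_triangle_ineq4)
  also have "\<dots> \<le> Bb + \<bar>ut z\<bar>" using norm_snd_le[of "snd (gb z)" "fst (gb z)"] Bb(2)[OF True] by (simp add: add_right_mono)
  finally show ?thesis using True by (simp add: add.commute)
qed (simp add: Vt_def)

lemma weak_time: "weak_derivative \<Omega> (0, 1) W Vt"
proof -
  have "continuous_on \<Omega> (\<lambda>x. gb x \<bullet> (0, 1))" by (intro continuous_intros gb)
  from weak_derivative_C1[OF open_\<Omega> b this] have "weak_derivative \<Omega> (0, 1) b (\<lambda>x. gb x \<bullet> (0, 1))" .
  moreover have "weak_derivative \<Omega> (0, 1) u ut" using ut by (simp add: L2_time_derivative_def)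
  ultimately have "weak_derivative \<Omega> (0, 1) (\<lambda>z. b z - u z) (\<lambda>z. gb z \<bullet> (0, 1) - ut z)" by (rule weak_derivative_diff)
  from weak_derivative_chain[OF this open_\<Omega> pen_deriv]
  have "weak_derivative \<Omega> (0, 1) (\<lambda>x. pen (b x - u x)) (\<lambda>x. clip (b x - u x) * (gb x \<bullet> (0, 1) - ut x))"
    using clip_props(1,2,3) pen_props(3) by simp
  then show ?thesis by (rule weak_derivative_cong) (auto simp: W_def Vt_def a_def inner_prod_def)
qed

lemma parts_time: "test_data \<Omega> \<phi> \<phi>' K \<Longrightarrow> (LINT z|lebesgue. W z * \<phi>' z (0, 1)) = - (LINT z|lebesgue. Vt z * \<phi> z)"
  by (rule weak_derivative_test_data[OF weak_time open_\<Omega>]) (auto simp: W_outside)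

lemma W11_slice:
  assumes t: "t \<in> {0<..<T}" and w: "W11 D (\<lambda>x. u (x, t)) (\<lambda>x. G (x, t))"
  shows "W11 D (\<lambda>x. W (x, t)) (\<lambda>x. Vs (x, t))"
proof -
  have in\<Omega>: "(x, t) \<in> \<Omega> \<longleftrightarrow> x \<in> D" for x using t by (simp add: space_time_def)
  have DS: "D \<in> sets lebesgue" using D(1) by simp
  have p: "((\<lambda>x. (x, t)) has_derivative (\<lambda>h. (h, 0))) (at x)" for x :: "real^'m" by (auto intro!: derivative_eq_intros)
  have bd: "((\<lambda>x. b (x, t)) has_derivative (\<lambda>h. fst (gb (x, t)) \<bullet> h)) (at x)" if x: "x \<in> D" for x
    by (rule has_derivative_eq_rhs[OF has_derivative_compose[OF p b]]) (use x t in \<open>auto simp: space_time_def inner_prod_def\<close>)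
  have bc: "continuous_on D (\<lambda>x. b (x, t))"
    by (rule continuous_on_compose2[OF continuous_b]) (use t in \<open>auto intro!: continuous_intros simp: space_time_def\<close>)
  have gc: "continuous_on D (\<lambda>x. fst (gb (x, t)))"
    by (intro continuous_on_fst continuous_on_compose2[OF gb]) (use t in \<open>auto intro!: continuous_intros simp: space_time_def\<close>)
  have "weak_derivative D (axis i 1) (\<lambda>x. W (x, t)) (\<lambda>x. Vs (x, t) $ i)" for i
  proof -
    have "continuous_on D (\<lambda>x. fst (gb (x, t)) \<bullet> axis i 1)" by (intro continuous_intros gc)
    from weak_derivative_C1[OF D(1) bd this]
    have "weak_derivative D (axis i 1) (\<lambda>x. b (x, t)) (\<lambda>x. fst (gb (x, t)) \<bullet> axis i 1)" .
    moreover have "weak_derivative D (axis i 1) (\<lambda>x. u (x, t)) (\<lambda>x. G (x, t) $ i)" using w by (simp add: W11_def)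
    ultimately have "weak_derivative D (axis i 1) (\<lambda>x. b (x, t) - u (x, t)) (\<lambda>x. fst (gb (x, t)) \<bullet> axis i 1 - G (x, t) $ i)"
      by (rule weak_derivative_diff)
    from weak_derivative_chain[OF this D(1) pen_deriv]
    have "weak_derivative D (axis i 1) (\<lambda>x. pen (b (x, t) - u (x, t))) (\<lambda>x. clip (b (x, t) - u (x, t)) * (fst (gb (x, t)) \<bullet> axis i 1 - G (x, t) $ i))"
      using clip_props(1,2,3) pen_props(3) by simp
    then show ?thesis
      by (rule weak_derivative_cong) (auto simp: W_def Vs_def a_def in\<Omega> inner_axis)
  qed
  moreover have iu: "integrable lebesgue (\<lambda>x. indicator D x *\<^sub>R u (x, t))" and iG: "integrable lebesgue (\<lambda>x. indicator D x *\<^sub>R G (x, t))"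
    using w by (simp_all add: W11_def set_integrable_def)
  have iD: "integrable lebesgue (\<lambda>x. indicator D x * Bb)"
    using emeasure_bounded_finite[OF D(2)] D(1) by (simp add: integrable_real_indicator)
  have mb: "(\<lambda>x. indicator D x *\<^sub>R b (x, t)) \<in> borel_measurable lebesgue" "(\<lambda>x. indicator D x *\<^sub>R fst (gb (x, t))) \<in> borel_measurable lebesgue"
    using continuous_imp_measurable_on_sets_lebesgue[OF bc DS] continuous_imp_measurable_on_sets_lebesgue[OF gc DS]
    by (simp_all add: lebesgue_on_measurable_iff[OF DS])
  have We: "(\<lambda>x. W (x, t)) = (\<lambda>x. pen (indicator D x *\<^sub>R b (x, t) - indicator D x *\<^sub>R u (x, t)))"
    by (auto simp: W_def fun_eq_iff pen_def in\<Omega>)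
  have Ve: "(\<lambda>x. Vs (x, t)) = (\<lambda>x. clip (indicator D x *\<^sub>R b (x, t) - indicator D x *\<^sub>R u (x, t)) *\<^sub>R (indicator D x *\<^sub>R fst (gb (x, t)) - indicator D x *\<^sub>R G (x, t)))"
    by (auto simp: Vs_def a_def fun_eq_iff in\<Omega>)
  have Wm: "(\<lambda>x. W (x, t)) \<in> borel_measurable lebesgue" unfolding We
    by (intro measurable_compose[OF _ pen_borel] borel_measurable_diff mb borel_measurable_integrable[OF iu])
  have Vm: "(\<lambda>x. Vs (x, t)) \<in> borel_measurable lebesgue" unfolding Ve
    by (intro borel_measurable_scaleR measurable_compose[OF _ clip_borel] borel_measurable_diff mb borel_measurable_integrable[OF iu] borel_measurable_integrable[OF iG])
  have iW: "integrable lebesgue (\<lambda>x. W (x, t))"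
  proof (rule Bochner_Integration.integrable_bound[OF Bochner_Integration.integrable_add[OF integrable_abs[OF iu] iD] Wm])
    show "AE x in lebesgue. norm (W (x, t)) \<le> norm (\<bar>indicator D x *\<^sub>R u (x, t)\<bar> + indicator D x * Bb)"
      using W_le[of "(_, t)"] W_nonneg Bb(3) by (intro always_eventually) (auto simp: indicator_def in\<Omega> W_outside abs_of_nonneg)
  qed
  have iV: "integrable lebesgue (\<lambda>x. Vs (x, t))"
  proof (rule Bochner_Integration.integrable_bound[OF Bochner_Integration.integrable_add[OF integrable_norm[OF iG] iD] Vm])
    show "AE x in lebesgue. norm (Vs (x, t)) \<le> norm (norm (indicator D x *\<^sub>R G (x, t)) + indicator D x * Bb)"
      using Vs_bound[of "(_, t)"] Bb(3) by (intro always_eventually) (auto simp: indicator_def in\<Omega> W_outside abs_of_nonneg)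
  qed
  have "(\<lambda>x. indicator D x *\<^sub>R W (x, t)) = (\<lambda>x. W (x, t))" "(\<lambda>x. indicator D x *\<^sub>R Vs (x, t)) = (\<lambda>x. Vs (x, t))"
    by (auto simp: fun_eq_iff indicator_def in\<Omega> W_outside)
  then have "(\<lambda>x. W (x, t)) absolutely_integrable_on D" "(\<lambda>x. Vs (x, t)) absolutely_integrable_on D"
    using iW iV by (simp_all add: set_integrable_def)
  ultimately show ?thesis by (simp add: W11_def)
qed

lemma parts_space:
  assumes t: "t \<in> {0<..<T}" and w: "W11 D (\<lambda>x. u (x, t)) (\<lambda>x. G (x, t))" and \<phi>: "test_data D \<phi> \<phi>' K"
  shows "(LINT x|lebesgue. W (x, t) * \<phi>' x (axis i 1)) = - (LINT x|lebesgue. Vs (x, t) $ i * \<phi> x)"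
  by (rule weak_derivative_test_data[OF _ D(1) \<phi>]) (use W11_slice[OF t w] in \<open>auto simp: W11_def W_outside space_time_def\<close>)

lemma slices_W11: "AE t in lebesgue. t \<in> {0<..<T} \<longrightarrow> W11 D (\<lambda>x. u (x, t)) (\<lambda>x. G (x, t))"
  using G by (simp add: L2_W11_def AE_lebesgue_on_iff)

lemma L2_W11_v: "L2_W11 D T (\<lambda>z. u z + W z) (\<lambda>z. G z + Vs z)"
proof -
  have m: "(\<lambda>z. indicator \<Omega> z * (\<bar>u z\<bar> + norm (G z))) \<in> borel_measurable lebesgue"
  proof -
    have "(\<lambda>z. \<bar>indicator \<Omega> z *\<^sub>R u z\<bar> + norm (indicator \<Omega> z *\<^sub>R G z)) \<in> borel_measurable lebesgue"
      by (intro borel_measurable_add borel_measurable_abs measurable_compose[OF _ borel_measurable_norm] measurable_data)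
    moreover have "(\<lambda>z. \<bar>indicator \<Omega> z *\<^sub>R u z\<bar> + norm (indicator \<Omega> z *\<^sub>R G z)) = (\<lambda>z. indicator \<Omega> z * (\<bar>u z\<bar> + norm (G z)))"
      by (auto simp: indicator_def)
    ultimately show ?thesis by simp
  qed
  have sl: "AE t in lebesgue_on {0<..<T}. (\<lambda>x. \<bar>u (x, t)\<bar> + norm (G (x, t))) \<in> borel_measurable (lebesgue_on D)"
  proof -
    have "AE t in lebesgue_on {0<..<T}. W11 D (\<lambda>x. u (x, t)) (\<lambda>x. G (x, t))" using G by (simp add: L2_W11_def)
    then show ?thesis
    proof (rule eventually_mono)
      fix t assume "W11 D (\<lambda>x. u (x, t)) (\<lambda>x. G (x, t))"
      then have "integrable (lebesgue_on D) (\<lambda>x. u (x, t))" "integrable (lebesgue_on D) (\<lambda>x. G (x, t))"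
        using D(1) by (simp_all add: W11_def absolutely_integrable_on_def[symmetric] set_integrable_def integrable_restrict_space)
      then show "(\<lambda>x. \<bar>u (x, t)\<bar> + norm (G (x, t))) \<in> borel_measurable (lebesgue_on D)" by auto
    qed
  qed
  have fin: "(\<integral>\<^sup>+t. (\<integral>\<^sup>+x. ennreal (\<bar>u (x, t)\<bar> + norm (G (x, t))) \<partial>lebesgue_on D)\<^sup>2 \<partial>lebesgue_on {0<..<T}) < \<infinity>"
    using G by (simp add: L2_W11_def)
  have "(\<integral>\<^sup>+t. (\<integral>\<^sup>+x. ennreal (\<bar>u (x, t) + W (x, t)\<bar> + norm (G (x, t) + Vs (x, t))) \<partial>lebesgue_on D)\<^sup>2 \<partial>lebesgue_on {0<..<T}) < \<infinity>"
  proof (rule L2_square_add_finite[where f="\<lambda>z. \<bar>u z\<bar> + norm (G z)" and g="\<lambda>z. \<bar>u z + W z\<bar> + norm (G z + Vs z)" and B="2 * Bb", OF D m _ fin _ _ sl])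
    show "\<bar>u z + W z\<bar> + norm (G z + Vs z) \<le> \<bar>u z\<bar> + norm (G z) + 2 * Bb" if "z \<in> \<Omega>" for z
      using W_sum[OF that] Gv_bound[OF that] by linarith
  qed (use Bb in auto)
  moreover have "AE t in lebesgue_on {0<..<T}. W11 D (\<lambda>x. u (x, t) + W (x, t)) (\<lambda>x. G (x, t) + Vs (x, t))"
    unfolding AE_lebesgue_on_iff[OF lmeasurable_interval(2)[THEN fmeasurableD], simplified]
    using slices_W11 by (rule eventually_mono) (use W11_add[OF D(1)] W11_slice in auto)
  moreover have "(\<lambda>z. u z + W z) \<in> borel_measurable (lebesgue_on \<Omega>)" "(\<lambda>z. G z + Vs z) \<in> borel_measurable (lebesgue_on \<Omega>)"
    using G borel_measurable_add[OF _ measurable_restrict_space1[OF measurable_WV(1)]] borel_measurable_add[OF _ measurable_restrict_space1[OF measurable_WV(2)]]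
    by (simp_all add: L2_W11_def)
  ultimately show ?thesis by (simp add: L2_W11_def)
qed

lemma ut_square_integrable: "integrable lebesgue (\<lambda>z. indicator \<Omega> z * (ut z)\<^sup>2)"
proof (rule integrableI_nonneg)
  have "(\<lambda>z. (indicator \<Omega> z *\<^sub>R ut z)\<^sup>2) \<in> borel_measurable lebesgue" by (intro borel_measurable_power measurable_data)
  moreover have "(\<lambda>z. (indicator \<Omega> z *\<^sub>R ut z)\<^sup>2) = (\<lambda>z. indicator \<Omega> z * (ut z)\<^sup>2)" by (auto simp: indicator_def)
  ultimately show "(\<lambda>z. indicator \<Omega> z * (ut z)\<^sup>2) \<in> borel_measurable lebesgue" by simp
  have "(\<integral>\<^sup>+z. ennreal ((ut z)\<^sup>2) \<partial>lebesgue_on \<Omega>) = (\<integral>\<^sup>+z. ennreal ((ut z)\<^sup>2) * indicator \<Omega> z \<partial>lebesgue)"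
    by (rule nn_integral_restrict_space) (use sets_\<Omega> in simp)
  also have "\<dots> = (\<integral>\<^sup>+z. ennreal (indicator \<Omega> z * (ut z)\<^sup>2) \<partial>lebesgue)"
    by (rule nn_integral_cong) (auto simp: indicator_def)
  finally show "(\<integral>\<^sup>+z. ennreal (indicator \<Omega> z * (ut z)\<^sup>2) \<partial>lebesgue) < \<infinity>"
    using ut by (simp add: L2_time_derivative_def)
qed simp

lemma const_integrable: "integrable lebesgue (\<lambda>z. indicator \<Omega> z * c :: real)"
  using emeasure_bounded_finite[OF bounded_\<Omega>] open_\<Omega> by (simp add: integrable_real_indicator)

lemma L2_time_derivative_v: "L2_time_derivative D T (\<lambda>z. u z + W z) (\<lambda>z. ut z + Vt z)"
proof -
  have "weak_derivative \<Omega> (0, 1) (\<lambda>z. u z + W z) (\<lambda>z. ut z + Vt z)"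
    by (rule weak_derivative_add[OF open_\<Omega> _ weak_time]) (use ut in \<open>simp add: L2_time_derivative_def\<close>)
  moreover have "(\<lambda>z. ut z + Vt z) \<in> borel_measurable (lebesgue_on \<Omega>)"
    by (rule borel_measurable_add[OF _ measurable_restrict_space1[OF measurable_WV(3)]]) (use ut in \<open>simp add: L2_time_derivative_def\<close>)
  moreover have "(\<integral>\<^sup>+z. ennreal ((ut z + Vt z)\<^sup>2) \<partial>lebesgue_on \<Omega>) < \<infinity>"
  proof -
    have i: "integrable lebesgue (\<lambda>z. 8 * (indicator \<Omega> z * (ut z)\<^sup>2) + indicator \<Omega> z * (2 * Bb\<^sup>2))"
      using ut_square_integrable const_integrable[of "2 * Bb\<^sup>2"] by auto
    have "(\<integral>\<^sup>+z. ennreal ((ut z + Vt z)\<^sup>2) \<partial>lebesgue_on \<Omega>) = (\<integral>\<^sup>+z. ennreal ((ut z + Vt z)\<^sup>2) * indicator \<Omega> z \<partial>lebesgue)"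
      by (rule nn_integral_restrict_space) (use sets_\<Omega> in simp)
    also have "\<dots> \<le> (\<integral>\<^sup>+z. ennreal (8 * (indicator \<Omega> z * (ut z)\<^sup>2) + indicator \<Omega> z * (2 * Bb\<^sup>2)) \<partial>lebesgue)"
    proof (rule nn_integral_mono)
      fix z
      have "(ut z + Vt z)\<^sup>2 \<le> 8 * (ut z)\<^sup>2 + 2 * Bb\<^sup>2" if "z \<in> \<Omega>"
      proof -
        have "\<bar>ut z + Vt z\<bar> \<le> 2 * \<bar>ut z\<bar> + Bb" using Vt_bound[of z] that by (simp split: if_splits)
        then have "(ut z + Vt z)\<^sup>2 \<le> (2 * \<bar>ut z\<bar> + Bb)\<^sup>2" using abs_le_square_iff Bb(3) by (metis abs_ge_zero abs_of_nonneg add_nonneg_nonneg mult_2)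
        also have "\<dots> \<le> 8 * (ut z)\<^sup>2 + 2 * Bb\<^sup>2"
          using zero_le_power2[of "2 * \<bar>ut z\<bar> - Bb"] by (simp add: power2_eq_square algebra_simps)
        finally show ?thesis .
      qed
      then show "ennreal ((ut z + Vt z)\<^sup>2) * indicator \<Omega> z \<le> ennreal (8 * (indicator \<Omega> z * (ut z)\<^sup>2) + indicator \<Omega> z * (2 * Bb\<^sup>2))"
        by (auto simp: indicator_def ennreal_plus[symmetric] simp del: ennreal_plus intro!: ennreal_leI)
    qed
    also have "\<dots> < \<infinity>" using nn_integral_eq_integral[OF i] by (simp add: indicator_def)
    finally show ?thesis .
  qed
  ultimately show ?thesis by (simp add: L2_time_derivative_def)
qed

end

text \<open>Here p and r are the derivatives of the barrier, G and w those of u. Convexity of the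
  integrand along the segment from G to p bounds its change by a times the difference of end values,
  and the tangent plane at p, not at G, bounds that by the flux at p plus \<delta>. For the
  quadratic part, the change is a w (r - w) + a^2 (r - w)^2 / 2, and a^2 \<le> 2 a turns this into
  at most a r (r - w).\<close>

lemma truncated_energy_density:
  fixes A :: "real^'m^'m"
  assumes A: "sym_pos_def A" and \<delta>: "\<delta> > 0" and a: "0 \<le> a" "a \<le> 1"
  shows "aniso A (G + a *\<^sub>R (p - G)) + (w + a * (r - w))\<^sup>2 / 2
    \<le> aniso A G + w\<^sup>2 / 2 + (\<delta> + flux A \<delta> p \<bullet> (a *\<^sub>R (p - G)) + r * (a * (r - w)))"
proof -
  have "aniso_reg A \<delta> p - aniso_reg A \<delta> G \<le> flux A \<delta> p \<bullet> (p - G)"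
  proof -
    have "flux A \<delta> p \<bullet> (p - G) = - ((A *v p) \<bullet> (G - p) / aniso_reg A \<delta> p)"
      by (simp add: flux_def[OF A] inner_diff_right diff_divide_distrib)
    then show ?thesis using aniso_reg_convex[OF A \<delta>, of p G] by linarith
  qed
  then have "aniso A p - aniso A G \<le> \<delta> + flux A \<delta> p \<bullet> (p - G)"
    using aniso_le_reg[OF A, of p \<delta>] aniso_reg_le[OF A \<delta>, of G] by linarith
  then have "a * (aniso A p - aniso A G) \<le> a * (\<delta> + flux A \<delta> p \<bullet> (p - G))" using a by (intro mult_left_mono)
  also have "\<dots> \<le> \<delta> + flux A \<delta> p \<bullet> (a *\<^sub>R (p - G))"
    using a \<delta> by (simp add: distrib_left mult_left_le_one_le)
  finally have 1: "aniso A (G + a *\<^sub>R (p - G)) \<le> aniso A G + (\<delta> + flux A \<delta> p \<bullet> (a *\<^sub>R (p - G)))"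
    using aniso_convex[OF A a, of G p] by linarith
  have "a * a \<le> 2 * a" using a by (intro mult_right_mono) auto
  then have "(a * a) * (r - w)\<^sup>2 \<le> (2 * a) * (r - w)\<^sup>2" by (rule mult_right_mono) simp
  moreover have "(w + a * (r - w))\<^sup>2 = w\<^sup>2 + 2 * (a * (w * (r - w))) + (a * a) * (r - w)\<^sup>2"
    "r * (a * (r - w)) = a * (w * (r - w)) + a * (r - w)\<^sup>2"
    by (simp_all add: power2_eq_square algebra_simps)
  ultimately have "(w + a * (r - w))\<^sup>2 / 2 \<le> w\<^sup>2 / 2 + r * (a * (r - w))" by linarith
  with 1 show ?thesis by linarith
qed

context truncation
begin

lemma gb_components: "z \<in> \<Omega> \<Longrightarrow> norm (fst (gb z)) \<le> Bb" "z \<in> \<Omega> \<Longrightarrow> \<bar>snd (gb z)\<bar> \<le> Bb"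
  using norm_fst_le[of "fst (gb z)" "snd (gb z)"] norm_snd_le[of "snd (gb z)" "fst (gb z)"] Bb(2)[of z] by auto

lemma Vt_integrable: "integrable lebesgue Vt"
proof (rule Bochner_Integration.integrable_bound[OF Bochner_Integration.integrable_add[OF ut_square_integrable const_integrable[of "1 + Bb"]] measurable_WV(3)])
  have "\<bar>Vt z\<bar> \<le> \<bar>indicator \<Omega> z * (ut z)\<^sup>2 + indicator \<Omega> z * (1 + Bb)\<bar>" for z
  proof (cases "z \<in> \<Omega>")
    case True
    have "0 \<le> (\<bar>ut z\<bar> - 1)\<^sup>2" by simp
    then have "2 * \<bar>ut z\<bar> \<le> (ut z)\<^sup>2 + 1" by (simp add: power2_eq_square algebra_simps)
    moreover have "0 \<le> (ut z)\<^sup>2" by simp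
    ultimately show ?thesis using Vt_bound[of z] True Bb(3) by simp
  qed (simp add: W_outside)
  then show "AE z in lebesgue. norm (Vt z) \<le> norm (indicator \<Omega> z * (ut z)\<^sup>2 + indicator \<Omega> z * (1 + Bb))" by simp
qed

text \<open>Integrating \<open>truncated_energy_density\<close> gives a first-order inequality in
  which u appears only through \<open>Vs\<close> and \<open>Vt\<close>. Finiteness of the energy is
  what allows the energy of u to be subtracted on both sides.\<close>

lemma energy_inequality:
  assumes A: "sym_pos_def A" and card: "CARD('m) \<ge> 2" and \<delta>: "\<delta> > 0"
    and fin: "energy (aniso A) D T u < \<infinity>"
    and min: "energy (aniso A) D T u \<le> energy (aniso A) D T (\<lambda>z. u z + W z)"
  shows "integrable lebesgue Vs" "integrable lebesgue (\<lambda>z. flux A \<delta> (fst (gb z)) \<bullet> Vs z)" "integrable lebesgue (\<lambda>z. Vt z * snd (gb z))"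
    "0 \<le> \<delta> * measure lebesgue \<Omega> + (LINT z|lebesgue. flux A \<delta> (fst (gb z)) \<bullet> Vs z) + (LINT z|lebesgue. Vt z * snd (gb z))"
proof -
  define f1 where "f1 z = indicator \<Omega> z * (aniso A (G z) + (ut z)\<^sup>2 / 2)" for z
  define f2 where "f2 z = indicator \<Omega> z * (aniso A (G z + Vs z) + (ut z + Vt z)\<^sup>2 / 2)" for z
  have f1_0: "0 \<le> f1 z" "0 \<le> f2 z" for z by (simp_all add: f1_def f2_def aniso_nonneg[OF A])
  have Eu: "energy (aniso A) D T u = (\<integral>\<^sup>+z. ennreal (f1 z) \<partial>lebesgue)"
    unfolding f1_def by (rule energy_eq[OF D(1) G ut])
  have Ev: "energy (aniso A) D T (\<lambda>z. u z + W z) = (\<integral>\<^sup>+z. ennreal (f2 z) \<partial>lebesgue)"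
    unfolding f2_def by (rule energy_eq[OF D(1) L2_W11_v L2_time_derivative_v])
  have aniso0: "aniso A 0 = 0" using aniso_scale[OF A, of 0 0] by simp
  have f1m: "f1 \<in> borel_measurable lebesgue"
  proof -
    have "(\<lambda>z. aniso A (indicator \<Omega> z *\<^sub>R G z) + (indicator \<Omega> z *\<^sub>R ut z)\<^sup>2 / 2) \<in> borel_measurable lebesgue"
      by (intro borel_measurable_add borel_measurable_divide borel_measurable_power borel_measurable_const measurable_data
          measurable_compose[OF _ borel_measurable_continuous_onI[OF aniso_continuous[OF A]]])
    moreover have "(\<lambda>z. aniso A (indicator \<Omega> z *\<^sub>R G z) + (indicator \<Omega> z *\<^sub>R ut z)\<^sup>2 / 2) = f1"
      by (auto simp: fun_eq_iff f1_def indicator_def aniso0)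
    ultimately show ?thesis by simp
  qed
  have if1: "integrable lebesgue f1"
    by (rule integrableI_nonneg[OF f1m]) (use f1_0 fin Eu in auto)
  \<comment> \<open>Coercivity turns finite energy into joint integrability of G over
    space-time.\<close>
  obtain c where c: "c > 0" "\<And>p. c * norm p \<le> aniso A p" using aniso_lower_bound[OF A] by blast
  have iG: "integrable lebesgue (\<lambda>z. indicator \<Omega> z *\<^sub>R G z)"
  proof (rule Bochner_Integration.integrable_bound[OF integrable_mult_right[OF if1, of "1 / c"] measurable_data(2)])
    have "norm (indicator \<Omega> z *\<^sub>R G z) \<le> norm (1 / c * f1 z)" for z
    proof (cases "z \<in> \<Omega>")
      case True
      have "c * norm (G z) \<le> f1 z" using c(2)[of "G z"] True by (simp add: f1_def add_increasing2)
      then have "norm (G z) \<le> 1 / c * f1 z" using c(1) by (simp add: field_simps)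
      then show ?thesis using True f1_0(1)[of z] c(1) by simp
    qed simp
    then show "AE z in lebesgue. norm (indicator \<Omega> z *\<^sub>R G z) \<le> norm (1 / c * f1 z)" by simp
  qed
  show iV: "integrable lebesgue Vs"
  proof (rule Bochner_Integration.integrable_bound[OF Bochner_Integration.integrable_add[OF integrable_norm[OF iG] const_integrable[of Bb]] measurable_WV(2)])
    have "norm (Vs z) \<le> norm (norm (indicator \<Omega> z *\<^sub>R G z) + indicator \<Omega> z * Bb)" for z
      using Vs_bound[of z] Bb(3) by (cases "z \<in> \<Omega>") (auto simp: W_outside)
    then show "AE z in lebesgue. norm (Vs z) \<le> norm (norm (indicator \<Omega> z *\<^sub>R G z) + indicator \<Omega> z * Bb)" by simp
  qed
  have flm: "(\<lambda>z. flux A \<delta> (fst (indicator \<Omega> z *\<^sub>R gb z))) \<in> borel_measurable lebesgue"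
    by (intro measurable_compose[OF measurable_fst_snd(1)[OF measurable_data(5)] borel_measurable_continuous_onI[OF flux_continuous[OF A \<delta> continuous_on_id]]])
  obtain C where C: "\<And>p. norm (flux A \<delta> p) \<le> C" using flux_bound[OF A card \<delta>] by blast
  have flV: "(\<lambda>z. flux A \<delta> (fst (indicator \<Omega> z *\<^sub>R gb z)) \<bullet> Vs z) = (\<lambda>z. flux A \<delta> (fst (gb z)) \<bullet> Vs z)"
    by (auto simp: fun_eq_iff indicator_def W_outside)
  show ifl: "integrable lebesgue (\<lambda>z. flux A \<delta> (fst (gb z)) \<bullet> Vs z)"
    unfolding flV[symmetric]
  proof (rule Bochner_Integration.integrable_bound[OF integrable_mult_right[OF integrable_norm[OF iV], of C]])
    show "(\<lambda>z. flux A \<delta> (fst (indicator \<Omega> z *\<^sub>R gb z)) \<bullet> Vs z) \<in> borel_measurable lebesgue"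
      by (rule borel_measurable_inner[OF flm measurable_WV(2)])
    have "norm (flux A \<delta> p \<bullet> Vs z) \<le> norm (C * norm (Vs z))" for p z
    proof -
      have "\<bar>flux A \<delta> p \<bullet> Vs z\<bar> \<le> norm (flux A \<delta> p) * norm (Vs z)" by (rule Cauchy_Schwarz_ineq2)
      also have "\<dots> \<le> C * norm (Vs z)" using C by (intro mult_right_mono) auto
      finally show ?thesis by simp
    qed
    then show "AE z in lebesgue. norm (flux A \<delta> (fst (indicator \<Omega> z *\<^sub>R gb z)) \<bullet> Vs z) \<le> norm (C * norm (Vs z))" by simp
  qed
  have gVt: "(\<lambda>z. Vt z * snd (indicator \<Omega> z *\<^sub>R gb z)) = (\<lambda>z. Vt z * snd (gb z))"
    by (auto simp: fun_eq_iff indicator_def W_outside)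
  show igt: "integrable lebesgue (\<lambda>z. Vt z * snd (gb z))"
    unfolding gVt[symmetric]
    by (rule integrable_times_bounded[OF Vt_integrable measurable_fst_snd(2)[OF measurable_data(5)], where B=Bb])
       (use gb_components(2) Bb(3) in \<open>simp add: indicator_def\<close>)
  define R where "R z = indicator \<Omega> z * \<delta> + flux A \<delta> (fst (gb z)) \<bullet> Vs z + Vt z * snd (gb z)" for z
  have iR: "integrable lebesgue R"
    unfolding R_def by (intro Bochner_Integration.integrable_add const_integrable ifl igt)
  have le: "f2 z \<le> f1 z + R z" for z
  proof (cases "z \<in> \<Omega>")
    case True
    then show ?thesis
      using truncated_energy_density[OF A \<delta> a_bounds[of z], of "G z" "fst (gb z)" "ut z" "snd (gb z)"]
      by (simp add: f1_def f2_def R_def Vs_def Vt_def mult.commute)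
  qed (simp add: f1_def f2_def R_def W_outside)
  have "ennreal (LINT z|lebesgue. f1 z) = (\<integral>\<^sup>+z. ennreal (f1 z) \<partial>lebesgue)"
    by (rule nn_integral_eq_integral[OF if1, symmetric]) (simp add: f1_0)
  also have "\<dots> \<le> (\<integral>\<^sup>+z. ennreal (f2 z) \<partial>lebesgue)" using min unfolding Eu Ev .
  also have "\<dots> \<le> (\<integral>\<^sup>+z. ennreal (f1 z + R z) \<partial>lebesgue)" by (intro nn_integral_mono ennreal_leI le)
  also have "\<dots> = ennreal (LINT z|lebesgue. f1 z + R z)"
    by (rule nn_integral_eq_integral[OF Bochner_Integration.integrable_add[OF if1 iR]]) (intro always_eventually allI order_trans[OF f1_0(2) le])
  finally have "(LINT z|lebesgue. f1 z) \<le> (LINT z|lebesgue. f1 z + R z)"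
    by (subst (asm) ennreal_le_iff) (intro integral_nonneg_AE always_eventually allI order_trans[OF f1_0(2) le])
  also have "\<dots> = (LINT z|lebesgue. f1 z) + (LINT z|lebesgue. R z)" by (rule Bochner_Integration.integral_add[OF if1 iR])
  finally have "0 \<le> (LINT z|lebesgue. R z)" by simp
  also have "(LINT z|lebesgue. R z) = (LINT z|lebesgue. indicator \<Omega> z * \<delta>) + (LINT z|lebesgue. flux A \<delta> (fst (gb z)) \<bullet> Vs z) + (LINT z|lebesgue. Vt z * snd (gb z))"
    unfolding R_def
    using const_integrable[of \<delta>] ifl igt by (simp add: Bochner_Integration.integral_add Bochner_Integration.integrable_add)
  also have "(LINT z|lebesgue. indicator \<Omega> z * \<delta>) = \<delta> * measure lebesgue \<Omega>" by simp
  finally show "0 \<le> \<delta> * measure lebesgue \<Omega> + (LINT z|lebesgue. flux A \<delta> (fst (gb z)) \<bullet> Vs z) + (LINT z|lebesgue. Vt z * snd (gb z))" .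
qed

end

section \<open>Comparison with the barrier\<close>

text \<open>Quantifying over \<delta> inside fixes c, and with it K and \<epsilon>, before the
  regularisation parameter is sent to 0.\<close>

definition curvature_const :: "real^'m^'m \<Rightarrow> real \<Rightarrow> bool" where
  "curvature_const A c \<longleftrightarrow> c > 0 \<and> (\<forall>\<delta> p N \<mu>. \<delta> > 0 \<longrightarrow> \<mu> \<ge> 0 \<longrightarrow> (\<forall>x. \<mu> * (x \<bullet> x) \<le> x \<bullet> (N *v x)) \<longrightarrow>
     c * \<mu> / aniso_reg A \<delta> p \<le> ((1 / aniso_reg A \<delta> p) *\<^sub>R A - (1 / (aniso_reg A \<delta> p) ^ 3) *\<^sub>R outer (A *v p)) \<bullet> N)"

lemma curvature_const_exists:
  fixes A :: "real^'m^'m"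
  assumes A: "sym_pos_def A" and "CARD('m) \<ge> 2"
  shows "\<exists>c. curvature_const A c"
proof (rule aniso_hessian_bound[OF A assms(2)])
  fix c assume c: "c > 0" and h: "\<And>\<delta> p N \<mu>. \<lbrakk>\<delta> > 0; \<mu> \<ge> 0; \<And>x. \<mu> * (x \<bullet> x) \<le> x \<bullet> (N *v x)\<rbrakk> \<Longrightarrow>
       c * \<mu> / aniso_reg A \<delta> p \<le> ((1 / aniso_reg A \<delta> p) *\<^sub>R A - (1 / (aniso_reg A \<delta> p) ^ 3) *\<^sub>R outer (A *v p)) \<bullet> N"
  show ?thesis unfolding curvature_const_def
    by (intro exI[of _ c] conjI allI impI c h) auto
qed

text \<open>Its gradient is K times the weight times x, and its Hessian is at least K times the
  weight: the ratio of curvature to size is at least K, however small the multiple of the weight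
  that is added to \<psi>.\<close>

definition gauss_weight :: "real \<Rightarrow> 'a::euclidean_space \<Rightarrow> real" where
  "gauss_weight K x = exp (K * (x \<bullet> x) / 2)"

lemma gauss_weight_pos: "0 < gauss_weight K x" by (simp add: gauss_weight_def)

lemma gauss_weight_deriv: "(gauss_weight K has_derivative (\<lambda>h. gauss_weight K x * (K * (x \<bullet> h)))) (at x)"
proof -
  have 1: "((\<lambda>x. K * (x \<bullet> x) / 2) has_derivative (\<lambda>h. K * (x \<bullet> h))) (at x)"
    by (auto intro!: derivative_eq_intros simp: inner_commute algebra_simps)
  show ?thesis
    unfolding gauss_weight_def[abs_def]
    by (rule has_derivative_eq_rhs[OF has_derivative_exp[OF 1]]) (simp add: fun_eq_iff)
qed

lemma gauss_weight_continuous: "continuous_on S (gauss_weight K)"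
  unfolding gauss_weight_def[abs_def] by (intro continuous_intros) auto

context truncation
begin

text \<open>Both sides of the first-order inequality are measured by the integral of W S, where S is
  the term added to \<psi>. The flux contributes at most -(c K / Cq) times it, the time derivative
  at most (pi/T)^2 times it, and \<open>cK\<close> leaves a surplus of 1. So the integral of W S is
  at most \<delta> times the volume for every small \<delta>, hence 0, while S is positive in the
  cylinder.\<close>

lemma truncation_vanishes:
  assumes C2: "C2_domain D" and A: "sym_pos_def A" and card: "CARD('m) \<ge> 2" and cc: "curvature_const A c"
    and g: "L-lipschitz_on \<Omega> g" "\<And>z. z \<in> \<Omega> \<Longrightarrow> norm (g z) \<le> B"
    and \<psi>: "\<And>z. z \<in> \<Omega> \<Longrightarrow> (\<psi> has_derivative (\<lambda>h. g z \<bullet> h)) (at z)" "convex_on_segments (closure \<Omega>) \<psi>"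
    and \<epsilon>: "0 < \<epsilon>" and K: "0 < K"
    and b_eq: "\<And>z. z \<in> \<Omega> \<Longrightarrow> b z = \<psi> z + \<epsilon> * sin (pi * snd z / T) * gauss_weight K (fst z)"
    and gb_eq: "\<And>z. z \<in> \<Omega> \<Longrightarrow> gb z = g z + ((\<epsilon> * sin (pi * snd z / T) * K * gauss_weight K (fst z)) *\<^sub>R fst z,
        pi / T * cos (pi * snd z / T) * (\<epsilon> * gauss_weight K (fst z)))"
    and small: "\<And>x. x \<in> D \<Longrightarrow> \<epsilon> * (K * gauss_weight K x * norm x) \<le> 1" "\<And>x. x \<in> D \<Longrightarrow> \<epsilon> * gauss_weight K x \<le> 1"
    and Cq: "Cq > 0" "\<And>\<delta> p. \<lbrakk>0 < \<delta>; \<delta> \<le> 1; norm p \<le> B + 1\<rbrakk> \<Longrightarrow> aniso_reg A \<delta> p \<le> Cq"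
    and cK: "(pi / T)\<^sup>2 + 1 \<le> c * K / Cq"
    and u\<psi>: "AE z in lebesgue. z \<in> \<Omega> \<longrightarrow> \<psi> z \<le> u z"
    and tr: "AE t in lebesgue. t \<in> {0<..<T} \<longrightarrow> has_trace D (\<lambda>x. W (x, t)) (frontier D) (\<lambda>x. 0)"
    and fin: "energy (aniso A) D T u < \<infinity>"
    and min: "energy (aniso A) D T u \<le> energy (aniso A) D T (\<lambda>z. u z + W z)"
  shows "AE z in lebesgue. W z = 0"
proof -
  let ?\<eta> = "\<lambda>t. sin (pi * t / T)"
  have sin0: "0 < ?\<eta> t" if "t \<in> {0<..<T}" for t
    using that by (intro sin_gt_zero) (auto simp: divide_less_eq)
  have in\<Omega>: "z \<in> \<Omega> \<longleftrightarrow> fst z \<in> D \<and> snd z \<in> {0<..<T}" for z by (cases z) (simp add: space_time_def)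
  have w0: "0 < gauss_weight K x" for x :: "real^'m" by (rule gauss_weight_pos)
  have w0': "0 \<le> gauss_weight K x" for x :: "real^'m" by (rule less_imp_le[OF w0])
  have gc: "continuous_on \<Omega> g" using g(1) by (rule lipschitz_on_continuous_on)
  have mono: "0 \<le> (g z - g y) \<bullet> (z - y)" if "closed_segment z y \<subseteq> \<Omega>" for z y
    by (rule convex_on_segments_monotone_gradient[OF \<psi>(2) order_trans[OF that closure_subset] \<psi>(1) \<psi>(1)];
        rule subsetD[OF that]) simp_all
  \<comment> \<open>Since u lies above \<psi>, the excess of b over u is at most the added term,
    hence at most the sine; the quadratic bound on \<open>pen\<close> then gives half the squared
    sine.\<close>
  have Wb: "AE z in lebesgue. z \<in> \<Omega> \<longrightarrow> W z \<le> 1 / 2 * (?\<eta> (snd z))\<^sup>2"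
    using u\<psi>
  proof (rule eventually_mono, intro impI)
    fix z assume a: "z \<in> \<Omega> \<longrightarrow> \<psi> z \<le> u z" and z: "z \<in> \<Omega>"
    have s: "0 < ?\<eta> (snd z)" using sin0 z in\<Omega> by blast
    have zD: "fst z \<in> D" using z in\<Omega> by blast
    have "b z - u z \<le> ?\<eta> (snd z) * (\<epsilon> * gauss_weight K (fst z))" using a z b_eq[OF z] by simp
    also have "\<dots> \<le> ?\<eta> (snd z) * 1" using s small(2)[OF zD] by (intro mult_left_mono) auto
    finally have "max 0 (b z - u z) \<le> ?\<eta> (snd z)" using s by simp
    then have "(max 0 (b z - u z))\<^sup>2 \<le> (?\<eta> (snd z))\<^sup>2" by (intro power_mono) auto
    then show "W z \<le> 1 / 2 * (?\<eta> (snd z))\<^sup>2" using pen_props(4)[of "b z - u z"] z by (simp add: W_def)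
  qed
  have Wle: "AE z in lebesgue. W z \<le> 1 / 2"
    using Wb
  proof (rule eventually_mono)
    fix z assume a: "z \<in> \<Omega> \<longrightarrow> W z \<le> 1 / 2 * (?\<eta> (snd z))\<^sup>2"
    have "(?\<eta> (snd z))\<^sup>2 \<le> 1" by (simp add: abs_square_le_1)
    then show "W z \<le> 1 / 2" using a by (cases "z \<in> \<Omega>") (auto simp: W_outside)
  qed
  have iW: "integrable lebesgue W"
  proof (rule Bochner_Integration.integrable_bound[OF const_integrable[of "1 / 2"] measurable_WV(1)])
    show "AE z in lebesgue. norm (W z) \<le> norm (indicator \<Omega> z * (1 / 2 :: real))"
      using Wle by (rule eventually_mono) (auto simp: indicator_def W_outside W_nonneg)
  qed
  define S where "S z = \<epsilon> * ?\<eta> (snd z) * gauss_weight K (fst z)" for z :: "(real^'m) \<times> real"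
  have S0: "0 < S z" if "z \<in> \<Omega>" for z unfolding S_def using that in\<Omega> by (intro mult_pos_pos \<epsilon> w0 sin0) auto
  have Sc: "continuous_on X S" for X
    unfolding S_def using T by (intro continuous_intros continuous_on_compose2[OF gauss_weight_continuous[of UNIV]]) auto
  have iWS: "integrable lebesgue (\<lambda>z. W z * S z)"
  proof -
    have "(\<lambda>z. indicator \<Omega> z *\<^sub>R S z) \<in> borel_measurable lebesgue"
      using continuous_imp_measurable_on_sets_lebesgue[OF Sc sets_\<Omega>] by (simp add: lebesgue_on_measurable_iff[OF sets_\<Omega>])
    then have "integrable lebesgue (\<lambda>z. W z * (indicator \<Omega> z *\<^sub>R S z))"
    proof (rule integrable_times_bounded[OF iW])
      fix z show "\<bar>indicator \<Omega> z *\<^sub>R S z\<bar> \<le> 1"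
      proof (cases "z \<in> \<Omega>")
        case True
        then have "S z = ?\<eta> (snd z) * (\<epsilon> * gauss_weight K (fst z))" by (simp add: S_def)
        also have "\<dots> \<le> 1 * 1" using sin0[of "snd z"] True in\<Omega> small(2) \<epsilon> w0[of "fst z"] by (intro mult_mono) (auto simp: less_imp_le)
        finally show ?thesis using S0[OF True] True by simp
      qed simp
    qed
    moreover have "(\<lambda>z. W z * (indicator \<Omega> z *\<^sub>R S z)) = (\<lambda>z. W z * S z)" by (auto simp: fun_eq_iff indicator_def W_outside)
    ultimately show ?thesis by simp
  qed
  have time: "(LINT z|lebesgue. Vt z * snd (gb z)) \<le> (pi / T)\<^sup>2 * (LINT z|lebesgue. W z * S z)"
  proof -
    have "(LINT z|lebesgue. Vt z * (snd (g z) + pi / T * cos (pi * snd z / T) * (\<epsilon> * gauss_weight K (fst z))))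
      \<le> (LINT z|lebesgue. W z * ((pi / T)\<^sup>2 * ?\<eta> (snd z) * (\<epsilon> * gauss_weight K (fst z))))"
    proof (rule time_flux_inequality[where \<psi>=\<psi> and B=B and Zb=1 and C="1/2" and D=D,
          OF C2 D(2) T \<psi>(1) gc g(2) _ _ _ _ _ iW W_nonneg W_outside(1) Wb _ Vt_integrable W_outside(3)])
      show "snd (g (x, t)) \<le> snd (g (x, t'))" if x: "x \<in> D" "0 < t" "t \<le> t'" "t' < T" for x t t'
      proof (cases "t = t'")
        case False
        have "closed_segment (x, t) (x, t') \<subseteq> \<Omega>"
        proof
          fix z assume "z \<in> closed_segment (x, t) (x, t')"
          then obtain s where s: "0 \<le> s" "s \<le> 1" "z = (1 - s) *\<^sub>R (x, t) + s *\<^sub>R (x, t')" unfolding in_segment by blast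
          have "fst z = x" unfolding s(3) fst_add fst_scaleR fst_conv scaleR_add_left[symmetric] by simp
          moreover have "snd z \<in> closed_segment t t'"
            unfolding s(3) snd_add snd_scaleR snd_conv in_segment using s(1,2) by blast
          ultimately have "fst z = x" "snd z \<in> closed_segment t t'" by blast+
          then show "z \<in> \<Omega>" using x by (auto simp: in\<Omega> closed_segment_eq_real_ivl)
        qed
        from mono[OF this] have "0 \<le> (snd (g (x, t)) - snd (g (x, t'))) * (t - t')" by (simp add: inner_prod_def)
        then show ?thesis using False x by (simp add: zero_le_mult_iff)
      qed simp
      show "((\<lambda>x. \<epsilon> * gauss_weight K x) has_derivative (\<lambda>h. \<epsilon> * (gauss_weight K x * (K * (x \<bullet> h))))) (at x)" for x :: "real^'m"
        by (rule has_derivative_mult_right[OF gauss_weight_deriv])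
      show "continuous_on UNIV (\<lambda>x::real^'m. \<epsilon> * (gauss_weight K x * (K * (x \<bullet> v))))" for v
        by (intro continuous_intros gauss_weight_continuous)
    qed (use small(2) less_imp_le[OF \<epsilon>] w0' parts_time in auto)
    moreover have "(LINT z|lebesgue. Vt z * (snd (g z) + pi / T * cos (pi * snd z / T) * (\<epsilon> * gauss_weight K (fst z)))) = (LINT z|lebesgue. Vt z * snd (gb z))"
    proof (rule Bochner_Integration.integral_cong[OF refl])
      fix z show "Vt z * (snd (g z) + pi / T * cos (pi * snd z / T) * (\<epsilon> * gauss_weight K (fst z))) = Vt z * snd (gb z)"
        using gb_eq[of z] by (cases "z \<in> \<Omega>") (simp_all add: W_outside)
    qed
    moreover have "(LINT z|lebesgue. W z * ((pi / T)\<^sup>2 * ?\<eta> (snd z) * (\<epsilon> * gauss_weight K (fst z)))) = (pi / T)\<^sup>2 * (LINT z|lebesgue. W z * S z)"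
    proof -
      have "(LINT z|lebesgue. W z * ((pi / T)\<^sup>2 * ?\<eta> (snd z) * (\<epsilon> * gauss_weight K (fst z)))) = (LINT z|lebesgue. (pi / T)\<^sup>2 * (W z * S z))"
        by (rule Bochner_Integration.integral_cong[OF refl]) (simp only: S_def mult_ac)
      then show ?thesis by (simp only: integral_mult_right_zero)
    qed
    ultimately show ?thesis by simp
  qed
  have ineq: "(LINT z|lebesgue. W z * S z) \<le> \<delta> * measure lebesgue \<Omega>" if \<delta>: "0 < \<delta>" "\<delta> \<le> 1" for \<delta>
  proof -
    note E = energy_inequality[OF A card \<delta>(1) fin min]
    have c0: "c > 0" and cH: "\<And>p N \<mu>. \<lbrakk>\<mu> \<ge> 0; \<And>x. \<mu> * (x \<bullet> x) \<le> x \<bullet> (N *v x)\<rbrakk> \<Longrightarrow>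
       c * \<mu> / aniso_reg A \<delta> p \<le> ((1 / aniso_reg A \<delta> p) *\<^sub>R A - (1 / (aniso_reg A \<delta> p) ^ 3) *\<^sub>R outer (A *v p)) \<bullet> N"
      using cc \<delta>(1) by (auto simp: curvature_const_def)
    let ?F = "\<lambda>z. flux A \<delta> (fst (gb z)) \<bullet> Vs z"
    have slice: "(LINT x|lebesgue. ?F (x, t)) \<le> - (c * K / Cq) * (LINT x|lebesgue. W (x, t) * S (x, t))"
      if w: "t \<in> {0<..<T} \<longrightarrow> W11 D (\<lambda>x. u (x, t)) (\<lambda>x. G (x, t))"
        and trt: "t \<in> {0<..<T} \<longrightarrow> has_trace D (\<lambda>x. W (x, t)) (frontier D) (\<lambda>x. 0)"
        and Wt: "AE x in lebesgue. W (x, t) \<le> 1 / 2" for t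
    proof (cases "t \<in> {0<..<T}")
      case False
      then have "(x, t) \<notin> \<Omega>" for x by (simp add: in\<Omega>)
      then show ?thesis by (simp add: W_outside)
    next
      case t: True
      then have xin: "(x, t) \<in> \<Omega> \<longleftrightarrow> x \<in> D" for x by (simp add: in\<Omega>)
      note w' = W11_slice[OF t w[rule_format, OF t]]
      have ind: "(\<lambda>x. indicator D x *\<^sub>R W (x, t)) = (\<lambda>x. W (x, t))" "(\<lambda>x. indicator D x *\<^sub>R Vs (x, t)) = (\<lambda>x. Vs (x, t))"
        by (auto simp: fun_eq_iff indicator_def xin W_outside)
      have iWt: "integrable lebesgue (\<lambda>x. W (x, t))" and iVt: "integrable lebesgue (\<lambda>x. Vs (x, t))"
        using w' ind by (simp_all add: W11_def set_integrable_def)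
      \<comment> \<open>The coefficient of x in the added gradient, with the factor K included, so
        that \<open>r * gauss_weight K x\<close> is K times S and is a lower bound for the Jacobian
        of Z.\<close>
      define r where "r = \<epsilon> * ?\<eta> t * K"
      have r0: "0 \<le> r" using \<epsilon> K sin0[OF t] by (simp add: r_def)
      define p where "p x = (if x \<in> D then fst (g (x, t)) else 0)" for x
      define Z where "Z x = (r * gauss_weight K x) *\<^sub>R x" for x :: "real^'m"
      define Z' where "Z' x h = (r * gauss_weight K x) *\<^sub>R h + (r * (gauss_weight K x * (K * (x \<bullet> h)))) *\<^sub>R x" for x h :: "real^'m"
      have gbt: "fst (gb (x, t)) = p x + Z x" if "x \<in> D" for x
        using gb_eq[of "(x, t)"] that xin by (simp add: p_def Z_def r_def mult_ac)
      have "(LINT x|lebesgue. flux A \<delta> (p x + Z x) \<bullet> Vs (x, t)) \<le> - (LINT x|lebesgue. W (x, t) * (c * (r * gauss_weight K x) / Cq))"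
      proof (rule slice_flux_inequality[where A=A and \<delta>=\<delta> and D=D and M="1/2" and L=L and p=p and Z=Z and Z'=Z' and c=c and W="\<lambda>x. W (x, t)"
            and V="\<lambda>x. Vs (x, t)" and \<mu>="\<lambda>x. r * gauss_weight K x" and Cq=Cq])
        show "c * \<mu> / aniso_reg A \<delta> p \<le> ((1 / aniso_reg A \<delta> p) *\<^sub>R A - (1 / (aniso_reg A \<delta> p) ^ 3) *\<^sub>R outer (A *v p)) \<bullet> N"
          if "\<mu> \<ge> 0" "\<And>x. \<mu> * (x \<bullet> x) \<le> x \<bullet> (N *v x)" for p N \<mu>
          by (rule cH) (rule that)+
        show "(LINT x|lebesgue. W (x, t) * \<phi>' x (axis i 1)) = - (LINT x|lebesgue. Vs (x, t) $ i * \<phi> x)"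
          if "test_data D \<phi> \<phi>' K" for i \<phi> \<phi>' K
          by (rule parts_space[OF t w[rule_format, OF t] that])
        show "L-lipschitz_on D p"
        proof (rule lipschitz_onI)
          fix x y assume xy: "x \<in> D" "y \<in> D"
          have "dist (p x) (p y) \<le> dist (g (x, t)) (g (y, t))" using xy by (simp add: p_def dist_fst_le)
          also have "\<dots> \<le> L * dist (x, t) (y, t)" by (rule lipschitz_onD[OF g(1)]) (use xy xin in auto)
          finally show "dist (p x) (p y) \<le> L * dist x y" by (simp add: dist_Pair_Pair)
        qed (rule lipschitz_on_nonneg[OF g(1)])
        have "continuous_on D (\<lambda>x. fst (g (x, t)))"
          by (intro continuous_on_fst continuous_on_compose2[OF gc]) (auto intro!: continuous_intros simp: xin)
        then have "(\<lambda>x. indicator D x *\<^sub>R fst (g (x, t))) \<in> borel_measurable lebesgue"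
          using continuous_imp_measurable_on_sets_lebesgue[of D "\<lambda>x. fst (g (x, t))"] D(1) by (simp add: lebesgue_on_measurable_iff)
        moreover have "(\<lambda>x. indicator D x *\<^sub>R fst (g (x, t))) = p" by (auto simp: p_def fun_eq_iff)
        ultimately show "p \<in> borel_measurable lebesgue" by simp
        show "0 \<le> (p x - p y) \<bullet> (x - y)" if xy: "closed_segment x y \<subseteq> D" for x y
        proof -
          have "closed_segment (x, t) (y, t) \<subseteq> \<Omega>"
          proof
            fix z assume "z \<in> closed_segment (x, t) (y, t)"
            then obtain s where s: "0 \<le> s" "s \<le> 1" "z = (1 - s) *\<^sub>R (x, t) + s *\<^sub>R (y, t)" unfolding in_segment by blast
            have "snd z = t" unfolding s(3) snd_add snd_scaleR snd_conv scaleR_add_left[symmetric] by simp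
            moreover have "fst z \<in> closed_segment x y"
              unfolding s(3) fst_add fst_scaleR fst_conv in_segment using s(1,2) by blast
            ultimately have "fst z \<in> closed_segment x y" "snd z = t" by blast+
            then show "z \<in> \<Omega>" using xy t by (auto simp: in\<Omega>)
          qed
          from mono[OF this] show ?thesis using xy by (simp add: p_def inner_prod_def subset_iff)
        qed
        show "(Z has_derivative Z' x) (at x)" for x
          unfolding Z_def[abs_def] Z'_def[abs_def]
          by (rule has_derivative_scaleR[OF has_derivative_mult_right[OF gauss_weight_deriv] has_derivative_ident])
        show "continuous_on UNIV (\<lambda>x. Z' x h)" for h
          unfolding Z'_def by (intro continuous_intros gauss_weight_continuous)
        show "continuous_on UNIV (\<lambda>x::real^'m. r * gauss_weight K x)" by (intro continuous_intros gauss_weight_continuous)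
        show "0 \<le> r * gauss_weight K x" for x :: "real^'m" using r0 w0[of x] by simp
        show "r * gauss_weight K x * (h \<bullet> h) \<le> h \<bullet> Z' x h" for x h :: "real^'m"
        proof -
          have "h \<bullet> Z' x h = r * gauss_weight K x * (h \<bullet> h) + (r * gauss_weight K x * K) * (x \<bullet> h)\<^sup>2"
            by (simp add: Z'_def inner_add_right power2_eq_square inner_commute mult_ac)
          moreover have "0 \<le> (r * gauss_weight K x * K) * (x \<bullet> h)\<^sup>2" using r0 w0[of x] K by simp
          ultimately show ?thesis by linarith
        qed
        show "aniso_reg A \<delta> (p x + Z x) \<le> Cq" if x: "x \<in> D" for x
        proof (rule Cq(2)[OF \<delta>])
          have "norm (p x) \<le> B"
            using x xin g(2)[of "(x, t)"] norm_fst_le[of "fst (g (x, t))" "snd (g (x, t))"] by (simp add: p_def)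
          moreover have "norm (Z x) \<le> 1"
          proof -
            have "norm (Z x) = ?\<eta> t * (\<epsilon> * (K * gauss_weight K x * norm x))"
              using sin0[OF t] \<epsilon> K w0[of x] by (simp add: Z_def r_def abs_mult)
            also have "\<dots> \<le> 1 * 1" using small(1)[OF x] sin0[OF t] \<epsilon> K w0[of x] by (intro mult_mono) auto
            finally show ?thesis by simp
          qed
          ultimately show "norm (p x + Z x) \<le> B + 1" using norm_triangle_ineq[of "p x" "Z x"] by linarith
        qed
      qed (use A card \<delta>(1) c0 C2 D(2) iWt iVt Wt trt t Cq(1) in \<open>auto simp: W_outside xin W_nonneg\<close>)
      moreover have "(LINT x|lebesgue. flux A \<delta> (p x + Z x) \<bullet> Vs (x, t)) = (LINT x|lebesgue. ?F (x, t))"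
      proof (rule Bochner_Integration.integral_cong[OF refl])
        fix x show "flux A \<delta> (p x + Z x) \<bullet> Vs (x, t) = ?F (x, t)"
          using gbt[of x] by (cases "x \<in> D") (simp_all add: W_outside xin)
      qed
      moreover have "(LINT x|lebesgue. W (x, t) * (c * (r * gauss_weight K x) / Cq)) = (c * K / Cq) * (LINT x|lebesgue. W (x, t) * S (x, t))"
      proof -
        have "(LINT x|lebesgue. W (x, t) * (c * (r * gauss_weight K x) / Cq)) = (LINT x|lebesgue. (c * K / Cq) * (W (x, t) * S (x, t)))"
          by (rule Bochner_Integration.integral_cong[OF refl]) (simp add: S_def r_def)
        then show ?thesis by (simp only: integral_mult_right_zero)
      qed
      ultimately show ?thesis by (simp only: mult_minus_left)
    qed
    have "AE t in lebesgue. (LINT x|lebesgue. ?F (x, t)) \<le> - (c * K / Cq) * (LINT x|lebesgue. W (x, t) * S (x, t))"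
      using slices_W11 tr AE_lebesgue_slices[OF Wle] by eventually_elim (rule slice)
    then have "(LINT t|lebesgue. LINT x|lebesgue. ?F (x, t)) \<le> (LINT t|lebesgue. - (c * K / Cq) * (LINT x|lebesgue. W (x, t) * S (x, t)))"
      by (intro integral_mono_AE lebesgue_integral_slices(2)[OF E(2)] integrable_mult_right lebesgue_integral_slices(2)[OF iWS])
    then have "(LINT z|lebesgue. ?F z) \<le> - (c * K / Cq) * (LINT z|lebesgue. W z * S z)"
      using lebesgue_integral_slices(3)[OF E(2)] lebesgue_integral_slices(3)[OF iWS] by simp
    \<comment> \<open>The energy inequality with its flux term replaced by the slice estimate
      integrated over time, and its time term by \<open>time\<close>.\<close>
    then have "0 \<le> \<delta> * measure lebesgue \<Omega> - (c * K / Cq) * (LINT z|lebesgue. W z * S z) + (pi / T)\<^sup>2 * (LINT z|lebesgue. W z * S z)"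
      using E(4) time by linarith
    moreover have "0 \<le> (LINT z|lebesgue. W z * S z)"
    proof (rule Bochner_Integration.integral_nonneg)
      fix z show "0 \<le> W z * S z" using S0[of z] W_nonneg[of z] by (cases "z \<in> \<Omega>") (auto simp: W_outside less_imp_le)
    qed
    then have "((pi / T)\<^sup>2 + 1) * (LINT z|lebesgue. W z * S z) \<le> (c * K / Cq) * (LINT z|lebesgue. W z * S z)"
      by (intro mult_right_mono cK)
    ultimately show ?thesis by (simp only: distrib_right mult_1)
  qed
  have WS0: "0 \<le> W z * S z" for z using S0[of z] W_nonneg[of z] by (cases "z \<in> \<Omega>") (auto simp: W_outside less_imp_le)
  have "(LINT z|lebesgue. W z * S z) \<le> 0"
  proof (rule field_le_epsilon)
    fix e :: real assume e: "0 < e"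
    define m where "m = measure lebesgue \<Omega> + 1"
    have m: "m > 0" by (simp add: m_def add_nonneg_pos)
    define \<delta> where "\<delta> = min 1 (e / m)"
    have "0 < \<delta>" "\<delta> \<le> 1" using e m by (auto simp: \<delta>_def)
    from ineq[OF this] have "(LINT z|lebesgue. W z * S z) \<le> \<delta> * measure lebesgue \<Omega>" .
    also have "\<dots> \<le> \<delta> * m" using \<open>0 < \<delta>\<close> by (simp add: m_def)
    also have "\<dots> \<le> e / m * m" using m by (intro mult_right_mono) (auto simp: \<delta>_def)
    finally show "(LINT z|lebesgue. W z * S z) \<le> 0 + e" using m by simp
  qed
  then have "(LINT z|lebesgue. W z * S z) = 0" using Bochner_Integration.integral_nonneg[of lebesgue "\<lambda>z. W z * S z"] WS0 by fastforce
  then have "AE z in lebesgue. W z * S z = 0"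
    using integral_nonneg_eq_0_iff_AE[OF iWS] WS0 by simp
  then show ?thesis
  proof (rule eventually_mono)
    fix z assume "W z * S z = 0"
    then show "W z = 0" using S0[of z] by (cases "z \<in> \<Omega>") (auto simp: W_outside)
  qed
qed

end

section \<open>Traces and admissibility of the competitor\<close>

lemma hausdorff_measure_mono:
  assumes "E \<subseteq> F"
  shows "hausdorff_measure P s E \<le> hausdorff_measure P s F"
proof -
  have "hausdorff_premeasure P s \<delta> E \<le> hausdorff_premeasure P s \<delta> F" for \<delta>
    unfolding hausdorff_premeasure_def
    by (rule Inf_superset_mono, rule Collect_mono) (use assms subset_trans in blast)
  then show ?thesis unfolding hausdorff_measure_def by (rule SUP_subset_mono[OF subset_refl])
qed

lemma approx_limit_dominated:
  assumes "approx_limit \<Omega> f x c" "r1 > 0" and le: "\<And>y. y \<in> \<Omega> \<Longrightarrow> dist y x < r1 \<Longrightarrow> \<bar>h y - c\<bar> \<le> \<bar>f y - c\<bar>"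
  shows "approx_limit \<Omega> h x c"
  unfolding approx_limit_def
proof (rule tendsto_sandwich[OF _ _ tendsto_const assms(1)[unfolded approx_limit_def]])
  have "eventually (\<lambda>r. 0 < r \<and> r < r1) (at_right (0::real))"
    using assms(2) unfolding eventually_at_right_field by blast
  then show "eventually (\<lambda>r. (\<integral>\<^sup>+y\<in>\<Omega> \<inter> ball x r. ennreal \<bar>h y - c\<bar> \<partial>lebesgue) / emeasure lebesgue (\<Omega> \<inter> ball x r)
     \<le> (\<integral>\<^sup>+y\<in>\<Omega> \<inter> ball x r. ennreal \<bar>f y - c\<bar> \<partial>lebesgue) / emeasure lebesgue (\<Omega> \<inter> ball x r)) (at_right 0)"
  proof (rule eventually_mono)
    fix r assume r: "0 < r \<and> r < r1"
    show "(\<integral>\<^sup>+y\<in>\<Omega> \<inter> ball x r. ennreal \<bar>h y - c\<bar> \<partial>lebesgue) / emeasure lebesgue (\<Omega> \<inter> ball x r)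
     \<le> (\<integral>\<^sup>+y\<in>\<Omega> \<inter> ball x r. ennreal \<bar>f y - c\<bar> \<partial>lebesgue) / emeasure lebesgue (\<Omega> \<inter> ball x r)"
    proof (rule divide_right_mono_ennreal, rule nn_integral_mono)
      fix y
      show "ennreal \<bar>h y - c\<bar> * indicator (\<Omega> \<inter> ball x r) y \<le> ennreal \<bar>f y - c\<bar> * indicator (\<Omega> \<inter> ball x r) y"
        using le[of y] r by (auto simp: indicator_def dist_commute intro!: ennreal_leI)
    qed
  qed
qed simp

text \<open>Being pointwise closer to the boundary value near each boundary point can only shrink
  the exceptional set, so no trace theory is involved.\<close>

lemma has_trace_dominated:
  assumes "has_trace \<Omega> f S g"
    and "\<And>x. x \<in> S \<Longrightarrow> \<exists>r>0. \<forall>y\<in>\<Omega>. dist y x < r \<longrightarrow> \<bar>h y - g x\<bar> \<le> \<bar>f y - g x\<bar>"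
  shows "has_trace \<Omega> h S g"
proof -
  have "{x \<in> S. \<not> approx_limit \<Omega> h x (g x)} \<subseteq> {x \<in> S. \<not> approx_limit \<Omega> f x (g x)}"
    using assms(2) approx_limit_dominated by blast
  from hausdorff_measure_mono[OF this] show ?thesis using assms(1) unfolding has_trace_def by (metis le_zero_eq)
qed

context truncation
begin

text \<open>W is nonzero only where u lies below b, and there \<open>u + W\<close> lies between u
  and b. Where b is at most the prescribed value g, that is 0 laterally and \<open>u0 x\<close>
  initially, the competitor is no farther from g than u is, and laterally W itself is at most the
  absolute value of u.\<close>

lemma admissible_v:
  assumes u: "u \<in> admissible D T \<psi> u0" and r0: "r0 > 0"
    and lateral: "\<And>x t. x \<in> D \<Longrightarrow> t \<in> {0<..<T} \<Longrightarrow> infdist x (frontier D) < r0 \<Longrightarrow> b (x, t) \<le> 0"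
    and initial: "\<And>x. x \<in> D \<Longrightarrow> \<exists>r>0. \<forall>z\<in>\<Omega>. dist z (x, 0) < r \<longrightarrow> b z \<le> u0 x"
  shows "(\<lambda>z. u z + W z) \<in> admissible D T \<psi> u0"
    and "AE t in lebesgue. t \<in> {0<..<T} \<longrightarrow> has_trace D (\<lambda>x. W (x, t)) (frontier D) (\<lambda>x. 0)"
proof -
  have cases: "W z = 0 \<or> (u z < b z \<and> 0 \<le> W z \<and> W z \<le> b z - u z)" for z
    using pen_props(1,2,3)[of "b z - u z"] by (cases "b z \<le> u z") (auto simp: W_def max_def)
  have near: "\<exists>r>0. \<forall>y\<in>D. dist y x < r \<longrightarrow> b (y, t) \<le> 0" if "x \<in> frontier D" "t \<in> {0<..<T}" for x t
  proof (intro exI[of _ r0] conjI ballI impI r0)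
    fix y assume y: "y \<in> D" "dist y x < r0"
    have "infdist y (frontier D) \<le> dist y x" by (rule infdist_le[OF that(1)])
    then show "b (y, t) \<le> 0" using lateral[OF y(1) that(2)] y(2) by simp
  qed
  have tru: "AE t in lebesgue. t \<in> {0<..<T} \<longrightarrow> has_trace D (\<lambda>x. u (x, t)) (frontier D) (\<lambda>x. 0)"
    using u by (simp add: admissible_def AE_lebesgue_on_iff)
  have trW: "has_trace D (\<lambda>x. W (x, t)) (frontier D) (\<lambda>x. 0)" "has_trace D (\<lambda>x. u (x, t) + W (x, t)) (frontier D) (\<lambda>x. 0)"
    if t: "t \<in> {0<..<T}" and h: "has_trace D (\<lambda>x. u (x, t)) (frontier D) (\<lambda>x. 0)" for t
  proof -
    have *: "\<exists>r>0. \<forall>y\<in>D. dist y x < r \<longrightarrow> \<bar>W (y, t)\<bar> \<le> \<bar>u (y, t)\<bar> \<and> \<bar>u (y, t) + W (y, t)\<bar> \<le> \<bar>u (y, t)\<bar>" if x: "x \<in> frontier D" for x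
    proof -
      obtain r where r: "r > 0" "\<forall>y\<in>D. dist y x < r \<longrightarrow> b (y, t) \<le> 0" using near[OF x t] by blast
      have "\<bar>W (y, t)\<bar> \<le> \<bar>u (y, t)\<bar> \<and> \<bar>u (y, t) + W (y, t)\<bar> \<le> \<bar>u (y, t)\<bar>" if "y \<in> D" "dist y x < r" for y
        using cases[of "(y, t)"] r(2) that by fastforce
      then show ?thesis using r(1) by blast
    qed
    show "has_trace D (\<lambda>x. W (x, t)) (frontier D) (\<lambda>x. 0)"
      by (rule has_trace_dominated[OF h]) (use * in force)
    show "has_trace D (\<lambda>x. u (x, t) + W (x, t)) (frontier D) (\<lambda>x. 0)"
      by (rule has_trace_dominated[OF h]) (use * in force)
  qed
  show "AE t in lebesgue. t \<in> {0<..<T} \<longrightarrow> has_trace D (\<lambda>x. W (x, t)) (frontier D) (\<lambda>x. 0)"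
    using tru by (rule eventually_mono) (use trW(1) in blast)
  have trv: "AE t in lebesgue_on {0<..<T}. has_trace D (\<lambda>x. u (x, t) + W (x, t)) (frontier D) (\<lambda>x. 0)"
    unfolding AE_lebesgue_on_iff[OF lmeasurable_interval(2)[THEN fmeasurableD], simplified]
    using tru by (rule eventually_mono) (use trW(2) in auto)
  have "has_trace \<Omega> u (D \<times> {0}) (\<lambda>z. u0 (fst z))" using u by (simp add: admissible_def)
  then have tri: "has_trace \<Omega> (\<lambda>z. u z + W z) (D \<times> {0}) (\<lambda>z. u0 (fst z))"
  proof (rule has_trace_dominated)
    fix x assume x: "x \<in> D \<times> {0::real}"
    then obtain r where r: "r > 0" "\<forall>z\<in>\<Omega>. dist z x < r \<longrightarrow> b z \<le> u0 (fst x)" using initial[of "fst x"] by auto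
    have "\<bar>u y + W y - u0 (fst x)\<bar> \<le> \<bar>u y - u0 (fst x)\<bar>" if "y \<in> \<Omega>" "dist y x < r" for y
      using cases[of y] r(2) that by fastforce
    then show "\<exists>r>0. \<forall>y\<in>\<Omega>. dist y x < r \<longrightarrow> \<bar>u y + W y - u0 (fst x)\<bar> \<le> \<bar>u y - u0 (fst x)\<bar>" using r(1) by blast
  qed
  have "AE z in lebesgue_on \<Omega>. \<psi> z \<le> u z" using u by (simp add: admissible_def)
  then have "AE z in lebesgue_on \<Omega>. \<psi> z \<le> u z + W z" by (rule eventually_mono) (use W_nonneg add_increasing2 in blast)
  then show "(\<lambda>z. u z + W z) \<in> admissible D T \<psi> u0"
    using L2_W11_v trv tri by (auto simp: admissible_def)
qed

end

text \<open>c0 is half the gap between 0 and the maximum of \<psi> on the lateral boundary; uniform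
  continuity gives up the other half over a strip of width r0. It leaves room for an added term of
  size up to c0.\<close>

lemma infdist_frontier_negative:
  fixes D :: "'a::euclidean_space set" and T :: real
  assumes D: "bounded D" "D \<noteq> {}" and T: "0 < T"
    and c: "continuous_on (closure D \<times> {0..T}) \<psi>"
    and neg: "\<And>x t. x \<in> frontier D \<Longrightarrow> t \<in> {0..T} \<Longrightarrow> \<psi> (x, t) < (0::real)"
  shows "\<exists>c0>0. \<exists>r0>0. \<forall>x\<in>D. \<forall>t\<in>{0<..<T}. infdist x (frontier D) < r0 \<longrightarrow> \<psi> (x, t) \<le> - c0"
proof -
  have cl: "compact (closure D)" using D(1) by simp
  have cpt: "compact (closure D \<times> {0..T})" by (intro compact_Times cl compact_Icc)
  have fr: "frontier D \<noteq> {}" using D by (metis frontier_eq_empty not_bounded_UNIV)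
  have cfr: "compact (frontier D)" using D(1) by (rule compact_frontier_bounded)
  have frc: "frontier D \<subseteq> closure D" by (simp add: frontier_def)
  have "\<exists>z\<in>frontier D \<times> {0..T}. \<forall>y\<in>frontier D \<times> {0..T}. \<psi> y \<le> \<psi> z"
    by (rule continuous_attains_sup) (use cfr fr T frc in \<open>auto intro!: compact_Times continuous_on_subset[OF c] compact_Icc\<close>)
  then obtain z where z: "z \<in> frontier D \<times> {0..T}" "\<And>y. y \<in> frontier D \<times> {0..T} \<Longrightarrow> \<psi> y \<le> \<psi> z" by blast
  define c0 where "c0 = - \<psi> z / 2"
  have c0: "c0 > 0" using neg[of "fst z" "snd z"] z(1) by (auto simp: c0_def)
  have "uniformly_continuous_on (closure D \<times> {0..T}) \<psi>" by (rule compact_uniformly_continuous[OF c cpt])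
  then obtain d where d: "d > 0" "\<And>y y'. y \<in> closure D \<times> {0..T} \<Longrightarrow> y' \<in> closure D \<times> {0..T} \<Longrightarrow> dist y' y < d \<Longrightarrow> dist (\<psi> y') (\<psi> y) < c0"
    using c0 unfolding uniformly_continuous_on_def by meson
  have "\<psi> (x, t) \<le> - c0" if x: "x \<in> D" "t \<in> {0<..<T}" "infdist x (frontier D) < d" for x t
  proof -
    obtain y where y: "y \<in> frontier D" "infdist x (frontier D) = dist x y"
      using infdist_attains_inf[OF frontier_closed fr] by blast
    have "dist (\<psi> (x, t)) (\<psi> (y, t)) < c0"
      by (rule d(2)) (use x y frc closure_subset in \<open>auto simp: dist_Pair_Pair\<close>)
    moreover have "\<psi> (y, t) \<le> - (2 * c0)" using z(2)[of "(y, t)"] y x by (auto simp: c0_def)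
    ultimately show ?thesis by (simp add: dist_real_def)
  qed
  then show ?thesis using c0 d(1) by blast
qed

lemma closure_space_time:
  fixes D :: "'a::euclidean_space set"
  assumes "T > 0"
  shows "closure (space_time D T) = closure D \<times> {0..T}"
  using assms by (simp add: space_time_def closure_Times)

text \<open>The order of choices avoids circularity. Cq depends only on the bound B + 1 for the
  spatial gradient of the barrier, because \<epsilon> will keep the added part below 1; K depends on
  Cq, c and T; and \<epsilon> is chosen last, depending on K.\<close>

lemma minimizer_above_barrier:
  fixes D :: "(real^'m) set"
  assumes card: "CARD('m) \<ge> 2" and C2: "C2_domain D" and bD: "bounded D" and T: "T > 0" and A: "sym_pos_def A"
    and C11: "C11_closure (space_time D T) \<psi>" and cvx: "convex_on_segments (closure (space_time D T)) \<psi>"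
    and neg: "\<And>x t. x \<in> frontier D \<Longrightarrow> t \<in> {0..T} \<Longrightarrow> \<psi> (x, t) < 0"
    and init: "\<And>x. x \<in> closure D \<Longrightarrow> \<psi> (x, 0) < u0 x"
    and min: "is_minimizer (aniso A) D T \<psi> u0 u"
  shows "\<exists>\<epsilon>>0. \<exists>K. AE z in lebesgue. z \<in> space_time D T \<longrightarrow> \<psi> z + \<epsilon> * sin (pi * snd z / T) * gauss_weight K (fst z) \<le> u z"
proof -
  let ?\<Omega> = "space_time D T"
  have oD: "open D" and D0: "D \<noteq> {}" using C2 by (auto simp: C2_domain_def)
  have b\<Omega>: "bounded ?\<Omega>" using bD by (simp add: space_time_def bounded_Times)
  have clo: "closure ?\<Omega> = closure D \<times> {0..T}" by (rule closure_space_time[OF T])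
  have cpt: "compact (closure ?\<Omega>)" using b\<Omega> by simp
  have sub: "?\<Omega> \<subseteq> closure ?\<Omega>" by (rule closure_subset)
  obtain x0 where x0: "x0 \<in> D" using D0 by blast
  have z0: "(x0, T / 2) \<in> ?\<Omega>" using x0 T by (simp add: space_time_def)
  obtain g L where g: "\<And>z. z \<in> ?\<Omega> \<Longrightarrow> (\<psi> has_derivative (\<lambda>h. g z \<bullet> h)) (at z)" "L-lipschitz_on ?\<Omega> g"
    and c\<psi>: "continuous_on (closure ?\<Omega>) \<psi>"
    using C11 unfolding C11_closure_def by blast
  have "bounded (g ` ?\<Omega>)"
    by (rule bounded_uniformly_continuous_image[OF lipschitz_on_uniformly_continuous[OF g(2)] b\<Omega>])
  then obtain B where B: "\<And>z. z \<in> ?\<Omega> \<Longrightarrow> norm (g z) \<le> B" unfolding bounded_iff by blast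
  have B0: "0 \<le> B" using B[OF z0] norm_ge_zero order_trans by blast
  have "bounded (\<psi> ` closure ?\<Omega>)" by (rule compact_imp_bounded[OF compact_continuous_image[OF c\<psi> cpt]])
  then obtain B\<psi> where B\<psi>: "\<And>z. z \<in> ?\<Omega> \<Longrightarrow> \<bar>\<psi> z\<bar> \<le> B\<psi>" unfolding bounded_iff using sub by (auto simp: subset_iff)
  have B\<psi>0: "0 \<le> B\<psi>" using B\<psi>[OF z0] by linarith
  obtain R where R: "\<And>x. x \<in> D \<Longrightarrow> norm x \<le> R" using bD unfolding bounded_iff by blast
  have R0: "0 \<le> R" using R[OF x0] norm_ge_zero order_trans by blast
  obtain c0 r0 where c0: "c0 > 0" "r0 > 0" "\<And>x t. x \<in> D \<Longrightarrow> t \<in> {0<..<T} \<Longrightarrow> infdist x (frontier D) < r0 \<Longrightarrow> \<psi> (x, t) \<le> - c0"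
    using infdist_frontier_negative[OF bD D0 T c\<psi>[unfolded clo] neg] by blast
  obtain c where c: "curvature_const A c" using curvature_const_exists[OF A card] by blast
  have cpos: "c > 0" using c by (simp add: curvature_const_def)
  obtain C where C: "C > 0" "\<And>p. aniso A p \<le> C * norm p" using aniso_linear_bound[OF A] by blast
  \<comment> \<open>Linear growth of the integrand on gradients of norm at most B + 1, plus 1 for
    the regularisation with \<delta> \<le> 1.\<close>
  define Cq where "Cq = C * (B + 1) + 1"
  have Cq0: "Cq > 0" using C(1) B0 by (simp add: Cq_def add_nonneg_pos)
  have Cq: "aniso_reg A \<delta> p \<le> Cq" if "0 < \<delta>" "\<delta> \<le> 1" "norm p \<le> B + 1" for \<delta> p
  proof -
    have "C * norm p \<le> C * (B + 1)" using that(3) C(1) by (intro mult_left_mono) auto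
    then show ?thesis using aniso_reg_le[OF A that(1), of p] C(2)[of p] that(2) by (simp add: Cq_def)
  qed
  \<comment> \<open>The value for which c K / Cq equals (pi/T)^2 + 1.\<close>
  define K where "K = Cq * ((pi / T)\<^sup>2 + 1) / c"
  have sq: "0 < (pi / T)\<^sup>2 + 1" by (intro add_nonneg_pos) auto
  have K: "K > 0" unfolding K_def using Cq0 cpos sq by simp
  have cK: "(pi / T)\<^sup>2 + 1 \<le> c * K / Cq" using Cq0 cpos by (simp add: K_def)
  define Zb where "Zb = exp (K * R\<^sup>2 / 2)"
  have Zb: "0 < Zb" by (simp add: Zb_def)
  have wZ: "gauss_weight K x \<le> Zb" if "x \<in> D" for x
  proof -
    have "x \<bullet> x \<le> R\<^sup>2" using R[OF that] R0 by (simp add: dot_square_norm power_mono)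
    then show ?thesis using K by (simp add: gauss_weight_def Zb_def)
  qed
  note w0 = gauss_weight_pos
  \<comment> \<open>The three bounds keep the added spatial gradient at most 1, the added term at
    most the sine, and the added term at most c0 near the lateral boundary.\<close>
  define \<epsilon> where "\<epsilon> = Min {1 / (1 + K * Zb * R), 1 / Zb, c0 / Zb}"
  have \<epsilon>: "\<epsilon> > 0" "\<epsilon> \<le> 1 / (1 + K * Zb * R)" "\<epsilon> \<le> 1 / Zb" "\<epsilon> \<le> c0 / Zb"
    using Zb K R0 c0(1) by (auto simp: \<epsilon>_def add_pos_nonneg)
  have \<epsilon>w: "\<epsilon> * gauss_weight K x \<le> 1" "\<epsilon> * gauss_weight K x \<le> c0" "\<epsilon> * (K * gauss_weight K x * norm x) \<le> 1" if x: "x \<in> D" for x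
  proof -
    have 1: "\<epsilon> * gauss_weight K x \<le> \<epsilon> * Zb" using wZ[OF x] \<epsilon>(1) by simp
    show "\<epsilon> * gauss_weight K x \<le> 1" "\<epsilon> * gauss_weight K x \<le> c0" using 1 \<epsilon>(3,4) Zb by (auto simp: le_divide_eq)
    have "\<epsilon> * (K * gauss_weight K x * norm x) \<le> \<epsilon> * (K * Zb * R)"
      using wZ[OF x] R[OF x] K \<epsilon>(1) w0[of K x] Zb by (intro mult_left_mono mult_mono) auto
    also have "\<dots> \<le> 1 / (1 + K * Zb * R) * (1 + K * Zb * R)"
      using \<epsilon>(1,2) K Zb R0 by (intro mult_mono) auto
    also have "\<dots> = 1" using K Zb R0 by (simp add: add_nonneg_eq_0_iff)
    finally show "\<epsilon> * (K * gauss_weight K x * norm x) \<le> 1" .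
  qed
  define b where "b z = \<psi> z + \<epsilon> * sin (pi * snd z / T) * gauss_weight K (fst z)" for z
  define gb where "gb z = g z + ((\<epsilon> * sin (pi * snd z / T) * K * gauss_weight K (fst z)) *\<^sub>R fst z,
        pi / T * cos (pi * snd z / T) * (\<epsilon> * gauss_weight K (fst z)))" for z
  have in\<Omega>: "z \<in> ?\<Omega> \<longleftrightarrow> fst z \<in> D \<and> snd z \<in> {0<..<T}" for z by (cases z) (simp add: space_time_def)
  have umem: "u \<in> admissible D T \<psi> u0" and fin: "energy (aniso A) D T u < \<infinity>"
    and umin: "\<And>v. v \<in> admissible D T \<psi> u0 \<Longrightarrow> energy (aniso A) D T u \<le> energy (aniso A) D T v"
    using min by (auto simp: is_minimizer_def)
  obtain G where G: "L2_W11 D T u G" using umem by (auto simp: admissible_def)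
  \<comment> \<open>Finite energy selects the branch of \<open>energy\<close> in which a square
    integrable time derivative exists.\<close>
  obtain ut where ut: "L2_time_derivative D T u ut" using fin by (auto simp: energy_def split: if_splits)
  have sinabs: "\<bar>\<epsilon> * sin y * gauss_weight K x\<bar> \<le> 1" if "x \<in> D" for x y
  proof -
    have "\<bar>\<epsilon> * sin y * gauss_weight K x\<bar> = \<bar>sin y\<bar> * (\<epsilon> * gauss_weight K x)" using \<epsilon>(1) w0[of K x] by (simp add: abs_mult)
    also have "\<dots> \<le> 1 * 1" using \<epsilon>w(1)[OF that] \<epsilon>(1) w0[of K x] by (intro mult_mono) auto
    finally show ?thesis by simp
  qed
  define Bb where "Bb = B\<psi> + 1 + B + 1 + pi / T"
  interpret truncation D T u G ut b gb Bb
  proof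
    show "(b has_derivative (\<lambda>h. gb z \<bullet> h)) (at z)" if z: "z \<in> ?\<Omega>" for z
    proof -
      have 2: "((\<lambda>z. gauss_weight K (fst z)) has_derivative (\<lambda>h. gauss_weight K (fst z) * (K * (fst z \<bullet> fst h)))) (at z)"
        by (rule has_derivative_compose[OF has_derivative_fst[OF has_derivative_ident] gauss_weight_deriv])
      have 3: "((\<lambda>z. sin (pi * snd z / T)) has_derivative (\<lambda>h. cos (pi * snd z / T) * (pi * snd h / T))) (at z)"
      proof -
        have "((\<lambda>z. pi * snd z / T) has_derivative (\<lambda>h. pi * snd h / T)) (at z)"
          unfolding divide_inverse by (auto intro!: derivative_eq_intros)
        from has_derivative_sin[OF this] show ?thesis by (rule has_derivative_eq_rhs) (simp add: fun_eq_iff)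
      qed
      show ?thesis unfolding b_def[abs_def]
        by (rule has_derivative_eq_rhs[OF has_derivative_add[OF g(1)[OF z] has_derivative_mult[OF has_derivative_mult_right[OF 3] 2]]])
           (simp add: fun_eq_iff gb_def inner_add_left inner_prod_def algebra_simps)
    qed
    have gc: "continuous_on ?\<Omega> g" by (rule lipschitz_on_continuous_on[OF g(2)])
    show "continuous_on ?\<Omega> gb"
      unfolding gb_def[abs_def] using T
      by (intro continuous_intros gc continuous_on_compose2[OF gauss_weight_continuous[of UNIV]]) auto
    show "\<bar>b z\<bar> \<le> Bb" if z: "z \<in> ?\<Omega>" for z
      using B\<psi>[OF z] sinabs[of "fst z" "pi * snd z / T"] z in\<Omega>[of z] B0 T pi_gt_zero
        divide_nonneg_pos[of pi T] unfolding b_def Bb_def by linarith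
    show "norm (gb z) \<le> Bb" if z: "z \<in> ?\<Omega>" for z
    proof -
      have zD: "fst z \<in> D" using z in\<Omega> by blast
      have "norm ((\<epsilon> * sin (pi * snd z / T) * K * gauss_weight K (fst z)) *\<^sub>R fst z) = \<bar>sin (pi * snd z / T)\<bar> * (\<epsilon> * (K * gauss_weight K (fst z) * norm (fst z)))"
        using \<epsilon>(1) K w0[of K "fst z"] by (simp add: abs_mult)
      also have "\<dots> \<le> 1 * 1" using \<epsilon>w(3)[OF zD] \<epsilon>(1) K w0[of K "fst z"] by (intro mult_mono) auto
      finally have 1: "norm ((\<epsilon> * sin (pi * snd z / T) * K * gauss_weight K (fst z)) *\<^sub>R fst z) \<le> 1" by simp
      have "\<bar>pi / T * cos (pi * snd z / T) * (\<epsilon> * gauss_weight K (fst z))\<bar> = pi / T * (\<bar>cos (pi * snd z / T)\<bar> * (\<epsilon> * gauss_weight K (fst z)))"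
        using \<epsilon>(1) T w0[of K "fst z"] by (simp add: abs_mult)
      also have "\<dots> \<le> pi / T * (1 * 1)" using \<epsilon>w(1)[OF zD] \<epsilon>(1) T w0[of K "fst z"] by (intro mult_left_mono mult_mono) auto
      finally have 2: "\<bar>pi / T * cos (pi * snd z / T) * (\<epsilon> * gauss_weight K (fst z))\<bar> \<le> pi / T" by simp
      have "norm (gb z) \<le> norm (g z) + (norm ((\<epsilon> * sin (pi * snd z / T) * K * gauss_weight K (fst z)) *\<^sub>R fst z) + norm (pi / T * cos (pi * snd z / T) * (\<epsilon> * gauss_weight K (fst z))))"
        unfolding gb_def by (intro order_trans[OF norm_triangle_ineq] add_left_mono norm_Pair_le)
      then show ?thesis using 1 2 B[OF z] B\<psi>0 unfolding Bb_def real_norm_def by linarith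
    qed
    show "0 \<le> Bb" using B\<psi>0 B0 T by (simp add: Bb_def)
  qed (use oD bD T G ut in auto)
  have lat: "b (x, t) \<le> 0" if x: "x \<in> D" "t \<in> {0<..<T}" "infdist x (frontier D) < r0" for x t
  proof -
    have "\<epsilon> * sin (pi * t / T) * gauss_weight K x = sin (pi * t / T) * (\<epsilon> * gauss_weight K x)" by simp
    also have "\<dots> \<le> 1 * (\<epsilon> * gauss_weight K x)" using \<epsilon>(1) w0[of K x] by (intro mult_right_mono) auto
    also have "\<dots> \<le> c0" using \<epsilon>w(2)[OF x(1)] by simp
    finally show ?thesis using c0(3)[OF x] by (simp add: b_def)
  qed
  have ini: "\<exists>r>0. \<forall>z\<in>?\<Omega>. dist z (x, 0) < r \<longrightarrow> b z \<le> u0 x" if x: "x \<in> D" for x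
  proof -
    have bc: "continuous_on (closure ?\<Omega>) b"
      unfolding b_def[abs_def] using T
      by (intro continuous_intros c\<psi> continuous_on_compose2[OF gauss_weight_continuous[of UNIV]]) auto
    have x0: "(x, 0) \<in> closure ?\<Omega>" using x T closure_subset[of D] by (auto simp: clo)
    \<comment> \<open>The sine vanishes at time 0, so b starts at \<psi>. Near (x, 0) the barrier is
      compared with the fixed number \<open>u0 x\<close>, so continuity of b is enough and none of
      u0 is assumed.\<close>
    have "u0 x - b (x, 0) > 0" using init[of x] x closure_subset[of D] by (auto simp: b_def)
    then obtain d where d: "d > 0" "\<And>z. z \<in> closure ?\<Omega> \<Longrightarrow> dist z (x, 0) < d \<Longrightarrow> dist (b z) (b (x, 0)) < u0 x - b (x, 0)"
      using bc x0 unfolding continuous_on_iff by meson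
    have "b z \<le> u0 x" if "z \<in> ?\<Omega>" "dist z (x, 0) < d" for z
      using d(2)[OF subsetD[OF sub that(1)] that(2)] unfolding dist_real_def by linarith
    then show ?thesis using d(1) by blast
  qed
  note adm = admissible_v[OF umem c0(2) lat ini]
  have u\<psi>: "AE z in lebesgue. z \<in> ?\<Omega> \<longrightarrow> \<psi> z \<le> u z"
    using umem AE_lebesgue_on_iff[OF sets_\<Omega>] by (simp add: admissible_def)
  have "AE z in lebesgue. W z = 0"
    by (rule truncation_vanishes[where c=c and L=L and g=g and B=B and \<psi>=\<psi> and \<epsilon>=\<epsilon> and K=K and Cq=Cq,
          OF C2 A card c g(2) B g(1) cvx \<epsilon>(1) K b_def gb_def \<epsilon>w(3,1) Cq0 Cq cK u\<psi> adm(2) fin umin[OF adm(1)]])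
  then have "AE z in lebesgue. z \<in> ?\<Omega> \<longrightarrow> b z \<le> u z"
    by (rule eventually_mono) (use pen_props(5) in \<open>fastforce simp: W_def\<close>)
  then show ?thesis using \<epsilon>(1) unfolding b_def by blast
qed

text \<open>A single rescaled function of the blow-up sequence suffices: where it is differentiable
  within \<open>Q1\<close> it is continuous there. With u below b at a contact point this yields a
  nonempty open set, at slightly earlier times, on which u < b, against the inequality that holds
  almost everywhere.\<close>

lemma singular_point_off_barrier:
  fixes D :: "(real^'m) set"
  assumes D: "open D" and t0: "t0 \<in> {0<..<T}"
    and sing: "x0 \<in> singular_points D \<psi> u t0"
    and b: "continuous_on (space_time D T) b" "\<And>z. z \<in> space_time D T \<Longrightarrow> \<psi> z < b z"
  shows "\<not> (AE z in lebesgue. z \<in> space_time D T \<longrightarrow> b z \<le> u z)"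
proof
  let ?\<Omega> = "space_time D T"
  assume ae: "AE z in lebesgue. z \<in> ?\<Omega> \<longrightarrow> b z \<le> u z"
  have o\<Omega>: "open ?\<Omega>" by (rule space_time_lebesgue[OF D])
  have fb: "x0 \<in> free_boundary D \<psi> u t0" using sing by (simp add: singular_points_def)
  obtain M c where "is_blowup u x0 t0 (parabolic_polynomial M c)" using sing by (auto simp: singular_points_def)
  then obtain r where r: "\<And>j. 0 < r j" "r \<longlonglongrightarrow> 0"
      "\<And>\<alpha>. \<alpha> \<in> {0<..<1} \<Longrightarrow> C1_holder_loc_limit \<alpha> Q1 (\<lambda>j. parabolic_rescaling u x0 t0 (r j)) (parabolic_polynomial M c)"
    unfolding is_blowup_def by blast
  define Q where "Q = (Q1 :: ((real^'m) \<times> real) set)"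
  \<comment> \<open>A compact piece of the top s = 0 of \<open>Q1\<close>. It contains a whole ball
    in space because the base point may be only a limit of contact points.\<close>
  define KK where "KK = cball (0 :: real^'m) (1 / 2) \<times> {0::real}"
  have KK: "compact KK" "KK \<subseteq> Q" by (auto simp: KK_def Q_def Q1_def intro!: compact_Times)
  have "C1_holder_loc_limit (1 / 2) Q (\<lambda>j. parabolic_rescaling u x0 t0 (r j)) (parabolic_polynomial M c)"
    unfolding Q_def by (rule r(3)) auto
  then obtain F P where FP: "\<forall>K. compact K \<and> K \<subseteq> Q \<longrightarrow>
          (\<exists>C. \<forall>z\<in>K. \<forall>w\<in>K. norm (P z - P w) \<le> C * dist z w powr (1 / 2)) \<and>
          (\<forall>\<epsilon>>0. \<forall>\<^sub>F j in sequentially.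
             (\<forall>z\<in>K. (parabolic_rescaling u x0 t0 (r j) has_derivative (\<lambda>h. F j z \<bullet> h)) (at z within Q)) \<and>
             (\<forall>z\<in>K. \<bar>parabolic_rescaling u x0 t0 (r j) z - parabolic_polynomial M c z\<bar> \<le> \<epsilon> \<and> norm (F j z - P z) \<le> \<epsilon>) \<and>
             (\<forall>z\<in>K. \<forall>w\<in>K. norm ((F j z - P z) - (F j w - P w)) \<le> \<epsilon> * dist z w powr (1 / 2)))"
    unfolding C1_holder_loc_limit_def by blast
  have "\<forall>\<^sub>F j in sequentially. \<forall>z\<in>KK. (parabolic_rescaling u x0 t0 (r j) has_derivative (\<lambda>h. F j z \<bullet> h)) (at z within Q)"
    by (rule eventually_mono[OF FP[rule_format, OF conjI[OF KK], THEN conjunct2, rule_format, OF zero_less_one]]) blast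
  then obtain j where j: "\<And>z. z \<in> KK \<Longrightarrow> (parabolic_rescaling u x0 t0 (r j) has_derivative (\<lambda>h. F j z \<bullet> h)) (at z within Q)"
    unfolding eventually_sequentially by blast
  define \<rho> where "\<rho> = r j"
  have \<rho>: "\<rho> > 0" using r(1) by (simp add: \<rho>_def)
  \<comment> \<open>Continuity of u at \<open>x0\<close> is not known, so equality with \<psi> might
    fail there; a true contact point within half the scale is used in its place.\<close>
  have "x0 \<in> closure (contact_set D \<psi> u t0)" using fb by (simp add: free_boundary_def frontier_def)
  then obtain x where x: "x \<in> contact_set D \<psi> u t0" "dist x x0 < \<rho> / 2"
    using \<rho> unfolding closure_approachable by (meson half_gt_zero)
  have xD: "x \<in> D" "u (x, t0) = \<psi> (x, t0)" using x(1) by (auto simp: contact_set_def)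
  have x\<Omega>: "(x, t0) \<in> ?\<Omega>" using xD(1) t0 by (simp add: space_time_def)
  define y where "y = (1 / \<rho>) *\<^sub>R (x - x0)"
  have yx: "x0 + \<rho> *\<^sub>R y = x" using \<rho> by (simp add: y_def)
  have yn: "norm y < 1 / 2" using x(2) \<rho> by (simp add: y_def dist_norm divide_less_eq)
  define f where "f = parabolic_rescaling u x0 t0 \<rho>"
  have "(y, 0) \<in> KK" using yn by (simp add: KK_def)
  from has_derivative_continuous[OF j[OF this]] have fc: "continuous (at (y, 0) within Q) f"
    by (simp add: f_def \<rho>_def)
  define S where "S z = (x0 + \<rho> *\<^sub>R fst z, t0 + \<rho>\<^sup>2 * snd z)" for z :: "(real^'m) \<times> real"
  have uf: "u (S z) = \<rho>\<^sup>2 * f z + u (x0, t0)" for z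
    using \<rho> by (cases z) (simp add: S_def f_def parabolic_rescaling_def)
  have Sy: "S (y, 0) = (x, t0)" using yx by (simp add: S_def)
  have "((\<lambda>z. u (S z)) \<longlongrightarrow> u (S (y, 0))) (at (y, 0) within Q)"
    unfolding uf using fc unfolding continuous_within by (intro tendsto_intros)
  moreover have "((\<lambda>z. b (S z)) \<longlongrightarrow> b (S (y, 0))) (at (y, 0) within Q)"
  proof -
    have "isCont b (x, t0)" using b(1) o\<Omega> x\<Omega> continuous_on_eq_continuous_at by blast
    moreover have "(S \<longlongrightarrow> S (y, 0)) (at (y, 0) within Q)" unfolding S_def by (intro tendsto_intros)
    ultimately show ?thesis unfolding Sy using isCont_tendsto_compose by blast
  qed
  ultimately have "((\<lambda>z. b (S z) - u (S z)) \<longlongrightarrow> b (x, t0) - u (x, t0)) (at (y, 0) within Q)"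
    unfolding Sy by (intro tendsto_diff)
  then have e1: "\<forall>\<^sub>F z in at (y, 0) within Q. 0 < b (S z) - u (S z)"
    by (rule order_tendstoD(1)) (use b(2)[OF x\<Omega>] xD(2) in simp)
  have e2: "\<forall>\<^sub>F z in at (y, 0) within Q. S z \<in> ?\<Omega>"
  proof -
    have "(S \<longlongrightarrow> (x, t0)) (at (y, 0) within Q)" unfolding Sy[symmetric] S_def by (intro tendsto_intros)
    from topological_tendstoD[OF this o\<Omega> x\<Omega>] show ?thesis .
  qed
  from eventually_conj[OF e1 e2] obtain d where d: "d > 0" "\<And>z. z \<in> Q \<Longrightarrow> z \<noteq> (y, 0) \<Longrightarrow> dist z (y, 0) < d \<Longrightarrow> u (S z) < b (S z) \<and> S z \<in> ?\<Omega>"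
    unfolding eventually_at by force
  \<comment> \<open>\<open>Q1\<close> contains its top s = 0, where continuity is one-sided;
    restricting to s < 0 gives an open set, whose image cannot be null.\<close>
  define E where "E = ball (y, 0) d \<inter> (ball (0::real^'m) 1 \<times> {-1<..<0::real})"
  have "open E" unfolding E_def by (intro open_Int open_ball open_Times open_greaterThanLessThan)
  have "(y, - min (d / 2) (1 / 2)) \<in> E"
    using d(1) yn by (simp add: E_def dist_Pair_Pair min_def)
  have Emap: "u (S z) < b (S z) \<and> S z \<in> ?\<Omega>" if "z \<in> E" for z
    by (rule d(2)) (use that in \<open>auto simp: E_def Q_def Q1_def dist_commute\<close>)
  define S' where "S' z = ((1 / \<rho>) *\<^sub>R (fst z - x0), (snd z - t0) / \<rho>\<^sup>2)" for z :: "(real^'m) \<times> real"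
  have SS': "S (S' z) = z" "S' (S z) = z" for z using \<rho> by (auto simp: S_def S'_def prod_eq_iff)
  have S'c: "continuous_on UNIV S'" unfolding S'_def using \<rho> by (intro continuous_intros) auto
  define E2 where "E2 = S' -` E"
  have oE2: "open E2" unfolding E2_def by (rule open_vimage[OF \<open>open E\<close> S'c])
  have neE2: "E2 \<noteq> {}" using \<open>(y, _) \<in> E\<close> SS'(2) unfolding E2_def by (metis empty_iff vimageI)
  have bad: "u z < b z \<and> z \<in> ?\<Omega>" if "z \<in> E2" for z using Emap[of "S' z"] that SS'(1) by (simp add: E2_def)
  have "AE z in lebesgue. z \<notin> E2" using ae by (rule eventually_mono) (use bad in force)
  then have "E2 \<in> null_sets lebesgue" by (simp add: completion.AE_iff_null_sets)
  then show False using oE2 neE2 by (metis negligible_iff_null_sets open_not_negligible)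
qed

lemma parabolic_hausdorff_dim_empty: "parabolic_hausdorff_dim {} \<le> 0"
  unfolding parabolic_hausdorff_dim_def hausdorff_dim_def
  by (rule Inf_lower) (auto intro!: exI[of _ 0] simp: zero_ereal_def)

theorem theorem1p3:
  fixes n :: nat
    and D :: "(real^'m) set"
    and T :: real
    and A :: "real^'m^'m"
    and \<psi> u :: "(real^'m) \<times> real \<Rightarrow> real"
    and u0 :: "real^'m \<Rightarrow> real"
  assumes "n \<ge> 1" and "CARD('m) = n + 1"
    and "C2_domain D" and "bounded D" and "T > 0"
    and "sym_pos_def A"
    and "C11_closure (space_time D T) \<psi>"
    and "convex_on_segments (closure (space_time D T)) \<psi>"
    and "\<forall>x\<in>frontier D. \<forall>t\<in>{0..T}. \<psi> (x, t) < 0"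
    and "\<forall>x\<in>closure D. \<psi> (x, 0) < u0 x"
    and "is_minimizer (aniso A) D T \<psi> u0 u"
    and "precise_representative (space_time D T) u"
  shows "parabolic_hausdorff_dim (singular_set D T \<psi> u) \<le> ereal (real n - 1)"
proof -
  obtain \<epsilon> K where \<epsilon>: "\<epsilon> > 0" and
    ae: "AE z in lebesgue. z \<in> space_time D T \<longrightarrow> \<psi> z + \<epsilon> * sin (pi * snd z / T) * gauss_weight K (fst z) \<le> u z"
    using minimizer_above_barrier[of D T A \<psi> u0 u] assms by auto
  let ?b = "\<lambda>z. \<psi> z + \<epsilon> * sin (pi * snd z / T) * gauss_weight K (fst z)"
  have oD: "open D" using assms(3) by (simp add: C2_domain_def)
  have "continuous_on (space_time D T) \<psi>"
    using assms(7) continuous_on_subset[OF _ closure_subset] by (auto simp: C11_closure_def)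
  then have c: "continuous_on (space_time D T) ?b"
    using assms(5) by (intro continuous_intros continuous_on_compose2[OF gauss_weight_continuous[of UNIV]]) auto
  have lt: "\<psi> z < ?b z" if "z \<in> space_time D T" for z
  proof -
    have "0 < sin (pi * snd z / T)"
      using that assms(5) by (intro sin_gt_zero) (auto simp: space_time_def divide_less_eq)
    then show ?thesis using \<epsilon> gauss_weight_pos[of K "fst z"] by simp
  qed
  have "x \<notin> singular_points D \<psi> u t" if t: "t \<in> {0<..<T}" for x t
    using singular_point_off_barrier[OF oD t _ c lt] ae by blast
  then have "singular_set D T \<psi> u = {}" by (auto simp: singular_set_def)
  moreover have "(0::ereal) \<le> ereal (real n - 1)" using assms(1) by simp
  ultimately show ?thesis using parabolic_hausdorff_dim_empty[where 'a="real^'m"] by (metis order_trans)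
qed

end
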